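(* Let $(R,\mathfrak{m})$ be a $t$-dimensional local ring possessing a (normalized) dualizing complex $D^{\bullet}$, and let $E = E(R/\mathfrak{m})$ be the injective hull of the residue field. Let $M \neq 0$ be a finitely generated $R$-module, and let $d = \dim_R M$. Then: (a) $H^t_{\mathfrak{m}}(M,D^{\bullet}) \cong \operatorname{Hom}_R(M,E) \neq 0$, and $H^i_{\mathfrak{m}}(M,D^{\bullet}) = 0$ for all $i \neq t$. (b) If $\operatorname{pd}_R M = p < \infty$, then $H^{p+d}_{\mathfrak{m}}(M,D^{\bullet}) \neq 0$ if and only if $\delta_{\rm CM}(M) = \delta_{\rm CM}(R)$.
   Context: All rings are Noetherian, commutative, with $1 \neq 0$. A dualizing complex $D^{\bullet}$ of $R$ is regarded as a bounded complex of injective $R$-modules with finitely generated cohomology, normalized so that $\mathrm{R}\Gamma_{\mathfrak{m}}(D^{\bullet}) \cong E[-t]$ with $t=\dim R$, i.e. so that local duality reads $H^i_{\mathfrak{m}}(X) \cong \operatorname{Hom}_R(\operatorname{Ext}^{t-i}_R(X,D^{\bullet}),E)$ for complexes $X$ with finitely generated cohomology. The generalized local cohomology $H^i_{\mathfrak{m}}(M,D^{\bullet})$ is defined as the $i$-th cohomology of $\mathrm{R}\Gamma_{\mathfrak{m}}(\operatorname{RHom}_R(M,D^{\bullet}))$. The Cohen-Macaulay defect of a finitely generated $R$-module $M$ is $\delta_{\rm CM}(M) = \dim_R M - \operatorname{depth}_R M$. *)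

theory Defs
  imports "HOL-Algebra.Module" "HOL-Algebra.QuotRing" "HOL-Algebra.Ideal_Product"
    "HOL-Algebra.Ring_Divisibility" "HOL-Library.Extended_Nat"
begin

text \<open>
  Modules over a ring \<open>R\<close> are records of type \<open>('a, 'm) module\<close>; the fields \<open>mult\<close> and \<open>one\<close>
  inherited from the record of rings carry no meaning for them and are left undefined.
\<close>

section \<open>Modules\<close>

definition mod_hom :: "('a, 'r) ring_scheme \<Rightarrow> ('a, 'm) module \<Rightarrow> ('a, 'n) module \<Rightarrow> ('m \<Rightarrow> 'n) set"
  where "mod_hom R M N =
    {f \<in> carrier M \<rightarrow> carrier N.
       (\<forall>x\<in>carrier M. \<forall>y\<in>carrier M. f (x \<oplus>\<^bsub>M\<^esub> y) = f x \<oplus>\<^bsub>N\<^esub> f y) \<and>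
       (\<forall>r\<in>carrier R. \<forall>x\<in>carrier M. f (r \<odot>\<^bsub>M\<^esub> x) = r \<odot>\<^bsub>N\<^esub> f x)}"

definition mod_iso :: "('a, 'r) ring_scheme \<Rightarrow> ('a, 'm) module \<Rightarrow> ('a, 'n) module \<Rightarrow> bool"
  where "mod_iso R M N \<longleftrightarrow> (\<exists>f\<in>mod_hom R M N. bij_betw f (carrier M) (carrier N))"

definition zero_module :: "('a, 'm) module \<Rightarrow> bool"
  where "zero_module M \<longleftrightarrow> carrier M = {\<zero>\<^bsub>M\<^esub>}"

definition regular_module :: "('a, 'r) ring_scheme \<Rightarrow> ('a, 'a) module"
  where "regular_module R =
    \<lparr>carrier = carrier R, monoid.mult = undefined, one = undefined,
     ring.zero = \<zero>\<^bsub>R\<^esub>, add = add R, smult = (\<otimes>\<^bsub>R\<^esub>)\<rparr>"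

definition quotient_module :: "('a, 'm) module \<Rightarrow> 'm set \<Rightarrow> ('a, 'm set) module"
  where "quotient_module M N =
    \<lparr>carrier = a_rcosets\<^bsub>M\<^esub> N, monoid.mult = undefined, one = undefined,
     ring.zero = N, add = set_add M, smult = (\<lambda>r C. \<Union>x\<in>C. N +>\<^bsub>M\<^esub> (r \<odot>\<^bsub>M\<^esub> x))\<rparr>"

text \<open>Elements of \<open>Hom\<^sub>R(M, N)\<close> are functions fixed to be \<open>undefined\<close> outside \<open>carrier M\<close>,
  so that equality of elements is equality of homomorphisms.\<close>

definition Hom_module :: "('a, 'r) ring_scheme \<Rightarrow> ('a, 'm) module \<Rightarrow> ('a, 'n) module \<Rightarrow> ('a, 'm \<Rightarrow> 'n) module"
  where "Hom_module R M N =
    \<lparr>carrier = mod_hom R M N \<inter> extensional (carrier M), monoid.mult = undefined, one = undefined,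
     ring.zero = (\<lambda>x\<in>carrier M. \<zero>\<^bsub>N\<^esub>),
     add = (\<lambda>f g. \<lambda>x\<in>carrier M. f x \<oplus>\<^bsub>N\<^esub> g x),
     smult = (\<lambda>r f. \<lambda>x\<in>carrier M. r \<odot>\<^bsub>N\<^esub> f x)\<rparr>"

definition gen_submodule :: "('a, 'r) ring_scheme \<Rightarrow> ('a, 'm) module \<Rightarrow> 'm set \<Rightarrow> 'm set"
  where "gen_submodule R M S = \<Inter>{H. submodule H R M \<and> S \<subseteq> H}"

definition fg_module :: "('a, 'r) ring_scheme \<Rightarrow> ('a, 'm) module \<Rightarrow> bool"
  where "fg_module R M \<longleftrightarrow>
    module R M \<and> (\<exists>S\<subseteq>carrier M. finite S \<and> gen_submodule R M S = carrier M)"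

definition annihilator :: "('a, 'r) ring_scheme \<Rightarrow> ('a, 'm) module \<Rightarrow> 'a set"
  where "annihilator R M = {r \<in> carrier R. \<forall>x\<in>carrier M. r \<odot>\<^bsub>M\<^esub> x = \<zero>\<^bsub>M\<^esub>}"


section \<open>Injective and projective modules\<close>

text \<open>
  A definition in HOL cannot quantify over types, so the test modules \<open>A\<close>, \<open>B\<close> below live on one
  fixed type. This is no restriction: \<open>injective_module_extend\<close> (Baer's criterion) and
  \<open>projective_module_lift\<close> below derive the universal properties for test modules on all types.
\<close>

definition injective_module :: "('a, 'r) ring_scheme \<Rightarrow> ('a, 'm) module \<Rightarrow> bool"
  where "injective_module R I \<longleftrightarrow> module R I \<and>
    (\<forall>(A::('a, 'a) module) (B::('a, 'a) module) i f.
       module R A \<and> module R B \<and>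
       i \<in> mod_hom R A B \<and> inj_on i (carrier A) \<and> f \<in> mod_hom R A I \<longrightarrow>
       (\<exists>g\<in>mod_hom R B I. \<forall>x\<in>carrier A. g (i x) = f x))"

definition projective_module :: "('a, 'r) ring_scheme \<Rightarrow> ('a, 'p) module \<Rightarrow> bool"
  where "projective_module R P \<longleftrightarrow> module R P \<and>
    (\<forall>(A::('a, 'p \<Rightarrow> 'a) module) (B::('a, 'p) module) g f.
       module R A \<and> module R B \<and>
       g \<in> mod_hom R A B \<and> g ` carrier A = carrier B \<and> f \<in> mod_hom R P B \<longrightarrow>
       (\<exists>h\<in>mod_hom R P A. \<forall>x\<in>carrier P. g (h x) = f x))"

text \<open>\<open>E\<close> is an injective hull of \<open>N\<close>: an injective module that is an essential extension
  of (an isomorphic copy of) \<open>N\<close>.\<close>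

definition injective_hull :: "('a, 'r) ring_scheme \<Rightarrow> ('a, 'm) module \<Rightarrow> ('a, 'e) module \<Rightarrow> bool"
  where "injective_hull R N E \<longleftrightarrow> injective_module R E \<and>
    (\<exists>j\<in>mod_hom R N E. inj_on j (carrier N) \<and>
       (\<forall>H. submodule H R E \<and> H \<noteq> {\<zero>\<^bsub>E\<^esub>} \<longrightarrow> H \<inter> j ` carrier N \<noteq> {\<zero>\<^bsub>E\<^esub>}))"


section \<open>Local rings, dimension, depth, projective dimension\<close>

definition noetherian_local_ring :: "('a, 'r) ring_scheme \<Rightarrow> 'a set \<Rightarrow> bool"
  where "noetherian_local_ring R \<mm> \<longleftrightarrow>
    cring R \<and> noetherian_ring R \<and> \<one>\<^bsub>R\<^esub> \<noteq> \<zero>\<^bsub>R\<^esub> \<and>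
    maximalideal \<mm> R \<and> (\<forall>\<nn>. maximalideal \<nn> R \<longrightarrow> \<nn> = \<mm>)"

definition residue_module :: "('a, 'r) ring_scheme \<Rightarrow> 'a set \<Rightarrow> ('a, 'a set) module"
  where "residue_module R \<mm> = quotient_module (regular_module R) \<mm>"

definition krull_dim :: "('a, 'r) ring_scheme \<Rightarrow> enat"
  where "krull_dim R = Sup {enat n |n. \<exists>\<pp>.
    (\<forall>i\<le>n. primeideal (\<pp> i) R) \<and> (\<forall>i<n. \<pp> i \<subset> \<pp> (Suc i))}"

definition module_dim :: "('a, 'r) ring_scheme \<Rightarrow> ('a, 'm) module \<Rightarrow> enat"
  where "module_dim R M = krull_dim (R Quot (annihilator R M))"

definition seq_submodule :: "('a, 'r) ring_scheme \<Rightarrow> ('a, 'm) module \<Rightarrow> 'a list \<Rightarrow> 'm set"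
  where "seq_submodule R M xs = gen_submodule R M {x \<odot>\<^bsub>M\<^esub> y |x y. x \<in> set xs \<and> y \<in> carrier M}"

definition regular_sequence :: "('a, 'r) ring_scheme \<Rightarrow> ('a, 'm) module \<Rightarrow> 'a list \<Rightarrow> bool"
  where "regular_sequence R M xs \<longleftrightarrow>
    (\<forall>i<length xs. let Q = quotient_module M (seq_submodule R M (take i xs)) in
       \<forall>y\<in>carrier Q. (xs ! i) \<odot>\<^bsub>Q\<^esub> y = \<zero>\<^bsub>Q\<^esub> \<longrightarrow> y = \<zero>\<^bsub>Q\<^esub>) \<and>
    \<not> zero_module (quotient_module M (seq_submodule R M xs))"

definition depth :: "('a, 'r) ring_scheme \<Rightarrow> 'a set \<Rightarrow> ('a, 'm) module \<Rightarrow> enat"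
  where "depth R \<mm> M = Sup {enat (length xs) |xs. set xs \<subseteq> \<mm> \<and> regular_sequence R M xs}"

text \<open>For a nonzero finitely generated module over a Noetherian local ring both numbers are finite.\<close>

definition cm_defect :: "('a, 'r) ring_scheme \<Rightarrow> 'a set \<Rightarrow> ('a, 'm) module \<Rightarrow> int"
  where "cm_defect R \<mm> M = int (the_enat (module_dim R M)) - int (the_enat (depth R \<mm> M))"

text \<open>
  The modules of the resolution live on the type \<open>nat \<Rightarrow> 'a\<close>, on which there are copies of all
  \<open>R\<^sup>k\<close> and of their submodules. For finitely generated \<open>M\<close> over a Noetherian ring this suffices:
  \<open>M\<close> has a resolution by modules \<open>R\<^sup>k\<close>, and if \<open>M\<close> has some projective resolution of length \<open>n\<close>,
  then the \<open>n\<close>-th syzygy of the former is projective as well (Schanuel).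
\<close>

definition has_projective_resolution :: "('a, 'r) ring_scheme \<Rightarrow> ('a, 'm) module \<Rightarrow> nat \<Rightarrow> bool"
  where "has_projective_resolution R M n \<longleftrightarrow>
    (\<exists>(P :: nat \<Rightarrow> ('a, nat \<Rightarrow> 'a) module) \<delta> \<epsilon>.
       (\<forall>i. projective_module R (P i)) \<and> (\<forall>i>n. zero_module (P i)) \<and>
       \<epsilon> \<in> mod_hom R (P 0) M \<and> \<epsilon> ` carrier (P 0) = carrier M \<and>
       (\<forall>i. \<delta> i \<in> mod_hom R (P (Suc i)) (P i)) \<and>
       \<delta> 0 ` carrier (P 1) = {x \<in> carrier (P 0). \<epsilon> x = \<zero>\<^bsub>M\<^esub>} \<and>
       (\<forall>i. \<delta> (Suc i) ` carrier (P (Suc (Suc i))) = {x \<in> carrier (P (Suc i)). \<delta> i x = \<zero>\<^bsub>P i\<^esub>}))"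

definition proj_dim :: "('a, 'r) ring_scheme \<Rightarrow> ('a, 'm) module \<Rightarrow> enat"
  where "proj_dim R M = Inf {enat n |n. has_projective_resolution R M n}"


section \<open>Cochain complexes\<close>

record ('a, 'm) cochain =
  obj :: "int \<Rightarrow> ('a, 'm) module"
  dif :: "int \<Rightarrow> 'm \<Rightarrow> 'm"

definition cochain_complex :: "('a, 'r) ring_scheme \<Rightarrow> ('a, 'm) cochain \<Rightarrow> bool"
  where "cochain_complex R X \<longleftrightarrow>
    (\<forall>n. module R (obj X n) \<and> dif X n \<in> mod_hom R (obj X n) (obj X (n + 1)) \<and>
       (\<forall>x\<in>carrier (obj X n). dif X (n + 1) (dif X n x) = \<zero>\<^bsub>obj X (n + 1 + 1)\<^esub>))"

definition cocycles :: "('a, 'm) cochain \<Rightarrow> int \<Rightarrow> 'm set"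
  where "cocycles X n = {x \<in> carrier (obj X n). dif X n x = \<zero>\<^bsub>obj X (n + 1)\<^esub>}"

definition coboundaries :: "('a, 'm) cochain \<Rightarrow> int \<Rightarrow> 'm set"
  where "coboundaries X n = dif X (n - 1) ` carrier (obj X (n - 1))"

definition cohomology :: "('a, 'm) cochain \<Rightarrow> int \<Rightarrow> ('a, 'm set) module"
  where "cohomology X n = quotient_module ((obj X n)\<lparr>carrier := cocycles X n\<rparr>) (coboundaries X n)"

definition chain_map ::
  "('a, 'r) ring_scheme \<Rightarrow> ('a, 'm) cochain \<Rightarrow> ('a, 'n) cochain \<Rightarrow> (int \<Rightarrow> 'm \<Rightarrow> 'n) \<Rightarrow> bool"
  where "chain_map R X Y f \<longleftrightarrow>
    (\<forall>n. f n \<in> mod_hom R (obj X n) (obj Y n) \<and>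
       (\<forall>x\<in>carrier (obj X n). f (n + 1) (dif X n x) = dif Y n (f n x)))"

definition cohomology_map :: "('a, 'n) cochain \<Rightarrow> (int \<Rightarrow> 'm \<Rightarrow> 'n) \<Rightarrow> int \<Rightarrow> 'm set \<Rightarrow> 'n set"
  where "cohomology_map Y f n C = (\<Union>x\<in>C. coboundaries Y n +>\<^bsub>obj Y n\<^esub> f n x)"

definition quasi_iso ::
  "('a, 'r) ring_scheme \<Rightarrow> ('a, 'm) cochain \<Rightarrow> ('a, 'n) cochain \<Rightarrow> (int \<Rightarrow> 'm \<Rightarrow> 'n) \<Rightarrow> bool"
  where "quasi_iso R X Y f \<longleftrightarrow>
    cochain_complex R X \<and> cochain_complex R Y \<and> chain_map R X Y f \<and>
    (\<forall>n. bij_betw (cohomology_map Y f n) (carrier (cohomology X n)) (carrier (cohomology Y n)))"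

text \<open>
  Isomorphism in the derived category, as a roof \<open>X \<leftarrow> Z \<rightarrow> Y\<close> of quasi-isomorphisms. The apex is
  taken on the type of \<open>X\<close>; when \<open>Y\<close> is a module in a single degree (the only use below) this is
  no restriction, since then a truncation of \<open>X\<close> serves as apex.
\<close>

definition derived_iso :: "('a, 'r) ring_scheme \<Rightarrow> ('a, 'm) cochain \<Rightarrow> ('a, 'n) cochain \<Rightarrow> bool"
  where "derived_iso R X Y \<longleftrightarrow>
    (\<exists>(Z :: ('a, 'm) cochain) f g. quasi_iso R Z X f \<and> quasi_iso R Z Y g)"

text \<open>The complex \<open>M[-k]\<close>: the module \<open>M\<close> placed in degree \<open>k\<close>.\<close>

definition in_degree :: "int \<Rightarrow> ('a, 'm) module \<Rightarrow> ('a, 'm) cochain"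
  where "in_degree k M =
    \<lparr>obj = (\<lambda>n. if n = k then M else M\<lparr>carrier := {\<zero>\<^bsub>M\<^esub>}\<rparr>), dif = (\<lambda>n x. \<zero>\<^bsub>M\<^esub>)\<rparr>"

definition bounded_below :: "('a, 'm) cochain \<Rightarrow> bool"
  where "bounded_below X \<longleftrightarrow> (\<exists>a. \<forall>n<a. zero_module (obj X n))"

definition bounded_above :: "('a, 'm) cochain \<Rightarrow> bool"
  where "bounded_above X \<longleftrightarrow> (\<exists>b. \<forall>n>b. zero_module (obj X n))"

text \<open>The complex \<open>Hom\<^sub>R(M, Y)\<close> for a module \<open>M\<close>; it represents \<open>RHom\<^sub>R(M, Y)\<close> when \<open>Y\<close> is a
  bounded below complex of injectives.\<close>

definition Hom_into :: "('a, 'r) ring_scheme \<Rightarrow> ('a, 'm) module \<Rightarrow> ('a, 'n) cochain \<Rightarrow> ('a, 'm \<Rightarrow> 'n) cochain"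
  where "Hom_into R M Y =
    \<lparr>obj = (\<lambda>n. Hom_module R M (obj Y n)), dif = (\<lambda>n f. \<lambda>x\<in>carrier M. dif Y n (f x))\<rparr>"

text \<open>The total Hom complex: \<open>Hom\<^sup>n(X, Y) = \<Prod>\<^sub>i Hom\<^sub>R(X\<^sup>i, Y\<^sup>i\<^sup>+\<^sup>n)\<close> with differential
  \<open>f \<mapsto> d\<^sub>Y \<circ> f - (-1)\<^sup>n f \<circ> d\<^sub>X\<close>.\<close>

definition Hom_complex ::
  "('a, 'r) ring_scheme \<Rightarrow> ('a, 'm) cochain \<Rightarrow> ('a, 'n) cochain \<Rightarrow> ('a, int \<Rightarrow> 'm \<Rightarrow> 'n) cochain"
  where "Hom_complex R X Y =
    \<lparr>obj = (\<lambda>n. let H = (\<lambda>i. Hom_module R (obj X i) (obj Y (i + n))) in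
       \<lparr>carrier = {f. \<forall>i. f i \<in> carrier (H i)}, monoid.mult = undefined, one = undefined,
        ring.zero = (\<lambda>i. \<zero>\<^bsub>H i\<^esub>), add = (\<lambda>f g i. f i \<oplus>\<^bsub>H i\<^esub> g i), smult = (\<lambda>r f i. r \<odot>\<^bsub>H i\<^esub> f i)\<rparr>),
     dif = (\<lambda>n f i. \<lambda>x\<in>carrier (obj X i).
       let u = dif Y (i + n) (f i x); v = f (i + 1) (dif X i x); N = obj Y (i + (n + 1))
       in if even n then u \<ominus>\<^bsub>N\<^esub> v else u \<oplus>\<^bsub>N\<^esub> v)\<rparr>"

text \<open>The homothety map \<open>R \<rightarrow> Hom(X, X)\<close>, with \<open>R\<close> in degree \<open>0\<close>.\<close>

definition homothety ::
  "('a, 'r) ring_scheme \<Rightarrow> ('a, 'm) cochain \<Rightarrow> int \<Rightarrow> 'a \<Rightarrow> (int \<Rightarrow> 'm \<Rightarrow> 'm)"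
  where "homothety R X n r =
    (if n = 0 then (\<lambda>i. \<lambda>x\<in>carrier (obj X i). r \<odot>\<^bsub>obj X i\<^esub> x)
     else \<zero>\<^bsub>obj (Hom_complex R X X) n\<^esub>)"


section \<open>Local cohomology and dualizing complexes\<close>

fun ideal_power :: "('a, 'r) ring_scheme \<Rightarrow> 'a set \<Rightarrow> nat \<Rightarrow> 'a set"
  where
    "ideal_power R I 0 = carrier R"
  | "ideal_power R I (Suc k) = ideal_prod R I (ideal_power R I k)"

definition torsion_module :: "('a, 'r) ring_scheme \<Rightarrow> 'a set \<Rightarrow> ('a, 'm) module \<Rightarrow> ('a, 'm) module"
  where "torsion_module R \<mm> M =
    M\<lparr>carrier := {x \<in> carrier M. \<exists>k. \<forall>a\<in>ideal_power R \<mm> k. a \<odot>\<^bsub>M\<^esub> x = \<zero>\<^bsub>M\<^esub>}\<rparr>"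

definition torsion_complex :: "('a, 'r) ring_scheme \<Rightarrow> 'a set \<Rightarrow> ('a, 'm) cochain \<Rightarrow> ('a, 'm) cochain"
  where "torsion_complex R \<mm> X = \<lparr>obj = (\<lambda>n. torsion_module R \<mm> (obj X n)), dif = dif X\<rparr>"

definition injective_resolution ::
  "('a, 'r) ring_scheme \<Rightarrow> ('a, 'm) cochain \<Rightarrow> ('a, 'j) cochain \<Rightarrow> bool"
  where "injective_resolution R X J \<longleftrightarrow>
    bounded_below J \<and> (\<forall>n. injective_module R (obj J n)) \<and> (\<exists>f. quasi_iso R X J f)"

text \<open>
  \<open>R\<Gamma>\<^sub>\<mm>(X)\<close> is \<open>\<Gamma>\<^sub>\<mm>(J)\<close> for an injective resolution \<open>J\<close> of \<open>X\<close>, so local cohomology is well defined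
  only up to isomorphism: \<open>local_cohomology R \<mm> J i\<close> is \<open>H\<^sup>i\<^sub>\<mm>(X)\<close> computed with the resolution \<open>J\<close>.
  Since a dualizing complex \<open>D\<close> is a bounded complex of injectives, \<open>RHom\<^sub>R(M, D)\<close> is
  \<open>Hom_into R M D\<close>, and \<open>local_cohomology R \<mm> J i\<close> is \<open>H\<^sup>i\<^sub>\<mm>(M, D)\<close> for every \<open>J\<close> with
  \<open>resolves_RHom R M D J\<close>.
\<close>

definition local_cohomology :: "('a, 'r) ring_scheme \<Rightarrow> 'a set \<Rightarrow> ('a, 'j) cochain \<Rightarrow> int \<Rightarrow> ('a, 'j set) module"
  where "local_cohomology R \<mm> J i = cohomology (torsion_complex R \<mm> J) i"

definition resolves_RHom ::
  "('a, 'r) ring_scheme \<Rightarrow> ('a, 'm) module \<Rightarrow> ('a, 'd) cochain \<Rightarrow> ('a, 'j) cochain \<Rightarrow> bool"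
  where "resolves_RHom R M D J \<longleftrightarrow> injective_resolution R (Hom_into R M D) J"

definition dualizing_complex :: "('a, 'r) ring_scheme \<Rightarrow> ('a, 'd) cochain \<Rightarrow> bool"
  where "dualizing_complex R D \<longleftrightarrow>
    cochain_complex R D \<and> bounded_below D \<and> bounded_above D \<and>
    (\<forall>n. injective_module R (obj D n)) \<and>
    (\<forall>n. fg_module R (cohomology D n)) \<and>
    quasi_iso R (in_degree 0 (regular_module R)) (Hom_complex R D D) (homothety R D)"

text \<open>Normalization: \<open>R\<Gamma>\<^sub>\<mm>(D) \<cong> E[-t]\<close>, where \<open>R\<Gamma>\<^sub>\<mm>(D) = \<Gamma>\<^sub>\<mm>(D)\<close> because \<open>D\<close> consists of
  injectives.\<close>

definition normalized_dualizing_complex ::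
  "('a, 'r) ring_scheme \<Rightarrow> 'a set \<Rightarrow> nat \<Rightarrow> ('a, 'e) module \<Rightarrow> ('a, 'd) cochain \<Rightarrow> bool"
  where "normalized_dualizing_complex R \<mm> t E D \<longleftrightarrow>
    dualizing_complex R D \<and> derived_iso R (torsion_complex R \<mm> D) (in_degree (int t) E)"


section \<open>Universal properties for test modules on arbitrary types\<close>

lemma mod_homD:
  assumes "f \<in> mod_hom R M N"
  shows "x \<in> carrier M \<Longrightarrow> f x \<in> carrier N"
    and "x \<in> carrier M \<Longrightarrow> y \<in> carrier M \<Longrightarrow> f (x \<oplus>\<^bsub>M\<^esub> y) = f x \<oplus>\<^bsub>N\<^esub> f y"
    and "r \<in> carrier R \<Longrightarrow> x \<in> carrier M \<Longrightarrow> f (r \<odot>\<^bsub>M\<^esub> x) = r \<odot>\<^bsub>N\<^esub> f x"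
  using assms by (auto simp: mod_hom_def)

lemma mod_hom_zero:
  assumes "module R M" "module R N" "f \<in> mod_hom R M N"
  shows "f \<zero>\<^bsub>M\<^esub> = \<zero>\<^bsub>N\<^esub>"
proof -
  interpret M: module R M by fact
  interpret N: module R N by fact
  have "f (\<zero>\<^bsub>R\<^esub> \<odot>\<^bsub>M\<^esub> \<zero>\<^bsub>M\<^esub>) = \<zero>\<^bsub>R\<^esub> \<odot>\<^bsub>N\<^esub> f \<zero>\<^bsub>M\<^esub>"
    by (rule mod_homD(3)[OF assms(3)]) auto
  then show ?thesis using mod_homD(1)[OF assms(3)] by simp
qed

lemma module_regular_module:
  assumes "cring R" shows "module R (regular_module R)"
proof -
  interpret cring R by fact
  have "abelian_group (regular_module R)"
    by (rule abelian_groupI)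
       (auto simp: regular_module_def a_ac intro: bexI[of _ "\<ominus>\<^bsub>R\<^esub> _"] l_neg)
  then show ?thesis
    by (intro moduleI) (auto simp: regular_module_def l_distr r_distr m_assoc assms)
qed

text \<open>Baer's criterion: an injective module has the extension property for test modules on all types.\<close>

theorem injective_module_extend:
  fixes A :: "('a, 'm) module" and B :: "('a, 'n) module" and I :: "('a, 'k) module"
  assumes I: "injective_module R I" and A: "module R A" and B: "module R B"
    and i: "i \<in> mod_hom R A B" and inj: "inj_on i (carrier A)" and f: "f \<in> mod_hom R A I"
  shows "\<exists>g\<in>mod_hom R B I. \<forall>x\<in>carrier A. g (i x) = f x"
proof -
  have Im: "module R I" using I by (simp add: injective_module_def)
  interpret A: module R A by fact
  interpret B: module R B by fact
  interpret I: module R I by fact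
  define lin where "lin G \<longleftrightarrow> G \<subseteq> carrier B \<times> carrier I \<and>
     (\<forall>x y x' y'. (x, y) \<in> G \<longrightarrow> (x', y') \<in> G \<longrightarrow> (x \<oplus>\<^bsub>B\<^esub> x', y \<oplus>\<^bsub>I\<^esub> y') \<in> G) \<and>
     (\<forall>r\<in>carrier R. \<forall>x y. (x, y) \<in> G \<longrightarrow> (r \<odot>\<^bsub>B\<^esub> x, r \<odot>\<^bsub>I\<^esub> y) \<in> G) \<and>
     (\<forall>y. (\<zero>\<^bsub>B\<^esub>, y) \<in> G \<longrightarrow> y = \<zero>\<^bsub>I\<^esub>)" for G
  define G0 where "G0 = (\<lambda>x. (i x, f x)) ` carrier A"
  have lin0: "lin G0"
    unfolding lin_def
  proof (intro conjI allI ballI impI)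
    show "G0 \<subseteq> carrier B \<times> carrier I"
      using mod_homD(1)[OF i] mod_homD(1)[OF f] by (auto simp: G0_def)
  next
    fix x y x' y' assume "(x, y) \<in> G0" "(x', y') \<in> G0"
    then obtain a a' where "a \<in> carrier A" "a' \<in> carrier A" "x = i a" "y = f a" "x' = i a'" "y' = f a'"
      by (auto simp: G0_def)
    then have "(x \<oplus>\<^bsub>B\<^esub> x', y \<oplus>\<^bsub>I\<^esub> y') = (i (a \<oplus>\<^bsub>A\<^esub> a'), f (a \<oplus>\<^bsub>A\<^esub> a'))" "a \<oplus>\<^bsub>A\<^esub> a' \<in> carrier A"
      using mod_homD(2)[OF i] mod_homD(2)[OF f] by auto
    then show "(x \<oplus>\<^bsub>B\<^esub> x', y \<oplus>\<^bsub>I\<^esub> y') \<in> G0" unfolding G0_def by blast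
  next
    fix r x y assume r: "r \<in> carrier R" and "(x, y) \<in> G0"
    then obtain a where "a \<in> carrier A" "x = i a" "y = f a" by (auto simp: G0_def)
    then have "(r \<odot>\<^bsub>B\<^esub> x, r \<odot>\<^bsub>I\<^esub> y) = (i (r \<odot>\<^bsub>A\<^esub> a), f (r \<odot>\<^bsub>A\<^esub> a))" "r \<odot>\<^bsub>A\<^esub> a \<in> carrier A"
      using mod_homD(3)[OF i] mod_homD(3)[OF f] r by auto
    then show "(r \<odot>\<^bsub>B\<^esub> x, r \<odot>\<^bsub>I\<^esub> y) \<in> G0" unfolding G0_def by blast
  next
    fix y assume "(\<zero>\<^bsub>B\<^esub>, y) \<in> G0"
    then obtain a where a: "a \<in> carrier A" "\<zero>\<^bsub>B\<^esub> = i a" "y = f a" by (auto simp: G0_def)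
    then have "a = \<zero>\<^bsub>A\<^esub>"
      using mod_hom_zero[OF A B i] inj by (metis A.M.zero_closed inj_onD)
    then show "y = \<zero>\<^bsub>I\<^esub>" using a mod_hom_zero[OF A Im f] by simp
  qed
  define S where "S = {G. lin G \<and> G0 \<subseteq> G}"
  have "\<exists>G\<in>S. \<forall>X\<in>S. G \<subseteq> X \<longrightarrow> X = G"
  proof (rule subset_Zorn_nonempty)
    show "S \<noteq> {}" using lin0 by (auto simp: S_def)
  next
    fix C assume C: "C \<noteq> {}" "subset.chain S C"
    have sub: "C \<subseteq> S" and ch: "\<And>X Y. X \<in> C \<Longrightarrow> Y \<in> C \<Longrightarrow> X \<subseteq> Y \<or> Y \<subseteq> X"
      using C(2) by (auto simp: subset_chain_def)
    have "lin (\<Union>C)"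
      unfolding lin_def
    proof (intro conjI allI ballI impI)
      show "\<Union>C \<subseteq> carrier B \<times> carrier I" using sub unfolding S_def lin_def by blast
    next
      fix x y x' y' assume "(x, y) \<in> \<Union>C" "(x', y') \<in> \<Union>C"
      then obtain X where X: "X \<in> C" "(x, y) \<in> X" "(x', y') \<in> X" using ch by blast
      then have "lin X" using sub by (auto simp: S_def)
      then have "(x \<oplus>\<^bsub>B\<^esub> x', y \<oplus>\<^bsub>I\<^esub> y') \<in> X" using X by (simp add: lin_def)
      then show "(x \<oplus>\<^bsub>B\<^esub> x', y \<oplus>\<^bsub>I\<^esub> y') \<in> \<Union>C" using X by blast
    next
      fix r x y assume "r \<in> carrier R" "(x, y) \<in> \<Union>C"
      then show "(r \<odot>\<^bsub>B\<^esub> x, r \<odot>\<^bsub>I\<^esub> y) \<in> \<Union>C" using sub unfolding S_def lin_def by blast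
    next
      fix y assume "(\<zero>\<^bsub>B\<^esub>, y) \<in> \<Union>C"
      then show "y = \<zero>\<^bsub>I\<^esub>" using sub unfolding S_def lin_def by blast
    qed
    then show "\<Union>C \<in> S" using C(1) sub by (auto simp: S_def)
  qed
  then obtain G where GS: "G \<in> S" and max: "\<And>X. X \<in> S \<Longrightarrow> G \<subseteq> X \<Longrightarrow> X = G" by blast
  have linG: "lin G" and G0G: "G0 \<subseteq> G" using GS by (auto simp: S_def)
  have Gc: "x \<in> carrier B" "y \<in> carrier I" if "(x, y) \<in> G" for x y
    using linG that by (auto simp: lin_def)
  have Ga: "(x \<oplus>\<^bsub>B\<^esub> x', y \<oplus>\<^bsub>I\<^esub> y') \<in> G" if "(x, y) \<in> G" "(x', y') \<in> G" for x y x' y'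
    using linG that by (simp add: lin_def)
  have Gm: "(r \<odot>\<^bsub>B\<^esub> x, r \<odot>\<^bsub>I\<^esub> y) \<in> G" if "(x, y) \<in> G" "r \<in> carrier R" for r x y
    using linG that by (simp add: lin_def)
  have Gn: "(\<ominus>\<^bsub>B\<^esub> x, \<ominus>\<^bsub>I\<^esub> y) \<in> G" if "(x, y) \<in> G" for x y
    using Gm[OF that, of "\<ominus>\<^bsub>R\<^esub> \<one>\<^bsub>R\<^esub>"] Gc[OF that] by (simp add: B.smult_l_minus I.smult_l_minus)
  have Gu: "y = y'" if "(x, y) \<in> G" "(x, y') \<in> G" for x y y'
  proof -
    have "(\<zero>\<^bsub>B\<^esub>, y \<oplus>\<^bsub>I\<^esub> \<ominus>\<^bsub>I\<^esub> y') \<in> G"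
      using Ga[OF that(1) Gn[OF that(2)]] Gc[OF that(1)] by (simp add: B.M.r_neg)
    then have "y \<oplus>\<^bsub>I\<^esub> \<ominus>\<^bsub>I\<^esub> y' = \<zero>\<^bsub>I\<^esub>" using linG by (simp add: lin_def)
    then show ?thesis using Gc that
      by (metis I.M.add.inv_closed I.M.minus_equality I.M.minus_minus)
  qed
  have G00: "(\<zero>\<^bsub>B\<^esub>, \<zero>\<^bsub>I\<^esub>) \<in> G"
    using G0G mod_hom_zero[OF A B i] mod_hom_zero[OF A Im f] unfolding G0_def by force
  have dom: "\<exists>y. (b, y) \<in> G" if b: "b \<in> carrier B" for b
  proof -
    define \<aa> where "\<aa> = {r \<in> carrier R. \<exists>y. (r \<odot>\<^bsub>B\<^esub> b, y) \<in> G}"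
    define \<phi> where "\<phi> r = (THE y. (r \<odot>\<^bsub>B\<^esub> b, y) \<in> G)" for r
    have \<phi>: "(r \<odot>\<^bsub>B\<^esub> b, \<phi> r) \<in> G" if "r \<in> \<aa>" for r
    proof -
      obtain y where "(r \<odot>\<^bsub>B\<^esub> b, y) \<in> G" using \<open>r \<in> \<aa>\<close> by (auto simp: \<aa>_def)
      then show ?thesis unfolding \<phi>_def by (rule theI) (auto intro: Gu \<open>(r \<odot>\<^bsub>B\<^esub> b, y) \<in> G\<close>)
    qed
    define RR where "RR = regular_module R"
    have RR: "module R RR" unfolding RR_def by (rule module_regular_module) (rule A.R.is_cring)
    interpret RR: module R RR by fact
    have RRs: "carrier RR = carrier R" "\<zero>\<^bsub>RR\<^esub> = \<zero>\<^bsub>R\<^esub>" "(\<oplus>\<^bsub>RR\<^esub>) = (\<oplus>\<^bsub>R\<^esub>)" "(\<odot>\<^bsub>RR\<^esub>) = (\<otimes>\<^bsub>R\<^esub>)"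
      by (auto simp: RR_def regular_module_def)
    have add\<aa>: "r \<oplus>\<^bsub>R\<^esub> s \<in> \<aa>" "\<phi> (r \<oplus>\<^bsub>R\<^esub> s) = \<phi> r \<oplus>\<^bsub>I\<^esub> \<phi> s" if "r \<in> \<aa>" "s \<in> \<aa>" for r s
    proof -
      have "((r \<oplus>\<^bsub>R\<^esub> s) \<odot>\<^bsub>B\<^esub> b, \<phi> r \<oplus>\<^bsub>I\<^esub> \<phi> s) \<in> G"
        using Ga[OF \<phi>[OF that(1)] \<phi>[OF that(2)]] that b by (simp add: \<aa>_def B.smult_l_distr)
      moreover from this show "r \<oplus>\<^bsub>R\<^esub> s \<in> \<aa>" using that by (auto simp: \<aa>_def)
      ultimately show "\<phi> (r \<oplus>\<^bsub>R\<^esub> s) = \<phi> r \<oplus>\<^bsub>I\<^esub> \<phi> s" using Gu \<phi> by blast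
    qed
    have mul\<aa>: "s \<otimes>\<^bsub>R\<^esub> r \<in> \<aa>" "\<phi> (s \<otimes>\<^bsub>R\<^esub> r) = s \<odot>\<^bsub>I\<^esub> \<phi> r" if "r \<in> \<aa>" "s \<in> carrier R" for r s
    proof -
      have "((s \<otimes>\<^bsub>R\<^esub> r) \<odot>\<^bsub>B\<^esub> b, s \<odot>\<^bsub>I\<^esub> \<phi> r) \<in> G"
        using Gm[OF \<phi>[OF that(1)] that(2)] that b by (simp add: \<aa>_def B.smult_assoc1)
      moreover from this show "s \<otimes>\<^bsub>R\<^esub> r \<in> \<aa>" using that by (auto simp: \<aa>_def)
      ultimately show "\<phi> (s \<otimes>\<^bsub>R\<^esub> r) = s \<odot>\<^bsub>I\<^esub> \<phi> r" using Gu \<phi> by blast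
    qed
    have z\<aa>: "\<zero>\<^bsub>R\<^esub> \<in> \<aa>" using G00 b by (auto simp: \<aa>_def)
    have "submodule \<aa> R RR"
    proof (rule RR.submoduleI)
      fix a assume a: "a \<in> \<aa>"
      then have ac: "a \<in> carrier R" by (simp add: \<aa>_def)
      have "\<ominus>\<^bsub>RR\<^esub> a = (\<ominus>\<^bsub>R\<^esub> \<one>\<^bsub>R\<^esub>) \<odot>\<^bsub>RR\<^esub> a"
        using ac by (simp add: RR.smult_l_minus RRs(1))
      then show "\<ominus>\<^bsub>RR\<^esub> a \<in> \<aa>" using mul\<aa>(1)[OF a, of "\<ominus>\<^bsub>R\<^esub> \<one>\<^bsub>R\<^esub>"] by (simp add: RRs)
    qed (use z\<aa> add\<aa> mul\<aa> in \<open>auto simp: RRs \<aa>_def\<close>)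
    then have mod\<aa>: "module R (RR\<lparr>carrier := \<aa>\<rparr>)" by (rule submodule.submodule_is_module) (rule RR)
    have "(\<lambda>x. x) \<in> mod_hom R (RR\<lparr>carrier := \<aa>\<rparr>) RR"
      by (auto simp: mod_hom_def RRs \<aa>_def)
    moreover have "\<phi> \<in> mod_hom R (RR\<lparr>carrier := \<aa>\<rparr>) I"
      using add\<aa> mul\<aa> Gc(2)[OF \<phi>] by (auto simp: mod_hom_def RRs)
    moreover have "inj_on (\<lambda>x. x) (carrier (RR\<lparr>carrier := \<aa>\<rparr>))" by simp
    ultimately have "\<exists>\<psi>\<in>mod_hom R RR I. \<forall>x\<in>carrier (RR\<lparr>carrier := \<aa>\<rparr>). \<psi> x = \<phi> x"
      using I[unfolded injective_module_def, THEN conjunct2, rule_format,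
        of "RR\<lparr>carrier := \<aa>\<rparr>" RR "\<lambda>x. x" \<phi>] mod\<aa> RR by blast
    then obtain \<psi> where \<psi>: "\<psi> \<in> mod_hom R RR I" "\<And>x. x \<in> \<aa> \<Longrightarrow> \<psi> x = \<phi> x" by auto
    define c where "c = \<psi> \<one>\<^bsub>R\<^esub>"
    have c: "c \<in> carrier I" unfolding c_def using mod_homD(1)[OF \<psi>(1)] by (simp add: RRs)
    have \<psi>c: "\<psi> r = r \<odot>\<^bsub>I\<^esub> c" if "r \<in> carrier R" for r
      using mod_homD(3)[OF \<psi>(1) that, of "\<one>\<^bsub>R\<^esub>"] that by (simp add: RRs c_def)
    define G' where "G' = {(x \<oplus>\<^bsub>B\<^esub> r \<odot>\<^bsub>B\<^esub> b, y \<oplus>\<^bsub>I\<^esub> r \<odot>\<^bsub>I\<^esub> c) | x y r. (x, y) \<in> G \<and> r \<in> carrier R}"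
    have GG': "G \<subseteq> G'"
    proof
      fix z assume "z \<in> G"
      moreover obtain x y where z: "z = (x, y)" by fastforce
      ultimately have "z = (x \<oplus>\<^bsub>B\<^esub> \<zero>\<^bsub>R\<^esub> \<odot>\<^bsub>B\<^esub> b, y \<oplus>\<^bsub>I\<^esub> \<zero>\<^bsub>R\<^esub> \<odot>\<^bsub>I\<^esub> c)"
        using Gc b c by auto
      with \<open>z \<in> G\<close> z show "z \<in> G'" unfolding G'_def by blast
    qed
    have "lin G'"
      unfolding lin_def
    proof (intro conjI allI ballI impI)
      show "G' \<subseteq> carrier B \<times> carrier I" using Gc b c by (auto simp: G'_def)
    next
      fix x y x' y' assume "(x, y) \<in> G'" "(x', y') \<in> G'"
      then obtain u v r u' v' r' where *: "(u, v) \<in> G" "(u', v') \<in> G" "r \<in> carrier R" "r' \<in> carrier R"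
        "x = u \<oplus>\<^bsub>B\<^esub> r \<odot>\<^bsub>B\<^esub> b" "y = v \<oplus>\<^bsub>I\<^esub> r \<odot>\<^bsub>I\<^esub> c" "x' = u' \<oplus>\<^bsub>B\<^esub> r' \<odot>\<^bsub>B\<^esub> b" "y' = v' \<oplus>\<^bsub>I\<^esub> r' \<odot>\<^bsub>I\<^esub> c"
        by (auto simp: G'_def)
      then have "x \<oplus>\<^bsub>B\<^esub> x' = (u \<oplus>\<^bsub>B\<^esub> u') \<oplus>\<^bsub>B\<^esub> (r \<oplus>\<^bsub>R\<^esub> r') \<odot>\<^bsub>B\<^esub> b"
        "y \<oplus>\<^bsub>I\<^esub> y' = (v \<oplus>\<^bsub>I\<^esub> v') \<oplus>\<^bsub>I\<^esub> (r \<oplus>\<^bsub>R\<^esub> r') \<odot>\<^bsub>I\<^esub> c"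
        using Gc[OF *(1)] Gc[OF *(2)] b c
        by (simp_all add: B.smult_l_distr I.smult_l_distr B.M.a_ac I.M.a_ac)
      then show "(x \<oplus>\<^bsub>B\<^esub> x', y \<oplus>\<^bsub>I\<^esub> y') \<in> G'" unfolding G'_def using Ga[OF *(1,2)] *(3,4) by blast
    next
      fix s x y assume s: "s \<in> carrier R" and "(x, y) \<in> G'"
      then obtain u v r where *: "(u, v) \<in> G" "r \<in> carrier R"
        "x = u \<oplus>\<^bsub>B\<^esub> r \<odot>\<^bsub>B\<^esub> b" "y = v \<oplus>\<^bsub>I\<^esub> r \<odot>\<^bsub>I\<^esub> c"
        by (auto simp: G'_def)
      then have "s \<odot>\<^bsub>B\<^esub> x = s \<odot>\<^bsub>B\<^esub> u \<oplus>\<^bsub>B\<^esub> (s \<otimes>\<^bsub>R\<^esub> r) \<odot>\<^bsub>B\<^esub> b"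
        "s \<odot>\<^bsub>I\<^esub> y = s \<odot>\<^bsub>I\<^esub> v \<oplus>\<^bsub>I\<^esub> (s \<otimes>\<^bsub>R\<^esub> r) \<odot>\<^bsub>I\<^esub> c"
        using Gc[OF *(1)] b c s
        by (simp_all add: B.smult_r_distr I.smult_r_distr B.smult_assoc1 I.smult_assoc1)
      then show "(s \<odot>\<^bsub>B\<^esub> x, s \<odot>\<^bsub>I\<^esub> y) \<in> G'" unfolding G'_def using Gm[OF *(1) s] *(2) s by blast
    next
      fix z assume "(\<zero>\<^bsub>B\<^esub>, z) \<in> G'"
      then obtain u v r where *: "(u, v) \<in> G" "r \<in> carrier R"
        "\<zero>\<^bsub>B\<^esub> = u \<oplus>\<^bsub>B\<^esub> r \<odot>\<^bsub>B\<^esub> b" "z = v \<oplus>\<^bsub>I\<^esub> r \<odot>\<^bsub>I\<^esub> c"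
        by (auto simp: G'_def)
      have rb: "\<ominus>\<^bsub>B\<^esub> u = r \<odot>\<^bsub>B\<^esub> b"
        using *(1-3) Gc b by (metis B.M.minus_equality B.M.a_comm B.smult_closed)
      then have rG: "(r \<odot>\<^bsub>B\<^esub> b, \<ominus>\<^bsub>I\<^esub> v) \<in> G" using Gn[OF *(1)] by simp
      then have ra: "r \<in> \<aa>" using *(2) by (auto simp: \<aa>_def)
      then have "r \<odot>\<^bsub>I\<^esub> c = \<ominus>\<^bsub>I\<^esub> v" using \<psi>(2)[OF ra] \<psi>c[OF *(2)] Gu[OF \<phi>[OF ra] rG] by simp
      then show "z = \<zero>\<^bsub>I\<^esub>" using *(4) Gc[OF *(1)] by (simp add: I.M.r_neg)
    qed
    then have "G' = G" using max[of G'] GG' G0G by (auto simp: S_def)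
    moreover have "(\<zero>\<^bsub>B\<^esub> \<oplus>\<^bsub>B\<^esub> \<one>\<^bsub>R\<^esub> \<odot>\<^bsub>B\<^esub> b, \<zero>\<^bsub>I\<^esub> \<oplus>\<^bsub>I\<^esub> \<one>\<^bsub>R\<^esub> \<odot>\<^bsub>I\<^esub> c) \<in> G'"
      unfolding G'_def using G00 A.R.one_closed by blast
    ultimately show ?thesis by (metis B.M.l_zero B.smult_one b)
  qed
  define g where "g b = (THE y. (b, y) \<in> G)" for b
  have geq: "g x = y" if "(x, y) \<in> G" for x y
    unfolding g_def using that by (rule the_equality) (rule Gu[OF _ that])
  have gG: "(b, g b) \<in> G" if "b \<in> carrier B" for b
    using dom[OF that] geq by auto
  have "g \<in> mod_hom R B I"
    using gG Gc(2)[OF gG] geq Ga Gm by (auto simp: mod_hom_def)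
  moreover have "\<forall>x\<in>carrier A. g (i x) = f x"
    using geq G0G unfolding G0_def by blast
  ultimately show ?thesis by blast
qed


text \<open>The free module \<open>R\<^sup>(\<^sup>S\<^sup>)\<close>.\<close>

definition free_module :: "('a, 'r) ring_scheme \<Rightarrow> 's set \<Rightarrow> ('a, 's \<Rightarrow> 'a) module"
  where "free_module R S =
    \<lparr>carrier = {u \<in> S \<rightarrow>\<^sub>E carrier R. finite {s \<in> S. u s \<noteq> \<zero>\<^bsub>R\<^esub>}},
     monoid.mult = undefined, one = undefined,
     ring.zero = (\<lambda>s\<in>S. \<zero>\<^bsub>R\<^esub>), add = (\<lambda>u v. \<lambda>s\<in>S. u s \<oplus>\<^bsub>R\<^esub> v s),
     smult = (\<lambda>r u. \<lambda>s\<in>S. r \<otimes>\<^bsub>R\<^esub> u s)\<rparr>"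

lemma module_free_module:
  assumes "cring R" shows "module R (free_module R S)"
proof -
  interpret cring R by fact
  have fin: "finite {s \<in> S. u s \<oplus>\<^bsub>R\<^esub> v s \<noteq> \<zero>\<^bsub>R\<^esub>}"
    if "finite {s \<in> S. u s \<noteq> \<zero>\<^bsub>R\<^esub>}" "finite {s \<in> S. v s \<noteq> \<zero>\<^bsub>R\<^esub>}" for u v
    by (rule finite_subset[OF _ finite_UnI[OF that]]) auto
  have fin2: "finite {s \<in> S. r \<otimes>\<^bsub>R\<^esub> u s \<noteq> \<zero>\<^bsub>R\<^esub>}"
    if "finite {s \<in> S. u s \<noteq> \<zero>\<^bsub>R\<^esub>}" "r \<in> carrier R" for u r
    by (rule finite_subset[OF _ that(1)]) (use that(2) in auto)
  have "abelian_group (free_module R S)"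
  proof (rule abelian_groupI)
    fix u assume u: "u \<in> carrier (free_module R S)"
    let ?v = "\<lambda>s\<in>S. (\<ominus>\<^bsub>R\<^esub> \<one>\<^bsub>R\<^esub>) \<otimes>\<^bsub>R\<^esub> u s"
    have "?v \<in> carrier (free_module R S)"
      using u fin2[of u "\<ominus>\<^bsub>R\<^esub> \<one>\<^bsub>R\<^esub>"]
      by (auto simp: free_module_def PiE_iff intro: finite_subset[rotated])
    moreover have "?v \<oplus>\<^bsub>free_module R S\<^esub> u = \<zero>\<^bsub>free_module R S\<^esub>"
      using u by (auto simp: free_module_def PiE_iff l_minus l_neg intro!: restrict_ext)
    ultimately show "\<exists>v\<in>carrier (free_module R S). v \<oplus>\<^bsub>free_module R S\<^esub> u = \<zero>\<^bsub>free_module R S\<^esub>"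
      by blast
  qed (auto simp: free_module_def PiE_iff a_ac fin extensional_def fun_eq_iff intro: finite_subset[OF _ fin])
  then show ?thesis
    by (intro moduleI)
       (auto simp: free_module_def PiE_iff l_distr r_distr m_assoc assms extensional_def fun_eq_iff
         intro: finite_subset[OF _ fin2])
qed

definition lin_ext :: "'s set \<Rightarrow> ('a, 'r) ring_scheme \<Rightarrow> ('a, 'm) module \<Rightarrow> ('s \<Rightarrow> 'm) \<Rightarrow> ('s \<Rightarrow> 'a) \<Rightarrow> 'm"
  where "lin_ext S R M a u = (\<Oplus>\<^bsub>M\<^esub>s\<in>{s \<in> S. u s \<noteq> \<zero>\<^bsub>R\<^esub>}. u s \<odot>\<^bsub>M\<^esub> a s)"

lemma lin_ext_superset:
  assumes "module R M" "a \<in> S \<rightarrow> carrier M" "u \<in> S \<rightarrow> carrier R"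
    and "finite T" "{s \<in> S. u s \<noteq> \<zero>\<^bsub>R\<^esub>} \<subseteq> T" "T \<subseteq> S"
  shows "lin_ext S R M a u = (\<Oplus>\<^bsub>M\<^esub>s\<in>T. u s \<odot>\<^bsub>M\<^esub> a s)"
proof -
  interpret M: module R M by fact
  have "s \<in> S \<Longrightarrow> a s \<in> carrier M" "s \<in> S \<Longrightarrow> u s \<in> carrier R" for s using assms by auto
  then show ?thesis unfolding lin_ext_def using assms
    by (intro M.M.add.finprod_mono_neutral_cong_left) auto
qed

lemma lin_ext_hom:
  fixes M :: "('a, 'm) module"
  assumes M: "module R M" and a: "a \<in> S \<rightarrow> carrier M"
  shows "lin_ext S R M a \<in> mod_hom R (free_module R S) M"
proof -
  interpret M: module R M by fact
  have a': "s \<in> S \<Longrightarrow> a s \<in> carrier M" for s using a by auto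
  have *: "u \<in> S \<rightarrow> carrier R" "\<And>s. s \<in> S \<Longrightarrow> u s \<in> carrier R" "finite {s \<in> S. u s \<noteq> \<zero>\<^bsub>R\<^esub>}"
    if "u \<in> carrier (free_module R S)" for u
    using that by (auto simp: free_module_def)
  show ?thesis
    unfolding mod_hom_def
  proof (intro CollectI conjI ballI funcsetI)
    fix u assume "u \<in> carrier (free_module R S)"
    then show "lin_ext S R M a u \<in> carrier M"
      unfolding lin_ext_def by (intro M.M.finsum_closed) (auto simp: a' *)
  next
    fix u v assume u: "u \<in> carrier (free_module R S)" and v: "v \<in> carrier (free_module R S)"
    define T where "T = {s \<in> S. u s \<noteq> \<zero>\<^bsub>R\<^esub>} \<union> {s \<in> S. v s \<noteq> \<zero>\<^bsub>R\<^esub>}"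
    have T: "finite T" "T \<subseteq> S" using *[OF u] *[OF v] by (auto simp: T_def)
    let ?w = "u \<oplus>\<^bsub>free_module R S\<^esub> v"
    have w: "?w \<in> S \<rightarrow> carrier R" "\<And>s. s \<in> S \<Longrightarrow> ?w s = u s \<oplus>\<^bsub>R\<^esub> v s"
      using *(2)[OF u] *(2)[OF v] by (auto simp: free_module_def)
    have TS: "s \<in> S" if "s \<in> T" for s using that T by auto
    have "lin_ext S R M a ?w = (\<Oplus>\<^bsub>M\<^esub>s\<in>T. ?w s \<odot>\<^bsub>M\<^esub> a s)"
      by (rule lin_ext_superset[OF M a w(1) T(1) _ T(2)]) (auto simp: T_def w(2))
    also have "\<dots> = (\<Oplus>\<^bsub>M\<^esub>s\<in>T. u s \<odot>\<^bsub>M\<^esub> a s \<oplus>\<^bsub>M\<^esub> v s \<odot>\<^bsub>M\<^esub> a s)"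
      by (rule M.M.finsum_cong') (auto simp: w(2) TS a' *(2)[OF u] *(2)[OF v] M.smult_l_distr)
    also have "\<dots> = (\<Oplus>\<^bsub>M\<^esub>s\<in>T. u s \<odot>\<^bsub>M\<^esub> a s) \<oplus>\<^bsub>M\<^esub> (\<Oplus>\<^bsub>M\<^esub>s\<in>T. v s \<odot>\<^bsub>M\<^esub> a s)"
      by (rule M.M.finsum_addf) (auto simp: TS a' *(2)[OF u] *(2)[OF v])
    also have "(\<Oplus>\<^bsub>M\<^esub>s\<in>T. u s \<odot>\<^bsub>M\<^esub> a s) = lin_ext S R M a u"
      by (rule lin_ext_superset[OF M a *(1)[OF u] T(1) _ T(2), symmetric]) (auto simp: T_def)
    also have "(\<Oplus>\<^bsub>M\<^esub>s\<in>T. v s \<odot>\<^bsub>M\<^esub> a s) = lin_ext S R M a v"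
      by (rule lin_ext_superset[OF M a *(1)[OF v] T(1) _ T(2), symmetric]) (auto simp: T_def)
    finally show "lin_ext S R M a ?w = lin_ext S R M a u \<oplus>\<^bsub>M\<^esub> lin_ext S R M a v" .
  next
    fix r u assume r: "r \<in> carrier R" and u: "u \<in> carrier (free_module R S)"
    define T where "T = {s \<in> S. u s \<noteq> \<zero>\<^bsub>R\<^esub>}"
    have T: "finite T" "T \<subseteq> S" using *[OF u] by (auto simp: T_def)
    let ?w = "r \<odot>\<^bsub>free_module R S\<^esub> u"
    have w: "?w \<in> S \<rightarrow> carrier R" "\<And>s. s \<in> S \<Longrightarrow> ?w s = r \<otimes>\<^bsub>R\<^esub> u s"
      using *(2)[OF u] r by (auto simp: free_module_def)
    have TS: "s \<in> S" if "s \<in> T" for s using that T by auto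
    have "lin_ext S R M a ?w = (\<Oplus>\<^bsub>M\<^esub>s\<in>T. ?w s \<odot>\<^bsub>M\<^esub> a s)"
      by (rule lin_ext_superset[OF M a w(1) T(1) _ T(2)]) (auto simp: T_def w(2) r)
    also have "\<dots> = (\<Oplus>\<^bsub>M\<^esub>s\<in>T. r \<odot>\<^bsub>M\<^esub> (u s \<odot>\<^bsub>M\<^esub> a s))"
      by (rule M.M.finsum_cong') (auto simp: w(2) TS a' *(2)[OF u] r M.smult_assoc1)
    also have "\<dots> = r \<odot>\<^bsub>M\<^esub> (\<Oplus>\<^bsub>M\<^esub>s\<in>T. u s \<odot>\<^bsub>M\<^esub> a s)"
      by (rule M.finsum_smult_ldistr[symmetric]) (auto simp: T(1) r TS a' *(2)[OF u])
    finally show "lin_ext S R M a ?w = r \<odot>\<^bsub>M\<^esub> lin_ext S R M a u"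
      by (simp add: lin_ext_def T_def)
  qed
qed

lemma mod_hom_finsum:
  assumes M: "module R M" and N: "module R N" and g: "g \<in> mod_hom R M N"
    and T: "finite T" and v: "v \<in> T \<rightarrow> carrier M"
  shows "g (\<Oplus>\<^bsub>M\<^esub>s\<in>T. v s) = (\<Oplus>\<^bsub>N\<^esub>s\<in>T. g (v s))"
proof -
  interpret M: module R M by fact
  interpret N: module R N by fact
  show ?thesis using T v
  proof (induction T)
    case empty
    then show ?case using mod_hom_zero[OF M N g] by simp
  next
    case (insert x F)
    then have "v \<in> F \<rightarrow> carrier M" "v x \<in> carrier M" by auto
    moreover have "(\<lambda>s. g (v s)) \<in> F \<rightarrow> carrier N" using mod_homD(1)[OF g] calculation(1) by auto
    ultimately show ?case
      using insert mod_homD(1,2)[OF g] by (simp add: M.M.finsum_closed)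
  qed
qed

lemma lin_ext_comp:
  assumes M: "module R M" and N: "module R N" and g: "g \<in> mod_hom R M N"
    and a: "a \<in> S \<rightarrow> carrier M" and u: "u \<in> carrier (free_module R S)"
  shows "g (lin_ext S R M a u) = lin_ext S R N (\<lambda>s. g (a s)) u"
proof -
  interpret M: module R M by fact
  interpret N: module R N by fact
  have *: "\<And>s. s \<in> S \<Longrightarrow> u s \<in> carrier R" "finite {s \<in> S. u s \<noteq> \<zero>\<^bsub>R\<^esub>}"
    using u by (auto simp: free_module_def)
  have a': "s \<in> S \<Longrightarrow> a s \<in> carrier M" for s using a by auto
  have "g (lin_ext S R M a u) = (\<Oplus>\<^bsub>N\<^esub>s\<in>{s \<in> S. u s \<noteq> \<zero>\<^bsub>R\<^esub>}. g (u s \<odot>\<^bsub>M\<^esub> a s))"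
    unfolding lin_ext_def by (rule mod_hom_finsum[OF M N g *(2)]) (auto simp: * a')
  also have "\<dots> = lin_ext S R N (\<lambda>s. g (a s)) u"
    unfolding lin_ext_def
    by (rule N.M.finsum_cong') (auto simp: * a' mod_homD[OF g])
  finally show ?thesis .
qed

theorem projective_module_lift:
  fixes A :: "('a, 'm) module" and B :: "('a, 'n) module" and P :: "('a, 'p) module"
  assumes P: "projective_module R P" and A: "module R A" and B: "module R B"
    and g: "g \<in> mod_hom R A B" and surj: "g ` carrier A = carrier B" and f: "f \<in> mod_hom R P B"
  shows "\<exists>h\<in>mod_hom R P A. \<forall>x\<in>carrier P. g (h x) = f x"
proof -
  have Pm: "module R P" using P by (simp add: projective_module_def)
  interpret P: module R P by fact
  let ?S = "carrier P"
  let ?F = "free_module R ?S"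
  let ?p = "lin_ext ?S R P (\<lambda>x. x)"
  have F: "module R ?F" by (rule module_free_module) (rule P.R.is_cring)
  have p: "?p \<in> mod_hom R ?F P" by (rule lin_ext_hom[OF Pm]) auto
  have "?p ` carrier ?F = carrier P"
  proof
    show "?p ` carrier ?F \<subseteq> carrier P" using mod_homD(1)[OF p] by auto
    show "carrier P \<subseteq> ?p ` carrier ?F"
    proof
      fix x assume x: "x \<in> carrier P"
      define u where "u = (\<lambda>s\<in>?S. if s = x then \<one>\<^bsub>R\<^esub> else \<zero>\<^bsub>R\<^esub>)"
      have "{s \<in> ?S. u s \<noteq> \<zero>\<^bsub>R\<^esub>} \<subseteq> {x}" by (auto simp: u_def)
      then have "u \<in> carrier ?F"
        by (auto simp: free_module_def u_def intro: finite_subset)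
      moreover have "?p u = (\<Oplus>\<^bsub>P\<^esub>s\<in>{x}. u s \<odot>\<^bsub>P\<^esub> s)"
        by (rule lin_ext_superset[OF Pm]) (use x in \<open>auto simp: u_def\<close>)
      then have "?p u = x" using x by (simp add: u_def)
      ultimately show "x \<in> ?p ` carrier ?F" by force
    qed
  qed
  moreover have "(\<lambda>x. x) \<in> mod_hom R P P" by (auto simp: mod_hom_def)
  ultimately obtain \<sigma> where \<sigma>: "\<sigma> \<in> mod_hom R P ?F" "\<And>x. x \<in> carrier P \<Longrightarrow> ?p (\<sigma> x) = x"
    using P F Pm p unfolding projective_module_def by blast
  have "\<forall>x\<in>carrier P. \<exists>y\<in>carrier A. g y = f x"
    using surj mod_homD(1)[OF f] by (metis imageE)
  then obtain a where a: "\<And>x. x \<in> carrier P \<Longrightarrow> a x \<in> carrier A" "\<And>x. x \<in> carrier P \<Longrightarrow> g (a x) = f x"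
    by metis
  have aS: "a \<in> ?S \<rightarrow> carrier A" using a by auto
  let ?q = "lin_ext ?S R A a"
  have q: "?q \<in> mod_hom R ?F A" by (rule lin_ext_hom[OF A aS])
  have gq: "g (?q u) = f (?p u)" if "u \<in> carrier ?F" for u
  proof -
    interpret B: module R B by fact
    have u: "s \<in> ?S \<Longrightarrow> u s \<in> carrier R" for s using that by (auto simp: free_module_def)
    have "g (?q u) = lin_ext ?S R B (\<lambda>s. g (a s)) u" by (rule lin_ext_comp[OF A B g aS that])
    also have "\<dots> = lin_ext ?S R B f u"
      unfolding lin_ext_def by (rule B.M.finsum_cong') (auto simp: a u mod_homD[OF f])
    also have "\<dots> = f (?p u)"
      by (rule lin_ext_comp[OF Pm B f _ that, symmetric]) auto
    finally show ?thesis .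
  qed
  show ?thesis
  proof (intro bexI ballI)
    show "(\<lambda>x. ?q (\<sigma> x)) \<in> mod_hom R P A"
      using mod_homD[OF q] mod_homD[OF \<sigma>(1)] by (auto simp: mod_hom_def)
    show "g (?q (\<sigma> x)) = f x" if "x \<in> carrier P" for x
      using gq mod_homD(1)[OF \<sigma>(1) that] \<sigma>(2)[OF that] by simp
  qed
qed

end

theory Submission
  imports Defs
begin

text \<open>
  Let \<open>F\<close> be a resolution of \<open>M\<close> by finite free modules. The total complex of \<open>Hom\<^sub>R(F, D)\<close> consists of
  injectives and is quasi-isomorphic to \<open>Hom\<^sub>R(M, D)\<close>, so its torsion computes the generalized local cohomology.
  Since each \<open>F\<^sub>i\<close> is finite free, torsion passes through \<open>Hom\<^sub>R(F\<^sub>i, -)\<close>, and the torsion of the total complex is the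
  total complex of \<open>Hom\<^sub>R(F, \<Gamma>\<^sub>\<mm> D)\<close>. Since \<open>\<Gamma>\<^sub>\<mm> D\<close> is quasi-isomorphic to \<open>E[-t]\<close>, its cohomology is that of
  \<open>Hom\<^sub>R(F, E)[-t]\<close>, which is \<open>Hom\<^sub>R(M, E)\<close> in degree \<open>t\<close> because \<open>E\<close> is injective. This is (a).

  By (a), the cohomology in degree \<open>p + d\<close> is nonzero exactly if \<open>p + d = t\<close>. The Auslander--Buchsbaum formula
  \<open>p + depth M = depth R\<close> turns this into \<open>d - depth M = t - depth R\<close>.
\<close>

section \<open>Homomorphisms and submodules\<close>

text \<open>The modules \<open>Hom_module R M (obj D n)\<close> are in general not injective, and
  Hom out of \<open>M\<close> does not in general respect the roof between
  \<open>\<Gamma>\<^sub>\<mm> D\<close> and \<open>E[-t]\<close>. Both defects disappear with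
  \<open>F\<close> in place of \<open>M\<close>: maps out of a free module lift along surjections,
  and Hom out of it keeps injectivity. The total complex is a product over all \<open>i\<close>, yet
  in a fixed degree only finitely many factors are nonzero because \<open>D\<close> is bounded
  below; with the finite ranks this puts all components of a torsion valued element under one power
  of \<open>\<mm>\<close>. The given resolution \<open>J\<close> is arbitrary, so it is compared
  with the total complex by a map read off from an exact cone, and the comparison survives torsion
  because that cone is contractible.

  For (b), depth is defined by regular sequences, while the formula concerns the degree where
  \<open>Ext(R/\<mm>, -)\<close> first fails to vanish. The bridge is that \<open>\<mm>\<close> acts
  as zero on \<open>Ext(R/\<mm>, -)\<close>: this lowers the degree by exactly one, both when
  dividing by a regular element and when descending along a minimal resolution.\<close>

lemma mod_homI:
  assumes "\<And>x. x \<in> carrier M \<Longrightarrow> f x \<in> carrier N"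
    and "\<And>x y. x \<in> carrier M \<Longrightarrow> y \<in> carrier M \<Longrightarrow> f (x \<oplus>\<^bsub>M\<^esub> y) = f x \<oplus>\<^bsub>N\<^esub> f y"
    and "\<And>r x. r \<in> carrier R \<Longrightarrow> x \<in> carrier M \<Longrightarrow> f (r \<odot>\<^bsub>M\<^esub> x) = r \<odot>\<^bsub>N\<^esub> f x"
  shows "f \<in> mod_hom R M N"
  using assms by (auto simp: mod_hom_def)

lemma mod_hom_comp:
  assumes "f \<in> mod_hom R A B" "g \<in> mod_hom R B C"
  shows "(\<lambda>x. g (f x)) \<in> mod_hom R A C"
  using mod_homD[OF assms(1)] mod_homD[OF assms(2)] by (intro mod_homI) auto

lemma mod_hom_id: "(\<lambda>x. x) \<in> mod_hom R A A"
  by (intro mod_homI) auto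

lemma mod_hom_cong:
  assumes "f \<in> mod_hom R A B" "module R A" "\<And>x. x \<in> carrier A \<Longrightarrow> g x = f x"
  shows "g \<in> mod_hom R A B"
proof -
  interpret A: module R A by fact
  show ?thesis using mod_homD[OF assms(1)] by (intro mod_homI) (auto simp: assms(3))
qed

lemma mod_hom_minus:
  assumes "module R A" "module R B" "f \<in> mod_hom R A B" "x \<in> carrier A"
  shows "f (\<ominus>\<^bsub>A\<^esub> x) = \<ominus>\<^bsub>B\<^esub> f x"
proof -
  interpret A: module R A by fact
  interpret B: module R B by fact
  have "f (\<ominus>\<^bsub>A\<^esub> x) \<oplus>\<^bsub>B\<^esub> f x = \<zero>\<^bsub>B\<^esub>"
    using mod_homD(2)[OF assms(3), of "\<ominus>\<^bsub>A\<^esub> x" x] assms(4) mod_hom_zero[OF assms(1-3)]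
    by (simp add: A.M.l_neg)
  then show ?thesis
    using mod_homD(1)[OF assms(3)] assms(4) by (simp add: B.M.minus_equality)
qed

lemma mod_hom_diff:
  assumes "module R A" "module R B" "f \<in> mod_hom R A B" "x \<in> carrier A" "y \<in> carrier A"
  shows "f (x \<ominus>\<^bsub>A\<^esub> y) = f x \<ominus>\<^bsub>B\<^esub> f y"
proof -
  interpret A: module R A by fact
  show ?thesis
    using mod_homD(2)[OF assms(3), of x "\<ominus>\<^bsub>A\<^esub> y"] mod_hom_minus[OF assms(1-3,5)] assms(4,5)
    by (simp add: a_minus_def)
qed

lemma mod_hom_zero_map:
  assumes "module R B" shows "(\<lambda>x. \<zero>\<^bsub>B\<^esub>) \<in> mod_hom R A B"
proof -
  interpret B: module R B by fact
  show ?thesis by (intro mod_homI) auto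
qed

lemma mod_hom_plus:
  assumes "module R B" "f \<in> mod_hom R A B" "g \<in> mod_hom R A B"
  shows "(\<lambda>x. f x \<oplus>\<^bsub>B\<^esub> g x) \<in> mod_hom R A B"
proof -
  interpret B: module R B by fact
  show ?thesis using mod_homD[OF assms(2)] mod_homD[OF assms(3)]
    by (intro mod_homI) (auto simp: B.smult_r_distr B.M.a_ac)
qed

lemma mod_hom_uminus:
  assumes "module R B" "f \<in> mod_hom R A B"
  shows "(\<lambda>x. \<ominus>\<^bsub>B\<^esub> f x) \<in> mod_hom R A B"
proof -
  interpret B: module R B by fact
  show ?thesis using mod_homD[OF assms(2)]
    by (intro mod_homI) (auto simp: B.smult_r_minus B.M.minus_add)
qed

lemma mod_hom_sub:
  assumes "module R B" "f \<in> mod_hom R A B" "g \<in> mod_hom R A B"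
  shows "(\<lambda>x. f x \<ominus>\<^bsub>B\<^esub> g x) \<in> mod_hom R A B"
  unfolding a_minus_def by (rule mod_hom_plus[OF assms(1,2) mod_hom_uminus[OF assms(1,3)]])

lemma mod_hom_smult:
  assumes "module R B" "f \<in> mod_hom R A B" "r \<in> carrier R"
  shows "(\<lambda>x. r \<odot>\<^bsub>B\<^esub> f x) \<in> mod_hom R A B"
proof -
  interpret B: module R B by fact
  show ?thesis
  proof (intro mod_homI)
    fix s x assume s: "s \<in> carrier R" and x: "x \<in> carrier A"
    have "r \<odot>\<^bsub>B\<^esub> (s \<odot>\<^bsub>B\<^esub> f x) = s \<odot>\<^bsub>B\<^esub> (r \<odot>\<^bsub>B\<^esub> f x)"
      using s x assms(3) mod_homD(1)[OF assms(2) x]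
      by (metis B.R.m_comm B.smult_assoc1)
    then show "r \<odot>\<^bsub>B\<^esub> f (s \<odot>\<^bsub>A\<^esub> x) = s \<odot>\<^bsub>B\<^esub> (r \<odot>\<^bsub>B\<^esub> f x)"
      using mod_homD(3)[OF assms(2) s x] by simp
  qed (use mod_homD[OF assms(2)] assms(3) in \<open>auto simp: B.smult_r_distr\<close>)
qed

lemma module_sub: "module R M \<Longrightarrow> submodule H R M \<Longrightarrow> module R (M\<lparr>carrier := H\<rparr>)"
  by (rule submodule.submodule_is_module)

lemma submodule_carrier: "module R M \<Longrightarrow> submodule (carrier M) R M"
  by (rule module.carrier_is_submodule)

lemma submoduleI':
  assumes "module R M" "H \<subseteq> carrier M" "\<zero>\<^bsub>M\<^esub> \<in> H"
    and "\<And>a b. a \<in> H \<Longrightarrow> b \<in> H \<Longrightarrow> a \<oplus>\<^bsub>M\<^esub> b \<in> H"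
    and "\<And>r a. r \<in> carrier R \<Longrightarrow> a \<in> H \<Longrightarrow> r \<odot>\<^bsub>M\<^esub> a \<in> H"
  shows "submodule H R M"
proof -
  interpret M: module R M by fact
  show ?thesis
  proof (rule M.submoduleI)
    fix a assume a: "a \<in> H"
    then have "(\<ominus>\<^bsub>R\<^esub> \<one>\<^bsub>R\<^esub>) \<odot>\<^bsub>M\<^esub> a = \<ominus>\<^bsub>M\<^esub> a"
      using assms(2) M.smult_l_minus[of "\<one>\<^bsub>R\<^esub>" a] by auto
    then show "\<ominus>\<^bsub>M\<^esub> a \<in> H" using assms(5)[OF _ a, of "\<ominus>\<^bsub>R\<^esub> \<one>\<^bsub>R\<^esub>"] by simp
  qed (use assms in auto)
qed

lemma submoduleD:
  assumes "module R M" "submodule H R M"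
  shows "H \<subseteq> carrier M" "x \<in> H \<Longrightarrow> x \<in> carrier M" "\<zero>\<^bsub>M\<^esub> \<in> H"
    "x \<in> H \<Longrightarrow> y \<in> H \<Longrightarrow> x \<oplus>\<^bsub>M\<^esub> y \<in> H"
    "r \<in> carrier R \<Longrightarrow> x \<in> H \<Longrightarrow> r \<odot>\<^bsub>M\<^esub> x \<in> H"
    "x \<in> H \<Longrightarrow> \<ominus>\<^bsub>M\<^esub> x \<in> H"
    "x \<in> H \<Longrightarrow> y \<in> H \<Longrightarrow> x \<ominus>\<^bsub>M\<^esub> y \<in> H"
proof -
  interpret M: module R M by fact
  note E = M.submoduleE[OF assms(2)]
  show sub: "H \<subseteq> carrier M" by (rule E(1))
  show "x \<in> H \<Longrightarrow> x \<in> carrier M" using E(1) by auto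
  show "x \<in> H \<Longrightarrow> y \<in> H \<Longrightarrow> x \<oplus>\<^bsub>M\<^esub> y \<in> H" "r \<in> carrier R \<Longrightarrow> x \<in> H \<Longrightarrow> r \<odot>\<^bsub>M\<^esub> x \<in> H"
    "x \<in> H \<Longrightarrow> \<ominus>\<^bsub>M\<^esub> x \<in> H"
    using E by auto
  show "x \<in> H \<Longrightarrow> y \<in> H \<Longrightarrow> x \<ominus>\<^bsub>M\<^esub> y \<in> H" unfolding a_minus_def using E by auto
  obtain a where "a \<in> H" using E(2) by auto
  then show "\<zero>\<^bsub>M\<^esub> \<in> H" using E(4)[of "\<zero>\<^bsub>R\<^esub>" a] sub by auto
qed

lemma submodule_image:
  assumes "module R A" "module R B" "f \<in> mod_hom R A B" "submodule H R A"
  shows "submodule (f ` H) R B"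
proof (rule submoduleI'[OF assms(2)])
  note H = submoduleD[OF assms(1,4)]
  show "f ` H \<subseteq> carrier B" using H mod_homD(1)[OF assms(3)] by auto
  show "\<zero>\<^bsub>B\<^esub> \<in> f ` H" using H(3) mod_hom_zero[OF assms(1-3)] by force
  show "a \<oplus>\<^bsub>B\<^esub> b \<in> f ` H" if ab: "a \<in> f ` H" "b \<in> f ` H" for a b
  proof -
    obtain x y where "x \<in> H" "y \<in> H" "a = f x" "b = f y" using ab by blast
    then show ?thesis using H(2,4) mod_homD(2)[OF assms(3)] by (auto intro!: image_eqI[of _ _ "x \<oplus>\<^bsub>A\<^esub> y"])
  qed
  show "r \<odot>\<^bsub>B\<^esub> a \<in> f ` H" if ra: "r \<in> carrier R" "a \<in> f ` H" for r a
  proof -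
    obtain x where "x \<in> H" "a = f x" using ra by blast
    then show ?thesis using ra(1) H(2,5) mod_homD(3)[OF assms(3)] by (auto intro!: image_eqI[of _ _ "r \<odot>\<^bsub>A\<^esub> x"])
  qed
qed

lemma submodule_vimage:
  assumes "module R A" "module R B" "f \<in> mod_hom R A B" "submodule H R B"
  shows "submodule {x \<in> carrier A. f x \<in> H} R A"
proof -
  interpret A: module R A by fact
  note H = submoduleD[OF assms(2,4)]
  show ?thesis
    by (rule submoduleI'[OF assms(1)])
       (use H mod_homD[OF assms(3)] mod_hom_zero[OF assms(1-3)] in auto)
qed

lemma submodule_zero: "module R M \<Longrightarrow> submodule {\<zero>\<^bsub>M\<^esub>} R M"
proof -
  assume M: "module R M"
  interpret M: module R M by fact
  show ?thesis by (rule submoduleI'[OF M]) auto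
qed

lemma submodule_kernel:
  assumes "module R A" "module R B" "f \<in> mod_hom R A B"
  shows "submodule {x \<in> carrier A. f x = \<zero>\<^bsub>B\<^esub>} R A"
  using submodule_vimage[OF assms submodule_zero[OF assms(2)]] by simp

lemma mod_hom_sub_dom:
  assumes "f \<in> mod_hom R A B" "H \<subseteq> carrier A"
  shows "f \<in> mod_hom R (A\<lparr>carrier := H\<rparr>) B"
  using assms by (auto simp: mod_hom_def subset_iff)

lemma mod_hom_sub_cod:
  assumes "f \<in> mod_hom R A B" "\<And>x. x \<in> carrier A \<Longrightarrow> f x \<in> H"
  shows "f \<in> mod_hom R A (B\<lparr>carrier := H\<rparr>)"
  using assms by (auto simp: mod_hom_def)

lemma mod_hom_sub_codD:
  assumes "f \<in> mod_hom R A (B\<lparr>carrier := H\<rparr>)" "H \<subseteq> carrier B"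
  shows "f \<in> mod_hom R A B"
  using assms by (auto simp: mod_hom_def)

lemma minus_sub:
  assumes "module R M" "submodule H R M" "x \<in> H"
  shows "\<ominus>\<^bsub>M\<lparr>carrier := H\<rparr>\<^esub> x = \<ominus>\<^bsub>M\<^esub> x"
proof -
  interpret M: module R M by fact
  interpret H: module R "M\<lparr>carrier := H\<rparr>" by (rule module_sub) fact+
  show ?thesis
    using H.M.minus_equality[of "\<ominus>\<^bsub>M\<^esub> x" x] submoduleD[OF assms(1,2)] assms(3)
    by (simp add: M.M.l_neg)
qed

lemma (in abelian_group) diff_zero_iff:
  assumes "x \<in> carrier G" "y \<in> carrier G"
  shows "x \<ominus> y = \<zero> \<longleftrightarrow> x = y"
proof
  assume "x \<ominus> y = \<zero>"
  then have "x \<oplus> \<ominus> y = \<zero>" by (simp add: a_minus_def)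
  then have "\<ominus> (\<ominus> y) = x" using assms by (intro minus_equality) auto
  then show "x = y" using assms by simp
qed (use assms in \<open>simp add: a_minus_def r_neg\<close>)

lemma module_hom_eq_iff:
  assumes "module R A" "module R B" "f \<in> mod_hom R A B" "x \<in> carrier A" "y \<in> carrier A"
  shows "f x = f y \<longleftrightarrow> f (x \<ominus>\<^bsub>A\<^esub> y) = \<zero>\<^bsub>B\<^esub>"
proof -
  interpret B: module R B by fact
  show ?thesis using mod_hom_diff[OF assms] mod_homD(1)[OF assms(3)] assms(4,5)
    by (simp add: B.M.diff_zero_iff)
qed

section \<open>Factoring homomorphisms through images\<close>

lemma mod_hom_factor:
  assumes A: "module R A" and B: "module R B" and C: "module R C"
    and u: "u \<in> mod_hom R A B" and \<psi>: "\<psi> \<in> mod_hom R A C"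
    and ker: "\<And>x. x \<in> carrier A \<Longrightarrow> u x = \<zero>\<^bsub>B\<^esub> \<Longrightarrow> \<psi> x = \<zero>\<^bsub>C\<^esub>"
  shows "\<exists>\<theta>\<in>mod_hom R (B\<lparr>carrier := u ` carrier A\<rparr>) C. \<forall>x\<in>carrier A. \<theta> (u x) = \<psi> x"
proof -
  interpret A: module R A by fact
  define \<theta> where "\<theta> y = \<psi> (SOME x. x \<in> carrier A \<and> u x = y)" for y
  have eq: "\<theta> (u x) = \<psi> x" if x: "x \<in> carrier A" for x
  proof -
    have "\<exists>x'. x' \<in> carrier A \<and> u x' = u x" using x by blast
    then have s: "(SOME x'. x' \<in> carrier A \<and> u x' = u x) \<in> carrier A"
      "u (SOME x'. x' \<in> carrier A \<and> u x' = u x) = u x"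
      by (metis (mono_tags, lifting) someI_ex)+
    then show ?thesis unfolding \<theta>_def
      using module_hom_eq_iff[OF A B u s(1) x] module_hom_eq_iff[OF A C \<psi> s(1) x] ker x by simp
  qed
  have "\<theta> \<in> mod_hom R (B\<lparr>carrier := u ` carrier A\<rparr>) C"
  proof (rule mod_homI; clarsimp)
    fix x assume x: "x \<in> carrier A"
    show "\<theta> (u x) \<in> carrier C" using eq[OF x] mod_homD(1)[OF \<psi> x] by simp
    show "\<theta> (r \<odot>\<^bsub>B\<^esub> u x) = r \<odot>\<^bsub>C\<^esub> \<theta> (u x)" if r: "r \<in> carrier R" for r
      using eq[OF x] eq[OF A.smult_closed[OF r x]] mod_homD(3)[OF u r x] mod_homD(3)[OF \<psi> r x] by simp
    show "\<theta> (u x \<oplus>\<^bsub>B\<^esub> u y) = \<theta> (u x) \<oplus>\<^bsub>C\<^esub> \<theta> (u y)" if y: "y \<in> carrier A" for y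
      using eq[OF x] eq[OF y] eq[OF A.M.a_closed[OF x y]] mod_homD(2)[OF u x y] mod_homD(2)[OF \<psi> x y] by simp
  qed
  then show ?thesis using eq by blast
qed

lemma mod_hom_factor_surj:
  assumes "module R A" and "module R B" and "module R C"
    and "u \<in> mod_hom R A B" and "\<psi> \<in> mod_hom R A C" and "u ` carrier A = carrier B"
    and "\<And>x. x \<in> carrier A \<Longrightarrow> u x = \<zero>\<^bsub>B\<^esub> \<Longrightarrow> \<psi> x = \<zero>\<^bsub>C\<^esub>"
  shows "\<exists>\<theta>\<in>mod_hom R B C. \<forall>x\<in>carrier A. \<theta> (u x) = \<psi> x"
  using mod_hom_factor[OF assms(1-5,7)] assms(6) by simp

text \<open>A map that kills the kernel of \<open>u\<close> descends to the image of
  \<open>u\<close>, and from that submodule Baer's criterion extends it to \<open>B\<close>. The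
  null-homotopies below are built from this form, in which \<open>u\<close> is a differential and
  therefore rarely injective.\<close>

lemma injective_extend:
  assumes I: "injective_module R I" and A: "module R A" and B: "module R B"
    and u: "u \<in> mod_hom R A B" and \<psi>: "\<psi> \<in> mod_hom R A I"
    and ker: "\<And>x. x \<in> carrier A \<Longrightarrow> u x = \<zero>\<^bsub>B\<^esub> \<Longrightarrow> \<psi> x = \<zero>\<^bsub>I\<^esub>"
  shows "\<exists>s\<in>mod_hom R B I. \<forall>x\<in>carrier A. s (u x) = \<psi> x"
proof -
  have Im: "module R I" using I by (simp add: injective_module_def)
  let ?B = "B\<lparr>carrier := u ` carrier A\<rparr>"
  obtain \<theta> where \<theta>: "\<theta> \<in> mod_hom R ?B I" "\<And>x. x \<in> carrier A \<Longrightarrow> \<theta> (u x) = \<psi> x"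
    using mod_hom_factor[OF A B Im u \<psi> ker] by blast
  have S: "submodule (u ` carrier A) R B"
    by (rule submodule_image[OF A B u submodule_carrier[OF A]])
  have "\<exists>s\<in>mod_hom R B I. \<forall>x\<in>carrier ?B. s x = \<theta> x"
    by (rule injective_module_extend[OF I module_sub[OF B S] B _ _ \<theta>(1)])
       (use submoduleD[OF B S] in \<open>auto simp: mod_hom_def\<close>)
  then show ?thesis using \<theta>(2) by fastforce
qed

text \<open>Replacing \<open>B\<close> by the image of \<open>g\<close> makes \<open>g\<close>
  surjective. In most uses \<open>g\<close> is a differential, and the inclusion of images comes
  from exactness.\<close>

lemma projective_lift:
  assumes P: "projective_module R P" and A: "module R A" and B: "module R B"
    and g: "g \<in> mod_hom R A B" and f: "f \<in> mod_hom R P B" and sub: "f ` carrier P \<subseteq> g ` carrier A"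
  shows "\<exists>h\<in>mod_hom R P A. \<forall>x\<in>carrier P. g (h x) = f x"
proof -
  let ?B = "B\<lparr>carrier := g ` carrier A\<rparr>"
  have S: "submodule (g ` carrier A) R B"
    by (rule submodule_image[OF A B g submodule_carrier[OF A]])
  show ?thesis
    by (rule projective_module_lift[OF P A module_sub[OF B S]])
       (use sub in \<open>auto intro!: mod_hom_sub_cod g f\<close>)
qed

section \<open>Free modules\<close>

definition unit_vec :: "('a, 'r) ring_scheme \<Rightarrow> 's set \<Rightarrow> 's \<Rightarrow> 's \<Rightarrow> 'a"
  where "unit_vec R S s = (\<lambda>s'\<in>S. if s' = s then \<one>\<^bsub>R\<^esub> else \<zero>\<^bsub>R\<^esub>)"

lemma unit_vec_closed: "cring R \<Longrightarrow> unit_vec R S s \<in> carrier (free_module R S)"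
proof -
  assume "cring R"
  then interpret cring R .
  have "{s' \<in> S. unit_vec R S s s' \<noteq> \<zero>\<^bsub>R\<^esub>} \<subseteq> {s}" by (auto simp: unit_vec_def)
  then show ?thesis by (auto simp: free_module_def unit_vec_def intro: finite_subset)
qed

lemma lin_ext_unit_vec:
  assumes "module R M" "a \<in> S \<rightarrow> carrier M" "s \<in> S"
  shows "lin_ext S R M a (unit_vec R S s) = a s"
proof -
  interpret M: module R M by fact
  have "lin_ext S R M a (unit_vec R S s) = (\<Oplus>\<^bsub>M\<^esub>s'\<in>{s}. unit_vec R S s s' \<odot>\<^bsub>M\<^esub> a s')"
    by (intro lin_ext_superset[OF assms(1,2)]) (use assms(3) in \<open>auto simp: unit_vec_def\<close>)
  also have "\<dots> = a s" using assms(2,3) by (auto simp: unit_vec_def Pi_iff)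
  finally show ?thesis .
qed

text \<open>The sum is evaluated over arbitrary finite \<open>U \<subseteq> S\<close>, where it is
  the truncation of \<open>u\<close> to \<open>U\<close>; the support of \<open>u\<close> is one
  such set. Generality in \<open>U\<close> lets the induction insert one index at a time.\<close>

lemma free_module_expand:
  assumes R: "cring R" and u: "u \<in> carrier (free_module R S)"
  shows "lin_ext S R (free_module R S) (unit_vec R S) u = u"
proof -
  interpret cring R by fact
  let ?F = "free_module R S"
  have F: "module R ?F" by (rule module_free_module[OF R])
  interpret F: module R ?F by fact
  have uS: "\<And>s. s \<in> S \<Longrightarrow> u s \<in> carrier R" and fin: "finite {s \<in> S. u s \<noteq> \<zero>\<^bsub>R\<^esub>}"
    and ext: "u \<in> extensional S"
    using u by (auto simp: free_module_def PiE_iff)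
  define T where "T = {s \<in> S. u s \<noteq> \<zero>\<^bsub>R\<^esub>}"
  have "(\<Oplus>\<^bsub>?F\<^esub>s\<in>U. u s \<odot>\<^bsub>?F\<^esub> unit_vec R S s) = (\<lambda>s\<in>S. if s \<in> U then u s else \<zero>\<^bsub>R\<^esub>)"
    if "finite U" "U \<subseteq> S" for U using that
  proof (induction U)
    case empty
    show ?case by (simp only: F.M.finsum_empty) (simp add: free_module_def)
  next
    case (insert x U)
    have "(\<Oplus>\<^bsub>?F\<^esub>s\<in>insert x U. u s \<odot>\<^bsub>?F\<^esub> unit_vec R S s)
        = u x \<odot>\<^bsub>?F\<^esub> unit_vec R S x \<oplus>\<^bsub>?F\<^esub> (\<Oplus>\<^bsub>?F\<^esub>s\<in>U. u s \<odot>\<^bsub>?F\<^esub> unit_vec R S s)"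
      using insert by (intro F.M.finsum_insert) (auto intro!: F.smult_closed unit_vec_closed R uS)
    also have "\<dots> = (\<lambda>s\<in>S. if s \<in> insert x U then u s else \<zero>\<^bsub>R\<^esub>)"
      using insert uS by (subst insert.IH) (auto simp: free_module_def unit_vec_def intro!: restrict_ext)
    finally show ?case .
  qed
  from this[of T] have "lin_ext S R ?F (unit_vec R S) u = (\<lambda>s\<in>S. if s \<in> T then u s else \<zero>\<^bsub>R\<^esub>)"
    using fin by (simp add: lin_ext_def T_def)
  also have "\<dots> = u" using ext by (auto simp: T_def fun_eq_iff extensional_def)
  finally show ?thesis .
qed

lemma hom_free_expand:
  assumes R: "cring R" and M: "module R M" and f: "f \<in> mod_hom R (free_module R S) M"
    and u: "u \<in> carrier (free_module R S)"
  shows "f u = lin_ext S R M (\<lambda>s. f (unit_vec R S s)) u"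
  using lin_ext_comp[OF module_free_module[OF R] M f _ u, of "unit_vec R S"]
    free_module_expand[OF R u] unit_vec_closed[OF R, of S] by simp

lemma hom_free_eqI:
  assumes "cring R" "module R M" "f \<in> mod_hom R (free_module R S) M"
    and "g \<in> mod_hom R (free_module R S) M"
    and "\<And>s. s \<in> S \<Longrightarrow> f (unit_vec R S s) = g (unit_vec R S s)"
    and "u \<in> carrier (free_module R S)"
  shows "f u = g u"
proof -
  interpret M: module R M by fact
  note c = unit_vec_closed[OF assms(1), of S]
  have "lin_ext S R M (\<lambda>s. f (unit_vec R S s)) u = lin_ext S R M (\<lambda>s. g (unit_vec R S s)) u"
    unfolding lin_ext_def
    by (rule M.M.finsum_cong')
       (use assms(5,6) mod_homD(1)[OF assms(4) c] in \<open>auto simp: free_module_def\<close>)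
  then show ?thesis using hom_free_expand[OF assms(1,2,3,6)] hom_free_expand[OF assms(1,2,4,6)] by simp
qed

lemma projective_free_module:
  assumes R: "cring R" shows "projective_module R (free_module R S)"
  unfolding projective_module_def
proof (intro conjI allI impI module_free_module[OF R])
  fix A :: "('a, ('c \<Rightarrow> 'a) \<Rightarrow> 'a) module" and B :: "('a, 'c \<Rightarrow> 'a) module" and g f
  assume *: "module R A \<and> module R B \<and> g \<in> mod_hom R A B \<and> g ` carrier A = carrier B \<and>
    f \<in> mod_hom R (free_module R S) B"
  then have A: "module R A" and B: "module R B" and g: "g \<in> mod_hom R A B"
    and surj: "g ` carrier A = carrier B" and f: "f \<in> mod_hom R (free_module R S) B" by auto
  have "\<forall>s. \<exists>y\<in>carrier A. g y = f (unit_vec R S s)"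
    using surj mod_homD(1)[OF f unit_vec_closed[OF R]] by (metis imageE)
  then obtain a where a: "\<And>s. a s \<in> carrier A" "\<And>s. g (a s) = f (unit_vec R S s)" by metis
  have h: "lin_ext S R A a \<in> mod_hom R (free_module R S) A" by (rule lin_ext_hom[OF A]) (use a in auto)
  moreover have "g (lin_ext S R A a u) = f u" if "u \<in> carrier (free_module R S)" for u
    using lin_ext_comp[OF A B g _ that, of a] hom_free_expand[OF R B f that] a by simp
  ultimately show "\<exists>h\<in>mod_hom R (free_module R S) A. \<forall>x\<in>carrier (free_module R S). g (h x) = f x"
    by blast
qed

section \<open>Quotient modules and cohomology\<close>

lemma submodule_abelian_subgroup:
  assumes "module R M" "submodule H R M"
  shows "abelian_subgroup H M"
proof -
  interpret M: module R M by fact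
  show ?thesis
    by (rule abelian_subgroupI3[OF additive_subgroupI[OF submodule.axioms(1)[OF assms(2)]]])
       (rule M.M.abelian_group_axioms)
qed

lemma quotient_module_simps [simp]:
  "carrier (quotient_module M H) = a_rcosets\<^bsub>M\<^esub> H" "\<zero>\<^bsub>quotient_module M H\<^esub> = H"
  by (auto simp: quotient_module_def)

context
  fixes R :: "('a, 'r) ring_scheme" and M :: "('a, 'm) module" and H
  assumes M: "module R M" and H: "submodule H R M"
begin

interpretation M: module R M by (rule M)
interpretation H: abelian_subgroup H M by (rule submodule_abelian_subgroup[OF M H])

lemma coset_in_quotient: "x \<in> carrier M \<Longrightarrow> H +>\<^bsub>M\<^esub> x \<in> a_rcosets\<^bsub>M\<^esub> H"
  by (rule M.M.a_rcosetsI[OF submoduleD(1)[OF M H]])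

lemma quotient_cases:
  assumes "C \<in> a_rcosets\<^bsub>M\<^esub> H" obtains x where "x \<in> carrier M" "C = H +>\<^bsub>M\<^esub> x"
  using assms by (auto simp: A_RCOSETS_def')

lemma coset_eq_iff:
  assumes "x \<in> carrier M" "y \<in> carrier M"
  shows "H +>\<^bsub>M\<^esub> x = H +>\<^bsub>M\<^esub> y \<longleftrightarrow> x \<ominus>\<^bsub>M\<^esub> y \<in> H"
  using assms H.a_rcos_module[OF assms(2,1)] H.a_repr_independence'[of x y] H.a_rcos_self[OF assms(1)]
  by (metis a_minus_def)

lemma coset_eq_zero_iff:
  assumes "x \<in> carrier M"
  shows "H +>\<^bsub>M\<^esub> x = H \<longleftrightarrow> x \<in> H"
  using assms H.a_rcos_const H.a_rcos_self by blast

lemma quotient_add: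
  assumes "x \<in> carrier M" "y \<in> carrier M"
  shows "(H +>\<^bsub>M\<^esub> x) \<oplus>\<^bsub>quotient_module M H\<^esub> (H +>\<^bsub>M\<^esub> y) = H +>\<^bsub>M\<^esub> (x \<oplus>\<^bsub>M\<^esub> y)"
  using H.a_rcos_sum[OF assms] by (simp add: quotient_module_def)

text \<open>\<open>quotient_module\<close> defines scalar multiplication by a union over the whole
  coset. All members of the union coincide, since \<open>r\<close> times a difference of
  representatives stays in \<open>H\<close>, so the union collapses to one coset.\<close>

lemma quotient_smult:
  assumes r: "r \<in> carrier R" and x: "x \<in> carrier M"
  shows "r \<odot>\<^bsub>quotient_module M H\<^esub> (H +>\<^bsub>M\<^esub> x) = H +>\<^bsub>M\<^esub> (r \<odot>\<^bsub>M\<^esub> x)"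
proof -
  have "H +>\<^bsub>M\<^esub> (r \<odot>\<^bsub>M\<^esub> y) = H +>\<^bsub>M\<^esub> (r \<odot>\<^bsub>M\<^esub> x)" if y: "y \<in> H +>\<^bsub>M\<^esub> x" for y
  proof -
    have yc: "y \<in> carrier M" using H.a_elemrcos_carrier[OF x y] .
    have "y \<ominus>\<^bsub>M\<^esub> x \<in> H" using H.a_rcos_module[OF x yc] y by (simp add: a_minus_def)
    then have "r \<odot>\<^bsub>M\<^esub> (y \<ominus>\<^bsub>M\<^esub> x) \<in> H" by (rule submoduleD(5)[OF M H r])
    moreover have "r \<odot>\<^bsub>M\<^esub> (y \<ominus>\<^bsub>M\<^esub> x) = r \<odot>\<^bsub>M\<^esub> y \<ominus>\<^bsub>M\<^esub> r \<odot>\<^bsub>M\<^esub> x"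
      using r x yc by (simp add: a_minus_def M.smult_r_distr M.smult_r_minus)
    ultimately show ?thesis using r x yc by (simp add: coset_eq_iff)
  qed
  then have "(\<Union>y\<in>H +>\<^bsub>M\<^esub> x. H +>\<^bsub>M\<^esub> (r \<odot>\<^bsub>M\<^esub> y)) = (\<Union>y\<in>H +>\<^bsub>M\<^esub> x. H +>\<^bsub>M\<^esub> (r \<odot>\<^bsub>M\<^esub> x))"
    by (rule SUP_cong[OF refl])
  also have "\<dots> = H +>\<^bsub>M\<^esub> (r \<odot>\<^bsub>M\<^esub> x)" using H.a_rcos_self[OF x] by auto
  finally show ?thesis by (simp add: quotient_module_def)
qed

lemma module_quotient: "module R (quotient_module M H)"
proof -
  let ?Q = "quotient_module M H"
  have car: "H +>\<^bsub>M\<^esub> x \<in> carrier ?Q" if "x \<in> carrier M" for x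
    using coset_in_quotient[OF that] by simp
  have *: "\<exists>x\<in>carrier M. C = H +>\<^bsub>M\<^esub> x" if "C \<in> carrier ?Q" for C
    using that by (auto elim: quotient_cases)
  have z: "\<zero>\<^bsub>?Q\<^esub> = H +>\<^bsub>M\<^esub> \<zero>\<^bsub>M\<^esub>" using coset_eq_zero_iff[of "\<zero>\<^bsub>M\<^esub>"] submoduleD(3)[OF M H] by simp
  note q = quotient_add quotient_smult
  have "abelian_group ?Q"
  proof (rule abelian_groupI)
    show "\<zero>\<^bsub>?Q\<^esub> \<in> carrier ?Q" unfolding z by (rule car) simp
    show "x \<oplus>\<^bsub>?Q\<^esub> y \<in> carrier ?Q" if xy: "x \<in> carrier ?Q" "y \<in> carrier ?Q" for x y
    proof -
      obtain x' y' where "x' \<in> carrier M" "y' \<in> carrier M" "x = H +>\<^bsub>M\<^esub> x'" "y = H +>\<^bsub>M\<^esub> y'"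
        using *[OF xy(1)] *[OF xy(2)] by blast
      then show ?thesis using car by (simp only: q) auto
    qed
    show "x \<oplus>\<^bsub>?Q\<^esub> y \<oplus>\<^bsub>?Q\<^esub> z = x \<oplus>\<^bsub>?Q\<^esub> (y \<oplus>\<^bsub>?Q\<^esub> z)"
      if xyz: "x \<in> carrier ?Q" "y \<in> carrier ?Q" "z \<in> carrier ?Q" for x y z
    proof -
      obtain x' y' z' where "x' \<in> carrier M" "y' \<in> carrier M" "z' \<in> carrier M"
        "x = H +>\<^bsub>M\<^esub> x'" "y = H +>\<^bsub>M\<^esub> y'" "z = H +>\<^bsub>M\<^esub> z'"
        using *[OF xyz(1)] *[OF xyz(2)] *[OF xyz(3)] by blast
      then show ?thesis by (simp add: q M.M.a_assoc)
    qed
    show "x \<oplus>\<^bsub>?Q\<^esub> y = y \<oplus>\<^bsub>?Q\<^esub> x" if xy: "x \<in> carrier ?Q" "y \<in> carrier ?Q" for x y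
    proof -
      obtain x' y' where "x' \<in> carrier M" "y' \<in> carrier M" "x = H +>\<^bsub>M\<^esub> x'" "y = H +>\<^bsub>M\<^esub> y'"
        using *[OF xy(1)] *[OF xy(2)] by blast
      then show ?thesis by (simp add: q M.M.a_comm)
    qed
    fix x assume "x \<in> carrier ?Q"
    then obtain x' where x: "x' \<in> carrier M" "x = H +>\<^bsub>M\<^esub> x'" using * by blast
    show "\<zero>\<^bsub>?Q\<^esub> \<oplus>\<^bsub>?Q\<^esub> x = x" unfolding z x(2) using x(1) by (subst q) auto
    show "\<exists>y\<in>carrier ?Q. y \<oplus>\<^bsub>?Q\<^esub> x = \<zero>\<^bsub>?Q\<^esub>"
      by (rule bexI[of _ "H +>\<^bsub>M\<^esub> (\<ominus>\<^bsub>M\<^esub> x')"])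
         (unfold z x(2), use x(1) car in \<open>auto simp only: q M.M.l_neg M.M.a_inv_closed\<close>)
  qed
  then show ?thesis
  proof (rule moduleI[OF M.R.is_cring])
    show "a \<odot>\<^bsub>?Q\<^esub> x \<in> carrier ?Q" if ax: "a \<in> carrier R" "x \<in> carrier ?Q" for a x
    proof -
      obtain x' where "x' \<in> carrier M" "x = H +>\<^bsub>M\<^esub> x'" using *[OF ax(2)] by blast
      then show ?thesis using ax(1) car by (simp only: q M.smult_closed)
    qed
    show "(a \<oplus>\<^bsub>R\<^esub> b) \<odot>\<^bsub>?Q\<^esub> x = a \<odot>\<^bsub>?Q\<^esub> x \<oplus>\<^bsub>?Q\<^esub> b \<odot>\<^bsub>?Q\<^esub> x"
      if ax: "a \<in> carrier R" "b \<in> carrier R" "x \<in> carrier ?Q" for a b x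
    proof -
      obtain x' where "x' \<in> carrier M" "x = H +>\<^bsub>M\<^esub> x'" using *[OF ax(3)] by blast
      then show ?thesis using ax by (simp add: q M.smult_l_distr)
    qed
    show "a \<odot>\<^bsub>?Q\<^esub> (x \<oplus>\<^bsub>?Q\<^esub> y) = a \<odot>\<^bsub>?Q\<^esub> x \<oplus>\<^bsub>?Q\<^esub> a \<odot>\<^bsub>?Q\<^esub> y"
      if ax: "a \<in> carrier R" "x \<in> carrier ?Q" "y \<in> carrier ?Q" for a x y
    proof -
      obtain x' y' where "x' \<in> carrier M" "y' \<in> carrier M" "x = H +>\<^bsub>M\<^esub> x'" "y = H +>\<^bsub>M\<^esub> y'"
        using *[OF ax(2)] *[OF ax(3)] by blast
      then show ?thesis using ax by (simp add: q M.smult_r_distr)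
    qed
    show "(a \<otimes>\<^bsub>R\<^esub> b) \<odot>\<^bsub>?Q\<^esub> x = a \<odot>\<^bsub>?Q\<^esub> (b \<odot>\<^bsub>?Q\<^esub> x)"
      if ax: "a \<in> carrier R" "b \<in> carrier R" "x \<in> carrier ?Q" for a b x
    proof -
      obtain x' where "x' \<in> carrier M" "x = H +>\<^bsub>M\<^esub> x'" using *[OF ax(3)] by blast
      then show ?thesis using ax by (simp add: q M.smult_assoc1)
    qed
    show "\<one>\<^bsub>R\<^esub> \<odot>\<^bsub>?Q\<^esub> x = x" if ax: "x \<in> carrier ?Q" for x
    proof -
      obtain x' where "x' \<in> carrier M" "x = H +>\<^bsub>M\<^esub> x'" using *[OF ax] by blast
      then show ?thesis by (simp add: q)
    qed
  qed
qed

lemma quotient_hom: "(\<lambda>x. H +>\<^bsub>M\<^esub> x) \<in> mod_hom R M (quotient_module M H)"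
  by (intro mod_homI) (auto simp: quotient_add quotient_smult coset_in_quotient)

lemma quotient_surj: "(\<lambda>x. H +>\<^bsub>M\<^esub> x) ` carrier M = carrier (quotient_module M H)"
  by (auto simp: coset_in_quotient elim: quotient_cases)

lemma zero_quotient_iff: "zero_module (quotient_module M H) \<longleftrightarrow> H = carrier M"
proof -
  have "zero_module (quotient_module M H) \<longleftrightarrow> (\<forall>x\<in>carrier M. H +>\<^bsub>M\<^esub> x = H)"
    unfolding zero_module_def quotient_surj[symmetric] quotient_module_simps(2)
    using M.M.zero_closed by blast
  then show ?thesis using coset_eq_zero_iff submoduleD(1)[OF M H] by blast
qed

text \<open>The first isomorphism theorem, with the kernel described on representatives, so that
  cosets do not surface where it is applied.\<close>

lemma mod_iso_quotient:
  assumes W: "module R W" and \<theta>: "\<theta> \<in> mod_hom R M W" and surj: "\<theta> ` carrier M = carrier W"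
    and ker: "\<And>x. x \<in> carrier M \<Longrightarrow> \<theta> x = \<zero>\<^bsub>W\<^esub> \<longleftrightarrow> x \<in> H"
  shows "mod_iso R (quotient_module M H) W"
proof -
  let ?Q = "quotient_module M H"
  obtain \<phi> where \<phi>: "\<phi> \<in> mod_hom R ?Q W" "\<And>x. x \<in> carrier M \<Longrightarrow> \<phi> (H +>\<^bsub>M\<^esub> x) = \<theta> x"
    using mod_hom_factor_surj[OF M module_quotient W quotient_hom \<theta> quotient_surj]
      ker coset_eq_zero_iff by auto
  have "inj_on \<phi> (carrier ?Q)"
  proof (rule inj_onI)
    fix C C' assume C: "C \<in> carrier ?Q" "C' \<in> carrier ?Q" "\<phi> C = \<phi> C'"
    then obtain x y where "x \<in> carrier M" "C = H +>\<^bsub>M\<^esub> x" "y \<in> carrier M" "C' = H +>\<^bsub>M\<^esub> y"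
      by (auto elim!: quotient_cases)
    moreover from this have "x \<ominus>\<^bsub>M\<^esub> y \<in> H"
      using C(3) \<phi>(2) module_hom_eq_iff[OF M W \<theta>, of x y] ker[of "x \<ominus>\<^bsub>M\<^esub> y"] by simp
    ultimately show "C = C'" by (simp add: coset_eq_iff)
  qed
  moreover have "\<phi> ` carrier ?Q = carrier W"
    unfolding quotient_surj[symmetric] image_image using \<phi>(2) surj by simp
  ultimately show ?thesis unfolding mod_iso_def bij_betw_def using \<phi>(1) by blast
qed

end

text \<open>The same facts in several index forms: \<open>n + 1 + 1\<close> and
  \<open>n + 2\<close>, or \<open>n - 1 + 1\<close> and \<open>n\<close>, are equal integers, but
  the terms \<open>obj X\<close> at them do not match syntactically.\<close>

lemma cochain_complexD:
  assumes "cochain_complex R X"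
  shows "module R (obj X n)" "dif X n \<in> mod_hom R (obj X n) (obj X (n + 1))"
    "m = n + 1 \<Longrightarrow> dif X n \<in> mod_hom R (obj X n) (obj X m)"
    "x \<in> carrier (obj X n) \<Longrightarrow> dif X (n + 1) (dif X n x) = \<zero>\<^bsub>obj X (n + 2)\<^esub>"
    "x \<in> carrier (obj X (n - 1)) \<Longrightarrow> dif X n (dif X (n - 1) x) = \<zero>\<^bsub>obj X (n + 1)\<^esub>"
    "dif X (n - 1) \<in> mod_hom R (obj X (n - 1)) (obj X n)"
proof -
  have *: "dif X k \<in> mod_hom R (obj X k) (obj X (k + 1))"
    "x \<in> carrier (obj X k) \<Longrightarrow> dif X (k + 1) (dif X k x) = \<zero>\<^bsub>obj X (k + 1 + 1)\<^esub>" for k x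
    using assms unfolding cochain_complex_def by blast+
  show "module R (obj X n)" using assms unfolding cochain_complex_def by blast
  show "dif X n \<in> mod_hom R (obj X n) (obj X (n + 1))"
    "m = n + 1 \<Longrightarrow> dif X n \<in> mod_hom R (obj X n) (obj X m)" using * by blast+
  show "x \<in> carrier (obj X n) \<Longrightarrow> dif X (n + 1) (dif X n x) = \<zero>\<^bsub>obj X (n + 2)\<^esub>"
    using *(2)[of x n] by (simp add: add.assoc)
  show "x \<in> carrier (obj X (n - 1)) \<Longrightarrow> dif X n (dif X (n - 1) x) = \<zero>\<^bsub>obj X (n + 1)\<^esub>"
    using *(2)[of x "n - 1"] by simp
  show "dif X (n - 1) \<in> mod_hom R (obj X (n - 1)) (obj X n)"
    using *(1)[of "n - 1"] by simp
qed

lemma submodule_of_sub: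
  assumes "module R M" "submodule Z R M" "submodule B R M" "B \<subseteq> Z"
  shows "submodule B R (M\<lparr>carrier := Z\<rparr>)"
  by (rule submoduleI'[OF module_sub[OF assms(1,2)]])
     (use assms(4) submoduleD[OF assms(1,3)] in auto)

context
  fixes R :: "('a, 'r) ring_scheme" and X :: "('a, 'm) cochain"
  assumes X: "cochain_complex R X"
begin

lemma submodule_cocycles: "submodule (cocycles X n) R (obj X n)"
  unfolding cocycles_def by (rule submodule_kernel) (use cochain_complexD[OF X] in auto)

lemma submodule_coboundaries: "submodule (coboundaries X n) R (obj X n)"
  unfolding coboundaries_def
  by (rule submodule_image[OF cochain_complexD(1)[OF X] cochain_complexD(1)[OF X] cochain_complexD(6)[OF X]])
     (rule submodule_carrier[OF cochain_complexD(1)[OF X]])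

lemma coboundaries_cocycles: "coboundaries X n \<subseteq> cocycles X n"
  unfolding coboundaries_def cocycles_def
  using cochain_complexD(5)[OF X] mod_homD(1)[OF cochain_complexD(6)[OF X]] by auto

lemma submodule_coboundaries_cocycles:
  "submodule (coboundaries X n) R ((obj X n)\<lparr>carrier := cocycles X n\<rparr>)"
  by (rule submodule_of_sub[OF cochain_complexD(1)[OF X] submodule_cocycles submodule_coboundaries
    coboundaries_cocycles])

lemma module_cocycles: "module R ((obj X n)\<lparr>carrier := cocycles X n\<rparr>)"
  by (rule module_sub[OF cochain_complexD(1)[OF X] submodule_cocycles])

lemma zero_cohomology_iff: "zero_module (cohomology X n) \<longleftrightarrow> cocycles X n \<subseteq> coboundaries X n"
  unfolding cohomology_def
  by (subst zero_quotient_iff[OF module_cocycles submodule_coboundaries_cocycles])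
     (use coboundaries_cocycles in auto)

lemma mod_iso_cohomology:
  assumes W: "module R W" and \<theta>: "\<theta> \<in> mod_hom R ((obj X n)\<lparr>carrier := cocycles X n\<rparr>) W"
    and surj: "\<theta> ` cocycles X n = carrier W"
    and ker: "\<And>x. x \<in> cocycles X n \<Longrightarrow> \<theta> x = \<zero>\<^bsub>W\<^esub> \<longleftrightarrow> x \<in> coboundaries X n"
  shows "mod_iso R (cohomology X n) W"
  unfolding cohomology_def
  by (rule mod_iso_quotient[OF module_cocycles submodule_coboundaries_cocycles W \<theta>])
     (use surj ker in auto)

end

section \<open>Quasi-isomorphisms in terms of cocycles\<close>

lemma coset_sub_carrier: "H +>\<^bsub>M\<lparr>carrier := Z\<rparr>\<^esub> x = H +>\<^bsub>M\<^esub> x"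
  by (simp add: a_r_coset_def')

lemma minus_sub':
  assumes "module R M" "submodule Z R M" "x \<in> Z" "y \<in> Z"
  shows "x \<ominus>\<^bsub>M\<lparr>carrier := Z\<rparr>\<^esub> y = x \<ominus>\<^bsub>M\<^esub> y"
  unfolding a_minus_def using minus_sub[OF assms(1,2,4)] by simp

text \<open>Injectivity and surjectivity on cohomology, stated through representatives: cosets
  disappear and diagram chases can add and subtract elements directly.\<close>

definition elementwise_quasi_iso ::
  "('a, 'r) ring_scheme \<Rightarrow> ('a, 'm) cochain \<Rightarrow> ('a, 'n) cochain \<Rightarrow> (int \<Rightarrow> 'm \<Rightarrow> 'n) \<Rightarrow> bool"
  where "elementwise_quasi_iso R X Y f \<longleftrightarrow>
    cochain_complex R X \<and> cochain_complex R Y \<and> chain_map R X Y f \<and>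
    (\<forall>n. \<forall>x\<in>cocycles X n. f n x \<in> coboundaries Y n \<longrightarrow> x \<in> coboundaries X n) \<and>
    (\<forall>n. \<forall>y\<in>cocycles Y n. \<exists>x\<in>cocycles X n. y \<ominus>\<^bsub>obj Y n\<^esub> f n x \<in> coboundaries Y n)"

lemma chain_map_cocycles:
  assumes "cochain_complex R X" "cochain_complex R Y" "chain_map R X Y f" "x \<in> cocycles X n"
  shows "f n x \<in> cocycles Y n"
proof -
  have f: "f n \<in> mod_hom R (obj X n) (obj Y n)" "f (n+1) \<in> mod_hom R (obj X (n+1)) (obj Y (n+1))"
    "f (n + 1) (dif X n x) = dif Y n (f n x)"
    using assms(3,4) unfolding chain_map_def cocycles_def by blast+
  show ?thesis using assms(4) f mod_homD(1)[OF f(1)]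
      mod_hom_zero[OF cochain_complexD(1)[OF assms(1)] cochain_complexD(1)[OF assms(2)] f(2)]
    by (auto simp: cocycles_def)
qed

lemma chain_map_coboundaries:
  assumes "chain_map R X Y f" "x \<in> coboundaries X n"
  shows "f n x \<in> coboundaries Y n"
proof -
  have f: "f (n-1) \<in> mod_hom R (obj X (n-1)) (obj Y (n-1))"
    "\<forall>x\<in>carrier (obj X (n-1)). f n (dif X (n-1) x) = dif Y (n-1) (f (n-1) x)"
    using assms(1) unfolding chain_map_def by (auto dest!: spec[of _ "n - 1"])
  show ?thesis using assms(2) f(2) mod_homD(1)[OF f(1)] by (auto simp: coboundaries_def)
qed

text \<open>\<open>cohomology_map\<close> is a union over a coset. Since \<open>f\<close> sends
  coboundaries to coboundaries, all members agree and the class of \<open>x\<close> goes to the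
  class of \<open>f n x\<close>; bijectivity then unfolds to the two conditions on
  representatives.\<close>

lemma quasi_iso_elementwise:
  assumes "quasi_iso R X Y f"
  shows "elementwise_quasi_iso R X Y f"
proof -
  have X: "cochain_complex R X" and Y: "cochain_complex R Y" and f: "chain_map R X Y f"
    and bij: "bij_betw (cohomology_map Y f n) (carrier (cohomology X n)) (carrier (cohomology Y n))" for n
    using assms by (auto simp: quasi_iso_def)
  have fh: "f n \<in> mod_hom R (obj X n) (obj Y n)" for n using f by (auto simp: chain_map_def)
  note mX = cochain_complexD(1)[OF X] and mY = cochain_complexD(1)[OF Y]
  note zX = module_cocycles[OF X] and zY = module_cocycles[OF Y]
  note bX = submodule_coboundaries_cocycles[OF X] and bY = submodule_coboundaries_cocycles[OF Y]
  have cocX: "x \<in> carrier (obj X n)" if "x \<in> cocycles X n" for x n using that by (simp add: cocycles_def)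
  have carX: "coboundaries X n +>\<^bsub>obj X n\<^esub> x \<in> carrier (cohomology X n)" if "x \<in> cocycles X n" for x n
    using coset_in_quotient[OF zX bX, of x n] that by (simp add: cohomology_def coset_sub_carrier)
  have carY: "coboundaries Y n +>\<^bsub>obj Y n\<^esub> x \<in> carrier (cohomology Y n)" if "x \<in> cocycles Y n" for x n
    using coset_in_quotient[OF zY bY, of x n] that by (simp add: cohomology_def coset_sub_carrier)
  have map: "cohomology_map Y f n (coboundaries X n +>\<^bsub>obj X n\<^esub> x) = coboundaries Y n +>\<^bsub>obj Y n\<^esub> f n x"
    if x: "x \<in> cocycles X n" for x n
  proof -
    interpret BX: abelian_subgroup "coboundaries X n" "obj X n"
      by (rule submodule_abelian_subgroup[OF mX submodule_coboundaries[OF X]])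
    have "coboundaries Y n +>\<^bsub>obj Y n\<^esub> f n y = coboundaries Y n +>\<^bsub>obj Y n\<^esub> f n x"
      if y: "y \<in> coboundaries X n +>\<^bsub>obj X n\<^esub> x" for y
    proof -
      have yc: "y \<in> carrier (obj X n)" using BX.a_elemrcos_carrier[OF cocX[OF x] y] .
      have "y \<ominus>\<^bsub>obj X n\<^esub> x \<in> coboundaries X n"
        using BX.a_rcos_module[OF cocX[OF x] yc] y by (simp add: a_minus_def)
      then have "f n y \<ominus>\<^bsub>obj Y n\<^esub> f n x \<in> coboundaries Y n"
        using chain_map_coboundaries[OF f] mod_hom_diff[OF mX mY fh yc cocX[OF x]] by metis
      then show ?thesis
        using coset_eq_iff[OF mY submodule_coboundaries[OF Y]] mod_homD(1)[OF fh] yc cocX[OF x] by simp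
    qed
    then show ?thesis using BX.a_rcos_self[OF cocX[OF x]] unfolding cohomology_map_def by blast
  qed
  show ?thesis
    unfolding elementwise_quasi_iso_def
  proof (intro conjI X Y f allI ballI impI)
    fix n x assume x: "x \<in> cocycles X n" and fx: "f n x \<in> coboundaries Y n"
    have z: "\<zero>\<^bsub>obj X n\<^esub> \<in> cocycles X n" by (rule submoduleD(3)[OF mX submodule_cocycles[OF X]])
    have "f n \<zero>\<^bsub>obj X n\<^esub> = \<zero>\<^bsub>obj Y n\<^esub>" by (rule mod_hom_zero[OF mX mY fh])
    then have "f n \<zero>\<^bsub>obj X n\<^esub> \<in> coboundaries Y n"
      using submoduleD(3)[OF mY submodule_coboundaries[OF Y]] by simp
    then have "coboundaries Y n +>\<^bsub>obj Y n\<^esub> f n x = coboundaries Y n +>\<^bsub>obj Y n\<^esub> f n \<zero>\<^bsub>obj X n\<^esub>"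
      using fx coset_eq_zero_iff[OF mY submodule_coboundaries[OF Y]]
        submoduleD(2)[OF mY submodule_coboundaries[OF Y]] by metis
    then have "coboundaries X n +>\<^bsub>obj X n\<^esub> x = coboundaries X n +>\<^bsub>obj X n\<^esub> \<zero>\<^bsub>obj X n\<^esub>"
      using map[OF x] map[OF z] bij[of n] carX[OF x] carX[OF z]
      by (metis bij_betw_imp_inj_on inj_onD)
    also have "\<dots> = coboundaries X n"
      using coset_eq_zero_iff[OF mX submodule_coboundaries[OF X]] cocX[OF z]
        submoduleD(3)[OF mX submodule_coboundaries[OF X]] by simp
    finally show "x \<in> coboundaries X n"
      using coset_eq_zero_iff[OF mX submodule_coboundaries[OF X] cocX[OF x]] by simp
  next
    fix n y assume y: "y \<in> cocycles Y n"
    have "coboundaries Y n +>\<^bsub>obj Y n\<^esub> y \<in> cohomology_map Y f n ` carrier (cohomology X n)"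
      using carY[OF y] bij[of n] by (simp add: bij_betw_def)
    then obtain C where C: "C \<in> carrier (cohomology X n)"
      "coboundaries Y n +>\<^bsub>obj Y n\<^esub> y = cohomology_map Y f n C" by auto
    from C(1) obtain x where x: "x \<in> cocycles X n" "C = coboundaries X n +>\<^bsub>obj X n\<^esub> x"
      using quotient_cases[OF zX bX, of C n] by (auto simp: cohomology_def coset_sub_carrier)
    then have "coboundaries Y n +>\<^bsub>obj Y n\<^esub> y = coboundaries Y n +>\<^bsub>obj Y n\<^esub> f n x"
      using C(2) map by simp
    then have "y \<ominus>\<^bsub>obj Y n\<^esub> f n x \<in> coboundaries Y n"
      using coset_eq_iff[OF mY submodule_coboundaries[OF Y], of y n "f n x"] y
        mod_homD(1)[OF fh cocX[OF x(1)]] by (auto simp: cocycles_def)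
    then show "\<exists>x\<in>cocycles X n. y \<ominus>\<^bsub>obj Y n\<^esub> f n x \<in> coboundaries Y n" using x(1) by blast
  qed
qed

section \<open>Products and Hom modules\<close>

definition prod_module :: "('a, 'm) module \<Rightarrow> ('a, 'n) module \<Rightarrow> ('a, 'm \<times> 'n) module"
  where "prod_module A B =
    \<lparr>carrier = carrier A \<times> carrier B, monoid.mult = undefined, one = undefined,
     ring.zero = (\<zero>\<^bsub>A\<^esub>, \<zero>\<^bsub>B\<^esub>), add = (\<lambda>p q. (fst p \<oplus>\<^bsub>A\<^esub> fst q, snd p \<oplus>\<^bsub>B\<^esub> snd q)),
     smult = (\<lambda>r p. (r \<odot>\<^bsub>A\<^esub> fst p, r \<odot>\<^bsub>B\<^esub> snd p))\<rparr>"

definition Pi_module :: "('i \<Rightarrow> ('a, 'm) module) \<Rightarrow> ('a, 'i \<Rightarrow> 'm) module"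
  where "Pi_module H =
    \<lparr>carrier = {f. \<forall>i. f i \<in> carrier (H i)}, monoid.mult = undefined, one = undefined,
     ring.zero = (\<lambda>i. \<zero>\<^bsub>H i\<^esub>), add = (\<lambda>f g i. f i \<oplus>\<^bsub>H i\<^esub> g i), smult = (\<lambda>r f i. r \<odot>\<^bsub>H i\<^esub> f i)\<rparr>"

lemma prod_module_simps [simp]:
  "carrier (prod_module A B) = carrier A \<times> carrier B"
  "\<zero>\<^bsub>prod_module A B\<^esub> = (\<zero>\<^bsub>A\<^esub>, \<zero>\<^bsub>B\<^esub>)"
  "p \<oplus>\<^bsub>prod_module A B\<^esub> q = (fst p \<oplus>\<^bsub>A\<^esub> fst q, snd p \<oplus>\<^bsub>B\<^esub> snd q)"
  "r \<odot>\<^bsub>prod_module A B\<^esub> p = (r \<odot>\<^bsub>A\<^esub> fst p, r \<odot>\<^bsub>B\<^esub> snd p)"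
  by (simp_all add: prod_module_def)

lemma Pi_module_simps [simp]:
  "carrier (Pi_module H) = {f. \<forall>i. f i \<in> carrier (H i)}"
  "\<zero>\<^bsub>Pi_module H\<^esub> = (\<lambda>i. \<zero>\<^bsub>H i\<^esub>)"
  "f \<oplus>\<^bsub>Pi_module H\<^esub> g = (\<lambda>i. f i \<oplus>\<^bsub>H i\<^esub> g i)"
  "r \<odot>\<^bsub>Pi_module H\<^esub> f = (\<lambda>i. r \<odot>\<^bsub>H i\<^esub> f i)"
  by (simp_all add: Pi_module_def)

lemma Hom_module_simps [simp]:
  "carrier (Hom_module R M N) = mod_hom R M N \<inter> extensional (carrier M)"
  "\<zero>\<^bsub>Hom_module R M N\<^esub> = (\<lambda>x\<in>carrier M. \<zero>\<^bsub>N\<^esub>)"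
  "f \<oplus>\<^bsub>Hom_module R M N\<^esub> g = (\<lambda>x\<in>carrier M. f x \<oplus>\<^bsub>N\<^esub> g x)"
  "r \<odot>\<^bsub>Hom_module R M N\<^esub> f = (\<lambda>x\<in>carrier M. r \<odot>\<^bsub>N\<^esub> f x)"
  by (simp_all add: Hom_module_def)

lemma module_prod:
  assumes "module R A" "module R B" shows "module R (prod_module A B)"
proof -
  interpret A: module R A by fact
  interpret B: module R B by fact
  have "abelian_group (prod_module A B)"
    by (rule abelian_groupI)
       (auto simp: A.M.a_ac B.M.a_ac intro!: bexI[of _ "\<ominus>\<^bsub>A\<^esub> _"] bexI[of _ "\<ominus>\<^bsub>B\<^esub> _"] A.M.l_neg B.M.l_neg)
  then show ?thesis
    by (intro moduleI A.R.is_cring)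
       (auto simp: A.smult_l_distr B.smult_l_distr A.smult_r_distr B.smult_r_distr A.smult_assoc1 B.smult_assoc1)
qed

lemma module_Pi:
  assumes R: "cring R" and "\<And>i. module R (H i)" shows "module R (Pi_module H)"
proof -
  interpret H: module R "H i" for i by fact
  have "abelian_group (Pi_module H)"
  proof (rule abelian_groupI)
    fix x assume "x \<in> carrier (Pi_module H)"
    then show "\<exists>y\<in>carrier (Pi_module H). y \<oplus>\<^bsub>Pi_module H\<^esub> x = \<zero>\<^bsub>Pi_module H\<^esub>"
      by (intro bexI[of _ "\<lambda>i. \<ominus>\<^bsub>H i\<^esub> x i"]) (auto simp: H.M.l_neg)
  qed (auto simp: H.M.a_ac)
  then show ?thesis
    by (intro moduleI R) (auto simp: H.smult_l_distr H.smult_r_distr H.smult_assoc1)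
qed

lemma restrict_hom:
  assumes "module R A" "f \<in> mod_hom R A B"
  shows "restrict f (carrier A) \<in> carrier (Hom_module R A B)"
  using mod_hom_cong[OF assms(2,1), of "restrict f (carrier A)"] by simp

lemma module_Hom:
  assumes M: "module R M" and N: "module R N" shows "module R (Hom_module R M N)"
proof -
  interpret N: module R N by fact
  note r = restrict_hom[OF M, of _ N]
  let ?H = "Hom_module R M N"
  have cl: "f x \<in> carrier N" if "f \<in> carrier ?H" "x \<in> carrier M" for f x
    using that mod_homD(1)[of f R M N x] by simp
  have e: "(\<lambda>x\<in>carrier M. f x) = f" if "f \<in> carrier ?H" for f
    using that by (auto simp: extensional_restrict)
  have "abelian_group ?H"
  proof (rule abelian_groupI)
    fix f assume f: "f \<in> carrier ?H"
    then have "(\<lambda>x\<in>carrier M. \<ominus>\<^bsub>N\<^esub> f x) \<in> carrier ?H" by (intro r mod_hom_uminus[OF N]) auto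
    moreover have "(\<lambda>x\<in>carrier M. \<ominus>\<^bsub>N\<^esub> f x) \<oplus>\<^bsub>?H\<^esub> f = \<zero>\<^bsub>?H\<^esub>"
      using cl[OF f] by (auto simp: N.M.l_neg intro!: restrict_ext)
    ultimately show "\<exists>g\<in>carrier ?H. g \<oplus>\<^bsub>?H\<^esub> f = \<zero>\<^bsub>?H\<^esub>" by blast
    show "\<zero>\<^bsub>?H\<^esub> \<oplus>\<^bsub>?H\<^esub> f = f" using cl[OF f] f by (auto simp: fun_eq_iff extensional_def)
    fix g assume g: "g \<in> carrier ?H"
    show "f \<oplus>\<^bsub>?H\<^esub> g \<in> carrier ?H"
      using r[OF mod_hom_plus[OF N, of f M g]] f g by simp
    show "f \<oplus>\<^bsub>?H\<^esub> g = g \<oplus>\<^bsub>?H\<^esub> f" using cl[OF f] cl[OF g] by (auto simp: N.M.a_ac intro!: restrict_ext)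
    fix h assume h: "h \<in> carrier ?H"
    show "f \<oplus>\<^bsub>?H\<^esub> g \<oplus>\<^bsub>?H\<^esub> h = f \<oplus>\<^bsub>?H\<^esub> (g \<oplus>\<^bsub>?H\<^esub> h)"
      using cl[OF f] cl[OF g] cl[OF h] by (auto simp: N.M.a_ac intro!: restrict_ext)
  next
    show "\<zero>\<^bsub>?H\<^esub> \<in> carrier ?H" using r[OF mod_hom_zero_map[OF N]] by simp
  qed
  then show ?thesis
  proof (rule moduleI[OF N.R.is_cring])
    show "a \<odot>\<^bsub>?H\<^esub> f \<in> carrier ?H" if "a \<in> carrier R" "f \<in> carrier ?H" for a f
      using r[OF mod_hom_smult[OF N, of f M a]] that by simp
    show "\<one>\<^bsub>R\<^esub> \<odot>\<^bsub>?H\<^esub> f = f" if "f \<in> carrier ?H" for f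
      using that cl[OF that] by (auto simp: fun_eq_iff extensional_def)
  qed (use cl in \<open>auto simp: N.smult_l_distr N.smult_r_distr N.smult_assoc1 intro!: restrict_ext\<close>)
qed

lemma injectiveD: "injective_module R I \<Longrightarrow> module R I"
  by (simp add: injective_module_def)

lemma fst_hom: "fst \<in> mod_hom R (prod_module A B) A"
  and snd_hom: "snd \<in> mod_hom R (prod_module A B) B"
  by (auto simp: mod_hom_def)

lemma Pi_proj_hom: "(\<lambda>f. f i) \<in> mod_hom R (Pi_module H) (H i)"
  by (auto simp: mod_hom_def)

lemma Hom_eval_hom: "x \<in> carrier M \<Longrightarrow> (\<lambda>f. f x) \<in> mod_hom R (Hom_module R M N) N"
  by (auto simp: mod_hom_def)

section \<open>Injectivity of products and of Hom out of free modules\<close>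

lemma injective_prod:
  assumes "injective_module R I" "injective_module R J"
  shows "injective_module R (prod_module I J)"
  unfolding injective_module_def
proof (intro conjI allI impI module_prod injectiveD assms)
  fix A B :: "('a, 'a) module" and i f
  assume *: "module R A \<and> module R B \<and> i \<in> mod_hom R A B \<and> inj_on i (carrier A) \<and>
    f \<in> mod_hom R A (prod_module I J)"
  then have f: "f \<in> mod_hom R A (prod_module I J)" by blast
  have "(\<lambda>x. fst (f x)) \<in> mod_hom R A I" "(\<lambda>x. snd (f x)) \<in> mod_hom R A J"
    using mod_hom_comp[OF f fst_hom] mod_hom_comp[OF f snd_hom] by auto
  then obtain g h where g: "g \<in> mod_hom R B I" "\<And>x. x \<in> carrier A \<Longrightarrow> g (i x) = fst (f x)"
    and h: "h \<in> mod_hom R B J" "\<And>x. x \<in> carrier A \<Longrightarrow> h (i x) = snd (f x)"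
    using injective_module_extend[OF assms(1), of A B i "\<lambda>x. fst (f x)"]
      injective_module_extend[OF assms(2), of A B i "\<lambda>x. snd (f x)"] * by auto
  have "(\<lambda>y. (g y, h y)) \<in> mod_hom R B (prod_module I J)"
    using mod_homD[OF g(1)] mod_homD[OF h(1)] by (intro mod_homI) auto
  then show "\<exists>g\<in>mod_hom R B (prod_module I J). \<forall>x\<in>carrier A. g (i x) = f x"
    using g(2) h(2) by (intro bexI[of _ "\<lambda>y. (g y, h y)"]) auto
qed

lemma injective_Pi:
  assumes R: "cring R" and inj: "\<And>i. injective_module R (H i)"
  shows "injective_module R (Pi_module H)"
  unfolding injective_module_def
proof (intro conjI allI impI module_Pi R injectiveD inj)
  fix A B :: "('a, 'a) module" and u f
  assume *: "module R A \<and> module R B \<and> u \<in> mod_hom R A B \<and> inj_on u (carrier A) \<and>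
    f \<in> mod_hom R A (Pi_module H)"
  then have f: "f \<in> mod_hom R A (Pi_module H)" by blast
  have "(\<lambda>x. f x i) \<in> mod_hom R A (H i)" for i
    using mod_hom_comp[OF f Pi_proj_hom] by simp
  then have "\<forall>i. \<exists>g\<in>mod_hom R B (H i). \<forall>x\<in>carrier A. g (u x) = f x i"
    using injective_module_extend[OF inj, of A B u] * by blast
  then obtain g where g: "\<And>i. g i \<in> mod_hom R B (H i)" "\<And>i x. x \<in> carrier A \<Longrightarrow> g i (u x) = f x i"
    by metis
  have "(\<lambda>y i. g i y) \<in> mod_hom R B (Pi_module H)"
    using mod_homD[OF g(1)] by (intro mod_homI) auto
  then show "\<exists>g\<in>mod_hom R B (Pi_module H). \<forall>x\<in>carrier A. g (u x) = f x"
    using g(2) by (intro bexI[of _ "\<lambda>y i. g i y"]) auto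
qed

text \<open>Hom out of a free module is a product of copies of \<open>I\<close> indexed by the unit
  vectors. Evaluating at each of them gives maps into \<open>I\<close>; these are extended
  separately and recombined by \<open>lin_ext\<close>.\<close>

lemma injective_Hom_free:
  assumes R: "cring R" and I: "injective_module R I"
  shows "injective_module R (Hom_module R (free_module R S) I)"
  unfolding injective_module_def
proof (intro conjI allI impI module_Hom module_free_module R injectiveD I)
  let ?F = "free_module R S"
  let ?H = "Hom_module R ?F I"
  fix A B :: "('a, 'a) module" and u f
  assume *: "module R A \<and> module R B \<and> u \<in> mod_hom R A B \<and> inj_on u (carrier A) \<and>
    f \<in> mod_hom R A ?H"
  then have f: "f \<in> mod_hom R A ?H" and A: "module R A" and B: "module R B"
    and u: "u \<in> mod_hom R A B" by blast+
  interpret I: module R I by (rule injectiveD[OF I])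
  interpret B: module R B by fact
  note Im = injectiveD[OF I]
  have F: "module R ?F" by (rule module_free_module[OF R])
  note e = unit_vec_closed[OF R, of S]
  have "(\<lambda>x. f x (unit_vec R S s)) \<in> mod_hom R A I" for s
    using mod_hom_comp[OF f Hom_eval_hom[OF e]] by simp
  then have "\<forall>s. \<exists>g\<in>mod_hom R B I. \<forall>x\<in>carrier A. g (u x) = f x (unit_vec R S s)"
    using injective_module_extend[OF I, of A B u] * by blast
  then obtain g where g: "\<And>s. g s \<in> mod_hom R B I"
    "\<And>s x. x \<in> carrier A \<Longrightarrow> g s (u x) = f x (unit_vec R S s)"
    by metis
  define G where "G y = restrict (lin_ext S R I (\<lambda>s. g s y)) (carrier ?F)" for y
  have G: "G y \<in> carrier ?H" if "y \<in> carrier B" for y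
    unfolding G_def using mod_homD(1)[OF g(1)] that
    by (intro restrict_hom[OF F] lin_ext_hom[OF Im]) auto
  have Ge: "G y (unit_vec R S s) = g s y" if "y \<in> carrier B" "s \<in> S" for y s
    unfolding G_def using lin_ext_unit_vec[OF Im, of "\<lambda>s. g s y" S s] mod_homD(1)[OF g(1)] that e by simp
  have eqI: "v = w" if v: "v \<in> carrier ?H" and w: "w \<in> carrier ?H"
    and "\<And>s. s \<in> S \<Longrightarrow> v (unit_vec R S s) = w (unit_vec R S s)" for v w
  proof (rule extensionalityI[of _ "carrier ?F"])
    show "v \<in> extensional (carrier ?F)" "w \<in> extensional (carrier ?F)" using v w by auto
    show "v x = w x" if "x \<in> carrier ?F" for x
      by (rule hom_free_eqI[OF R Im, of v S w]) (use v w that(1) \<open>\<And>s. s \<in> S \<Longrightarrow> _ s = _ s\<close> in auto)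
  qed
  interpret H: module R ?H by (rule module_Hom[OF F Im])
  have "G \<in> mod_hom R B ?H"
  proof (rule mod_homI)
    show "G x \<in> carrier ?H" if "x \<in> carrier B" for x using G[OF that] .
    show "G (x \<oplus>\<^bsub>B\<^esub> y) = G x \<oplus>\<^bsub>?H\<^esub> G y" if "x \<in> carrier B" "y \<in> carrier B" for x y
      by (rule eqI[OF G[OF B.M.a_closed[OF that]] H.M.a_closed[OF G[OF that(1)] G[OF that(2)]]])
         (use that Ge mod_homD(2)[OF g(1)] e in auto)
    show "G (r \<odot>\<^bsub>B\<^esub> x) = r \<odot>\<^bsub>?H\<^esub> G x" if "r \<in> carrier R" "x \<in> carrier B" for r x
      by (rule eqI[OF G[OF B.smult_closed[OF that]] H.smult_closed[OF that(1) G[OF that(2)]]])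
         (use that Ge mod_homD(3)[OF g(1)] e in auto)
  qed
  moreover have "G (u x) = f x" if x: "x \<in> carrier A" for x
    by (rule eqI) (use x G[OF mod_homD(1)[OF u x]] Ge[OF mod_homD(1)[OF u x]] g(2) mod_homD(1)[OF f x] in auto)
  ultimately show "\<exists>g\<in>mod_hom R B ?H. \<forall>x\<in>carrier A. g (u x) = f x" by blast
qed

section \<open>Null-homotopies\<close>

text \<open>The classical recursion: \<open>\<psi> (Suc n)\<close> minus \<open>e n\<close> after
  \<open>s n\<close> kills the image of \<open>u n\<close>, hence by exactness the kernel of
  \<open>u (Suc n)\<close>, and so extends along \<open>u (Suc n)\<close> into the injective
  \<open>I (Suc n)\<close>. The downward closed predicate \<open>Q\<close> marks the indices where
  chain condition and exactness are available: it is constantly true for a whole complex, and it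
  cuts off the end of a resolution, where exactness stops.\<close>

lemma injective_null_homotopy:
  fixes C :: "nat \<Rightarrow> ('a, 'c) module" and I :: "nat \<Rightarrow> ('a, 'i) module"
  assumes C: "\<And>n. module R (C n)" and I: "\<And>n. injective_module R (I n)"
    and u: "\<And>n. u n \<in> mod_hom R (C n) (C (Suc n))"
    and e: "\<And>n. e n \<in> mod_hom R (I n) (I (Suc n))"
    and ee: "\<And>n y. y \<in> carrier (I n) \<Longrightarrow> e (Suc n) (e n y) = \<zero>\<^bsub>I (Suc (Suc n))\<^esub>"
    and \<psi>: "\<And>n. \<psi> n \<in> mod_hom R (C n) (I n)"
    and ch: "\<And>n x. Q (Suc n) \<Longrightarrow> x \<in> carrier (C n) \<Longrightarrow> \<psi> (Suc n) (u n x) = e n (\<psi> n x)"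
    and Q: "\<And>n. Q (Suc n) \<Longrightarrow> Q n"
    and ex0: "\<And>x. Q 0 \<Longrightarrow> x \<in> carrier (C 0) \<Longrightarrow> u 0 x = \<zero>\<^bsub>C 1\<^esub> \<Longrightarrow> \<psi> 0 x = \<zero>\<^bsub>I 0\<^esub>"
    and exS: "\<And>n x. Q (Suc n) \<Longrightarrow> x \<in> carrier (C (Suc n)) \<Longrightarrow> u (Suc n) x = \<zero>\<^bsub>C (Suc (Suc n))\<^esub> \<Longrightarrow>
      x \<in> u n ` carrier (C n)"
  shows "\<exists>s. (\<forall>n. s n \<in> mod_hom R (C (Suc n)) (I n)) \<and>
    (Q 0 \<longrightarrow> (\<forall>x\<in>carrier (C 0). \<psi> 0 x = s 0 (u 0 x))) \<and>
    (\<forall>n. Q (Suc n) \<longrightarrow> (\<forall>x\<in>carrier (C (Suc n)).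
       \<psi> (Suc n) x = e n (s n x) \<oplus>\<^bsub>I (Suc n)\<^esub> s (Suc n) (u (Suc n) x)))"
proof -
  note Im = injectiveD[OF I]
  \<comment> \<open>The second clause is the homotopy identity at \<open>n\<close> after applying
    \<open>e n\<close>, which removes the term with the previous \<open>s\<close>; this is what the
    next step uses. Where \<open>Q\<close> fails, \<open>s\<close> is chosen to be zero.\<close>
  let ?P = "\<lambda>n s. s \<in> mod_hom R (C (Suc n)) (I n) \<and>
    (Q n \<longrightarrow> (\<forall>x\<in>carrier (C n). e n (s (u n x)) = e n (\<psi> n x))) \<and>
    (n = 0 \<longrightarrow> Q 0 \<longrightarrow> (\<forall>x\<in>carrier (C 0). \<psi> 0 x = s (u 0 x)))"
  let ?r = "\<lambda>n s s'. Q (Suc n) \<longrightarrow> (\<forall>x\<in>carrier (C (Suc n)).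
       \<psi> (Suc n) x = e n (s x) \<oplus>\<^bsub>I (Suc n)\<^esub> s' (u (Suc n) x))"
  have "\<exists>s. \<forall>n. ?P n (s n) \<and> ?r n (s n) (s (Suc n))"
  proof (rule dependent_nat_choice)
    show "\<exists>s. ?P 0 s"
    proof (cases "Q 0")
      case True
      then obtain s where "s \<in> mod_hom R (C 1) (I 0)" "\<forall>x\<in>carrier (C 0). s (u 0 x) = \<psi> 0 x"
        using injective_extend[OF I C C, of "u 0" 0 1 "\<psi> 0" 0] u[of 0] \<psi>[of 0] ex0 by auto
      then show ?thesis by auto
    next
      case False
      then show ?thesis using mod_hom_zero_map[OF Im[of 0], of "C 1"] by auto
    qed
  next
    fix s n assume P: "?P n s"
    interpret I: module R "I (Suc n)" by (rule Im)
    show "\<exists>s'. ?P (Suc n) s' \<and> ?r n s s'"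
    proof (cases "Q (Suc n)")
      case False
      then show ?thesis using mod_hom_zero_map[OF Im[of "Suc n"], of "C (Suc (Suc n))"] by auto
    next
      case True
      define \<phi> where "\<phi> x = \<psi> (Suc n) x \<ominus>\<^bsub>I (Suc n)\<^esub> e n (s x)" for x
      have es: "(\<lambda>x. e n (s x)) \<in> mod_hom R (C (Suc n)) (I (Suc n))"
        using P e by (blast intro: mod_hom_comp)
      have \<phi>: "\<phi> \<in> mod_hom R (C (Suc n)) (I (Suc n))"
        unfolding \<phi>_def by (rule mod_hom_sub[OF Im \<psi> es])
      have "\<phi> x = \<zero>\<^bsub>I (Suc n)\<^esub>" if x: "x \<in> carrier (C (Suc n))" and ux: "u (Suc n) x = \<zero>\<^bsub>C (Suc (Suc n))\<^esub>" for x
      proof -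
        obtain y where y: "y \<in> carrier (C n)" "x = u n y" using exS[OF True x ux] by blast
        have "\<psi> (Suc n) x = e n (s x)" using ch[OF True y(1)] P Q[OF True] y by simp
        then show ?thesis unfolding \<phi>_def using mod_homD(1)[OF es x] by (simp add: I.M.diff_zero_iff)
      qed
      then obtain s' where s': "s' \<in> mod_hom R (C (Suc (Suc n))) (I (Suc n))"
        "\<And>x. x \<in> carrier (C (Suc n)) \<Longrightarrow> s' (u (Suc n) x) = \<phi> x"
        using injective_extend[OF I C C u \<phi>] by blast
      have "\<psi> (Suc n) x = e n (s x) \<oplus>\<^bsub>I (Suc n)\<^esub> s' (u (Suc n) x)" if x: "x \<in> carrier (C (Suc n))" for x
        using s'(2)[OF x] mod_homD(1)[OF es x] mod_homD(1)[OF \<psi> x]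
        by (simp add: \<phi>_def a_minus_def I.M.a_ac I.M.r_neg2 I.M.r_neg1 I.M.r_neg)
      moreover have "e (Suc n) (s' (u (Suc n) x)) = e (Suc n) (\<psi> (Suc n) x)" if x: "x \<in> carrier (C (Suc n))" for x
      proof -
        interpret I2: module R "I (Suc (Suc n))" by (rule Im)
        have "s x \<in> carrier (I n)" using mod_homD(1)[OF _ x] P by auto
        then have "e (Suc n) (e n (s x)) = \<zero>\<^bsub>I (Suc (Suc n))\<^esub>" by (rule ee)
        then show ?thesis
          using s'(2)[OF x] mod_hom_diff[OF Im Im e mod_homD(1)[OF \<psi> x] mod_homD(1)[OF es x]]
            mod_homD(1)[OF e mod_homD(1)[OF \<psi> x]] by (simp add: \<phi>_def a_minus_def)
      qed
      ultimately show ?thesis using s'(1) by (intro exI[of _ s']) auto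
    qed
  qed
  then obtain s where "\<And>n. ?P n (s n) \<and> ?r n (s n) (s (Suc n))" by blast
  then show ?thesis by (intro exI[of _ s]) blast
qed

text \<open>One inclusion suffices: in a complex the other one is
  \<open>coboundaries_cocycles\<close>.\<close>

definition exact :: "('a, 'm) cochain \<Rightarrow> bool"
  where "exact X \<longleftrightarrow> (\<forall>n. cocycles X n \<subseteq> coboundaries X n)"

lemma chain_mapD:
  assumes "chain_map R X Y f"
  shows "f n \<in> mod_hom R (obj X n) (obj Y n)"
    "x \<in> carrier (obj X n) \<Longrightarrow> f (n + 1) (dif X n x) = dif Y n (f n x)"
    "x \<in> carrier (obj X (n - 1)) \<Longrightarrow> f n (dif X (n - 1) x) = dif Y (n - 1) (f (n - 1) x)"
  using assms unfolding chain_map_def by (auto dest: spec[of _ n] spec[of _ "n - 1"])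

text \<open>Degrees are counted from a bound \<open>a\<close> below which \<open>Y\<close> vanishes,
  so that a recursion over the naturals can start there.\<close>

lemma exact_injective_null_homotopy:
  assumes X: "cochain_complex R X" and ex: "exact X" and Y: "cochain_complex R Y"
    and inj: "\<And>n. injective_module R (obj Y n)" and bb: "bounded_below Y"
    and \<phi>: "chain_map R X Y \<phi>"
  shows "\<exists>s. (\<forall>n. s n \<in> mod_hom R (obj X n) (obj Y (n - 1))) \<and>
    (\<forall>n. \<forall>x\<in>carrier (obj X n). \<phi> n x = dif Y (n - 1) (s n x) \<oplus>\<^bsub>obj Y n\<^esub> s (n + 1) (dif X n x))"
proof -
  obtain a where a: "\<And>n. n < a \<Longrightarrow> carrier (obj Y n) = {\<zero>\<^bsub>obj Y n\<^esub>}"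
    using bb unfolding bounded_below_def zero_module_def by blast
  note mX = cochain_complexD(1)[OF X] and mY = cochain_complexD(1)[OF Y]
  have sh: "a + int (Suc n) = (a + int n) + 1" for n by simp
  obtain s where s_all: "(\<forall>n. s n \<in> mod_hom R (obj X (a + int (Suc n))) (obj Y (a + int n))) \<and>
    (True \<longrightarrow> (\<forall>x\<in>carrier (obj X (a + int 0)). \<phi> (a + int 0) x = s 0 (dif X (a + int 0) x))) \<and>
    (\<forall>n. True \<longrightarrow> (\<forall>x\<in>carrier (obj X (a + int (Suc n))). \<phi> (a + int (Suc n)) x =
       dif Y (a + int n) (s n x) \<oplus>\<^bsub>obj Y (a + int (Suc n))\<^esub> s (Suc n) (dif X (a + int (Suc n)) x)))"
  proof (atomize_elim, rule injective_null_homotopy[where Q = "\<lambda>_. True"])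
    fix n
    show "dif X (a + int n) \<in> mod_hom R (obj X (a + int n)) (obj X (a + int (Suc n)))"
      "dif Y (a + int n) \<in> mod_hom R (obj Y (a + int n)) (obj Y (a + int (Suc n)))"
      by (rule cochain_complexD(3)[OF X sh] cochain_complexD(3)[OF Y sh])+
    show "dif Y (a + int (Suc n)) (dif Y (a + int n) y) = \<zero>\<^bsub>obj Y (a + int (Suc (Suc n)))\<^esub>"
      if "y \<in> carrier (obj Y (a + int n))" for y
      using cochain_complexD(4)[OF Y that] by (simp add: add_ac)
    show "\<phi> (a + int (Suc n)) (dif X (a + int n) x) = dif Y (a + int n) (\<phi> (a + int n) x)"
      if "x \<in> carrier (obj X (a + int n))" for x
      using chain_mapD(2)[OF \<phi> that] by (simp add: add_ac)
    show "x \<in> dif X (a + int n) ` carrier (obj X (a + int n))"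
      if "x \<in> carrier (obj X (a + int (Suc n)))" "dif X (a + int (Suc n)) x = \<zero>\<^bsub>obj X (a + int (Suc (Suc n)))\<^esub>" for x
    proof -
      have "x \<in> cocycles X (a + int (Suc n))" using that by (simp add: cocycles_def add_ac)
      then have "x \<in> coboundaries X (a + int (Suc n))" using ex by (auto simp: exact_def)
      then show ?thesis by (simp add: coboundaries_def)
    qed
  next
    fix x assume x: "x \<in> carrier (obj X (a + int 0))" "dif X (a + int 0) x = \<zero>\<^bsub>obj X (a + int 1)\<^esub>"
    then have "x \<in> coboundaries X a" using ex by (auto simp: exact_def cocycles_def)
    then obtain y where y: "y \<in> carrier (obj X (a - 1))" "x = dif X (a - 1) y" by (auto simp: coboundaries_def)
    \<comment> \<open>A kernel element in degree \<open>a\<close> is the differential of some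
      \<open>y\<close> in degree \<open>a - 1\<close>, where \<open>Y\<close> is already zero; so
      \<open>\<phi>\<close> sends it to the differential of zero.\<close>
    have "\<phi> (a - 1) y = \<zero>\<^bsub>obj Y (a - 1)\<^esub>" using mod_homD(1)[OF chain_mapD(1)[OF \<phi>] y(1)] a[of "a - 1"] by auto
    then show "\<phi> (a + int 0) x = \<zero>\<^bsub>obj Y (a + int 0)\<^esub>"
      using chain_mapD(3)[OF \<phi> y(1)] y(2) mod_hom_zero[OF mY mY cochain_complexD(6)[OF Y]] by simp
  qed (auto intro: mX mY inj chain_mapD[OF \<phi>])
  have s: "s n \<in> mod_hom R (obj X (a + int (Suc n))) (obj Y (a + int n))"
    and s0: "x \<in> carrier (obj X a) \<Longrightarrow> \<phi> a x = s 0 (dif X a x)"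
    and sS: "x \<in> carrier (obj X (a + int (Suc n))) \<Longrightarrow> \<phi> (a + int (Suc n)) x =
       dif Y (a + int n) (s n x) \<oplus>\<^bsub>obj Y (a + int (Suc n))\<^esub> s (Suc n) (dif X (a + int (Suc n)) x)" for n x
    using s_all by (simp_all del: of_nat_Suc)
  \<comment> \<open>\<open>\<sigma> n\<close> takes values in degree \<open>n - 1\<close>, so it is
    zero up to and including \<open>n = a\<close>, and the first map of the recursion becomes
    \<open>\<sigma> (a + 1)\<close>.\<close>
  define \<sigma> where "\<sigma> n = (if n \<le> a then (\<lambda>x. \<zero>\<^bsub>obj Y (n - 1)\<^esub>) else s (nat (n - a - 1)))" for n
  have \<sigma>: "\<sigma> n \<in> mod_hom R (obj X n) (obj Y (n - 1))" for n
    using s[of "nat (n - a - 1)"] mod_hom_zero_map[OF mY] by (auto simp: \<sigma>_def)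
  have "\<phi> n x = dif Y (n - 1) (\<sigma> n x) \<oplus>\<^bsub>obj Y n\<^esub> \<sigma> (n + 1) (dif X n x)"
    if x: "x \<in> carrier (obj X n)" for n x
  proof -
    interpret Y: module R "obj Y n" by (rule mY)
    have c: "\<phi> n x \<in> carrier (obj Y n)" "dif Y (n - 1) (\<sigma> n x) \<in> carrier (obj Y n)"
      "\<sigma> (n + 1) (dif X n x) \<in> carrier (obj Y n)"
      using mod_homD(1)[OF chain_mapD(1)[OF \<phi>] x] mod_homD(1)[OF cochain_complexD(6)[OF Y] mod_homD(1)[OF \<sigma> x]]
        mod_homD(1)[OF \<sigma>[of "n + 1"] mod_homD(1)[OF cochain_complexD(2)[OF X] x]] by auto
    consider "n < a" | "n = a" | "n > a" by linarith
    then show ?thesis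
    proof cases
      case 1
      then show ?thesis using c a[OF 1] Y.M.add.m_closed[OF c(2,3)] by auto
    next
      case 2
      then have an: "a = n" by simp
      have "dif Y (n - 1) (\<sigma> n x) = \<zero>\<^bsub>obj Y n\<^esub>"
        using an mod_hom_zero[OF mY mY cochain_complexD(6)[OF Y]] by (simp add: \<sigma>_def)
      then show ?thesis using s0[of x] x c unfolding an by (simp add: \<sigma>_def an)
    next
      case 3
      define k where "k = nat (n - a - 1)"
      have n: "n = a + int (Suc k)" using 3 by (simp add: k_def)
      have "nat (1 + int k) = Suc k" by simp
      then show ?thesis using sS[of x k] x unfolding n by (simp add: \<sigma>_def)
    qed
  qed
  then show ?thesis using \<sigma> by blast
qed

section \<open>Mapping cones\<close>

text \<open>The sign on the first component makes the terms \<open>f d x\<close> and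
  \<open>d f x\<close> cancel in the square of the differential.\<close>

definition cone :: "('a, 'm) cochain \<Rightarrow> ('a, 'n) cochain \<Rightarrow> (int \<Rightarrow> 'm \<Rightarrow> 'n) \<Rightarrow> ('a, 'm \<times> 'n) cochain"
  where "cone X Y f =
    \<lparr>obj = (\<lambda>n. prod_module (obj X (n + 1)) (obj Y n)),
     dif = (\<lambda>n p. (\<ominus>\<^bsub>obj X (n + 1 + 1)\<^esub> dif X (n + 1) (fst p),
       f (n + 1) (fst p) \<oplus>\<^bsub>obj Y (n + 1)\<^esub> dif Y n (snd p)))\<rparr>"

lemma (in abelian_group) a_inv_zero [simp]: "\<ominus> \<zero> = \<zero>"
  by (rule minus_equality) auto

lemma (in abelian_group) diff_diff_cancel:
  "x \<in> carrier G \<Longrightarrow> y \<in> carrier G \<Longrightarrow> x \<ominus> (x \<ominus> y) = y"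
  by (simp add: a_minus_def minus_add r_neg2)

lemma (in abelian_group) add_diff_cancel:
  "x \<in> carrier G \<Longrightarrow> y \<in> carrier G \<Longrightarrow> (x \<oplus> y) \<ominus> y = x"
  by (simp add: a_minus_def a_assoc r_neg)

lemma obj_cone [simp]: "obj (cone X Y f) n = prod_module (obj X (n + 1)) (obj Y n)"
  by (simp add: cone_def)

lemma dif_cone [simp]: "dif (cone X Y f) n p = (\<ominus>\<^bsub>obj X (n + 2)\<^esub> dif X (n + 1) (fst p),
    f (n + 1) (fst p) \<oplus>\<^bsub>obj Y (n + 1)\<^esub> dif Y n (snd p))"
  by (simp add: cone_def add.assoc)

lemma mod_hom_pair:
  "f \<in> mod_hom R A B \<Longrightarrow> g \<in> mod_hom R A C \<Longrightarrow> (\<lambda>x. (f x, g x)) \<in> mod_hom R A (prod_module B C)"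
  by (auto simp: mod_hom_def)

context
  fixes R :: "('a, 'r) ring_scheme" and X :: "('a, 'm) cochain" and Y :: "('a, 'n) cochain"
    and f :: "int \<Rightarrow> 'm \<Rightarrow> 'n"
  assumes X: "cochain_complex R X" and Y: "cochain_complex R Y" and f: "chain_map R X Y f"
begin

private lemma mX: "module R (obj X n)" and mY: "module R (obj Y n)"
  using cochain_complexD(1) X Y by auto

interpretation MX: module R "obj X n" for n by (rule mX)
interpretation MY: module R "obj Y n" for n by (rule mY)

private lemma dX: "dif X n \<in> mod_hom R (obj X n) (obj X (n + 1))"
  and dY: "dif Y n \<in> mod_hom R (obj Y n) (obj Y (n + 1))"
  using cochain_complexD(2) X Y by auto

private lemma dXc: "x \<in> carrier (obj X n) \<Longrightarrow> dif X n x \<in> carrier (obj X (n + 1))"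
  and dYc: "y \<in> carrier (obj Y n) \<Longrightarrow> dif Y n y \<in> carrier (obj Y (n + 1))"
  and fc: "x \<in> carrier (obj X n) \<Longrightarrow> f n x \<in> carrier (obj Y n)"
  by (rule mod_homD(1)[OF dX] mod_homD(1)[OF dY] mod_homD(1)[OF chain_mapD(1)[OF f]]; assumption)+

private lemma dX1: "dif X (n + 1) \<in> mod_hom R (obj X (n + 1)) (obj X (n + 2))"
  and dX1c: "x \<in> carrier (obj X (n + 1)) \<Longrightarrow> dif X (n + 1) x \<in> carrier (obj X (n + 2))"
  using dX[of "n + 1"] dXc[of x "n + 1"] by (simp_all add: add.assoc)

lemma cochain_complex_cone: "cochain_complex R (cone X Y f)"
  unfolding cochain_complex_def
proof (intro allI conjI ballI)
  fix n
  show "module R (obj (cone X Y f) n)" by (simp add: module_prod mX mY)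
  have "(\<lambda>p. \<ominus>\<^bsub>obj X (n + 2)\<^esub> dif X (n + 1) (fst p)) \<in>
      mod_hom R (prod_module (obj X (n + 1)) (obj Y n)) (obj X (n + 2))"
    by (rule mod_hom_uminus[OF mX mod_hom_comp[OF fst_hom dX1]])
  moreover have "(\<lambda>p. f (n + 1) (fst p) \<oplus>\<^bsub>obj Y (n + 1)\<^esub> dif Y n (snd p)) \<in>
      mod_hom R (prod_module (obj X (n + 1)) (obj Y n)) (obj Y (n + 1))"
    by (rule mod_hom_plus[OF mY mod_hom_comp[OF fst_hom chain_mapD(1)[OF f]] mod_hom_comp[OF snd_hom dY]])
  ultimately show "dif (cone X Y f) n \<in> mod_hom R (obj (cone X Y f) n) (obj (cone X Y f) (n + 1))"
    using mod_hom_pair by (fastforce simp: cone_def add.assoc)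
  fix p assume "p \<in> carrier (obj (cone X Y f) n)"
  then obtain x y where p: "p = (x, y)" "x \<in> carrier (obj X (n + 1))" "y \<in> carrier (obj Y n)"
    by (cases p) auto
  note x = p(2) and y = p(3)
  have 1: "dif X (n + 2) (\<ominus>\<^bsub>obj X (n + 2)\<^esub> dif X (n + 1) x) = \<zero>\<^bsub>obj X (n + 3)\<^esub>"
    using mod_hom_minus[OF mX mX dX dX1c[OF x]] cochain_complexD(4)[OF X x] by (simp add: add.assoc)
  have 2: "f (n + 2) (\<ominus>\<^bsub>obj X (n + 2)\<^esub> dif X (n + 1) x) = \<ominus>\<^bsub>obj Y (n + 2)\<^esub> dif Y (n + 1) (f (n + 1) x)"
    using mod_hom_minus[OF mX mY chain_mapD(1)[OF f] dX1c[OF x]] chain_mapD(2)[OF f x] by (simp add: add.assoc)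
  have 3: "dif Y (n + 1) (f (n + 1) x \<oplus>\<^bsub>obj Y (n + 1)\<^esub> dif Y n y) = dif Y (n + 1) (f (n + 1) x)"
    using mod_homD(2)[OF dY fc[OF x] dYc[OF y]] cochain_complexD(4)[OF Y y] dYc[OF fc[OF x]] by (simp add: add.assoc)
  have 4: "dif Y (n + 1) (f (n + 1) x) \<in> carrier (obj Y (n + 2))" using dYc[OF fc[OF x]] by (simp add: add.assoc)
  show "dif (cone X Y f) (n + 1) (dif (cone X Y f) n p) = \<zero>\<^bsub>obj (cone X Y f) (n + 1 + 1)\<^esub>"
    using 1 2 3 4 by (simp add: p(1) add.assoc MY.M.l_neg)
qed

text \<open>For a cocycle \<open>(x, y)\<close> of the cone, \<open>x\<close> is a cocycle and
  \<open>f x\<close> is minus the differential of \<open>y\<close>. Injectivity on cohomology gives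
  \<open>x = d x'\<close>; then \<open>y + f x'\<close> is a cocycle, and surjectivity writes it as
  \<open>f c + d q\<close>. The cochain \<open>(c - x', q)\<close> is mapped to
  \<open>(x, y)\<close>.\<close>

lemma exact_cone:
  assumes qi: "elementwise_quasi_iso R X Y f"
  shows "exact (cone X Y f)"
  unfolding exact_def
proof (intro allI subsetI)
  fix n p assume "p \<in> cocycles (cone X Y f) n"
  then obtain x y where p: "p = (x, y)" and x: "x \<in> carrier (obj X (n + 1))" and y: "y \<in> carrier (obj Y n)"
    and dx: "\<ominus>\<^bsub>obj X (n + 2)\<^esub> dif X (n + 1) x = \<zero>\<^bsub>obj X (n + 2)\<^esub>"
    and fx: "f (n + 1) x \<oplus>\<^bsub>obj Y (n + 1)\<^esub> dif Y n y = \<zero>\<^bsub>obj Y (n + 1)\<^esub>"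
    by (cases p) (auto simp: cocycles_def add.assoc)
  have xz: "x \<in> cocycles X (n + 1)"
    using dx dX1c[OF x] x MX.M.minus_minus[OF dX1c[OF x]] by (simp add: cocycles_def add.assoc)
  have "f (n + 1) x = dif Y n (\<ominus>\<^bsub>obj Y n\<^esub> y)"
    using mod_hom_minus[OF mY mY dY y] MY.M.minus_equality[OF fx dYc[OF y] fc[OF x]] by simp
  then have "f (n + 1) x \<in> coboundaries Y (n + 1)" using y by (auto simp: coboundaries_def)
  then have "x \<in> coboundaries X (n + 1)" using qi xz unfolding elementwise_quasi_iso_def by blast
  then obtain x' where x': "x' \<in> carrier (obj X n)" "x = dif X n x'" by (auto simp: coboundaries_def)
  let ?y = "y \<oplus>\<^bsub>obj Y n\<^esub> f n x'"
  have "dif Y n ?y = \<zero>\<^bsub>obj Y (n + 1)\<^esub>"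
    using mod_homD(2)[OF dY y fc[OF x'(1)]] chain_mapD(2)[OF f x'(1)] fx x'(2)
      MY.M.a_comm[OF dYc[OF y] fc[OF x]] by simp
  then have "?y \<in> cocycles Y n" using y fc[OF x'(1)] by (simp add: cocycles_def)
  then obtain c where c: "c \<in> cocycles X n" "?y \<ominus>\<^bsub>obj Y n\<^esub> f n c \<in> coboundaries Y n"
    using qi unfolding elementwise_quasi_iso_def by blast
  then obtain q where q: "q \<in> carrier (obj Y (n - 1))" "?y \<ominus>\<^bsub>obj Y n\<^esub> f n c = dif Y (n - 1) q"
    by (auto simp: coboundaries_def)
  have cc: "c \<in> carrier (obj X n)" and dc: "dif X n c = \<zero>\<^bsub>obj X (n + 1)\<^esub>" using c(1) by (auto simp: cocycles_def)
  let ?p = "c \<ominus>\<^bsub>obj X n\<^esub> x'"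
  have "\<ominus>\<^bsub>obj X (n + 1)\<^esub> dif X n ?p = x"
    using mod_hom_diff[OF mX mX dX cc x'(1)] dc x x'(2) by (simp add: a_minus_def)
  moreover have "f n ?p \<oplus>\<^bsub>obj Y n\<^esub> dif Y (n - 1) q = y"
    unfolding mod_hom_diff[OF mX mY chain_mapD(1)[OF f] cc x'(1)] q(2)[symmetric]
    using fc[OF cc] fc[OF x'(1)] y
    by (simp add: a_minus_def MY.M.a_ac MY.M.r_neg2 MY.M.r_neg1 MY.M.r_neg)
  ultimately have "p = dif (cone X Y f) (n - 1) (?p, q)" by (simp add: p add.commute[of 1])
  moreover have "(?p, q) \<in> carrier (obj (cone X Y f) (n - 1))" using cc x'(1) q(1) by simp
  ultimately show "p \<in> coboundaries (cone X Y f) n" unfolding coboundaries_def by blast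
qed

end

section \<open>Translates and the comparison of injective resolutions\<close>

definition shift :: "('a, 'm) cochain \<Rightarrow> ('a, 'm) cochain"
  where "shift X = \<lparr>obj = (\<lambda>n. obj X (n + 1)), dif = (\<lambda>n x. \<ominus>\<^bsub>obj X (n + 1 + 1)\<^esub> dif X (n + 1) x)\<rparr>"

lemma shift_simps: "obj (shift X) n = obj X (n + 1)"
  "dif (shift X) n x = \<ominus>\<^bsub>obj X (n + 2)\<^esub> dif X (n + 1) x"
  by (simp_all add: shift_def add.assoc)

lemma cochain_complex_shift:
  assumes X: "cochain_complex R X" shows "cochain_complex R (shift X)"
  unfolding cochain_complex_def
proof (intro allI conjI ballI)
  note mX = cochain_complexD(1)[OF X] and dX = cochain_complexD(2)[OF X]
  fix n
  interpret Z: module R "obj X (n + 3)" by (rule mX)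
  show "module R (obj (shift X) n)" by (simp add: shift_simps mX)
  show "dif (shift X) n \<in> mod_hom R (obj (shift X) n) (obj (shift X) (n + 1))"
    using mod_hom_uminus[OF mX dX[of "n + 1"]] by (simp add: shift_def)
  fix x assume "x \<in> carrier (obj (shift X) n)"
  then have x: "x \<in> carrier (obj X (n + 1))" by (simp add: shift_simps)
  show "dif (shift X) (n + 1) (dif (shift X) n x) = \<zero>\<^bsub>obj (shift X) (n + 1 + 1)\<^esub>"
    using mod_hom_minus[OF mX mX dX mod_homD(1)[OF dX x]] cochain_complexD(4)[OF X x]
    by (simp add: shift_simps add.assoc)
qed

text \<open>Projecting the cone of \<open>f\<close> to its first component and applying
  \<open>h\<close> is a chain map to the translate of \<open>K\<close>; the negated differential of
  \<open>shift\<close> is there for this. Its source is exact and its target injective, so it is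
  null-homotopic. The homotopy restricted to \<open>J\<close> is the map \<open>g\<close>, and
  restricted to \<open>X\<close> it is the homotopy \<open>\<sigma>\<close> between \<open>h\<close>
  and the composite of \<open>f\<close> and \<open>g\<close>.\<close>

lemma extend_along_quasi_iso:
  assumes qi: "elementwise_quasi_iso R X J f"
    and K: "cochain_complex R K" and inj: "\<And>n. injective_module R (obj K n)" and bb: "bounded_below K"
    and h: "chain_map R X K h"
  shows "\<exists>g \<sigma>. chain_map R J K g \<and> (\<forall>n. \<sigma> n \<in> mod_hom R (obj X (n + 1)) (obj K n)) \<and>
    (\<forall>n. \<forall>x\<in>carrier (obj X (n + 1)). g (n + 1) (f (n + 1) x) =
       h (n + 1) x \<oplus>\<^bsub>obj K (n + 1)\<^esub> (dif K n (\<sigma> n x) \<oplus>\<^bsub>obj K (n + 1)\<^esub> \<sigma> (n + 1) (dif X (n + 1) x)))"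
proof -
  have X: "cochain_complex R X" and J: "cochain_complex R J" and f: "chain_map R X J f"
    using qi by (auto simp: elementwise_quasi_iso_def)
  note mX = cochain_complexD(1)[OF X] and mJ = cochain_complexD(1)[OF J] and mK = cochain_complexD(1)[OF K]
  note dX = cochain_complexD(2)[OF X] and dJ = cochain_complexD(2)[OF J] and dK = cochain_complexD(2)[OF K]
  interpret MX: module R "obj X n" for n by (rule mX)
  interpret MJ: module R "obj J n" for n by (rule mJ)
  interpret MK: module R "obj K n" for n by (rule mK)
  note dXc = mod_homD(1)[OF dX] and dKc = mod_homD(1)[OF dK] and dJc = mod_homD(1)[OF dJ]
  note fc = mod_homD(1)[OF chain_mapD(1)[OF f]] and hc = mod_homD(1)[OF chain_mapD(1)[OF h]]
  let ?C = "cone X J f" and ?K = "shift K"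
  have "chain_map R ?C ?K (\<lambda>n p. h (n + 1) (fst p))"
    unfolding chain_map_def
  proof (intro allI conjI ballI)
    fix n
    show "(\<lambda>p. h (n + 1) (fst p)) \<in> mod_hom R (obj ?C n) (obj ?K n)"
      using mod_hom_comp[OF fst_hom chain_mapD(1)[OF h, of "n + 1"]] by (simp add: shift_simps)
    fix p assume "p \<in> carrier (obj ?C n)"
    then have x: "fst p \<in> carrier (obj X (n + 1))" by auto
    show "h (n + 1 + 1) (fst (dif ?C n p)) = dif ?K n (h (n + 1) (fst p))"
      using mod_hom_minus[OF mX mK chain_mapD(1)[OF h] dXc[OF x]] chain_mapD(2)[OF h x]
      by (simp add: shift_simps add.assoc)
  qed
  moreover have "bounded_below ?K"
    using bb unfolding bounded_below_def shift_simps by (metis add_less_cancel_right diff_add_cancel)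
  ultimately obtain s where s0: "\<And>n. s n \<in> mod_hom R (obj ?C n) (obj ?K (n - 1))"
    and s1: "\<And>n p. p \<in> carrier (obj ?C n) \<Longrightarrow>
      h (n + 1) (fst p) = dif ?K (n - 1) (s n p) \<oplus>\<^bsub>obj ?K n\<^esub> s (n + 1) (dif ?C n p)"
    using exact_injective_null_homotopy[OF cochain_complex_cone[OF X J f] exact_cone[OF X J f qi]
        cochain_complex_shift[OF K], of "\<lambda>n p. h (n + 1) (fst p)"] inj
    by (force simp: shift_simps(1))
  have sh: "s n \<in> mod_hom R (prod_module (obj X (n + 1)) (obj J n)) (obj K n)" for n
    using s0[of n] by (simp add: shift_simps)
  have s: "h (n + 1) x = (\<ominus>\<^bsub>obj K (n + 1)\<^esub> dif K n (s n (x, y))) \<oplus>\<^bsub>obj K (n + 1)\<^esub>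
      s (n + 1) (\<ominus>\<^bsub>obj X (n + 2)\<^esub> dif X (n + 1) x, f (n + 1) x \<oplus>\<^bsub>obj J (n + 1)\<^esub> dif J n y)"
    if "x \<in> carrier (obj X (n + 1))" "y \<in> carrier (obj J n)" for n x y
    using s1[of "(x, y)" n] that by (simp add: shift_simps add.commute[of 1])
  define g where "g n y = s n (\<zero>\<^bsub>obj X (n + 1)\<^esub>, y)" for n y
  define \<sigma> where "\<sigma> n x = s n (x, \<zero>\<^bsub>obj J n\<^esub>)" for n x
  have in0: "(\<lambda>y. (\<zero>\<^bsub>obj X (n + 1)\<^esub>, y)) \<in> mod_hom R (obj J n) (prod_module (obj X (n + 1)) (obj J n))" for n
    by (rule mod_hom_pair[OF mod_hom_zero_map[OF mX] mod_hom_id])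
  have in1: "(\<lambda>x. (x, \<zero>\<^bsub>obj J n\<^esub>)) \<in> mod_hom R (obj X (n + 1)) (prod_module (obj X (n + 1)) (obj J n))" for n
    by (rule mod_hom_pair[OF mod_hom_id mod_hom_zero_map[OF mJ]])
  have g: "g n \<in> mod_hom R (obj J n) (obj K n)" for n
    unfolding g_def using mod_hom_comp[OF in0 sh] by simp
  have \<sigma>: "\<sigma> n \<in> mod_hom R (obj X (n + 1)) (obj K n)" for n
    unfolding \<sigma>_def using mod_hom_comp[OF in1 sh] by simp
  have "chain_map R J K g"
    unfolding chain_map_def
  proof (intro allI conjI ballI g)
    \<comment> \<open>The case \<open>x = 0\<close> of the homotopy identity: the left side
      vanishes, and what remains says that \<open>g\<close> commutes with the differentials.\<close>
    fix n y assume y: "y \<in> carrier (obj J n)"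
    have "\<zero>\<^bsub>obj K (n + 1)\<^esub> = (\<ominus>\<^bsub>obj K (n + 1)\<^esub> dif K n (g n y)) \<oplus>\<^bsub>obj K (n + 1)\<^esub> g (n + 1) (dif J n y)"
      using s[OF MX.M.zero_closed y] mod_hom_zero[OF mX mK chain_mapD(1)[OF h]]
        mod_hom_zero[OF mX mX dX, of "n + 1"] mod_hom_zero[OF mX mJ chain_mapD(1)[OF f]] dJc[OF y]
      by (simp add: g_def add.assoc)
    then have "\<ominus>\<^bsub>obj K (n + 1)\<^esub> (g (n + 1) (dif J n y)) = \<ominus>\<^bsub>obj K (n + 1)\<^esub> dif K n (g n y)"
      using MK.M.minus_equality[of "n + 1" "\<ominus>\<^bsub>obj K (n + 1)\<^esub> dif K n (g n y)" "g (n + 1) (dif J n y)"]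
        dKc[OF mod_homD(1)[OF g y]] mod_homD(1)[OF g dJc[OF y]] by simp
    then show "g (n + 1) (dif J n y) = dif K n (g n y)"
      using dKc[OF mod_homD(1)[OF g y]] mod_homD(1)[OF g dJc[OF y]] by (metis MK.M.minus_minus)
  qed
  moreover have "g (n + 1) (f (n + 1) x) =
       h (n + 1) x \<oplus>\<^bsub>obj K (n + 1)\<^esub> (dif K n (\<sigma> n x) \<oplus>\<^bsub>obj K (n + 1)\<^esub> \<sigma> (n + 1) (dif X (n + 1) x))"
    if x: "x \<in> carrier (obj X (n + 1))" for n x
  proof -
    let ?d = "dif X (n + 1) x"
    have d: "?d \<in> carrier (obj X (n + 1 + 1))" "?d \<in> carrier (obj X (n + 2))"
      using dXc[OF x] by (simp_all add: add.assoc)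
    \<comment> \<open>Additivity splits the argument of \<open>s\<close> into an \<open>X\<close>
      part and a \<open>J\<close> part, so that the case \<open>y = 0\<close> of the homotopy
      identity involves only \<open>\<sigma>\<close> and \<open>g\<close>.\<close>
    have e: "(\<ominus>\<^bsub>obj X (n + 2)\<^esub> ?d, f (n + 1) x) = (\<ominus>\<^bsub>obj X (n + 2)\<^esub> ?d, \<zero>\<^bsub>obj J (n + 1)\<^esub>)
        \<oplus>\<^bsub>prod_module (obj X (n + 1 + 1)) (obj J (n + 1))\<^esub> (\<zero>\<^bsub>obj X (n + 1 + 1)\<^esub>, f (n + 1) x)"
      using d fc[OF x] by (simp add: add.assoc)
    have "s (n + 1) (\<ominus>\<^bsub>obj X (n + 2)\<^esub> ?d, f (n + 1) x)
        = \<sigma> (n + 1) (\<ominus>\<^bsub>obj X (n + 2)\<^esub> ?d) \<oplus>\<^bsub>obj K (n + 1)\<^esub> g (n + 1) (f (n + 1) x)"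
      unfolding e by (subst mod_homD(2)[OF sh]) (use d fc[OF x] in \<open>auto simp: \<sigma>_def g_def add.assoc\<close>)
    also have "\<sigma> (n + 1) (\<ominus>\<^bsub>obj X (n + 2)\<^esub> ?d) = \<ominus>\<^bsub>obj K (n + 1)\<^esub> \<sigma> (n + 1) ?d"
      using mod_hom_minus[OF mX mK \<sigma> d(1)] by (simp add: add.assoc)
    finally have "h (n + 1) x = (\<ominus>\<^bsub>obj K (n + 1)\<^esub> dif K n (\<sigma> n x)) \<oplus>\<^bsub>obj K (n + 1)\<^esub>
        (\<ominus>\<^bsub>obj K (n + 1)\<^esub> \<sigma> (n + 1) ?d \<oplus>\<^bsub>obj K (n + 1)\<^esub> g (n + 1) (f (n + 1) x))"
      using s[OF x MJ.M.zero_closed] mod_hom_zero[OF mJ mJ dJ] fc[OF x] by (simp add: \<sigma>_def)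
    then show ?thesis
      using dKc[OF mod_homD(1)[OF \<sigma> x]] mod_homD(1)[OF \<sigma> d(1)] mod_homD(1)[OF g fc[OF x]]
      by (simp add: MK.M.a_ac MK.M.r_neg2 MK.M.r_neg1 MK.M.r_neg)
  qed
  ultimately show ?thesis using \<sigma> by blast
qed

text \<open>Two out of three: on cocycles the term with \<open>dif X\<close> vanishes, so
  \<open>g f\<close> and \<open>h\<close> differ by a coboundary of \<open>K\<close>, while
  \<open>f\<close> and \<open>h\<close> are isomorphisms on cohomology.\<close>

lemma quasi_iso_factor:
  assumes fq: "elementwise_quasi_iso R X J f" and hq: "elementwise_quasi_iso R X K h"
    and g: "chain_map R J K g" and \<sigma>: "\<And>n. \<sigma> n \<in> mod_hom R (obj X (n + 1)) (obj K n)"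
    and gf: "\<And>n x. x \<in> carrier (obj X (n + 1)) \<Longrightarrow> g (n + 1) (f (n + 1) x) =
       h (n + 1) x \<oplus>\<^bsub>obj K (n + 1)\<^esub> (dif K n (\<sigma> n x) \<oplus>\<^bsub>obj K (n + 1)\<^esub> \<sigma> (n + 1) (dif X (n + 1) x))"
  shows "elementwise_quasi_iso R J K g"
proof -
  have X: "cochain_complex R X" and J: "cochain_complex R J" and K: "cochain_complex R K"
    and f: "chain_map R X J f" and h: "chain_map R X K h"
    using fq hq by (auto simp: elementwise_quasi_iso_def)
  note mX = cochain_complexD(1)[OF X] and mJ = cochain_complexD(1)[OF J] and mK = cochain_complexD(1)[OF K]
  interpret MJ: module R "obj J n" for n by (rule mJ)
  interpret MK: module R "obj K n" for n by (rule mK)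
  note fc = mod_homD(1)[OF chain_mapD(1)[OF f]] and hc = mod_homD(1)[OF chain_mapD(1)[OF h]]
    and gc = mod_homD(1)[OF chain_mapD(1)[OF g]]
  note sK = submodule_coboundaries[OF K]
  have gfz: "\<exists>b\<in>coboundaries K n. g n (f n x) = h n x \<oplus>\<^bsub>obj K n\<^esub> b" if "x \<in> cocycles X n" for n x
  proof -
    have x: "x \<in> carrier (obj X (n - 1 + 1))" "dif X n x = \<zero>\<^bsub>obj X (n + 1)\<^esub>"
      using that by (auto simp: cocycles_def)
    have "\<sigma> n \<zero>\<^bsub>obj X (n + 1)\<^esub> = \<zero>\<^bsub>obj K n\<^esub>" by (rule mod_hom_zero[OF mX mK \<sigma>])
    then have "g n (f n x) = h n x \<oplus>\<^bsub>obj K n\<^esub> dif K (n - 1) (\<sigma> (n - 1) x)"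
      using gf[OF x(1)] x(2) mod_homD(1)[OF cochain_complexD(6)[OF K] mod_homD(1)[OF \<sigma> x(1)]] by simp
    then show ?thesis using mod_homD(1)[OF \<sigma> x(1)] unfolding coboundaries_def by blast
  qed
  show ?thesis
    unfolding elementwise_quasi_iso_def
  proof (intro conjI J K g allI ballI impI)
    fix n y assume y: "y \<in> cocycles J n" and gy: "g n y \<in> coboundaries K n"
    then have yc: "y \<in> carrier (obj J n)" by (simp add: cocycles_def)
    obtain x where x: "x \<in> cocycles X n" "y \<ominus>\<^bsub>obj J n\<^esub> f n x \<in> coboundaries J n"
      using fq y unfolding elementwise_quasi_iso_def by blast
    then have xc: "x \<in> carrier (obj X n)" by (simp add: cocycles_def)
    obtain b where b: "b \<in> coboundaries K n" "g n (f n x) = h n x \<oplus>\<^bsub>obj K n\<^esub> b" using gfz[OF x(1)] by blast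
    have bc: "b \<in> carrier (obj K n)" by (rule submoduleD(2)[OF mK sK b(1)])
    have "g n (y \<ominus>\<^bsub>obj J n\<^esub> f n x) \<in> coboundaries K n" by (rule chain_map_coboundaries[OF g x(2)])
    then have "g n y \<ominus>\<^bsub>obj K n\<^esub> g n (f n x) \<in> coboundaries K n"
      using mod_hom_diff[OF mJ mK chain_mapD(1)[OF g] yc fc[OF xc]] by simp
    then have "g n y \<ominus>\<^bsub>obj K n\<^esub> (g n y \<ominus>\<^bsub>obj K n\<^esub> g n (f n x)) \<ominus>\<^bsub>obj K n\<^esub> b \<in> coboundaries K n"
      using submoduleD(7)[OF mK sK] gy b(1) by metis
    moreover have "g n y \<ominus>\<^bsub>obj K n\<^esub> (g n y \<ominus>\<^bsub>obj K n\<^esub> g n (f n x)) \<ominus>\<^bsub>obj K n\<^esub> b = h n x"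
      using gc[OF yc] hc[OF xc] bc unfolding b(2)
      by (simp add: MK.M.diff_diff_cancel MK.M.add_diff_cancel)
    ultimately have "x \<in> coboundaries X n" using hq x(1) unfolding elementwise_quasi_iso_def by metis
    then have "f n x \<in> coboundaries J n" by (rule chain_map_coboundaries[OF f])
    then have "(y \<ominus>\<^bsub>obj J n\<^esub> f n x) \<oplus>\<^bsub>obj J n\<^esub> f n x \<in> coboundaries J n"
      by (rule submoduleD(4)[OF mJ submodule_coboundaries[OF J] x(2)])
    then show "y \<in> coboundaries J n"
      using yc fc[OF xc] by (simp add: a_minus_def MJ.M.a_assoc MJ.M.l_neg)
  next
    fix n z assume z: "z \<in> cocycles K n"
    then have zc: "z \<in> carrier (obj K n)" by (simp add: cocycles_def)
    obtain x where x: "x \<in> cocycles X n" "z \<ominus>\<^bsub>obj K n\<^esub> h n x \<in> coboundaries K n"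
      using hq z unfolding elementwise_quasi_iso_def by blast
    then have xc: "x \<in> carrier (obj X n)" by (simp add: cocycles_def)
    obtain b where b: "b \<in> coboundaries K n" "g n (f n x) = h n x \<oplus>\<^bsub>obj K n\<^esub> b" using gfz[OF x(1)] by blast
    have bc: "b \<in> carrier (obj K n)" by (rule submoduleD(2)[OF mK sK b(1)])
    have "(z \<ominus>\<^bsub>obj K n\<^esub> h n x) \<ominus>\<^bsub>obj K n\<^esub> b \<in> coboundaries K n" by (rule submoduleD(7)[OF mK sK x(2) b(1)])
    moreover have "(z \<ominus>\<^bsub>obj K n\<^esub> h n x) \<ominus>\<^bsub>obj K n\<^esub> b = z \<ominus>\<^bsub>obj K n\<^esub> g n (f n x)"
      unfolding b(2) using zc hc[OF xc] bc by (simp add: a_minus_def MK.M.minus_add MK.M.a_ac)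
    moreover have "f n x \<in> cocycles J n" by (rule chain_map_cocycles[OF X J f x(1)])
    ultimately show "\<exists>y\<in>cocycles J n. z \<ominus>\<^bsub>obj K n\<^esub> g n y \<in> coboundaries K n" by auto
  qed
qed

section \<open>Torsion\<close>

lemma ideal_power_ideal:
  assumes "cring R" "ideal I R" shows "ideal (ideal_power R I k) R"
proof -
  interpret cring R by fact
  show ?thesis by (induction k) (auto intro: oneideal ideal_prod_is_ideal assms)
qed

lemma ideal_power_antimono:
  assumes "cring R" "ideal I R" "k \<le> l" shows "ideal_power R I l \<subseteq> ideal_power R I k"
proof -
  interpret cring R by fact
  have "ideal_power R I (Suc n) \<subseteq> ideal_power R I n" for n
    using ideal_prod_inter[OF assms(2) ideal_power_ideal[OF assms(1,2)]] by auto
  then show ?thesis using assms(3) by (rule lift_Suc_antimono_le)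
qed

lemma torsion_module_simps [simp]:
  "\<zero>\<^bsub>torsion_module R I M\<^esub> = \<zero>\<^bsub>M\<^esub>" "x \<oplus>\<^bsub>torsion_module R I M\<^esub> y = x \<oplus>\<^bsub>M\<^esub> y"
  "r \<odot>\<^bsub>torsion_module R I M\<^esub> x = r \<odot>\<^bsub>M\<^esub> x"
  by (simp_all add: torsion_module_def)

lemma in_torsion_iff:
  "x \<in> carrier (torsion_module R I M) \<longleftrightarrow>
    x \<in> carrier M \<and> (\<exists>k. \<forall>a\<in>ideal_power R I k. a \<odot>\<^bsub>M\<^esub> x = \<zero>\<^bsub>M\<^esub>)"
  by (simp add: torsion_module_def)

lemma torsion_module_eq: "torsion_module R I M = M\<lparr>carrier := carrier (torsion_module R I M)\<rparr>"
  by (simp add: torsion_module_def)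

lemma submodule_torsion:
  assumes I: "ideal I R" and M: "module R M"
  shows "submodule (carrier (torsion_module R I M)) R M"
proof (rule submoduleI'[OF M])
  interpret M: module R M by fact
  note R = M.R.is_cring
  have pc: "a \<in> carrier R" if "a \<in> ideal_power R I k" for a k
    using ideal.Icarr[OF ideal_power_ideal[OF R I] that] .
  show "carrier (torsion_module R I M) \<subseteq> carrier M" by (auto simp: in_torsion_iff)
  show "\<zero>\<^bsub>M\<^esub> \<in> carrier (torsion_module R I M)" using pc by (auto simp: in_torsion_iff)
  show "x \<oplus>\<^bsub>M\<^esub> y \<in> carrier (torsion_module R I M)"
    if xy: "x \<in> carrier (torsion_module R I M)" "y \<in> carrier (torsion_module R I M)" for x y
  proof -
    obtain k l where k: "\<And>a. a \<in> ideal_power R I k \<Longrightarrow> a \<odot>\<^bsub>M\<^esub> x = \<zero>\<^bsub>M\<^esub>"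
      and l: "\<And>a. a \<in> ideal_power R I l \<Longrightarrow> a \<odot>\<^bsub>M\<^esub> y = \<zero>\<^bsub>M\<^esub>"
      and c: "x \<in> carrier M" "y \<in> carrier M"
      using xy by (auto simp: in_torsion_iff)
    have "a \<odot>\<^bsub>M\<^esub> (x \<oplus>\<^bsub>M\<^esub> y) = \<zero>\<^bsub>M\<^esub>" if a: "a \<in> ideal_power R I (max k l)" for a
    proof -
      have "a \<in> ideal_power R I k" "a \<in> ideal_power R I l"
        using ideal_power_antimono[OF R I, of k "max k l"] ideal_power_antimono[OF R I, of l "max k l"] a by auto
      then show ?thesis using k l c pc by (simp add: M.smult_r_distr)
    qed
    then show ?thesis using c unfolding in_torsion_iff by auto
  qed
  show "r \<odot>\<^bsub>M\<^esub> x \<in> carrier (torsion_module R I M)"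
    if r: "r \<in> carrier R" and x: "x \<in> carrier (torsion_module R I M)" for r x
  proof -
    obtain k where k: "\<And>a. a \<in> ideal_power R I k \<Longrightarrow> a \<odot>\<^bsub>M\<^esub> x = \<zero>\<^bsub>M\<^esub>" and c: "x \<in> carrier M"
      using x by (auto simp: in_torsion_iff)
    have "a \<odot>\<^bsub>M\<^esub> (r \<odot>\<^bsub>M\<^esub> x) = \<zero>\<^bsub>M\<^esub>" if a: "a \<in> ideal_power R I k" for a
      using k[OF a] pc[OF a] r c by (metis M.R.m_comm M.smult_assoc1 M.smult_r_null)
    then show ?thesis using c r unfolding in_torsion_iff by auto
  qed
qed

lemma module_torsion: "ideal I R \<Longrightarrow> module R M \<Longrightarrow> module R (torsion_module R I M)"
  by (subst torsion_module_eq) (rule module_sub[OF _ submodule_torsion])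

lemma torsion_hom:
  assumes I: "ideal I R" and A: "module R A" and B: "module R B" and f: "f \<in> mod_hom R A B"
    and x: "x \<in> carrier (torsion_module R I A)"
  shows "f x \<in> carrier (torsion_module R I B)"
proof -
  interpret A: module R A by fact
  obtain k where k: "\<And>a. a \<in> ideal_power R I k \<Longrightarrow> a \<odot>\<^bsub>A\<^esub> x = \<zero>\<^bsub>A\<^esub>" and c: "x \<in> carrier A"
    using x by (auto simp: in_torsion_iff)
  have "a \<odot>\<^bsub>B\<^esub> f x = \<zero>\<^bsub>B\<^esub>" if a: "a \<in> ideal_power R I k" for a
    using k[OF a] mod_homD(3)[OF f ideal.Icarr[OF ideal_power_ideal[OF A.R.is_cring I] a] c]
      mod_hom_zero[OF A B f] by simp
  then show ?thesis using mod_homD(1)[OF f c] unfolding in_torsion_iff by auto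
qed

text \<open>The module \<open>N s\<close> varies with \<open>s\<close> because the family will
  consist of values in different degrees of a complex.\<close>

lemma torsion_finite:
  assumes I: "ideal I R" and R: "cring R" and "finite S"
    and "\<And>s. s \<in> S \<Longrightarrow> x s \<in> carrier (torsion_module R I (N s))"
  shows "\<exists>k. \<forall>s\<in>S. \<forall>a\<in>ideal_power R I k. a \<odot>\<^bsub>N s\<^esub> x s = \<zero>\<^bsub>N s\<^esub>"
  using assms(3,4)
proof (induction S)
  case empty
  then show ?case by simp
next
  case (insert s S)
  then obtain k where k: "\<forall>s\<in>S. \<forall>a\<in>ideal_power R I k. a \<odot>\<^bsub>N s\<^esub> x s = \<zero>\<^bsub>N s\<^esub>" by auto
  obtain l where l: "\<forall>a\<in>ideal_power R I l. a \<odot>\<^bsub>N s\<^esub> x s = \<zero>\<^bsub>N s\<^esub>"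
    using insert.prems[of s] by (auto simp: in_torsion_iff)
  have "ideal_power R I (max k l) \<subseteq> ideal_power R I k" "ideal_power R I (max k l) \<subseteq> ideal_power R I l"
    by (rule ideal_power_antimono[OF R I]; simp)+
  then show ?case using k l by (intro exI[of _ "max k l"]) blast
qed

lemma torsion_complex_simps [simp]:
  "obj (torsion_complex R I X) n = torsion_module R I (obj X n)"
  "dif (torsion_complex R I X) = dif X"
  by (simp_all add: torsion_complex_def)

lemma mod_hom_torsion:
  assumes "ideal I R" "module R A" "module R B" "f \<in> mod_hom R A B"
  shows "f \<in> mod_hom R (torsion_module R I A) (torsion_module R I B)"
proof (rule mod_homI)
  fix x assume "x \<in> carrier (torsion_module R I A)"
  then show "f x \<in> carrier (torsion_module R I B)" by (rule torsion_hom[OF assms])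
qed (use mod_homD[OF assms(4)] in \<open>auto simp: in_torsion_iff\<close>)

lemma cochain_complex_torsion:
  assumes "ideal I R" "cochain_complex R X"
  shows "cochain_complex R (torsion_complex R I X)"
  unfolding cochain_complex_def
proof (intro allI conjI ballI)
  note mX = cochain_complexD(1)[OF assms(2)]
  fix n
  show "module R (obj (torsion_complex R I X) n)" by (simp add: module_torsion[OF assms(1) mX])
  show "dif (torsion_complex R I X) n \<in> mod_hom R (obj (torsion_complex R I X) n) (obj (torsion_complex R I X) (n + 1))"
    by (simp add: mod_hom_torsion[OF assms(1) mX mX cochain_complexD(2)[OF assms(2)]])
  show "dif (torsion_complex R I X) (n + 1) (dif (torsion_complex R I X) n x) =
      \<zero>\<^bsub>obj (torsion_complex R I X) (n + 1 + 1)\<^esub>"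
    if "x \<in> carrier (obj (torsion_complex R I X) n)" for x
    using that cochain_complexD(4)[OF assms(2), of x n] by (simp add: in_torsion_iff add.assoc)
qed

lemma torsion_prod:
  assumes I: "ideal I R" and A: "module R A" and B: "module R B"
  shows "p \<in> carrier (torsion_module R I (prod_module A B)) \<longleftrightarrow>
    fst p \<in> carrier (torsion_module R I A) \<and> snd p \<in> carrier (torsion_module R I B)"
proof
  assume "p \<in> carrier (torsion_module R I (prod_module A B))"
  then show "fst p \<in> carrier (torsion_module R I A) \<and> snd p \<in> carrier (torsion_module R I B)"
    using torsion_hom[OF I module_prod[OF A B] A fst_hom] torsion_hom[OF I module_prod[OF A B] B snd_hom]
    by blast
next
  assume p: "fst p \<in> carrier (torsion_module R I A) \<and> snd p \<in> carrier (torsion_module R I B)"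
  interpret A: module R A by fact
  interpret B: module R B by fact
  interpret P: module R "prod_module A B" by (rule module_prod[OF A B])
  have c: "fst p \<in> carrier A" "snd p \<in> carrier B" using p by (auto simp: in_torsion_iff)
  have "(\<lambda>x. (x, \<zero>\<^bsub>B\<^esub>)) \<in> mod_hom R A (prod_module A B)"
    by (rule mod_hom_pair[OF mod_hom_id mod_hom_zero_map[OF B]])
  then have 1: "(fst p, \<zero>\<^bsub>B\<^esub>) \<in> carrier (torsion_module R I (prod_module A B))"
    using torsion_hom[OF I A P.module_axioms] p by blast
  have "(\<lambda>x. (\<zero>\<^bsub>A\<^esub>, x)) \<in> mod_hom R B (prod_module A B)"
    by (rule mod_hom_pair[OF mod_hom_zero_map[OF A] mod_hom_id])
  then have "(\<zero>\<^bsub>A\<^esub>, snd p) \<in> carrier (torsion_module R I (prod_module A B))"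
    using torsion_hom[OF I B P.module_axioms] p by blast
  from submoduleD(4)[OF P.module_axioms submodule_torsion[OF I P.module_axioms] 1 this]
  show "p \<in> carrier (torsion_module R I (prod_module A B))" using c by simp
qed

text \<open>Torsion is preserved by every homomorphism, hence by every homotopy. The cone of
  \<open>g\<close> is an exact bounded below complex of injectives, so its identity is
  null-homotopic; the contraction restricts to torsion elements and keeps their cone exact. Reading
  this off in the two components gives injectivity and surjectivity.\<close>

lemma torsion_quasi_iso:
  assumes I: "ideal I R" and qi: "elementwise_quasi_iso R J K g"
    and injJ: "\<And>n. injective_module R (obj J n)" and injK: "\<And>n. injective_module R (obj K n)"
    and bJ: "bounded_below J" and bK: "bounded_below K"
  shows "elementwise_quasi_iso R (torsion_complex R I J) (torsion_complex R I K) g"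
proof -
  have J: "cochain_complex R J" and K: "cochain_complex R K" and g: "chain_map R J K g"
    using qi by (auto simp: elementwise_quasi_iso_def)
  note mJ = cochain_complexD(1)[OF J] and mK = cochain_complexD(1)[OF K]
  note dJ = cochain_complexD(2)[OF J] and dK = cochain_complexD(2)[OF K]
  interpret MJ: module R "obj J n" for n by (rule mJ)
  interpret MK: module R "obj K n" for n by (rule mK)
  let ?C = "cone J K g"
  have C: "cochain_complex R ?C" by (rule cochain_complex_cone[OF J K g])
  obtain a b where ab: "\<And>n. n < a \<Longrightarrow> zero_module (obj J n)" "\<And>n. n < b \<Longrightarrow> zero_module (obj K n)"
    using bJ bK unfolding bounded_below_def by blast
  have "zero_module (obj ?C n)" if "n < min (a - 1) b" for n
    using ab(1)[of "n + 1"] ab(2)[of n] that by (simp add: zero_module_def)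
  then have "bounded_below ?C" unfolding bounded_below_def by blast
  moreover have "chain_map R ?C ?C (\<lambda>n p. p)" using mod_hom_id by (auto simp: chain_map_def)
  ultimately obtain s where s: "\<And>n. s n \<in> mod_hom R (obj ?C n) (obj ?C (n - 1))"
    and ds: "\<And>n p. p \<in> carrier (obj ?C n) \<Longrightarrow>
      p = dif ?C (n - 1) (s n p) \<oplus>\<^bsub>obj ?C n\<^esub> s (n + 1) (dif ?C n p)"
    using exact_injective_null_homotopy[OF C exact_cone[OF J K g qi] C, of "\<lambda>n p. p"] injective_prod[OF injJ injK]
    by force
  interpret MC: module R "obj ?C n" for n by (rule cochain_complexD(1)[OF C])
  \<comment> \<open>On a cocycle \<open>p\<close> of the cone the contraction gives
    \<open>p = d (s p)\<close>, and \<open>s p\<close> is torsion together with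
    \<open>p\<close>.\<close>
  have split: "\<exists>j k. j \<in> carrier (torsion_module R I (obj J n)) \<and> k \<in> carrier (torsion_module R I (obj K (n - 1))) \<and>
      p = dif ?C (n - 1) (j, k)"
    if p: "p \<in> carrier (torsion_module R I (obj ?C n))" and dp: "dif ?C n p = \<zero>\<^bsub>obj ?C (n + 1)\<^esub>" for n p
  proof -
    have pc: "p \<in> carrier (obj ?C n)" using p by (simp add: in_torsion_iff)
    have "s (n + 1) \<zero>\<^bsub>obj ?C (n + 1)\<^esub> = \<zero>\<^bsub>obj ?C n\<^esub>"
      using mod_hom_zero[OF MC.module_axioms MC.module_axioms s[of "n + 1"]] by simp
    then have "p = dif ?C (n - 1) (s n p) \<oplus>\<^bsub>obj ?C n\<^esub> \<zero>\<^bsub>obj ?C n\<^esub>" using ds[OF pc] unfolding dp by argo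
    also have "\<dots> = dif ?C (n - 1) (s n p)"
      using MC.M.r_zero[OF mod_homD(1)[OF cochain_complexD(6)[OF C] mod_homD(1)[OF s pc]]] .
    finally have e: "p = dif ?C (n - 1) (s n p)" .
    have "s n p \<in> carrier (torsion_module R I (obj ?C (n - 1)))"
      by (rule torsion_hom[OF I MC.module_axioms MC.module_axioms s p])
    then have "fst (s n p) \<in> carrier (torsion_module R I (obj J n))"
      "snd (s n p) \<in> carrier (torsion_module R I (obj K (n - 1)))"
      using torsion_prod[OF I mJ mK] by auto
    then show ?thesis using e by (intro exI[of _ "fst (s n p)"] exI[of _ "snd (s n p)"]) simp
  qed
  show ?thesis
    unfolding elementwise_quasi_iso_def
  proof (intro conjI cochain_complex_torsion I J K allI ballI impI)
    show "chain_map R (torsion_complex R I J) (torsion_complex R I K) g"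
      using mod_hom_torsion[OF I mJ mK chain_mapD(1)[OF g]] chain_mapD(2)[OF g]
      by (auto simp: chain_map_def in_torsion_iff)
  next
    fix n y assume y: "y \<in> cocycles (torsion_complex R I J) n"
      and gy: "g n y \<in> coboundaries (torsion_complex R I K) n"
    have yt: "y \<in> carrier (torsion_module R I (obj J n))" and dy: "dif J n y = \<zero>\<^bsub>obj J (n + 1)\<^esub>"
      and yc: "y \<in> carrier (obj J n)"
      using y by (auto simp: cocycles_def in_torsion_iff)
    obtain z where zt: "z \<in> carrier (torsion_module R I (obj K (n - 1)))" and z: "g n y = dif K (n - 1) z"
      using gy by (auto simp: coboundaries_def)
    then have zc: "z \<in> carrier (obj K (n - 1))" by (simp add: in_torsion_iff)
    have dzc: "dif K (n - 1) z \<in> carrier (obj K n)" by (rule mod_homD(1)[OF cochain_complexD(6)[OF K] zc])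
    \<comment> \<open>A primitive \<open>z\<close> of \<open>g n y\<close> makes this pair a cocycle
      of the cone in degree \<open>n - 1\<close>.\<close>
    let ?p = "(y, \<ominus>\<^bsub>obj K (n - 1)\<^esub> z)"
    have "?p \<in> carrier (torsion_module R I (obj ?C (n - 1)))"
      using torsion_prod[OF I mJ mK, of ?p n "n - 1"] yt
        submoduleD(6)[OF mK submodule_torsion[OF I mK] zt] by simp
    moreover have "dif ?C (n - 1) ?p = \<zero>\<^bsub>obj ?C (n - 1 + 1)\<^esub>"
      using dy mod_hom_minus[OF mK mK cochain_complexD(6)[OF K] zc] dzc z
      by (simp add: MK.M.r_neg add.commute[of 1])
    ultimately obtain j k where j: "j \<in> carrier (torsion_module R I (obj J (n - 1)))"
      and e: "?p = dif ?C (n - 1 - 1) (j, k)" using split[of ?p "n - 1"] by blast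
    have "y = \<ominus>\<^bsub>obj J n\<^esub> dif J (n - 1) j" using e by simp
    also have "\<dots> = dif J (n - 1) (\<ominus>\<^bsub>obj J (n - 1)\<^esub> j)"
      using mod_hom_minus[OF mJ mJ cochain_complexD(6)[OF J]] j by (simp add: in_torsion_iff)
    finally show "y \<in> coboundaries (torsion_complex R I J) n"
      using submoduleD(6)[OF mJ submodule_torsion[OF I mJ] j] by (auto simp: coboundaries_def)
  next
    fix n z assume z: "z \<in> cocycles (torsion_complex R I K) n"
    have zt: "z \<in> carrier (torsion_module R I (obj K n))" and dz: "dif K n z = \<zero>\<^bsub>obj K (n + 1)\<^esub>"
      and zc: "z \<in> carrier (obj K n)"
      using z by (auto simp: cocycles_def in_torsion_iff)
    let ?p = "(\<zero>\<^bsub>obj J (n + 1)\<^esub>, z)"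
    have "?p \<in> carrier (torsion_module R I (obj ?C n))"
      using torsion_prod[OF I mJ mK, of ?p "n + 1" n] zt submoduleD(3)[OF mJ submodule_torsion[OF I mJ]] by simp
    moreover have "dif ?C n ?p = \<zero>\<^bsub>obj ?C (n + 1)\<^esub>"
      using dz mod_hom_zero[OF mJ mJ dJ, of "n + 1"] mod_hom_zero[OF mJ mK chain_mapD(1)[OF g]]
      by (simp add: add.assoc)
    ultimately obtain j k where j: "j \<in> carrier (torsion_module R I (obj J n))"
      and k: "k \<in> carrier (torsion_module R I (obj K (n - 1)))"
      and e: "?p = dif ?C (n - 1) (j, k)" using split[of ?p n] by blast
    have jc: "j \<in> carrier (obj J n)" and kc: "k \<in> carrier (obj K (n - 1))"
      using j k by (auto simp: in_torsion_iff)
    have "\<ominus>\<^bsub>obj J (n + 1)\<^esub> dif J n j = \<zero>\<^bsub>obj J (n + 1)\<^esub>" using e by (simp add: add.commute[of 1])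
    then have "dif J n j = \<zero>\<^bsub>obj J (n + 1)\<^esub>"
      using MJ.M.minus_minus[OF mod_homD(1)[OF dJ jc]] by simp
    then have "j \<in> cocycles (torsion_complex R I J) n" using j by (simp add: cocycles_def)
    moreover have "z \<ominus>\<^bsub>torsion_module R I (obj K n)\<^esub> g n j = dif K (n - 1) k"
    proof -
      have gj: "g n j \<in> carrier (torsion_module R I (obj K n))"
        by (rule torsion_hom[OF I mJ mK chain_mapD(1)[OF g] j])
      then have 1: "z \<ominus>\<^bsub>torsion_module R I (obj K n)\<^esub> g n j = z \<ominus>\<^bsub>obj K n\<^esub> g n j"
        using minus_sub'[OF mK submodule_torsion[OF I mK] zt gj] torsion_module_eq by metis
      have "z = dif K (n - 1) k \<oplus>\<^bsub>obj K n\<^esub> g n j"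
        using e mod_homD(1)[OF cochain_complexD(6)[OF K] kc] gj by (simp add: MK.M.a_comm in_torsion_iff)
      then have "z \<ominus>\<^bsub>obj K n\<^esub> g n j = dif K (n - 1) k"
        using mod_homD(1)[OF cochain_complexD(6)[OF K] kc] gj
        by (metis MK.M.add_diff_cancel in_torsion_iff)
      with 1 show ?thesis by (rule trans)
    qed
    ultimately show "\<exists>j\<in>cocycles (torsion_complex R I J) n.
        z \<ominus>\<^bsub>obj (torsion_complex R I K) n\<^esub> g n j \<in> coboundaries (torsion_complex R I K) n"
      using k by (auto simp: coboundaries_def)
  qed
qed

section \<open>The total Hom complex of a free resolution\<close>

locale finite_free_resolution =
  fixes R :: "('a, 'r) ring_scheme" and M :: "('a, 'm) module" and rk :: "nat \<Rightarrow> nat"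
    and \<delta> :: "nat \<Rightarrow> (nat \<Rightarrow> 'a) \<Rightarrow> (nat \<Rightarrow> 'a)" and \<epsilon> :: "(nat \<Rightarrow> 'a) \<Rightarrow> 'm"
  assumes R: "cring R" and M: "module R M"
    and aug: "\<epsilon> \<in> mod_hom R (free_module R {..<rk 0}) M"
    and aug_surj: "\<epsilon> ` carrier (free_module R {..<rk 0}) = carrier M"
    and bd: "\<delta> i \<in> mod_hom R (free_module R {..<rk (Suc i)}) (free_module R {..<rk i})"
    and exact_0: "\<delta> 0 ` carrier (free_module R {..<rk 1}) =
      {x \<in> carrier (free_module R {..<rk 0}). \<epsilon> x = \<zero>\<^bsub>M\<^esub>}"
    and exact_Suc: "\<delta> (Suc i) ` carrier (free_module R {..<rk (Suc (Suc i))}) =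
      {x \<in> carrier (free_module R {..<rk (Suc i)}). \<delta> i x = \<zero>\<^bsub>free_module R {..<rk i}\<^esub>}"
begin

abbreviation "F i \<equiv> free_module R {..<rk i}"

lemma F: "module R (F i)" by (rule module_free_module[OF R])

sublocale R: cring R by (rule R)
sublocale F: module R "F i" for i by (rule F)

lemma projective_F: "projective_module R (F i)" by (rule projective_free_module[OF R])

lemma bdc: "x \<in> carrier (F (Suc i)) \<Longrightarrow> \<delta> i x \<in> carrier (F i)"
  by (rule mod_homD(1)[OF bd])

lemma bd_bd: "x \<in> carrier (F (Suc (Suc i))) \<Longrightarrow> \<delta> i (\<delta> (Suc i) x) = \<zero>\<^bsub>F i\<^esub>"
  using exact_Suc by blast

lemma aug_bd: "x \<in> carrier (F 1) \<Longrightarrow> \<epsilon> (\<delta> 0 x) = \<zero>\<^bsub>M\<^esub>"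
  using exact_0 by blast

definition \<sigma> :: "nat \<Rightarrow> 'a" where "\<sigma> i = (if even i then \<one>\<^bsub>R\<^esub> else \<ominus>\<^bsub>R\<^esub> \<one>\<^bsub>R\<^esub>)"

lemma \<sigma> [simp]: "\<sigma> i \<in> carrier R" by (simp add: \<sigma>_def)

lemma \<sigma>_0 [simp]: "\<sigma> 0 = \<one>\<^bsub>R\<^esub>" by (simp add: \<sigma>_def)

lemma \<sigma>_Suc:
  assumes "module R N" "y \<in> carrier N" shows "\<sigma> (Suc i) \<odot>\<^bsub>N\<^esub> y = \<ominus>\<^bsub>N\<^esub> (\<sigma> i \<odot>\<^bsub>N\<^esub> y)"
proof -
  interpret N: module R N by fact
  show ?thesis using assms(2) by (simp add: \<sigma>_def N.smult_l_minus)
qed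

lemma \<sigma>_\<sigma>:
  assumes "module R N" "y \<in> carrier N" shows "\<sigma> i \<odot>\<^bsub>N\<^esub> (\<sigma> i \<odot>\<^bsub>N\<^esub> y) = y"
proof -
  interpret N: module R N by fact
  show ?thesis using assms(2) by (simp add: \<sigma>_def N.smult_l_minus N.smult_r_minus)
qed

text \<open>The sign \<open>\<sigma> i\<close> makes the differentials of \<open>F\<close> and \<open>D\<close> anticommute.\<close>

definition tot :: "('a, 'd) cochain \<Rightarrow> ('a, nat \<Rightarrow> (nat \<Rightarrow> 'a) \<Rightarrow> 'd) cochain"
  where "tot D =
    \<lparr>obj = (\<lambda>n. Pi_module (\<lambda>i. Hom_module R (F i) (obj D (n - int i)))),
     dif = (\<lambda>n f i. \<lambda>x\<in>carrier (F i).
       \<sigma> i \<odot>\<^bsub>obj D (n + 1 - int i)\<^esub> dif D (n - int i) (f i x) \<oplus>\<^bsub>obj D (n + 1 - int i)\<^esub>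
       (case i of 0 \<Rightarrow> \<zero>\<^bsub>obj D (n + 1)\<^esub> | Suc j \<Rightarrow> f j (\<delta> j x)))\<rparr>"

lemma obj_tot: "obj (tot D) n = Pi_module (\<lambda>i. Hom_module R (F i) (obj D (n - int i)))"
  by (simp add: tot_def)

lemma tot_carrier_iff: "f \<in> carrier (obj (tot D) n) \<longleftrightarrow>
    (\<forall>i. f i \<in> mod_hom R (F i) (obj D (n - int i)) \<and> f i \<in> extensional (carrier (F i)))"
  by (simp add: obj_tot)

lemma tot_hom: "f \<in> carrier (obj (tot D) n) \<Longrightarrow> f i \<in> mod_hom R (F i) (obj D (n - int i))"
  by (simp add: tot_carrier_iff)

lemma tot_val: "f \<in> carrier (obj (tot D) n) \<Longrightarrow> x \<in> carrier (F i) \<Longrightarrow> f i x \<in> carrier (obj D (n - int i))"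
  by (rule mod_homD(1)[OF tot_hom])

lemma tot_eqI:
  assumes "f \<in> carrier (obj (tot D) n)" "g \<in> carrier (obj (tot D) n)"
    and "\<And>i x. x \<in> carrier (F i) \<Longrightarrow> f i x = g i x"
  shows "f = g"
  by (rule ext, rule extensionalityI[of _ "carrier (F _)"]) (use assms in \<open>auto simp: tot_carrier_iff\<close>)

lemma tot_restrict:
  assumes "\<And>i. h i \<in> mod_hom R (F i) (obj D (n - int i))"
  shows "(\<lambda>i. restrict (h i) (carrier (F i))) \<in> carrier (obj (tot D) n)"
  using restrict_hom[OF F assms] by (simp add: tot_carrier_iff)

lemma tot_ops:
  "\<zero>\<^bsub>obj (tot D) n\<^esub> = (\<lambda>i. \<lambda>x\<in>carrier (F i). \<zero>\<^bsub>obj D (n - int i)\<^esub>)"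
  "f \<oplus>\<^bsub>obj (tot D) n\<^esub> g = (\<lambda>i. \<lambda>x\<in>carrier (F i). f i x \<oplus>\<^bsub>obj D (n - int i)\<^esub> g i x)"
  "r \<odot>\<^bsub>obj (tot D) n\<^esub> f = (\<lambda>i. \<lambda>x\<in>carrier (F i). r \<odot>\<^bsub>obj D (n - int i)\<^esub> f i x)"
  by (simp_all add: obj_tot)

lemma idx: "n - int (Suc j) + 1 = n - int j" "n + 1 - int (Suc j) = n - int j"
  "n + 2 - int (Suc j) = n + 1 - int j" by simp_all

context
  fixes D :: "('a, 'd) cochain"
  assumes D: "cochain_complex R D"
begin

lemma mD: "module R (obj D n)" by (rule cochain_complexD(1)[OF D])

interpretation D: module R "obj D n" for n by (rule mD)

lemma dD: "dif D n \<in> mod_hom R (obj D n) (obj D (n + 1))"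
  by (rule cochain_complexD(2)[OF D])

lemma dDc: "x \<in> carrier (obj D n) \<Longrightarrow> dif D n x \<in> carrier (obj D (n + 1))"
  by (rule mod_homD(1)[OF dD])

lemma dD': "dif D (n - int i) \<in> mod_hom R (obj D (n - int i)) (obj D (n + 1 - int i))"
  using dD[of "n - int i"] by (simp add: algebra_simps)

lemma dDc': "x \<in> carrier (obj D (n - int i)) \<Longrightarrow> dif D (n - int i) x \<in> carrier (obj D (n + 1 - int i))"
  by (rule mod_homD(1)[OF dD'])

lemma dDc_Suc: "x \<in> carrier (obj D (n - int (Suc j))) \<Longrightarrow> dif D (n - int (Suc j)) x \<in> carrier (obj D (n - int j))"
  using dDc'[of x n "Suc j"] by simp

lemma dif_tot_0:
  assumes "f \<in> carrier (obj (tot D) n)" "x \<in> carrier (F 0)"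
  shows "dif (tot D) n f 0 x = dif D n (f 0 x)"
  using tot_val[OF assms] assms(2) dDc[of "f 0 x" n] by (simp add: tot_def)

lemma dif_tot_Suc:
  assumes "x \<in> carrier (F (Suc j))"
  shows "dif (tot D) n f (Suc j) x =
    \<sigma> (Suc j) \<odot>\<^bsub>obj D (n - int j)\<^esub> dif D (n - int (Suc j)) (f (Suc j) x) \<oplus>\<^bsub>obj D (n - int j)\<^esub> f j (\<delta> j x)"
  using assms by (simp add: tot_def)

lemma dif_tot_hom:
  assumes f: "f \<in> carrier (obj (tot D) n)"
  shows "dif (tot D) n f \<in> carrier (obj (tot D) (n + 1))"
proof -
  let ?g = "\<lambda>i x. \<sigma> i \<odot>\<^bsub>obj D (n + 1 - int i)\<^esub> dif D (n - int i) (f i x) \<oplus>\<^bsub>obj D (n + 1 - int i)\<^esub>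
       (case i of 0 \<Rightarrow> \<zero>\<^bsub>obj D (n + 1)\<^esub> | Suc j \<Rightarrow> f j (\<delta> j x))"
  have "?g i \<in> mod_hom R (F i) (obj D (n + 1 - int i))" for i
  proof (intro mod_hom_plus[OF mD] mod_hom_smult[OF mD] mod_hom_comp[OF tot_hom[OF f] dD'] \<sigma>)
    show "(\<lambda>x. case i of 0 \<Rightarrow> \<zero>\<^bsub>obj D (n + 1)\<^esub> | Suc j \<Rightarrow> f j (\<delta> j x)) \<in> mod_hom R (F i) (obj D (n + 1 - int i))"
    proof (cases i)
      case 0
      then show ?thesis using mod_hom_zero_map[OF mD] by simp
    next
      case (Suc j)
      then show ?thesis using mod_hom_comp[OF bd tot_hom[OF f, of j]] by simp
    qed
  qed
  from tot_restrict[of ?g, OF this] show ?thesis by (simp add: tot_def)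
qed

text \<open>On boundaries of the resolution only the part of the differential that comes from
  \<open>D\<close> survives, since \<open>\<delta> \<delta> = 0\<close>.\<close>

lemma dif_tot_bd:
  assumes f: "f \<in> carrier (obj (tot D) n)" and x: "x \<in> carrier (F (Suc j))"
  shows "dif (tot D) n f j (\<delta> j x) = \<sigma> j \<odot>\<^bsub>obj D (n + 1 - int j)\<^esub> dif D (n - int j) (f j (\<delta> j x))"
proof (cases j)
  case 0
  then show ?thesis using dif_tot_0[OF f] bdc[OF x] tot_val[OF f bdc[OF x]] dDc'[of _ n 0] by simp
next
  case (Suc k)
  have "f k (\<delta> k (\<delta> (Suc k) x)) = \<zero>\<^bsub>obj D (n - int k)\<^esub>"
    using bd_bd[of x k] x Suc mod_hom_zero[OF F mD tot_hom[OF f]] by simp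
  then show ?thesis
    using dif_tot_Suc[OF bdc[OF x, unfolded Suc], of n f] Suc dDc_Suc[OF tot_val[OF f bdc[OF x, unfolded Suc]]]
    by simp
qed

text \<open>In index \<open>Suc j\<close> the terms with \<open>d d\<close> and
  \<open>\<delta> \<delta>\<close> vanish, and the differential of \<open>f j (\<delta> j x)\<close>
  occurs twice, with the opposite signs \<open>\<sigma> (Suc j)\<close> and
  \<open>\<sigma> j\<close>.\<close>

lemma dif_dif_tot:
  assumes f: "f \<in> carrier (obj (tot D) n)"
  shows "dif (tot D) (n + 1) (dif (tot D) n f) = \<zero>\<^bsub>obj (tot D) (n + 2)\<^esub>"
proof (rule tot_eqI[of _ D "n + 2"])
  have c: "dif (tot D) n f \<in> carrier (obj (tot D) (n + 1))" by (rule dif_tot_hom[OF f])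
  show "dif (tot D) (n + 1) (dif (tot D) n f) \<in> carrier (obj (tot D) (n + 2))"
    using dif_tot_hom[OF c] by (simp add: add.assoc)
  show "\<zero>\<^bsub>obj (tot D) (n + 2)\<^esub> \<in> carrier (obj (tot D) (n + 2))"
    unfolding tot_ops by (rule tot_restrict[OF mod_hom_zero_map[OF mD]])
  fix i x assume x: "x \<in> carrier (F i)"
  show "dif (tot D) (n + 1) (dif (tot D) n f) i x = \<zero>\<^bsub>obj (tot D) (n + 2)\<^esub> i x"
  proof (cases i)
    case 0
    then show ?thesis
      using x dif_tot_0[OF c, of x] dif_tot_0[OF f, of x] cochain_complexD(4)[OF D tot_val[OF f, of x 0]]
      by (simp add: tot_ops)
  next
    case (Suc j)
    let ?N = "obj D (n + 1 - int j)" and ?y = "f j (\<delta> j x)" and ?z = "f (Suc j) x"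
    have xs: "x \<in> carrier (F (Suc j))" using x Suc by simp
    have z: "?z \<in> carrier (obj D (n - int (Suc j)))" by (rule tot_val[OF f xs])
    have y: "?y \<in> carrier (obj D (n - int j))" by (rule tot_val[OF f bdc[OF xs]])
    have dz: "dif D (n - int (Suc j)) ?z \<in> carrier (obj D (n - int j))" by (rule dDc_Suc[OF z])
    have ddz: "dif D (n - int j) (dif D (n - int (Suc j)) ?z) = \<zero>\<^bsub>?N\<^esub>"
      using cochain_complexD(4)[OF D z] by (simp add: algebra_simps)
    have dy: "dif D (n - int j) ?y \<in> carrier ?N" by (rule dDc'[OF y])
    have "dif D (n - int j) (dif (tot D) n f (Suc j) x)
        = \<sigma> (Suc j) \<odot>\<^bsub>?N\<^esub> \<zero>\<^bsub>?N\<^esub> \<oplus>\<^bsub>?N\<^esub> dif D (n - int j) ?y"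
      unfolding dif_tot_Suc[OF xs] using mod_homD(2)[OF dD' D.smult_closed[OF \<sigma> dz] y]
        mod_homD(3)[OF dD' \<sigma> dz] ddz by simp
    then have 1: "dif D (n - int j) (dif (tot D) n f (Suc j) x) = dif D (n - int j) ?y" using dy by simp
    have "dif (tot D) (n + 1) (dif (tot D) n f) (Suc j) x =
      \<sigma> (Suc j) \<odot>\<^bsub>?N\<^esub> dif D (n - int j) (dif (tot D) n f (Suc j) x) \<oplus>\<^bsub>?N\<^esub> dif (tot D) n f j (\<delta> j x)"
      using dif_tot_Suc[OF xs, of "n + 1" "dif (tot D) n f"] by simp
    also have "\<dots> = \<zero>\<^bsub>?N\<^esub>"
      unfolding 1 dif_tot_bd[OF f xs] using dy by (simp add: \<sigma>_Suc[OF mD] D.M.l_neg)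
    finally show ?thesis using xs unfolding Suc tot_ops idx by (simp del: of_nat_Suc)
  qed
qed

lemma cochain_complex_tot: "cochain_complex R (tot D)"
  unfolding cochain_complex_def
proof (intro allI conjI ballI)
  fix n
  have m: "module R (obj (tot D) n)" for n
    unfolding obj_tot by (intro module_Pi[OF R] module_Hom[OF F mD])
  then show "module R (obj (tot D) n)" .
  interpret T: module R "obj (tot D) n" for n by (rule m)
  show "dif (tot D) (n + 1) (dif (tot D) n f) = \<zero>\<^bsub>obj (tot D) (n + 1 + 1)\<^esub>"
    if "f \<in> carrier (obj (tot D) n)" for f
    using dif_dif_tot[OF that] by (simp add: add.assoc)
  show "dif (tot D) n \<in> mod_hom R (obj (tot D) n) (obj (tot D) (n + 1))"
  proof (rule mod_homI)
    show "dif (tot D) n f \<in> carrier (obj (tot D) (n + 1))" if "f \<in> carrier (obj (tot D) n)" for f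
      by (rule dif_tot_hom[OF that])
    show "dif (tot D) n (f \<oplus>\<^bsub>obj (tot D) n\<^esub> g) = dif (tot D) n f \<oplus>\<^bsub>obj (tot D) (n + 1)\<^esub> dif (tot D) n g"
      if f: "f \<in> carrier (obj (tot D) n)" and g: "g \<in> carrier (obj (tot D) n)" for f g
    proof (rule tot_eqI)
      note fg = T.M.a_closed[OF f g]
      show "dif (tot D) n (f \<oplus>\<^bsub>obj (tot D) n\<^esub> g) \<in> carrier (obj (tot D) (n + 1))" by (rule dif_tot_hom[OF fg])
      show "dif (tot D) n f \<oplus>\<^bsub>obj (tot D) (n + 1)\<^esub> dif (tot D) n g \<in> carrier (obj (tot D) (n + 1))"
        by (intro T.M.a_closed dif_tot_hom f g)
      fix i x assume x: "x \<in> carrier (F i)"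
      note fx = tot_val[OF f x] and gx = tot_val[OF g x]
      have 1: "dif D (n - int i) ((f \<oplus>\<^bsub>obj (tot D) n\<^esub> g) i x) =
          dif D (n - int i) (f i x) \<oplus>\<^bsub>obj D (n + 1 - int i)\<^esub> dif D (n - int i) (g i x)"
        using mod_homD(2)[OF dD' fx gx] x by (simp add: tot_ops)
      show "dif (tot D) n (f \<oplus>\<^bsub>obj (tot D) n\<^esub> g) i x =
          (dif (tot D) n f \<oplus>\<^bsub>obj (tot D) (n + 1)\<^esub> dif (tot D) n g) i x"
      proof (cases i)
        case 0
        then show ?thesis
          using x 1 dif_tot_0[OF f, of x] dif_tot_0[OF g, of x] dif_tot_0[OF fg, of x] by (simp add: tot_ops(2)[of D "n + 1"])
      next
        case (Suc j)
        have xs: "x \<in> carrier (F (Suc j))" using x Suc by simp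
        have c: "dif D (n - int (Suc j)) (f (Suc j) x) \<in> carrier (obj D (n - int j))"
          "dif D (n - int (Suc j)) (g (Suc j) x) \<in> carrier (obj D (n - int j))"
          "f j (\<delta> j x) \<in> carrier (obj D (n - int j))" "g j (\<delta> j x) \<in> carrier (obj D (n - int j))"
          by (intro dDc_Suc tot_val[OF f] tot_val[OF g] xs bdc)+
        have "dif D (n - int (Suc j)) ((f \<oplus>\<^bsub>obj (tot D) n\<^esub> g) (Suc j) x) =
          dif D (n - int (Suc j)) (f (Suc j) x) \<oplus>\<^bsub>obj D (n - int j)\<^esub> dif D (n - int (Suc j)) (g (Suc j) x)"
          using 1 unfolding Suc idx .
        moreover have "(f \<oplus>\<^bsub>obj (tot D) n\<^esub> g) j (\<delta> j x) = f j (\<delta> j x) \<oplus>\<^bsub>obj D (n - int j)\<^esub> g j (\<delta> j x)"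
          using bdc[OF xs] by (simp add: tot_ops)
        ultimately show ?thesis
          using xs c unfolding Suc tot_ops(2)[of D "n + 1"] idx
          by (simp add: dif_tot_Suc D.smult_r_distr D.M.a_ac del: of_nat_Suc)
      qed
    qed
    show "dif (tot D) n (r \<odot>\<^bsub>obj (tot D) n\<^esub> f) = r \<odot>\<^bsub>obj (tot D) (n + 1)\<^esub> dif (tot D) n f"
      if r: "r \<in> carrier R" and f: "f \<in> carrier (obj (tot D) n)" for r f
    proof (rule tot_eqI)
      note rf = T.smult_closed[OF r f]
      show "dif (tot D) n (r \<odot>\<^bsub>obj (tot D) n\<^esub> f) \<in> carrier (obj (tot D) (n + 1))" by (rule dif_tot_hom[OF rf])
      show "r \<odot>\<^bsub>obj (tot D) (n + 1)\<^esub> dif (tot D) n f \<in> carrier (obj (tot D) (n + 1))"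
        by (intro T.smult_closed dif_tot_hom f r)
      fix i x assume x: "x \<in> carrier (F i)"
      note fx = tot_val[OF f x]
      have 1: "dif D (n - int i) ((r \<odot>\<^bsub>obj (tot D) n\<^esub> f) i x) =
          r \<odot>\<^bsub>obj D (n + 1 - int i)\<^esub> dif D (n - int i) (f i x)"
        using mod_homD(3)[OF dD' r fx] x by (simp add: tot_ops)
      show "dif (tot D) n (r \<odot>\<^bsub>obj (tot D) n\<^esub> f) i x = (r \<odot>\<^bsub>obj (tot D) (n + 1)\<^esub> dif (tot D) n f) i x"
      proof (cases i)
        case 0
        then show ?thesis
          using x 1 dif_tot_0[OF f, of x] dif_tot_0[OF rf, of x] by (simp add: tot_ops(3)[of D "n + 1"])
      next
        case (Suc j)
        have xs: "x \<in> carrier (F (Suc j))" using x Suc by simp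
        have c: "dif D (n - int (Suc j)) (f (Suc j) x) \<in> carrier (obj D (n - int j))"
          "f j (\<delta> j x) \<in> carrier (obj D (n - int j))"
          by (intro dDc_Suc tot_val[OF f] xs bdc)+
        have comm: "\<sigma> (Suc j) \<odot>\<^bsub>obj D (n - int j)\<^esub> (r \<odot>\<^bsub>obj D (n - int j)\<^esub> y) =
            r \<odot>\<^bsub>obj D (n - int j)\<^esub> (\<sigma> (Suc j) \<odot>\<^bsub>obj D (n - int j)\<^esub> y)" if "y \<in> carrier (obj D (n - int j))" for y
          using that r by (metis D.smult_assoc1 R.m_comm \<sigma>)
        have "dif D (n - int (Suc j)) ((r \<odot>\<^bsub>obj (tot D) n\<^esub> f) (Suc j) x) =
          r \<odot>\<^bsub>obj D (n - int j)\<^esub> dif D (n - int (Suc j)) (f (Suc j) x)"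
          using 1 unfolding Suc idx .
        moreover have "(r \<odot>\<^bsub>obj (tot D) n\<^esub> f) j (\<delta> j x) = r \<odot>\<^bsub>obj D (n - int j)\<^esub> f j (\<delta> j x)"
          using bdc[OF xs] by (simp add: tot_ops)
        ultimately show ?thesis
          using xs c r unfolding Suc tot_ops(3)[of D "n + 1"] idx
          by (simp add: dif_tot_Suc D.smult_r_distr comm del: of_nat_Suc)
      qed
    qed
  qed
qed

end

end

section \<open>Injectivity, torsion and exactness of the total complex\<close>

context finite_free_resolution
begin

lemma injective_tot:
  assumes "\<And>n. injective_module R (obj D n)" shows "injective_module R (obj (tot D) n)"
  unfolding obj_tot by (intro injective_Pi[OF R] injective_Hom_free[OF R] assms)

text \<open>The factors in degree \<open>n\<close> take values in degrees
  \<open>n - i \<le> n\<close> of \<open>D\<close>, so a lower bound of \<open>D\<close> is one of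
  the total complex.\<close>

lemma tot_zero:
  assumes D: "cochain_complex R D" and a: "\<And>k. k < a \<Longrightarrow> zero_module (obj D k)" and n: "n < a"
  shows "zero_module (obj (tot D) n)"
proof -
  interpret T: module R "obj (tot D) n" by (rule cochain_complexD(1)[OF cochain_complex_tot[OF D]])
  have "f = \<zero>\<^bsub>obj (tot D) n\<^esub>" if f: "f \<in> carrier (obj (tot D) n)" for f
  proof (rule tot_eqI[OF f T.M.zero_closed])
    fix i x assume x: "x \<in> carrier (F i)"
    have "f i x = \<zero>\<^bsub>obj D (n - int i)\<^esub>" using tot_val[OF f x] a[of "n - int i"] n by (simp add: zero_module_def)
    then show "f i x = \<zero>\<^bsub>obj (tot D) n\<^esub> i x" using x by (simp add: tot_ops)
  qed
  then show ?thesis unfolding zero_module_def using T.M.zero_closed by blast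
qed

text \<open>An element of the product is torsion only if one power of the ideal kills all its
  components at once. Components with values below the bound \<open>a\<close> vanish, and each of
  the finitely many others is determined by its values at finitely many unit vectors, so a common
  exponent exists. The operations on both sides are shared, hence an equality of complexes and not
  only an isomorphism.\<close>

lemma torsion_tot:
  assumes D: "cochain_complex R D" and bb: "bounded_below D" and I: "ideal I R"
  shows "torsion_complex R I (tot D) = tot (torsion_complex R I D)"
proof -
  interpret D: module R "obj D n" for n by (rule cochain_complexD(1)[OF D])
  note mD = cochain_complexD(1)[OF D]
  note mT = cochain_complexD(1)[OF cochain_complex_tot[OF D]]
  obtain a where a: "\<And>k. k < a \<Longrightarrow> carrier (obj D k) = {\<zero>\<^bsub>obj D k\<^esub>}"
    using bb unfolding bounded_below_def zero_module_def by blast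
  have car: "carrier (torsion_module R I (obj (tot D) n)) = carrier (obj (tot (torsion_complex R I D)) n)" for n
  proof (intro equalityI subsetI)
    fix f assume "f \<in> carrier (torsion_module R I (obj (tot D) n))"
    then obtain k where f: "f \<in> carrier (obj (tot D) n)"
      and k: "\<And>b. b \<in> ideal_power R I k \<Longrightarrow> b \<odot>\<^bsub>obj (tot D) n\<^esub> f = \<zero>\<^bsub>obj (tot D) n\<^esub>"
      by (auto simp: in_torsion_iff)
    have "f i x \<in> carrier (torsion_module R I (obj D (n - int i)))" if x: "x \<in> carrier (F i)" for i x
    proof -
      have "b \<odot>\<^bsub>obj D (n - int i)\<^esub> f i x = \<zero>\<^bsub>obj D (n - int i)\<^esub>" if "b \<in> ideal_power R I k" for b
        using fun_cong[OF fun_cong[OF k[OF that], of i], of x] x by (simp add: tot_ops)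
      then show ?thesis using tot_val[OF f x] by (auto simp: in_torsion_iff)
    qed
    then have "f i \<in> mod_hom R (F i) (torsion_module R I (obj D (n - int i)))" for i
      using tot_hom[OF f] by (subst torsion_module_eq) (auto intro: mod_hom_sub_cod)
    then show "f \<in> carrier (obj (tot (torsion_complex R I D)) n)"
      using f by (simp add: tot_carrier_iff)
  next
    fix f assume f: "f \<in> carrier (obj (tot (torsion_complex R I D)) n)"
    have ft: "f i x \<in> carrier (torsion_module R I (obj D (n - int i)))" if "x \<in> carrier (F i)" for i x
      using tot_val[OF f that] by simp
    have fc: "f \<in> carrier (obj (tot D) n)"
      unfolding tot_carrier_iff
    proof (intro allI conjI)
      fix i
      show "f i \<in> mod_hom R (F i) (obj D (n - int i))"
        using tot_hom[OF f, of i]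
        by (auto simp: mod_hom_def in_torsion_iff)
      show "f i \<in> extensional (carrier (F i))" using f by (simp add: tot_carrier_iff)
    qed
    \<comment> \<open>For \<open>n < a\<close> the truncation by \<open>nat\<close> leaves the index
      \<open>0\<close> in the set, which is harmless.\<close>
    define S where "S = (SIGMA i:{..nat (n - a)}. {..<rk i})"
    have "finite S" by (simp add: S_def)
    have "\<exists>k. \<forall>p\<in>S. \<forall>b\<in>ideal_power R I k.
        b \<odot>\<^bsub>obj D (n - int (fst p))\<^esub> f (fst p) (unit_vec R {..<rk (fst p)} (snd p)) = \<zero>\<^bsub>obj D (n - int (fst p))\<^esub>"
      by (rule torsion_finite[OF I R \<open>finite S\<close>]) (rule ft[OF unit_vec_closed[OF R]])
    then obtain k where k: "\<forall>p\<in>S. \<forall>b\<in>ideal_power R I k.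
        b \<odot>\<^bsub>obj D (n - int (fst p))\<^esub> f (fst p) (unit_vec R {..<rk (fst p)} (snd p)) = \<zero>\<^bsub>obj D (n - int (fst p))\<^esub>" ..
    have "b \<odot>\<^bsub>obj (tot D) n\<^esub> f = \<zero>\<^bsub>obj (tot D) n\<^esub>" if b: "b \<in> ideal_power R I k" for b
    proof (rule tot_eqI)
      interpret T: module R "obj (tot D) n" by (rule mT)
      have bR: "b \<in> carrier R" using ideal.Icarr[OF ideal_power_ideal[OF R I] b] .
      show "b \<odot>\<^bsub>obj (tot D) n\<^esub> f \<in> carrier (obj (tot D) n)" using fc bR by blast
      show "\<zero>\<^bsub>obj (tot D) n\<^esub> \<in> carrier (obj (tot D) n)" by simp
      fix i x assume x: "x \<in> carrier (F i)"
      have "b \<odot>\<^bsub>obj D (n - int i)\<^esub> f i x = \<zero>\<^bsub>obj D (n - int i)\<^esub>"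
      proof (cases "n - int i < a")
        case True
        then show ?thesis using a[of "n - int i"] D.smult_closed[OF bR tot_val[OF fc x]] by auto
      next
        case False
        then have "i \<le> nat (n - a)" by linarith
        have "b \<odot>\<^bsub>obj D (n - int i)\<^esub> f i (unit_vec R {..<rk i} s) = \<zero>\<^bsub>obj D (n - int i)\<^esub>" if "s \<in> {..<rk i}" for s
          using bspec[OF bspec[OF k, of "(i, s)"] b] \<open>i \<le> nat (n - a)\<close> that by (simp add: S_def)
        then show ?thesis
          by (rule hom_free_eqI[OF R mD mod_hom_smult[OF mD tot_hom[OF fc] bR] mod_hom_zero_map[OF mD] _ x])
      qed
      then show "(b \<odot>\<^bsub>obj (tot D) n\<^esub> f) i x = \<zero>\<^bsub>obj (tot D) n\<^esub> i x" using x by (simp add: tot_ops)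
    qed
    then show "f \<in> carrier (torsion_module R I (obj (tot D) n))"
      using fc unfolding in_torsion_iff by blast
  qed
  have "torsion_module R I (obj (tot D) n) = obj (tot (torsion_complex R I D)) n" for n
  proof -
    have "torsion_module R I (obj (tot D) n) =
      (obj (tot D) n)\<lparr>carrier := carrier (obj (tot (torsion_complex R I D)) n)\<rparr>"
      unfolding car[symmetric] by (rule torsion_module_eq)
    also have "\<dots> = obj (tot (torsion_complex R I D)) n"
      by (simp add: obj_tot Pi_module_def)
    finally show ?thesis .
  qed
  moreover have "dif (torsion_complex R I (tot D)) = dif (tot (torsion_complex R I D))"
    by (simp add: tot_def cong: nat.case_cong)
  ultimately show ?thesis by (auto simp: torsion_complex_def)
qed

text \<open>Freeness of \<open>F\<close> does the work: a primitive is found index by index, lifting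
  each component through the differential of \<open>T\<close>. The recursion never has to end,
  because the total complex is a product.\<close>

lemma exact_tot:
  assumes T: "cochain_complex R T" and ex: "exact T"
  shows "exact (tot T)"
  unfolding exact_def
proof (intro allI subsetI)
  note mT = cochain_complexD(1)[OF T]
  interpret T: module R "obj T n" for n by (rule mT)
  fix n u assume "u \<in> cocycles (tot T) n"
  then have u: "u \<in> carrier (obj (tot T) n)" and du: "dif (tot T) n u = \<zero>\<^bsub>obj (tot T) (n + 1)\<^esub>"
    by (auto simp: cocycles_def)
  note uc = tot_val[OF u]
  have ix: "n - 1 - int i + 1 = n - int i" "n - 1 - int i = n - int (Suc i)" for i by simp_all
  have dT: "dif T (n - 1 - int i) \<in> mod_hom R (obj T (n - 1 - int i)) (obj T (n - int i))" for i
    using cochain_complexD(2)[OF T, of "n - 1 - int i"] unfolding ix(1) .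
  have du0: "dif T n (u 0 x) = \<zero>\<^bsub>obj T (n + 1)\<^esub>" if x: "x \<in> carrier (F 0)" for x
    using dif_tot_0[OF T u x] x by (simp add: du tot_ops)
  have duS: "\<sigma> (Suc j) \<odot>\<^bsub>obj T (n - int j)\<^esub> dif T (n - int (Suc j)) (u (Suc j) x) =
      \<ominus>\<^bsub>obj T (n - int j)\<^esub> u j (\<delta> j x)" if x: "x \<in> carrier (F (Suc j))" for j x
  proof -
    have "\<sigma> (Suc j) \<odot>\<^bsub>obj T (n - int j)\<^esub> dif T (n - int (Suc j)) (u (Suc j) x) \<oplus>\<^bsub>obj T (n - int j)\<^esub> u j (\<delta> j x)
      = \<zero>\<^bsub>obj T (n - int j)\<^esub>"
      using dif_tot_Suc[OF T x, of n u] x by (simp add: du tot_ops(1)[of T "n + 1"])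
    from T.M.minus_equality[OF this uc[OF bdc[OF x]] T.smult_closed[OF \<sigma> dDc_Suc[OF T uc[OF x]]]]
    show ?thesis by simp
  qed
  \<comment> \<open>The last clause is the equation for component \<open>i\<close> evaluated on
    boundaries, where the contribution of the preceding component drops out by
    \<open>\<delta> \<delta> = 0\<close>. It ensures that the values of the next
    \<open>\<phi>\<close> are cocycles.\<close>
  let ?P = "\<lambda>i w. w \<in> mod_hom R (F i) (obj T (n - 1 - int i)) \<and>
    (i = 0 \<longrightarrow> (\<forall>x\<in>carrier (F 0). dif T (n - 1) (w x) = u 0 x)) \<and>
    (\<forall>x\<in>carrier (F (Suc i)). \<sigma> i \<odot>\<^bsub>obj T (n - int i)\<^esub> dif T (n - 1 - int i) (w (\<delta> i x)) = u i (\<delta> i x))"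
  let ?r = "\<lambda>i w w'. \<forall>x\<in>carrier (F (Suc i)). u (Suc i) x =
    \<sigma> (Suc i) \<odot>\<^bsub>obj T (n - int (Suc i))\<^esub> dif T (n - 1 - int (Suc i)) (w' x) \<oplus>\<^bsub>obj T (n - int (Suc i))\<^esub> w (\<delta> i x)"
  have "\<exists>w. \<forall>i. ?P i (w i) \<and> ?r i (w i) (w (Suc i))"
  proof (rule dependent_nat_choice)
    have "u 0 x \<in> coboundaries T n" if x: "x \<in> carrier (F 0)" for x
      using ex du0[OF x] uc[OF x] unfolding exact_def by (auto simp: cocycles_def)
    then have "u 0 ` carrier (F 0) \<subseteq> dif T (n - 1) ` carrier (obj T (n - 1))"
      by (auto simp: coboundaries_def)
    then obtain w where w: "w \<in> mod_hom R (F 0) (obj T (n - 1))" "\<And>x. x \<in> carrier (F 0) \<Longrightarrow> dif T (n - 1) (w x) = u 0 x"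
      using projective_lift[OF projective_F mT mT cochain_complexD(6)[OF T], of "u 0" 0 n] tot_hom[OF u, of 0] by auto
    then show "\<exists>w. ?P 0 w" using bdc uc[of _ 0] by (intro exI[of _ w]) auto
  next
    fix w i assume P: "?P i w"
    let ?N = "obj T (n - int (Suc i))"
    have w: "w \<in> mod_hom R (F i) ?N" using P unfolding ix(2) by blast
    \<comment> \<open>The equation of index \<open>Suc i\<close> solved for the differential of the
      next component; the sign moves across because it is its own inverse.\<close>
    define \<phi> where "\<phi> x = \<sigma> (Suc i) \<odot>\<^bsub>?N\<^esub> (u (Suc i) x \<ominus>\<^bsub>?N\<^esub> w (\<delta> i x))" for x
    have wd: "(\<lambda>x. w (\<delta> i x)) \<in> mod_hom R (F (Suc i)) ?N" by (rule mod_hom_comp[OF bd w])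
    have uw: "(\<lambda>x. u (Suc i) x \<ominus>\<^bsub>?N\<^esub> w (\<delta> i x)) \<in> mod_hom R (F (Suc i)) ?N"
      by (rule mod_hom_sub[OF mT tot_hom[OF u] wd])
    have \<phi>: "\<phi> \<in> mod_hom R (F (Suc i)) ?N"
      unfolding \<phi>_def by (rule mod_hom_smult[OF mT uw \<sigma>])
    have "\<phi> x \<in> coboundaries T (n - int (Suc i))" if x: "x \<in> carrier (F (Suc i))" for x
    proof -
      let ?L = "obj T (n - int i)" and ?d = "dif T (n - int (Suc i))"
      have d: "?d \<in> mod_hom R ?N ?L" using dD'[OF T, of n "Suc i"] by simp
      have c: "?d (u (Suc i) x) \<in> carrier ?L" "?d (w (\<delta> i x)) \<in> carrier ?L" "u i (\<delta> i x) \<in> carrier ?L"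
        using mod_homD(1)[OF d uc[OF x]] mod_homD(1)[OF d mod_homD(1)[OF wd x]] uc[OF bdc[OF x]] .
      have "?d (\<phi> x) = \<sigma> (Suc i) \<odot>\<^bsub>?L\<^esub> (?d (u (Suc i) x) \<ominus>\<^bsub>?L\<^esub> ?d (w (\<delta> i x)))"
        unfolding \<phi>_def using mod_homD(3)[OF d \<sigma> mod_homD(1)[OF uw x]]
          mod_hom_diff[OF mT mT d uc[OF x] mod_homD(1)[OF wd x]] by simp
      also have "\<dots> = \<sigma> (Suc i) \<odot>\<^bsub>?L\<^esub> ?d (u (Suc i) x) \<oplus>\<^bsub>?L\<^esub> \<sigma> i \<odot>\<^bsub>?L\<^esub> ?d (w (\<delta> i x))"
        using c by (simp add: a_minus_def T.smult_r_distr T.smult_r_minus \<sigma>_Suc[OF mT])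
      also have "\<sigma> i \<odot>\<^bsub>?L\<^esub> ?d (w (\<delta> i x)) = u i (\<delta> i x)" using P x unfolding ix(2) by blast
      finally have "?d (\<phi> x) = \<zero>\<^bsub>?L\<^esub>" using duS[OF x] c by (simp add: T.M.l_neg)
      then have "\<phi> x \<in> cocycles T (n - int (Suc i))" using mod_homD(1)[OF \<phi> x] by (simp add: cocycles_def)
      then show ?thesis using ex by (auto simp: exact_def)
    qed
    then have "\<phi> ` carrier (F (Suc i)) \<subseteq> dif T (n - 1 - int (Suc i)) ` carrier (obj T (n - 1 - int (Suc i)))"
      by (auto simp: coboundaries_def algebra_simps)
    then obtain w' where w': "w' \<in> mod_hom R (F (Suc i)) (obj T (n - 1 - int (Suc i)))"
      "\<And>x. x \<in> carrier (F (Suc i)) \<Longrightarrow> dif T (n - 1 - int (Suc i)) (w' x) = \<phi> x"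
      using projective_lift[OF projective_F mT mT dT \<phi>] by auto
    have r: "?r i w w'"
    proof
      fix x assume x: "x \<in> carrier (F (Suc i))"
      have c: "u (Suc i) x \<in> carrier ?N" "w (\<delta> i x) \<in> carrier ?N" using uc[OF x] mod_homD(1)[OF wd x] .
      have "\<sigma> (Suc i) \<odot>\<^bsub>?N\<^esub> \<phi> x = u (Suc i) x \<ominus>\<^bsub>?N\<^esub> w (\<delta> i x)"
        unfolding \<phi>_def by (rule \<sigma>_\<sigma>[OF mT mod_homD(1)[OF uw x]])
      then show "u (Suc i) x = \<sigma> (Suc i) \<odot>\<^bsub>?N\<^esub> dif T (n - 1 - int (Suc i)) (w' x) \<oplus>\<^bsub>?N\<^esub> w (\<delta> i x)"
        unfolding w'(2)[OF x] using c by (simp add: a_minus_def T.M.a_assoc T.M.l_neg)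
    qed
    moreover have "\<sigma> (Suc i) \<odot>\<^bsub>?N\<^esub> dif T (n - 1 - int (Suc i)) (w' (\<delta> (Suc i) x)) = u (Suc i) (\<delta> (Suc i) x)"
      if x: "x \<in> carrier (F (Suc (Suc i)))" for x
    proof -
      have "w (\<delta> i (\<delta> (Suc i) x)) = \<zero>\<^bsub>?N\<^esub>" using bd_bd[OF x] mod_hom_zero[OF F mT w] by simp
      moreover have "\<sigma> (Suc i) \<odot>\<^bsub>?N\<^esub> \<phi> (\<delta> (Suc i) x) = u (Suc i) (\<delta> (Suc i) x) \<ominus>\<^bsub>?N\<^esub> w (\<delta> i (\<delta> (Suc i) x))"
        unfolding \<phi>_def by (rule \<sigma>_\<sigma>[OF mT mod_homD(1)[OF uw bdc[OF x]]])
      ultimately show ?thesis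
        using w'(2)[OF bdc[OF x]] uc[OF bdc[OF x]] by (simp add: a_minus_def del: of_nat_Suc)
    qed
    ultimately show "\<exists>w'. ?P (Suc i) w' \<and> ?r i w w'" using w'(1) by blast
  qed
  then obtain w where w0: "\<forall>i. ?P i (w i) \<and> ?r i (w i) (w (Suc i))" ..
  have w: "?P i (w i)" "?r i (w i) (w (Suc i))" for i
    by (rule conjunct1[OF spec[OF w0]], rule conjunct2[OF spec[OF w0]])
  define W where "W = (\<lambda>i. restrict (w i) (carrier (F i)))"
  have W: "W \<in> carrier (obj (tot T) (n - 1))" unfolding W_def
  proof (rule tot_restrict)
    show "w i \<in> mod_hom R (F i) (obj T (n - 1 - int i))" for i using conjunct1[OF w(1)[of i]] .
  qed
  have "dif (tot T) (n - 1) W \<in> carrier (obj (tot T) n)" using dif_tot_hom[OF T W] by simp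
  then have "dif (tot T) (n - 1) W = u"
  proof (rule tot_eqI[OF _ u])
    fix i x assume x: "x \<in> carrier (F i)"
    show "dif (tot T) (n - 1) W i x = u i x"
    proof (cases i)
      case 0
      then show ?thesis using dif_tot_0[OF T W, of x] x w(1)[of 0] by (simp add: W_def)
    next
      case (Suc j)
      then have xs: "x \<in> carrier (F (Suc j))" using x by simp
      have "u (Suc j) x = \<sigma> (Suc j) \<odot>\<^bsub>obj T (n - 1 - int j)\<^esub> dif T (n - 1 - int (Suc j)) (w (Suc j) x)
          \<oplus>\<^bsub>obj T (n - 1 - int j)\<^esub> w j (\<delta> j x)"
        unfolding ix(2)[of j] by (rule bspec[OF w(2)[of j] xs])
      then show ?thesis
        unfolding Suc dif_tot_Suc[OF T xs] using xs bdc[OF xs] by (simp add: W_def del: of_nat_Suc)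
    qed
  qed
  then show "u \<in> coboundaries (tot T) n" using W by (auto simp: coboundaries_def)
qed

end

lemma module_diff_closed: "module R N \<Longrightarrow> x \<in> carrier N \<Longrightarrow> y \<in> carrier N \<Longrightarrow> x \<ominus>\<^bsub>N\<^esub> y \<in> carrier N"
proof -
  assume a: "module R N" "x \<in> carrier N" "y \<in> carrier N"
  interpret N: module R N by fact
  show ?thesis using a(2,3) by (simp add: a_minus_def)
qed

lemma cochain_complex_Hom_into:
  assumes M: "module R M" and D: "cochain_complex R D"
  shows "cochain_complex R (Hom_into R M D)"
  unfolding cochain_complex_def
proof (intro allI conjI ballI)
  fix n
  note mD = cochain_complexD(1)[OF D]
  interpret D: module R "obj D n'" for n' by (rule mD)
  show "module R (obj (Hom_into R M D) n)" by (simp add: Hom_into_def module_Hom[OF M mD])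
  have d: "dif D n \<in> mod_hom R (obj D n) (obj D (n + 1))" by (rule cochain_complexD(2)[OF D])
  show "dif (Hom_into R M D) n \<in> mod_hom R (obj (Hom_into R M D) n) (obj (Hom_into R M D) (n + 1))"
  proof (rule mod_homI)
    fix f assume "f \<in> carrier (obj (Hom_into R M D) n)"
    then have f: "f \<in> mod_hom R M (obj D n)" by (simp add: Hom_into_def)
    show "dif (Hom_into R M D) n f \<in> carrier (obj (Hom_into R M D) (n + 1))"
      using restrict_hom[OF M mod_hom_comp[OF f d]] by (simp add: Hom_into_def)
    show "dif (Hom_into R M D) n (r \<odot>\<^bsub>obj (Hom_into R M D) n\<^esub> f) = r \<odot>\<^bsub>obj (Hom_into R M D) (n + 1)\<^esub> dif (Hom_into R M D) n f"
      if "r \<in> carrier R" for r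
      using mod_homD(3)[OF d that mod_homD(1)[OF f]] by (auto simp: Hom_into_def intro!: restrict_ext)
    fix g assume "g \<in> carrier (obj (Hom_into R M D) n)"
    then have g: "g \<in> mod_hom R M (obj D n)" by (simp add: Hom_into_def)
    show "dif (Hom_into R M D) n (f \<oplus>\<^bsub>obj (Hom_into R M D) n\<^esub> g) =
        dif (Hom_into R M D) n f \<oplus>\<^bsub>obj (Hom_into R M D) (n + 1)\<^esub> dif (Hom_into R M D) n g"
      using mod_homD(2)[OF d mod_homD(1)[OF f] mod_homD(1)[OF g]] by (auto simp: Hom_into_def intro!: restrict_ext)
  qed
  fix f assume "f \<in> carrier (obj (Hom_into R M D) n)"
  then have f: "f \<in> mod_hom R M (obj D n)" by (simp add: Hom_into_def)
  show "dif (Hom_into R M D) (n + 1) (dif (Hom_into R M D) n f) = \<zero>\<^bsub>obj (Hom_into R M D) (n + 1 + 1)\<^esub>"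
    using cochain_complexD(4)[OF D mod_homD(1)[OF f]] by (auto simp: Hom_into_def add.assoc intro!: restrict_ext)
qed

section \<open>The augmentation from Hom(M, D) to the total complex\<close>

context finite_free_resolution
begin

text \<open>By the hypothesis on \<open>u\<close>, its components of positive index form, up to
  sign, a chain map from the resolution to \<open>D\<close>. Read downwards from an index where
  \<open>D\<close> vanishes, this chain map starts at zero; \<open>F\<close> is exact in positive
  indices and \<open>D\<close> is injective, so it is null-homotopic there, and the homotopy is
  \<open>w\<close>. Component \<open>0\<close> is left out since exactness of \<open>F\<close> stops
  at \<open>F 0\<close>, whose cokernel is \<open>M\<close>.\<close>

lemma tot_descent:
  assumes D: "cochain_complex R D" and inj: "\<And>n. injective_module R (obj D n)" and bb: "bounded_below D"
    and u: "u \<in> carrier (obj (tot D) n)"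
    and du: "\<And>j x. x \<in> carrier (F (Suc (Suc j))) \<Longrightarrow> dif (tot D) n u (Suc (Suc j)) x = \<zero>\<^bsub>obj D (n - int (Suc j))\<^esub>"
  shows "\<exists>w\<in>carrier (obj (tot D) (n - 1)). \<forall>j. \<forall>x\<in>carrier (F (Suc j)). dif (tot D) (n - 1) w (Suc j) x = u (Suc j) x"
proof -
  obtain a where a: "\<And>k. k < a \<Longrightarrow> carrier (obj D k) = {\<zero>\<^bsub>obj D k\<^esub>}"
    using bb unfolding bounded_below_def zero_module_def by blast
  note mD = cochain_complexD(1)[OF D] and dD = cochain_complexD(2)[OF D]
  interpret D: module R "obj D n'" for n' by (rule mD)
  \<comment> \<open>Large enough for \<open>D\<close> to vanish in degree \<open>n - N\<close>,
    where component \<open>N\<close> of \<open>u\<close> takes its values. The index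
    \<open>k = N - i\<close> then runs through the resolution backwards.\<close>
  define N where "N = Suc (nat (n - a))"
  have Na: "n - int N < a" unfolding N_def by linarith
  define C where "C k = F (N - k)" for k
  define I where "I k = obj D (n - int N + int k)" for k
  \<comment> \<open>From \<open>k = N\<close> on the resolution is exhausted: \<open>N - k\<close>
    is \<open>0\<close> in the naturals, and zero maps serve as fillers.\<close>
  define v where "v k = (if k < N then \<delta> (N - Suc k) else (\<lambda>x. \<zero>\<^bsub>F 0\<^esub>))" for k
  \<comment> \<open>The sign turns hypothesis \<open>du\<close>, which expresses \<open>u\<close>
    after \<open>\<delta>\<close> as minus \<open>\<sigma>\<close> times the differential of
    \<open>u\<close>, into the chain condition for \<open>\<psi>\<close>.\<close>
  define e where "e k y = \<ominus>\<^bsub>I (Suc k)\<^esub> (\<sigma> (N - k) \<odot>\<^bsub>I (Suc k)\<^esub> dif D (n - int N + int k) y)" for k y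
  define \<psi> where "\<psi> k = (if k \<le> N then u (N - k) else (\<lambda>x. \<zero>\<^bsub>I k\<^esub>))" for k
  have mI: "module R (I k)" for k unfolding I_def by (rule mD)
  interpret I: module R "I k'" for k' by (rule mI)
  have Iix: "I k = obj D (n - int (N - k))" if "k \<le> N" for k
    using that by (simp add: I_def of_nat_diff algebra_simps)
  have dI: "dif D (n - int N + int k) \<in> mod_hom R (I k) (I (Suc k))" for k
    using dD[of "n - int N + int k"] by (simp add: I_def add_ac)
  have e: "e k \<in> mod_hom R (I k) (I (Suc k))" for k
    unfolding e_def by (rule mod_hom_uminus[OF mI mod_hom_smult[OF mI dI \<sigma>]])
  have \<psi>: "\<psi> k \<in> mod_hom R (C k) (I k)" for k
  proof (cases "k \<le> N")
    case True
    then have "\<psi> k = u (N - k)" by (simp add: \<psi>_def)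
    then show ?thesis unfolding C_def Iix[OF True] by (simp only: tot_hom[OF u])
  next
    case False
    then have "\<psi> k = (\<lambda>x. \<zero>\<^bsub>I k\<^esub>)" by (simp add: \<psi>_def)
    then show ?thesis by (simp only: mod_hom_zero_map[OF mI])
  qed
  have v: "v k \<in> mod_hom R (C k) (C (Suc k))" for k
  proof (cases "k < N")
    case True
    then have "N - k = Suc (N - Suc k)" by simp
    then show ?thesis unfolding v_def C_def using True bd[of "N - Suc k"] by simp
  next
    case False
    then show ?thesis unfolding v_def C_def using mod_hom_zero_map[OF F[of 0]] by simp
  qed
  have "\<exists>s. (\<forall>k. s k \<in> mod_hom R (C (Suc k)) (I k)) \<and>
    (0 < N \<longrightarrow> (\<forall>x\<in>carrier (C 0). \<psi> 0 x = s 0 (v 0 x))) \<and>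
    (\<forall>k. Suc k < N \<longrightarrow> (\<forall>x\<in>carrier (C (Suc k)).
       \<psi> (Suc k) x = e k (s k x) \<oplus>\<^bsub>I (Suc k)\<^esub> s (Suc k) (v (Suc k) x)))"
  proof (rule injective_null_homotopy[where Q = "\<lambda>k. k < N" and C = C and I = I and u = v and e = e and \<psi> = \<psi>, OF _ _ v e _ \<psi>])
    show "module R (C k)" for k unfolding C_def by (rule F)
    show "injective_module R (I k)" for k unfolding I_def by (rule inj)
    show "e (Suc k) (e k y) = \<zero>\<^bsub>I (Suc (Suc k))\<^esub>" if y: "y \<in> carrier (I k)" for k y
    proof -
      let ?d = "dif D (n - int N + int k)" and ?d' = "dif D (n - int N + int (Suc k))"
      have dy: "?d y \<in> carrier (I (Suc k))" by (rule mod_homD(1)[OF dI y])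
      have "?d' (?d y) = \<zero>\<^bsub>I (Suc (Suc k))\<^esub>"
        using cochain_complexD(4)[OF D y[unfolded I_def]] by (simp add: I_def add_ac)
      then have "?d' (e k y) = \<zero>\<^bsub>I (Suc (Suc k))\<^esub>"
        unfolding e_def using mod_hom_minus[OF mI mI dI, of _ "Suc k"] mod_homD(3)[OF dI, of _ _ "Suc k"] dy by simp
      then show ?thesis unfolding e_def[of "Suc k"] by simp
    qed
    show "\<psi> (Suc k) (v k x) = e k (\<psi> k x)" if k: "Suc k < N" and x: "x \<in> carrier (C k)" for k x
    proof -
      obtain j where j: "N - k = Suc (Suc j)" "N - Suc k = Suc j"
        using k by (metis Suc_diff_Suc Suc_lessD)
      have x': "x \<in> carrier (F (Suc (Suc j)))" using x by (simp add: C_def j)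
      have I1: "I (Suc k) = obj D (n - int (Suc j))" and I0: "I k = obj D (n - int (Suc (Suc j)))"
        using Iix[of "Suc k"] Iix[of k] k j by simp_all
      have ix: "n - int N + int k = n - int (Suc (Suc j))" using j(1) k by linarith
      have "\<sigma> (Suc (Suc j)) \<odot>\<^bsub>I (Suc k)\<^esub> dif D (n - int (Suc (Suc j))) (u (Suc (Suc j)) x) \<oplus>\<^bsub>I (Suc k)\<^esub>
          u (Suc j) (\<delta> (Suc j) x) = \<zero>\<^bsub>I (Suc k)\<^esub>"
        using du[OF x'] dif_tot_Suc[OF D x', of n u] unfolding I1 by simp
      then have "u (Suc j) (\<delta> (Suc j) x) \<oplus>\<^bsub>I (Suc k)\<^esub> \<sigma> (Suc (Suc j)) \<odot>\<^bsub>I (Suc k)\<^esub> dif D (n - int (Suc (Suc j))) (u (Suc (Suc j)) x)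
          = \<zero>\<^bsub>I (Suc k)\<^esub>"
        using tot_val[OF u bdc[OF x']] dDc_Suc[OF D tot_val[OF u x']] unfolding I1 by (subst D.M.a_comm) auto
      from I.M.minus_equality[OF this _ tot_val[OF u bdc[OF x'], folded I1]]
      have "\<ominus>\<^bsub>I (Suc k)\<^esub> (\<sigma> (Suc (Suc j)) \<odot>\<^bsub>I (Suc k)\<^esub> dif D (n - int (Suc (Suc j))) (u (Suc (Suc j)) x)) =
          u (Suc j) (\<delta> (Suc j) x)"
        using D.smult_closed[OF \<sigma> dDc_Suc[OF D tot_val[OF u x']]] unfolding I1 by blast
      then show ?thesis unfolding \<psi>_def v_def e_def ix using k j by simp
    qed
    show "k < N" if "Suc k < N" for k using that by simp
    show "\<psi> 0 x = \<zero>\<^bsub>I 0\<^esub>" if "x \<in> carrier (C 0)" for x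
      using mod_homD(1)[OF \<psi> that] a[OF Na] by (simp add: I_def)
    show "x \<in> v k ` carrier (C k)"
      if k: "Suc k < N" and x: "x \<in> carrier (C (Suc k))" and vx: "v (Suc k) x = \<zero>\<^bsub>C (Suc (Suc k))\<^esub>" for k x
    proof -
      obtain j where j: "N - k = Suc (Suc j)" "N - Suc k = Suc j" "N - Suc (Suc k) = j"
        using k by (metis Suc_diff_Suc Suc_lessD diff_Suc_Suc diff_Suc_1)
      show ?thesis using x vx k exact_Suc[of j] unfolding C_def v_def j by simp
    qed
  qed
  then obtain s where s: "\<And>k. s k \<in> mod_hom R (C (Suc k)) (I k)"
    and es: "\<And>k x. Suc k < N \<Longrightarrow> x \<in> carrier (C (Suc k)) \<Longrightarrow>
       \<psi> (Suc k) x = e k (s k x) \<oplus>\<^bsub>I (Suc k)\<^esub> s (Suc k) (v (Suc k) x)" by blast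
  \<comment> \<open>\<open>s k\<close> starts at \<open>C (Suc k) = F (N - Suc k)\<close>, so the
    map on \<open>F i\<close> is the one with \<open>k = N - Suc i\<close>.\<close>
  define w where "w i = (if i < N then s (N - Suc i) else (\<lambda>x. \<zero>\<^bsub>obj D (n - 1 - int i)\<^esub>))" for i
  have w: "w i \<in> mod_hom R (F i) (obj D (n - 1 - int i))" for i
  proof (cases "i < N")
    case True
    then have "C (Suc (N - Suc i)) = F i" "I (N - Suc i) = obj D (n - 1 - int i)"
      by (auto simp: C_def I_def of_nat_diff algebra_simps)
    then show ?thesis using s[of "N - Suc i"] True by (simp add: w_def)
  next
    case False
    then show ?thesis using mod_hom_zero_map[OF mD] by (simp add: w_def)
  qed
  define W where "W = (\<lambda>i. restrict (w i) (carrier (F i)))"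
  have W: "W \<in> carrier (obj (tot D) (n - 1))" unfolding W_def by (rule tot_restrict[OF w])
  have dW: "dif (tot D) (n - 1) W \<in> carrier (obj (tot D) n)" using dif_tot_hom[OF D W] by simp
  have "dif (tot D) (n - 1) W (Suc j) x = u (Suc j) x" if x: "x \<in> carrier (F (Suc j))" for j x
  proof (cases "Suc j < N")
    case False
    then have "n - int (Suc j) < a" using Na by linarith
    then show ?thesis using a tot_val[OF dW x] tot_val[OF u x] by fastforce
  next
    case True
    define k where "k = N - Suc (Suc j)"
    have k: "Suc k < N" "N - k = Suc (Suc j)" "N - Suc k = Suc j" "N - Suc (Suc k) = j" "N - Suc (Suc j) = k"
      "N - Suc j = Suc k" "Suc k \<le> N" "k < N" "j < N"
      using True by (auto simp: k_def)
    have ix: "n - int N + int k = n - 1 - int (Suc j)" using k(1,2) by linarith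
    have I1: "I (Suc k) = obj D (n - 1 - int j)" and I0: "I k = obj D (n - 1 - int (Suc j))"
      unfolding I_def ix by (rule arg_cong[of _ _ "obj D"], use ix in simp, rule refl)
    have xC: "x \<in> carrier (C (Suc k))" using x by (simp add: C_def k)
    have wx: "w (Suc j) x \<in> carrier (I k)" unfolding I0 by (rule mod_homD(1)[OF w x])
    have dwx: "dif D (n - 1 - int (Suc j)) (w (Suc j) x) \<in> carrier (I (Suc k))"
      using mod_homD(1)[OF dI wx] unfolding ix .
    have "u (Suc j) x = e k (w (Suc j) x) \<oplus>\<^bsub>I (Suc k)\<^esub> w j (\<delta> j x)"
      using es[OF k(1) xC] k True by (simp add: \<psi>_def w_def v_def)
    also have "e k (w (Suc j) x) = \<sigma> (Suc j) \<odot>\<^bsub>I (Suc k)\<^esub> dif D (n - 1 - int (Suc j)) (w (Suc j) x)"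
      unfolding e_def k(2) ix using \<sigma>_Suc[OF mI dwx, of "Suc j"] dwx by simp
    finally show ?thesis
      unfolding dif_tot_Suc[OF D x] I1 using x bdc[OF x] by (simp add: W_def del: of_nat_Suc)
  qed
  then show ?thesis using W by blast
qed

definition aug_map :: "('a, 'd) cochain \<Rightarrow> int \<Rightarrow> ('m \<Rightarrow> 'd) \<Rightarrow> nat \<Rightarrow> (nat \<Rightarrow> 'a) \<Rightarrow> 'd"
  where "aug_map D n f = (\<lambda>i. \<lambda>x\<in>carrier (F i). if i = 0 then f (\<epsilon> x) else \<zero>\<^bsub>obj D (n - int i)\<^esub>)"

lemma epi_eqI:
  assumes "f \<in> extensional (carrier M)" "g \<in> extensional (carrier M)"
    and "\<And>x. x \<in> carrier (F 0) \<Longrightarrow> f (\<epsilon> x) = g (\<epsilon> x)"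
  shows "f = g"
proof (rule extensionalityI[OF assms(1,2)])
  fix y assume "y \<in> carrier M"
  then obtain x where "x \<in> carrier (F 0)" "y = \<epsilon> x" using aug_surj by blast
  then show "f y = g y" using assms(3) by simp
qed

text \<open>The kernel of \<open>\<epsilon>\<close> is the image of \<open>\<delta> 0\<close>, so
  this is left exactness of Hom on the presentation of \<open>M\<close> by \<open>F 1\<close> and
  \<open>F 0\<close>.\<close>

lemma hom_factor_aug:
  assumes N: "module R N" and f: "f \<in> mod_hom R (F 0) N"
    and z: "\<And>x. x \<in> carrier (F 1) \<Longrightarrow> f (\<delta> 0 x) = \<zero>\<^bsub>N\<^esub>"
  obtains g where "g \<in> carrier (Hom_module R M N)" "\<And>x. x \<in> carrier (F 0) \<Longrightarrow> g (\<epsilon> x) = f x"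
proof -
  have "f x = \<zero>\<^bsub>N\<^esub>" if "x \<in> carrier (F 0)" "\<epsilon> x = \<zero>\<^bsub>M\<^esub>" for x
    using z that exact_0 by (metis (mono_tags, lifting) imageE mem_Collect_eq)
  then obtain g where g: "g \<in> mod_hom R M N" "\<And>x. x \<in> carrier (F 0) \<Longrightarrow> g (\<epsilon> x) = f x"
    using mod_hom_factor_surj[OF F M N aug f aug_surj] by blast
  show thesis
    by (rule that[OF restrict_hom[OF M g(1)]]) (use g(2) mod_homD(1)[OF aug] in auto)
qed

text \<open>By \<open>tot_descent\<close>, a cocycle of the total complex, and likewise a primitive
  of an element coming from \<open>M\<close>, can be changed by a coboundary until only component
  \<open>0\<close> is left. The vanishing of its differential in index \<open>1\<close> then says
  that this component kills the image of \<open>\<delta> 0\<close>, so it comes from a homomorphism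
  on \<open>M\<close>.\<close>

lemma aug_quasi_iso:
  assumes D: "cochain_complex R D" and inj: "\<And>n. injective_module R (obj D n)" and bb: "bounded_below D"
  shows "elementwise_quasi_iso R (Hom_into R M D) (tot D) (aug_map D)"
proof -
  note mD = cochain_complexD(1)[OF D] and dD = cochain_complexD(2)[OF D]
  interpret D: module R "obj D n'" for n' by (rule mD)
  let ?H = "Hom_into R M D"
  note H = cochain_complex_Hom_into[OF M D] and T = cochain_complex_tot[OF D]
  note mT = cochain_complexD(1)[OF T]
  interpret T: module R "obj (tot D) n'" for n' by (rule mT)
  have Hobj: "obj ?H n = Hom_module R M (obj D n)" and Hdif: "dif ?H n f = (\<lambda>x\<in>carrier M. dif D n (f x))" for n f
    by (simp_all add: Hom_into_def)
  note \<epsilon>c = mod_homD(1)[OF aug]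
  have am0: "aug_map D n f 0 x = f (\<epsilon> x)" if "x \<in> carrier (F 0)" for n f x using that by (simp add: aug_map_def)
  have amS: "aug_map D n f (Suc j) x = \<zero>\<^bsub>obj D (n - int (Suc j))\<^esub>" if "x \<in> carrier (F (Suc j))" for n f x j
    using that by (simp add: aug_map_def)
  have am: "aug_map D n f \<in> carrier (obj (tot D) n)" if f: "f \<in> carrier (obj ?H n)" for n f
    unfolding aug_map_def
  proof (rule tot_restrict)
    show "(\<lambda>x. if i = 0 then f (\<epsilon> x) else \<zero>\<^bsub>obj D (n - int i)\<^esub>) \<in> mod_hom R (F i) (obj D (n - int i))" for i
      using f mod_hom_comp[OF aug, of f "obj D n"] mod_hom_zero_map[OF mD] by (cases i) (auto simp: Hobj)
  qed
  have dif_am0: "dif (tot D) n (aug_map D n f) 0 x = dif D n (f (\<epsilon> x))"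
    if f: "f \<in> carrier (obj ?H n)" and x: "x \<in> carrier (F 0)" for n f x
    using dif_tot_0[OF D am[OF f] x] am0[OF x] by simp
  have dif_amS: "dif (tot D) n (aug_map D n f) (Suc j) x = \<zero>\<^bsub>obj D (n - int j)\<^esub>"
    if f: "f \<in> carrier (obj ?H n)" and x: "x \<in> carrier (F (Suc j))" for n f x j
  proof -
    have "dif D (n - int (Suc j)) \<zero>\<^bsub>obj D (n - int (Suc j))\<^esub> = \<zero>\<^bsub>obj D (n - int j)\<^esub>"
      using mod_hom_zero[OF mD mD dD'[OF D, of n "Suc j"]] by simp
    moreover have "aug_map D n f j (\<delta> j x) = \<zero>\<^bsub>obj D (n - int j)\<^esub>"
    proof (cases j)
      case 0
      then show ?thesis using am0[of "\<delta> 0 x"] x bdc[of x 0] aug_bd[of x] f mod_hom_zero[OF M mD, of f n] by (simp add: Hobj)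
    next
      case (Suc k)
      then show ?thesis using amS[of "\<delta> j x" k] bdc[OF x] by simp
    qed
    ultimately show ?thesis unfolding dif_tot_Suc[OF D x] amS[OF x] by (simp del: of_nat_Suc)
  qed
  have ch: "chain_map R ?H (tot D) (aug_map D)"
    unfolding chain_map_def
  proof (intro allI conjI ballI)
    fix n
    show "aug_map D n \<in> mod_hom R (obj ?H n) (obj (tot D) n)"
    proof (rule mod_homI)
      fix f assume f: "f \<in> carrier (obj ?H n)"
      show "aug_map D n f \<in> carrier (obj (tot D) n)" by (rule am[OF f])
      show "aug_map D n (f \<oplus>\<^bsub>obj ?H n\<^esub> g) = aug_map D n f \<oplus>\<^bsub>obj (tot D) n\<^esub> aug_map D n g" for g
        by (auto simp: tot_ops aug_map_def Hobj \<epsilon>c fun_eq_iff)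
      show "aug_map D n (r \<odot>\<^bsub>obj ?H n\<^esub> f) = r \<odot>\<^bsub>obj (tot D) n\<^esub> aug_map D n f" if "r \<in> carrier R" for r
        using that by (auto simp: tot_ops aug_map_def Hobj \<epsilon>c fun_eq_iff)
    qed
    fix f assume f: "f \<in> carrier (obj ?H n)"
    have df: "dif ?H n f \<in> carrier (obj ?H (n + 1))" by (rule mod_homD(1)[OF cochain_complexD(2)[OF H] f])
    show "aug_map D (n + 1) (dif ?H n f) = dif (tot D) n (aug_map D n f)"
    proof (rule tot_eqI[OF am[OF df] dif_tot_hom[OF D am[OF f]]])
      fix i x assume x: "x \<in> carrier (F i)"
      show "aug_map D (n + 1) (dif ?H n f) i x = dif (tot D) n (aug_map D n f) i x"
      proof (cases i)
        case 0
        then show ?thesis using x dif_am0[OF f, of x] am0[of x] \<epsilon>c by (simp add: Hdif)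
      next
        case (Suc j)
        then have xs: "x \<in> carrier (F (Suc j))" using x by simp
        show ?thesis unfolding Suc amS[OF xs] dif_amS[OF f xs] by simp
      qed
    qed
  qed
  show ?thesis
    unfolding elementwise_quasi_iso_def
  proof (intro conjI H T ch allI ballI impI)
    fix n f assume f: "f \<in> cocycles ?H n" and b: "aug_map D n f \<in> coboundaries (tot D) n"
    have fc: "f \<in> carrier (obj ?H n)" using f by (simp add: cocycles_def)
    obtain u where u: "u \<in> carrier (obj (tot D) (n - 1))" and du: "aug_map D n f = dif (tot D) (n - 1) u"
      using b by (auto simp: coboundaries_def)
    \<comment> \<open>An element in the image of the augmentation has no components of positive
      index, so the differential of \<open>u\<close> vanishes there, as \<open>tot_descent\<close>
      requires.\<close>
    have "dif (tot D) (n - 1) u (Suc (Suc j)) x = \<zero>\<^bsub>obj D (n - 1 - int (Suc j))\<^esub>"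
      if "x \<in> carrier (F (Suc (Suc j)))" for j x
      unfolding du[symmetric] amS[OF that] by (rule arg_cong[of _ _ "\<lambda>k. \<zero>\<^bsub>obj D k\<^esub>"]) simp
    then obtain w where w: "w \<in> carrier (obj (tot D) (n - 1 - 1))"
      and wu: "\<And>j x. x \<in> carrier (F (Suc j)) \<Longrightarrow> dif (tot D) (n - 1 - 1) w (Suc j) x = u (Suc j) x"
      using tot_descent[OF D inj bb u] by blast
    let ?d = "dif (tot D) (n - 1 - 1) w"
    have d: "?d \<in> carrier (obj (tot D) (n - 1))" using dif_tot_hom[OF D w] by simp
    define z where "z = u \<ominus>\<^bsub>obj (tot D) (n - 1)\<^esub> ?d"
    have z: "z \<in> carrier (obj (tot D) (n - 1))" unfolding z_def by (rule module_diff_closed[OF mT u d])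
    have "dif (tot D) (n - 1) ?d = \<zero>\<^bsub>obj (tot D) n\<^esub>"
      using dif_dif_tot[OF D w] by simp
    then have dz: "dif (tot D) (n - 1) z = aug_map D n f"
      unfolding z_def mod_hom_diff[OF mT mT cochain_complexD(6)[OF T] u d] du[symmetric]
      using am[OF fc] by (simp add: a_minus_def)
    have zS: "z (Suc j) x = \<zero>\<^bsub>obj D (n - 1 - int (Suc j))\<^esub>" if x: "x \<in> carrier (F (Suc j))" for j x
    proof -
      have "u = z \<oplus>\<^bsub>obj (tot D) (n - 1)\<^esub> ?d"
        unfolding z_def using u d by (simp add: a_minus_def T.M.a_assoc T.M.l_neg)
      then have "u (Suc j) x = z (Suc j) x \<oplus>\<^bsub>obj D (n - 1 - int (Suc j))\<^esub> u (Suc j) x"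
        using x wu[OF x] by (metis (no_types, lifting) restrict_apply' tot_ops(2))
      then show ?thesis using tot_val[OF u x] tot_val[OF z x] by (simp del: of_nat_Suc)
    qed
    have z0: "z 0 \<in> mod_hom R (F 0) (obj D (n - 1))" using tot_hom[OF z, of 0] by simp
    have "z 0 (\<delta> 0 x) = \<zero>\<^bsub>obj D (n - 1)\<^esub>" if x: "x \<in> carrier (F 1)" for x
    proof -
      have xs: "x \<in> carrier (F (Suc 0))" using x by simp
      have "\<zero>\<^bsub>obj D (n - int (Suc 0))\<^esub> = dif (tot D) (n - 1) z (Suc 0) x" unfolding dz amS[OF xs] ..
      also have "\<dots> = \<sigma> (Suc 0) \<odot>\<^bsub>obj D (n - 1)\<^esub> dif D (n - 1 - 1) \<zero>\<^bsub>obj D (n - 1 - 1)\<^esub> \<oplus>\<^bsub>obj D (n - 1)\<^esub> z 0 (\<delta> 0 x)"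
        using dif_tot_Suc[OF D xs, of "n - 1" z] zS[OF xs] by simp
      also have "dif D (n - 1 - 1) \<zero>\<^bsub>obj D (n - 1 - 1)\<^esub> = \<zero>\<^bsub>obj D (n - 1)\<^esub>"
        using mod_hom_zero[OF mD mD cochain_complexD(6)[OF D], of "n - 1"] .
      finally show ?thesis using mod_homD(1)[OF z0 bdc[OF xs]] by simp
    qed
    then obtain g where g: "g \<in> carrier (Hom_module R M (obj D (n - 1)))" "\<And>x. x \<in> carrier (F 0) \<Longrightarrow> g (\<epsilon> x) = z 0 x"
      using hom_factor_aug[OF mD z0] by blast
    then have gH: "g \<in> carrier (obj ?H (n - 1))" by (simp add: Hobj)
    have "f = dif ?H (n - 1) g"
    proof (rule epi_eqI)
      show "f \<in> extensional (carrier M)" using fc by (simp add: Hobj)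
      show "dif ?H (n - 1) g \<in> extensional (carrier M)" by (simp add: Hdif)
      show "f (\<epsilon> x) = dif ?H (n - 1) g (\<epsilon> x)" if x: "x \<in> carrier (F 0)" for x
        using am0[OF x, of n f] dif_tot_0[OF D z x] dz g(2)[OF x] \<epsilon>c[OF x] by (simp add: Hdif)
    qed
    then show "f \<in> coboundaries ?H n" using gH by (auto simp: coboundaries_def)
  next
    fix n u assume "u \<in> cocycles (tot D) n"
    then have u: "u \<in> carrier (obj (tot D) n)" and du: "dif (tot D) n u = \<zero>\<^bsub>obj (tot D) (n + 1)\<^esub>"
      by (auto simp: cocycles_def)
    have "dif (tot D) n u (Suc (Suc j)) x = \<zero>\<^bsub>obj D (n - int (Suc j))\<^esub>"
      if "x \<in> carrier (F (Suc (Suc j)))" for j x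
      unfolding du tot_ops restrict_apply'[OF that] by (rule arg_cong[of _ _ "\<lambda>k. \<zero>\<^bsub>obj D k\<^esub>"]) simp
    then obtain w where w: "w \<in> carrier (obj (tot D) (n - 1))"
      and wu: "\<And>j x. x \<in> carrier (F (Suc j)) \<Longrightarrow> dif (tot D) (n - 1) w (Suc j) x = u (Suc j) x"
      using tot_descent[OF D inj bb u] by blast
    let ?d = "dif (tot D) (n - 1) w"
    have d: "?d \<in> carrier (obj (tot D) n)" using dif_tot_hom[OF D w] by simp
    define z where "z = u \<ominus>\<^bsub>obj (tot D) n\<^esub> ?d"
    have z: "z \<in> carrier (obj (tot D) n)" unfolding z_def by (rule module_diff_closed[OF mT u d])
    have "dif (tot D) n ?d = \<zero>\<^bsub>obj (tot D) (n + 1)\<^esub>"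
      using dif_dif_tot[OF D w] by (simp add: add.commute)
    then have dz: "dif (tot D) n z = \<zero>\<^bsub>obj (tot D) (n + 1)\<^esub>"
      unfolding z_def mod_hom_diff[OF mT mT cochain_complexD(2)[OF T] u d] du by (simp add: a_minus_def)
    have uzd: "u = z \<oplus>\<^bsub>obj (tot D) n\<^esub> ?d"
      unfolding z_def using u d by (simp add: a_minus_def T.M.a_assoc T.M.l_neg)
    have zS: "z (Suc j) x = \<zero>\<^bsub>obj D (n - int (Suc j))\<^esub>" if x: "x \<in> carrier (F (Suc j))" for j x
    proof -
      have "u (Suc j) x = z (Suc j) x \<oplus>\<^bsub>obj D (n - int (Suc j))\<^esub> u (Suc j) x"
        using x wu[OF x] uzd by (metis (no_types, lifting) restrict_apply' tot_ops(2))
      then show ?thesis using tot_val[OF u x] tot_val[OF z x] by (simp del: of_nat_Suc)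
    qed
    have z0: "z 0 \<in> mod_hom R (F 0) (obj D n)" using tot_hom[OF z, of 0] by simp
    have "z 0 (\<delta> 0 x) = \<zero>\<^bsub>obj D n\<^esub>" if x: "x \<in> carrier (F 1)" for x
    proof -
      have xs: "x \<in> carrier (F (Suc 0))" using x by simp
      have "\<zero>\<^bsub>obj D n\<^esub> = dif (tot D) n z (Suc 0) x" unfolding dz tot_ops using xs by simp
      also have "\<dots> = \<sigma> (Suc 0) \<odot>\<^bsub>obj D n\<^esub> dif D (n - 1) \<zero>\<^bsub>obj D (n - 1)\<^esub> \<oplus>\<^bsub>obj D n\<^esub> z 0 (\<delta> 0 x)"
        using dif_tot_Suc[OF D xs, of n z] zS[OF xs] by simp
      also have "dif D (n - 1) \<zero>\<^bsub>obj D (n - 1)\<^esub> = \<zero>\<^bsub>obj D n\<^esub>"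
        using mod_hom_zero[OF mD mD cochain_complexD(6)[OF D]] .
      finally show ?thesis using mod_homD(1)[OF z0 bdc[OF xs]] by simp
    qed
    then obtain g where g: "g \<in> carrier (Hom_module R M (obj D n))" "\<And>x. x \<in> carrier (F 0) \<Longrightarrow> g (\<epsilon> x) = z 0 x"
      using hom_factor_aug[OF mD z0] by blast
    then have gH: "g \<in> carrier (obj ?H n)" by (simp add: Hobj)
    have "dif ?H n g = \<zero>\<^bsub>obj ?H (n + 1)\<^esub>"
    proof (rule epi_eqI)
      show "dif ?H n g (\<epsilon> x) = \<zero>\<^bsub>obj ?H (n + 1)\<^esub> (\<epsilon> x)" if x: "x \<in> carrier (F 0)" for x
        using dif_tot_0[OF D z x] dz g(2)[OF x] \<epsilon>c[OF x] x by (simp add: Hdif Hobj tot_ops)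
    qed (simp_all add: Hdif Hobj)
    then have "g \<in> cocycles ?H n" using gH by (simp add: cocycles_def)
    moreover have "aug_map D n g = z"
    proof (rule tot_eqI[OF am[OF gH] z])
      show "aug_map D n g i x = z i x" if "x \<in> carrier (F i)" for i x
        using that am0[of x] amS zS g(2)[of x] by (cases i) (auto simp del: of_nat_Suc)
    qed
    then have "u \<ominus>\<^bsub>obj (tot D) n\<^esub> aug_map D n g = ?d"
      unfolding z_def using T.M.diff_diff_cancel[OF u d] by simp
    ultimately show "\<exists>g\<in>cocycles ?H n. u \<ominus>\<^bsub>obj (tot D) n\<^esub> aug_map D n g \<in> coboundaries (tot D) n"
      using w by (auto simp: coboundaries_def)
  qed
qed

end

section \<open>The total complex over a complex with cohomology \<open>E\<close> in a single
  degree\<close>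

context finite_free_resolution
begin

context
  fixes T :: "('a, 't) cochain" and E :: "('a, 'e) module" and e :: "'t \<Rightarrow> 'e" and t :: int
  assumes T: "cochain_complex R T" and E: "injective_module R E"
    and e: "e \<in> mod_hom R (obj T t) E"
    and ed: "\<And>x. x \<in> coboundaries T t \<Longrightarrow> e x = \<zero>\<^bsub>E\<^esub>"
    and exact_off: "\<And>n. n \<noteq> t \<Longrightarrow> cocycles T n \<subseteq> coboundaries T n"
    and e_surj: "\<And>y. y \<in> carrier E \<Longrightarrow> \<exists>x\<in>cocycles T t. e x = y"
    and e_ker: "\<And>x. x \<in> cocycles T t \<Longrightarrow> e x = \<zero>\<^bsub>E\<^esub> \<Longrightarrow> x \<in> coboundaries T t"
begin

private lemma mT: "module R (obj T n)" by (rule cochain_complexD(1)[OF T])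
private lemma mE: "module R E" by (rule injectiveD[OF E])

interpretation MT: module R "obj T k" for k by (rule mT)
interpretation ME: module R E by (rule mE)

text \<open>The kernel of the chain map from \<open>T\<close> to \<open>E[-t]\<close> given by
  \<open>e\<close>. Its exactness expresses that this chain map is a quasi-isomorphism.\<close>

private definition T0 :: "('a, 't) cochain"
  where "T0 = \<lparr>obj = (\<lambda>n. (obj T n)\<lparr>carrier := {x \<in> carrier (obj T n). n = t \<longrightarrow> e x = \<zero>\<^bsub>E\<^esub>}\<rparr>), dif = dif T\<rparr>"

private lemma T0_sub: "submodule {x \<in> carrier (obj T n). n = t \<longrightarrow> e x = \<zero>\<^bsub>E\<^esub>} R (obj T n)"
proof (cases "n = t")
  case True
  then show ?thesis using submodule_kernel[OF mT mE e] by simp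
next
  case False
  then show ?thesis using submodule_carrier[OF mT] by simp
qed

private lemma T0_simps: "carrier (obj T0 n) = {x \<in> carrier (obj T n). n = t \<longrightarrow> e x = \<zero>\<^bsub>E\<^esub>}"
  "dif T0 = dif T" "add (obj T0 n) = add (obj T n)" "smult (obj T0 n) = smult (obj T n)"
  "\<zero>\<^bsub>obj T0 n\<^esub> = \<zero>\<^bsub>obj T n\<^esub>"
  by (simp_all add: T0_def)

private lemma T0_complex: "cochain_complex R T0"
  unfolding cochain_complex_def
proof (intro allI conjI ballI)
  fix n
  show "module R (obj T0 n)" unfolding T0_def using module_sub[OF mT T0_sub] by simp
  have d: "dif T n \<in> mod_hom R (obj T n) (obj T (n + 1))" by (rule cochain_complexD(2)[OF T])
  show "dif T0 n \<in> mod_hom R (obj T0 n) (obj T0 (n + 1))"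
  proof (rule mod_homI)
    fix x assume "x \<in> carrier (obj T0 n)"
    then have x: "x \<in> carrier (obj T n)" by (simp add: T0_simps)
    have "dif T n x \<in> coboundaries T t" if "n + 1 = t" using that x by (auto simp: coboundaries_def)
    then show "dif T0 n x \<in> carrier (obj T0 (n + 1))"
      using mod_homD(1)[OF d x] ed by (simp add: T0_simps)
  qed (use mod_homD[OF d] in \<open>auto simp: T0_simps\<close>)
  show "dif T0 (n + 1) (dif T0 n x) = \<zero>\<^bsub>obj T0 (n + 1 + 1)\<^esub>" if "x \<in> carrier (obj T0 n)" for x
    using that cochain_complexD(4)[OF T, of x n] by (simp add: T0_simps add.assoc)
qed

text \<open>In degree \<open>t\<close> this is \<open>e_ker\<close>. In degree \<open>t + 1\<close>
  a primitive \<open>y\<close> may lie outside the kernel of \<open>e\<close>; it is corrected by a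
  cocycle with the same value under \<open>e\<close>, which leaves its differential
  unchanged.\<close>

private lemma T0_exact: "exact T0"
  unfolding exact_def
proof (intro allI subsetI)
  fix n x assume "x \<in> cocycles T0 n"
  then have x: "x \<in> cocycles T n" and ex: "n = t \<Longrightarrow> e x = \<zero>\<^bsub>E\<^esub>" by (auto simp: cocycles_def T0_simps)
  have "x \<in> coboundaries T n" using x ex e_ker exact_off by (cases "n = t") auto
  then obtain y where y: "y \<in> carrier (obj T (n - 1))" "x = dif T (n - 1) y" by (auto simp: coboundaries_def)
  show "x \<in> coboundaries T0 n"
  proof (cases "n - 1 = t")
    case False
    then show ?thesis using y by (auto simp: coboundaries_def T0_simps)
  next
    case True
    obtain z where z: "z \<in> cocycles T t" "e z = e y"
      using e_surj[of "e y"] mod_homD(1)[OF e, of y] y(1) unfolding True by blast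
    have c: "y \<in> carrier (obj T t)" "z \<in> carrier (obj T t)" using y(1) True z(1) by (auto simp: cocycles_def)
    have n: "n = t + 1" using True by simp
    let ?w = "y \<ominus>\<^bsub>obj T t\<^esub> z"
    have "e ?w = \<zero>\<^bsub>E\<^esub>" using mod_hom_diff[OF mT mE e c] z(2) mod_homD(1)[OF e c(1)] by (simp add: a_minus_def ME.M.r_neg)
    moreover have "dif T t ?w = x"
      using mod_hom_diff[OF mT mT cochain_complexD(2)[OF T] c] z(1) y(2)
        mod_homD(1)[OF cochain_complexD(2)[OF T] c(1)] unfolding n
      by (simp add: cocycles_def a_minus_def)
    moreover have "?w \<in> carrier (obj T t)" by (rule module_diff_closed[OF mT c])
    ultimately show ?thesis unfolding coboundaries_def True T0_simps by auto
  qed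
qed

private lemma tot_T0_dif: "dif (tot T0) n f = dif (tot T) n f"
  by (simp add: tot_def T0_simps cong: nat.case_cong)

private lemma tot_T0_zero: "\<zero>\<^bsub>obj (tot T0) n\<^esub> = \<zero>\<^bsub>obj (tot T) n\<^esub>"
  by (simp add: tot_ops T0_simps)

private lemma mod_hom_T0: "h \<in> mod_hom R A (obj T0 n) \<longleftrightarrow>
    h \<in> mod_hom R A (obj T n) \<and> (\<forall>x\<in>carrier A. n = t \<longrightarrow> e (h x) = \<zero>\<^bsub>E\<^esub>)"
  by (auto simp: mod_hom_def T0_simps Pi_iff)

private lemma tot_T0_carrier: "f \<in> carrier (obj (tot T0) n) \<longleftrightarrow>
    f \<in> carrier (obj (tot T) n) \<and> (\<forall>i. \<forall>x\<in>carrier (F i). n - int i = t \<longrightarrow> e (f i x) = \<zero>\<^bsub>E\<^esub>)"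
  unfolding tot_carrier_iff mod_hom_T0 by blast

text \<open>Such a cocycle lies in the total complex of the exact \<open>T0\<close>, so
  \<open>exact_tot\<close> supplies a primitive there. Both results on \<open>tot T\<close> below
  reduce to arranging that \<open>e\<close> does not see the cocycle.\<close>

private lemma kill:
  assumes u: "u \<in> cocycles (tot T) n"
    and eu: "\<And>i x. x \<in> carrier (F i) \<Longrightarrow> n - int i = t \<Longrightarrow> e (u i x) = \<zero>\<^bsub>E\<^esub>"
  obtains w where "w \<in> carrier (obj (tot T) (n - 1))" "dif (tot T) (n - 1) w = u"
    "\<And>i x. x \<in> carrier (F i) \<Longrightarrow> n - 1 - int i = t \<Longrightarrow> e (w i x) = \<zero>\<^bsub>E\<^esub>"
proof -
  have "u \<in> cocycles (tot T0) n"
    using u eu by (auto simp: cocycles_def tot_T0_carrier tot_T0_dif tot_T0_zero)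
  then have "u \<in> coboundaries (tot T0) n" using exact_tot[OF T0_complex T0_exact] by (auto simp: exact_def)
  then obtain w where "w \<in> carrier (obj (tot T0) (n - 1))" "u = dif (tot T) (n - 1) w"
    by (auto simp: coboundaries_def tot_T0_dif)
  then show thesis using that by (auto simp: tot_T0_carrier)
qed

text \<open>Composition with \<open>e\<close> turns \<open>u\<close> into a cocycle of
  \<open>Hom(F, E)\<close>: in the equation for \<open>dif (tot T) n u\<close> the term with the
  differential of \<open>T\<close> is a coboundary up to sign, and \<open>e\<close> kills
  it.\<close>

private lemma e_cocycle:
  assumes u: "u \<in> cocycles (tot T) n" and n: "n - int i = t" and x: "x \<in> carrier (F (Suc i))"
  shows "e (u i (\<delta> i x)) = \<zero>\<^bsub>E\<^esub>"
proof -
  have uc: "u \<in> carrier (obj (tot T) n)" and du: "dif (tot T) n u = \<zero>\<^bsub>obj (tot T) (n + 1)\<^esub>"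
    using u by (auto simp: cocycles_def)
  let ?d = "dif T (n - int (Suc i)) (u (Suc i) x)"
  have "?d \<in> coboundaries T t"
    using tot_val[OF uc x] n by (auto simp: coboundaries_def algebra_simps)
  then have ed': "e ?d = \<zero>\<^bsub>E\<^esub>" by (rule ed)
  have c: "?d \<in> carrier (obj T t)" "u i (\<delta> i x) \<in> carrier (obj T t)"
    using dDc_Suc[OF T tot_val[OF uc x]] tot_val[OF uc bdc[OF x]] n by simp_all
  have "\<sigma> (Suc i) \<odot>\<^bsub>obj T t\<^esub> ?d \<oplus>\<^bsub>obj T t\<^esub> u i (\<delta> i x) = dif (tot T) n u (Suc i) x"
    using dif_tot_Suc[OF T x, of n u] n by simp
  also have "\<dots> = \<zero>\<^bsub>obj T t\<^esub>" using x n by (simp add: du tot_ops)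
  finally have "e (\<sigma> (Suc i) \<odot>\<^bsub>obj T t\<^esub> ?d \<oplus>\<^bsub>obj T t\<^esub> u i (\<delta> i x)) = \<zero>\<^bsub>E\<^esub>"
    using mod_hom_zero[OF mT mE e] by simp
  then show ?thesis
    using mod_homD(2)[OF e MT.smult_closed[OF \<sigma> c(1)] c(2)] mod_homD(3)[OF e \<sigma> c(1)] ed' mod_homD(1)[OF e c(2)] by simp
qed

private lemma mTot: "module R (obj (tot T) n)" by (rule cochain_complexD(1)[OF cochain_complex_tot[OF T]])

interpretation Tot: module R "obj (tot T) k" for k by (rule mTot)

private lemma tot_diff_val:
  assumes "f \<in> carrier (obj (tot T) n)" "g \<in> carrier (obj (tot T) n)" "x \<in> carrier (F i)"
  shows "(f \<ominus>\<^bsub>obj (tot T) n\<^esub> g) i x = f i x \<ominus>\<^bsub>obj T (n - int i)\<^esub> g i x"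
proof -
  have "f = (f \<ominus>\<^bsub>obj (tot T) n\<^esub> g) \<oplus>\<^bsub>obj (tot T) n\<^esub> g"
    using assms by (simp add: a_minus_def Tot.M.a_assoc Tot.M.l_neg)
  then have "f i x = (f \<ominus>\<^bsub>obj (tot T) n\<^esub> g) i x \<oplus>\<^bsub>obj T (n - int i)\<^esub> g i x"
    using assms(3) by (metis (no_types, lifting) restrict_apply' tot_ops(2))
  then show ?thesis
    using tot_val[OF module_diff_closed[OF mTot assms(1,2)] assms(3)] tot_val[OF assms(2,3)]
    by (simp add: MT.M.add_diff_cancel)
qed

private definition single :: "int \<Rightarrow> nat \<Rightarrow> ((nat \<Rightarrow> 'a) \<Rightarrow> 't) \<Rightarrow> nat \<Rightarrow> (nat \<Rightarrow> 'a) \<Rightarrow> 't"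
  where "single n j w = (\<lambda>i. \<lambda>x\<in>carrier (F i). if i = j then w x else \<zero>\<^bsub>obj T (n - int i)\<^esub>)"

private lemma single_closed:
  assumes "w \<in> mod_hom R (F j) (obj T (n - int j))" shows "single n j w \<in> carrier (obj (tot T) n)"
  unfolding single_def
proof (rule tot_restrict)
  show "(\<lambda>x. if i = j then w x else \<zero>\<^bsub>obj T (n - int i)\<^esub>) \<in> mod_hom R (F i) (obj T (n - int i))" for i
    using assms mod_hom_zero_map[OF mT] by (cases "i = j") auto
qed

private lemma dif_single_Suc:
  assumes w: "w \<in> mod_hom R (F j) (obj T (n - int j))" and x: "x \<in> carrier (F (Suc j))"
  shows "dif (tot T) n (single n j w) (Suc j) x = w (\<delta> j x)"
proof -
  have "dif T (n - int (Suc j)) \<zero>\<^bsub>obj T (n - int (Suc j))\<^esub> = \<zero>\<^bsub>obj T (n - int j)\<^esub>"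
    using mod_hom_zero[OF mT mT dD'[OF T, of n "Suc j"]] by simp
  then show ?thesis
    unfolding dif_tot_Suc[OF T x] using x bdc[OF x] mod_homD(1)[OF w bdc[OF x]]
    by (simp add: single_def del: of_nat_Suc)
qed

text \<open>For \<open>n < t\<close> no component takes values in degree \<open>t\<close>. For
  \<open>n > t\<close> exactly component \<open>Suc j\<close> does; its composite with
  \<open>e\<close> kills the kernel of \<open>\<delta> j\<close>, hence extends over
  \<open>F j\<close> because \<open>E\<close> is injective, and the extension lifts to
  \<open>w\<close> because \<open>F j\<close> is free. Subtracting the differential of
  \<open>w\<close> leaves a cocycle invisible to \<open>e\<close>.\<close>

lemma tot_exact_off:
  assumes n: "n \<noteq> t" shows "cocycles (tot T) n \<subseteq> coboundaries (tot T) n"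
proof
  fix u assume u: "u \<in> cocycles (tot T) n"
  then have uc: "u \<in> carrier (obj (tot T) n)" by (simp add: cocycles_def)
  show "u \<in> coboundaries (tot T) n"
  proof (cases "n < t")
    case True
    obtain w where "w \<in> carrier (obj (tot T) (n - 1))" "dif (tot T) (n - 1) w = u"
      by (rule kill[OF u]) (use True in auto)
    then show ?thesis by (auto simp: coboundaries_def)
  next
    case False
    define j where "j = nat (n - t - 1)"
    have j: "n - int (Suc j) = t" "n - 1 - int j = t" using False n by (auto simp: j_def)
    have uj: "u (Suc j) \<in> mod_hom R (F (Suc j)) (obj T t)" using tot_hom[OF uc, of "Suc j"] unfolding j(1) .
    have "e (u (Suc j) x) = \<zero>\<^bsub>E\<^esub>" if "x \<in> carrier (F (Suc j))" "\<delta> j x = \<zero>\<^bsub>F j\<^esub>" for x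
    proof -
      have "x \<in> \<delta> (Suc j) ` carrier (F (Suc (Suc j)))" using that exact_Suc by blast
      then show ?thesis using e_cocycle[OF u j(1)] by blast
    qed
    then obtain \<omega> where \<omega>: "\<omega> \<in> mod_hom R (F j) E" "\<And>x. x \<in> carrier (F (Suc j)) \<Longrightarrow> \<omega> (\<delta> j x) = e (u (Suc j) x)"
      using injective_extend[OF E F F bd mod_hom_comp[OF uj e]] by blast
    have "\<omega> x \<in> e ` carrier (obj T t)" if x: "x \<in> carrier (F j)" for x
    proof -
      obtain z where "z \<in> cocycles T t" "e z = \<omega> x" using e_surj[OF mod_homD(1)[OF \<omega>(1) x]] by blast
      then show ?thesis by (force simp: cocycles_def)
    qed
    then have "\<omega> ` carrier (F j) \<subseteq> e ` carrier (obj T t)" by blast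
    then obtain w where w: "w \<in> mod_hom R (F j) (obj T t)" "\<And>x. x \<in> carrier (F j) \<Longrightarrow> e (w x) = \<omega> x"
      using projective_lift[OF projective_F mT mE e \<omega>(1)] by blast
    define W where "W = single (n - 1) j w"
    have w': "w \<in> mod_hom R (F j) (obj T (n - 1 - int j))" using w(1) unfolding j(2) .
    have W: "W \<in> carrier (obj (tot T) (n - 1))" unfolding W_def by (rule single_closed[OF w'])
    let ?d = "dif (tot T) (n - 1) W"
    have db: "?d \<in> coboundaries (tot T) n" using W by (auto simp: coboundaries_def)
    have dc: "?d \<in> carrier (obj (tot T) n)" using dif_tot_hom[OF T W] by simp
    have z: "u \<ominus>\<^bsub>obj (tot T) n\<^esub> ?d \<in> cocycles (tot T) n"
      using submoduleD(7)[OF mTot submodule_cocycles[OF cochain_complex_tot[OF T]] u]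
        coboundaries_cocycles[OF cochain_complex_tot[OF T]] db by blast
    have "e ((u \<ominus>\<^bsub>obj (tot T) n\<^esub> ?d) i x) = \<zero>\<^bsub>E\<^esub>" if x: "x \<in> carrier (F i)" and i: "n - int i = t" for i x
    proof -
      have ij: "i = Suc j" using i j(1) by linarith
      have xs: "x \<in> carrier (F (Suc j))" using x ij by simp
      have c: "u (Suc j) x \<in> carrier (obj T t)" "w (\<delta> j x) \<in> carrier (obj T t)"
        using mod_homD(1)[OF uj xs] mod_homD(1)[OF w(1) bdc[OF xs]] .
      have "(u \<ominus>\<^bsub>obj (tot T) n\<^esub> ?d) i x = u (Suc j) x \<ominus>\<^bsub>obj T t\<^esub> w (\<delta> j x)"
        unfolding tot_diff_val[OF uc dc x] i unfolding ij W_def dif_single_Suc[OF w' xs] ..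
      then show ?thesis
        using mod_hom_diff[OF mT mE e c] w(2)[OF bdc[OF xs]] \<omega>(2)[OF xs] mod_homD(1)[OF e c(1)]
        by (simp add: ME.M.diff_zero_iff)
    qed
    from kill[OF z this] obtain v where "v \<in> carrier (obj (tot T) (n - 1))"
      "dif (tot T) (n - 1) v = u \<ominus>\<^bsub>obj (tot T) n\<^esub> ?d" by metis
    then have "u \<ominus>\<^bsub>obj (tot T) n\<^esub> ?d \<in> coboundaries (tot T) n"
      unfolding coboundaries_def by (metis image_eqI)
    from submoduleD(4)[OF mTot submodule_coboundaries[OF cochain_complex_tot[OF T]] this db]
    show ?thesis using uc dc by (simp add: a_minus_def Tot.M.a_assoc Tot.M.l_neg)
  qed
qed

text \<open>The class of a cocycle \<open>u\<close> is read off from \<open>e\<close> after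
  component \<open>0\<close>, which vanishes on the image of \<open>\<delta> 0\<close> and so
  factors through \<open>\<epsilon>\<close>. The kernel is handled by \<open>kill\<close>; for
  surjectivity a map \<open>h\<close> is lifted along \<open>e\<close>, and the lift is corrected to
  a cocycle.\<close>

lemma tot_cohomology_top:
  "\<exists>\<theta>\<in>mod_hom R ((obj (tot T) t)\<lparr>carrier := cocycles (tot T) t\<rparr>) (Hom_module R M E).
    \<theta> ` cocycles (tot T) t = carrier (Hom_module R M E) \<and>
    (\<forall>u\<in>cocycles (tot T) t. \<theta> u = \<zero>\<^bsub>Hom_module R M E\<^esub> \<longleftrightarrow> u \<in> coboundaries (tot T) t)"
proof -
  let ?H = "Hom_module R M E" and ?Z = "cocycles (tot T) t"
  interpret H: module R ?H by (rule module_Hom[OF M mE])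
  note \<epsilon>c = mod_homD(1)[OF aug]
  have uc: "u \<in> carrier (obj (tot T) t)" if "u \<in> ?Z" for u using that by (simp add: cocycles_def)
  have u0: "u 0 \<in> mod_hom R (F 0) (obj T t)" if "u \<in> ?Z" for u using tot_hom[OF uc[OF that], of 0] by simp
  have "\<exists>g. g \<in> carrier ?H \<and> (\<forall>x\<in>carrier (F 0). g (\<epsilon> x) = e (u 0 x))" if u: "u \<in> ?Z" for u
  proof -
    obtain g where "g \<in> carrier ?H" "\<And>x. x \<in> carrier (F 0) \<Longrightarrow> g (\<epsilon> x) = e (u 0 x)"
      by (rule hom_factor_aug[OF mE mod_hom_comp[OF u0[OF u] e]]) (use e_cocycle[OF u, of 0] in auto)
    then show ?thesis by blast
  qed
  then obtain \<theta> where \<theta>: "\<And>u. u \<in> ?Z \<Longrightarrow> \<theta> u \<in> carrier ?H"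
    "\<And>u x. u \<in> ?Z \<Longrightarrow> x \<in> carrier (F 0) \<Longrightarrow> \<theta> u (\<epsilon> x) = e (u 0 x)" by metis
  have uniq: "g = h" if "g \<in> carrier ?H" "h \<in> carrier ?H" "\<And>x. x \<in> carrier (F 0) \<Longrightarrow> g (\<epsilon> x) = h (\<epsilon> x)" for g h
    using that by (intro epi_eqI) auto
  note Zs = submodule_cocycles[OF cochain_complex_tot[OF T], of t]
  show ?thesis
  proof (intro bexI[of _ \<theta>] conjI ballI)
    show "\<theta> \<in> mod_hom R ((obj (tot T) t)\<lparr>carrier := ?Z\<rparr>) ?H"
    proof (rule mod_homI)
      fix u assume "u \<in> carrier ((obj (tot T) t)\<lparr>carrier := ?Z\<rparr>)"
      then have u: "u \<in> ?Z" by simp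
      show "\<theta> u \<in> carrier ?H" by (rule \<theta>(1)[OF u])
      show "\<theta> (r \<odot>\<^bsub>(obj (tot T) t)\<lparr>carrier := ?Z\<rparr>\<^esub> u) = r \<odot>\<^bsub>?H\<^esub> \<theta> u" if r: "r \<in> carrier R" for r
      proof (rule uniq)
        have ru: "r \<odot>\<^bsub>obj (tot T) t\<^esub> u \<in> ?Z" by (rule submoduleD(5)[OF mTot Zs r u])
        then show "\<theta> (r \<odot>\<^bsub>(obj (tot T) t)\<lparr>carrier := ?Z\<rparr>\<^esub> u) \<in> carrier ?H" using \<theta>(1) by simp
        show "r \<odot>\<^bsub>?H\<^esub> \<theta> u \<in> carrier ?H" by (rule H.smult_closed[OF r \<theta>(1)[OF u]])
        show "\<theta> (r \<odot>\<^bsub>(obj (tot T) t)\<lparr>carrier := ?Z\<rparr>\<^esub> u) (\<epsilon> x) = (r \<odot>\<^bsub>?H\<^esub> \<theta> u) (\<epsilon> x)" if x: "x \<in> carrier (F 0)" for x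
          using \<theta>(2)[OF ru x] \<theta>(2)[OF u x] x \<epsilon>c[OF x] mod_homD(3)[OF e r mod_homD(1)[OF u0[OF u] x]]
          by (simp add: tot_ops)
      qed
      fix v assume "v \<in> carrier ((obj (tot T) t)\<lparr>carrier := ?Z\<rparr>)"
      then have v: "v \<in> ?Z" by simp
      show "\<theta> (u \<oplus>\<^bsub>(obj (tot T) t)\<lparr>carrier := ?Z\<rparr>\<^esub> v) = \<theta> u \<oplus>\<^bsub>?H\<^esub> \<theta> v"
      proof (rule uniq)
        have uv: "u \<oplus>\<^bsub>obj (tot T) t\<^esub> v \<in> ?Z" by (rule submoduleD(4)[OF mTot Zs u v])
        then show "\<theta> (u \<oplus>\<^bsub>(obj (tot T) t)\<lparr>carrier := ?Z\<rparr>\<^esub> v) \<in> carrier ?H" using \<theta>(1) by simp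
        show "\<theta> u \<oplus>\<^bsub>?H\<^esub> \<theta> v \<in> carrier ?H" by (rule H.M.a_closed[OF \<theta>(1)[OF u] \<theta>(1)[OF v]])
        show "\<theta> (u \<oplus>\<^bsub>(obj (tot T) t)\<lparr>carrier := ?Z\<rparr>\<^esub> v) (\<epsilon> x) = (\<theta> u \<oplus>\<^bsub>?H\<^esub> \<theta> v) (\<epsilon> x)" if x: "x \<in> carrier (F 0)" for x
          using \<theta>(2)[OF uv x] \<theta>(2)[OF u x] \<theta>(2)[OF v x] x \<epsilon>c[OF x]
            mod_homD(2)[OF e mod_homD(1)[OF u0[OF u] x] mod_homD(1)[OF u0[OF v] x]]
          by (simp add: tot_ops)
      qed
    qed
    show "\<theta> u = \<zero>\<^bsub>?H\<^esub> \<longleftrightarrow> u \<in> coboundaries (tot T) t" if u: "u \<in> ?Z" for u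
    proof
      assume z: "\<theta> u = \<zero>\<^bsub>?H\<^esub>"
      have "e (u i x) = \<zero>\<^bsub>E\<^esub>" if x: "x \<in> carrier (F i)" and i: "t - int i = t" for i x
        using \<theta>(2)[OF u, of x] x i \<epsilon>c[of x] by (simp add: z)
      from kill[OF u this] obtain w where "w \<in> carrier (obj (tot T) (t - 1))" "dif (tot T) (t - 1) w = u" by metis
      then show "u \<in> coboundaries (tot T) t" by (auto simp: coboundaries_def)
    next
      assume "u \<in> coboundaries (tot T) t"
      then obtain w where w: "w \<in> carrier (obj (tot T) (t - 1))" "u = dif (tot T) (t - 1) w"
        by (auto simp: coboundaries_def)
      show "\<theta> u = \<zero>\<^bsub>?H\<^esub>"
      proof (rule uniq[OF \<theta>(1)[OF u] H.M.zero_closed])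
        fix x assume x: "x \<in> carrier (F 0)"
        have "u 0 x \<in> coboundaries T t"
          using dif_tot_0[OF T w(1) x] w(2) tot_val[OF w(1) x] by (auto simp: coboundaries_def)
        then show "\<theta> u (\<epsilon> x) = \<zero>\<^bsub>?H\<^esub> (\<epsilon> x)" using \<theta>(2)[OF u x] ed \<epsilon>c[OF x] by simp
      qed
    qed
    show "\<theta> ` ?Z = carrier ?H"
    proof (intro equalityI subsetI)
      show "h \<in> carrier ?H" if "h \<in> \<theta> ` ?Z" for h using that \<theta>(1) by blast
      fix h assume h: "h \<in> carrier ?H"
      then have hm: "h \<in> mod_hom R M E" by simp
      have he: "(\<lambda>x. h (\<epsilon> x)) \<in> mod_hom R (F 0) E" by (rule mod_hom_comp[OF aug hm])
      let ?ZT = "(obj T t)\<lparr>carrier := cocycles T t\<rparr>"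
      have eZ: "e \<in> mod_hom R ?ZT E" by (rule mod_hom_sub_dom[OF e]) (auto simp: cocycles_def)
      have "h (\<epsilon> x) \<in> e ` carrier ?ZT" if x: "x \<in> carrier (F 0)" for x
      proof -
        obtain z where "z \<in> cocycles T t" "e z = h (\<epsilon> x)" using e_surj[OF mod_homD(1)[OF he x]] by blast
        then show ?thesis by force
      qed
      then have "(\<lambda>x. h (\<epsilon> x)) ` carrier (F 0) \<subseteq> e ` carrier ?ZT" by blast
      then obtain w where w: "w \<in> mod_hom R (F 0) ?ZT" "\<And>x. x \<in> carrier (F 0) \<Longrightarrow> e (w x) = h (\<epsilon> x)"
        using projective_lift[OF projective_F module_cocycles[OF T] mE eZ he] by blast
      have w': "w \<in> mod_hom R (F 0) (obj T (t - int 0))"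
        using mod_hom_sub_codD[OF w(1)] by (simp add: cocycles_def)
      define W where "W = single t 0 w"
      have W: "W \<in> carrier (obj (tot T) t)" unfolding W_def by (rule single_closed[OF w'])
      define v where "v = dif (tot T) t W"
      have vb: "v \<in> coboundaries (tot T) (t + 1)" using W by (auto simp: coboundaries_def v_def)
      then have vz: "v \<in> cocycles (tot T) (t + 1)" using coboundaries_cocycles[OF cochain_complex_tot[OF T]] by blast
      have "e (v i x) = \<zero>\<^bsub>E\<^esub>" if x: "x \<in> carrier (F i)" and i: "t + 1 - int i = t" for i x
      proof -
        have i1: "i = Suc 0" using i by simp
        have xs: "x \<in> carrier (F (Suc 0))" using x i1 by simp
        show ?thesis
          unfolding v_def W_def i1 dif_single_Suc[OF w' xs] using w(2)[OF bdc[OF xs]] aug_bd[of x] xs mod_hom_zero[OF M mE hm] by simp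
      qed
      \<comment> \<open>The lift \<open>W\<close> may fail to be a cocycle, but \<open>e\<close>
        kills its differential \<open>v\<close>, as \<open>h\<close> after \<open>\<epsilon>\<close>
        vanishes on the image of \<open>\<delta> 0\<close>. A primitive \<open>y\<close> of
        \<open>v\<close> that \<open>e\<close> kills as well corrects \<open>W\<close> without
        changing its value under \<open>e\<close>.\<close>
      from kill[OF vz this] obtain y where y: "y \<in> carrier (obj (tot T) t)" "dif (tot T) t y = v"
        "\<And>i x. x \<in> carrier (F i) \<Longrightarrow> t - int i = t \<Longrightarrow> e (y i x) = \<zero>\<^bsub>E\<^esub>" by (metis add_diff_cancel_right')
      define u where "u = W \<ominus>\<^bsub>obj (tot T) t\<^esub> y"
      have uc: "u \<in> carrier (obj (tot T) t)" unfolding u_def by (rule module_diff_closed[OF mTot W y(1)])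
      have "v \<in> carrier (obj (tot T) (t + 1))" using vz by (simp add: cocycles_def)
      then have "dif (tot T) t u = \<zero>\<^bsub>obj (tot T) (t + 1)\<^esub>"
        unfolding u_def mod_hom_diff[OF mTot mTot cochain_complexD(2)[OF cochain_complex_tot[OF T]] W y(1)]
        by (simp add: v_def[symmetric] y(2) a_minus_def Tot.M.r_neg)
      then have u: "u \<in> ?Z" using uc by (simp add: cocycles_def)
      have "\<theta> u = h"
      proof (rule uniq[OF \<theta>(1)[OF u] h])
        fix x assume x: "x \<in> carrier (F 0)"
        have c: "w x \<in> carrier (obj T t)" "y 0 x \<in> carrier (obj T t)"
          using mod_homD(1)[OF w' x] tot_val[OF y(1) x] by simp_all
        have "u 0 x = w x \<ominus>\<^bsub>obj T t\<^esub> y 0 x"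
          unfolding u_def tot_diff_val[OF W y(1) x] using x by (simp add: W_def single_def)
        then have "e (u 0 x) = e (w x)"
          using mod_hom_diff[OF mT mE e c] y(3)[OF x] mod_homD(1)[OF e c(1)] by (simp add: a_minus_def)
        then show "\<theta> u (\<epsilon> x) = h (\<epsilon> x)" using \<theta>(2)[OF u x] w(2)[OF x] by simp
      qed
      then show "h \<in> \<theta> ` ?Z" using u by blast
    qed
  qed
qed

end

end

text \<open>The roof yields a homomorphism to \<open>E\<close> only from the cocycles of
  \<open>T\<close> in degree \<open>t\<close>, through their cohomology; injectivity of
  \<open>E\<close> extends it to all of \<open>obj T t\<close>. The abstract isomorphism thus
  becomes a single map \<open>e\<close> with which elements can be chased.\<close>

lemma derived_iso_in_degree:
  fixes T :: "('a, 't) cochain"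
  assumes T: "cochain_complex R T" and E: "injective_module R E" and di: "derived_iso R T (in_degree t E)"
  obtains e where "e \<in> mod_hom R (obj T t) E"
    "\<And>x. x \<in> coboundaries T t \<Longrightarrow> e x = \<zero>\<^bsub>E\<^esub>"
    "\<And>n. n \<noteq> t \<Longrightarrow> cocycles T n \<subseteq> coboundaries T n"
    "\<And>y. y \<in> carrier E \<Longrightarrow> \<exists>x\<in>cocycles T t. e x = y"
    "\<And>x. x \<in> cocycles T t \<Longrightarrow> e x = \<zero>\<^bsub>E\<^esub> \<Longrightarrow> x \<in> coboundaries T t"
proof -
  let ?Y = "in_degree t E"
  obtain Z :: "('a, 't) cochain" and f g where "quasi_iso R Z T f" "quasi_iso R Z ?Y g"
    using di unfolding derived_iso_def by blast
  then have fq: "elementwise_quasi_iso R Z T f" and gq: "elementwise_quasi_iso R Z ?Y g"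
    by (auto intro: quasi_iso_elementwise)
  then have Z: "cochain_complex R Z" and Y: "cochain_complex R ?Y" and f: "chain_map R Z T f" and g: "chain_map R Z ?Y g"
    by (auto simp: elementwise_quasi_iso_def)
  note mZ = cochain_complexD(1)[OF Z] and mT = cochain_complexD(1)[OF T] and mE = injectiveD[OF E]
  interpret ME: module R E by (rule mE)
  interpret MT: module R "obj T k" for k by (rule mT)
  have Yt: "obj ?Y t = E" "coboundaries ?Y t = {\<zero>\<^bsub>E\<^esub>}" "cocycles ?Y t = carrier E"
    by (auto simp: in_degree_def coboundaries_def cocycles_def)
  have Yn: "carrier (obj ?Y n) = {\<zero>\<^bsub>E\<^esub>}" "\<zero>\<^bsub>E\<^esub> \<in> coboundaries ?Y n" if "n \<noteq> t" for n
    using that by (auto simp: in_degree_def coboundaries_def)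
  have gt: "g t \<in> mod_hom R (obj Z t) E" using chain_mapD(1)[OF g, of t] Yt by simp
  have bsub: "b \<in> carrier (obj T n)" if "b \<in> coboundaries T n" for b n
    by (rule submoduleD(2)[OF mT submodule_coboundaries[OF T] that])
  have zsub: "b \<in> carrier (obj T n)" if "b \<in> cocycles T n" for b n using that by (simp add: cocycles_def)
  have bdback: "y \<in> coboundaries T n" if "y \<in> carrier (obj T n)" "z \<in> coboundaries Z n" "y \<ominus>\<^bsub>obj T n\<^esub> f n z \<in> coboundaries T n" for y z n
  proof -
    have fz: "f n z \<in> coboundaries T n" by (rule chain_map_coboundaries[OF f that(2)])
    from submoduleD(4)[OF mT submodule_coboundaries[OF T] that(3) fz] show ?thesis
      using that(1) bsub[OF fz] by (simp add: a_minus_def MT.M.a_assoc MT.M.l_neg)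
  qed
  let ?ZT = "(obj T t)\<lparr>carrier := cocycles T t\<rparr>" and ?ZZ = "(obj Z t)\<lparr>carrier := cocycles Z t\<rparr>"
  let ?B = "coboundaries T t"
  note mZT = module_cocycles[OF T, of t] and mZZ = module_cocycles[OF Z, of t] and sB = submodule_coboundaries_cocycles[OF T, of t]
  let ?Q = "quotient_module ?ZT ?B"
  let ?\<pi> = "\<lambda>y. ?B +>\<^bsub>?ZT\<^esub> y"
  note mQ = module_quotient[OF mZT sB] and \<pi> = quotient_hom[OF mZT sB]
  have fz: "f t z \<in> cocycles T t" if "z \<in> cocycles Z t" for z by (rule chain_map_cocycles[OF Z T f that])
  have fZ: "f t \<in> mod_hom R ?ZZ ?ZT"
    by (rule mod_hom_sub_cod[OF mod_hom_sub_dom[OF chain_mapD(1)[OF f]]]) (auto simp: fz cocycles_def[of Z])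
  have gZ: "g t \<in> mod_hom R ?ZZ E" by (rule mod_hom_sub_dom[OF gt]) (auto simp: cocycles_def)
  have pi_eq: "?\<pi> y = ?\<pi> y' \<longleftrightarrow> y \<ominus>\<^bsub>obj T t\<^esub> y' \<in> ?B" if yy: "y \<in> cocycles T t" "y' \<in> cocycles T t" for y y'
    using coset_eq_iff[OF mZT sB, of y y'] minus_sub'[OF mT submodule_cocycles[OF T] yy] yy by simp
  have pi_0: "?\<pi> y = \<zero>\<^bsub>?Q\<^esub> \<longleftrightarrow> y \<in> ?B" if "y \<in> cocycles T t" for y
    using coset_eq_zero_iff[OF mZT sB, of y] that by simp
  have "(\<lambda>z. ?\<pi> (f t z)) ` carrier ?ZZ = carrier ?Q"
  proof (intro equalityI subsetI)
    show "C \<in> carrier ?Q" if "C \<in> (\<lambda>z. ?\<pi> (f t z)) ` carrier ?ZZ" for C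
      using that mod_homD(1)[OF mod_hom_comp[OF fZ \<pi>]] by blast
    fix C assume "C \<in> carrier ?Q"
    then obtain y where y: "y \<in> cocycles T t" "C = ?\<pi> y" using quotient_surj[OF mZT sB] by auto
    then obtain z where z: "z \<in> cocycles Z t" "y \<ominus>\<^bsub>obj T t\<^esub> f t z \<in> ?B"
      using fq unfolding elementwise_quasi_iso_def by blast
    then have "C = ?\<pi> (f t z)" using pi_eq[OF y(1) fz[OF z(1)]] y(2) by simp
    then show "C \<in> (\<lambda>z. ?\<pi> (f t z)) ` carrier ?ZZ" using z(1) by auto
  qed
  moreover have "g t z = \<zero>\<^bsub>E\<^esub>" if "z \<in> carrier ?ZZ" "?\<pi> (f t z) = \<zero>\<^bsub>?Q\<^esub>" for z
  proof -
    have z: "z \<in> cocycles Z t" using that(1) by simp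
    then have "f t z \<in> ?B" using pi_0[OF fz[OF z]] that(2) by simp
    then have "z \<in> coboundaries Z t" using fq z unfolding elementwise_quasi_iso_def by blast
    then show ?thesis using chain_map_coboundaries[OF g] Yt(2) by blast
  qed
  \<comment> \<open>\<open>g t\<close> descends along the surjection from the cocycles of
    \<open>Z\<close> onto the cohomology of \<open>T\<close>: if \<open>f t z\<close> is a
    coboundary, so is \<open>z\<close>, because \<open>f\<close> is injective on cohomology.\<close>
  ultimately obtain \<theta> where \<theta>: "\<theta> \<in> mod_hom R ?Q E" "\<And>z. z \<in> cocycles Z t \<Longrightarrow> \<theta> (?\<pi> (f t z)) = g t z"
    using mod_hom_factor_surj[OF mZZ mQ mE mod_hom_comp[OF fZ \<pi>] gZ] by auto
  have inc: "(\<lambda>x. x) \<in> mod_hom R ?ZT (obj T t)" by (rule mod_hom_sub_dom[OF mod_hom_id]) (auto simp: cocycles_def)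
  obtain e where e: "e \<in> mod_hom R (obj T t) E" "\<And>y. y \<in> cocycles T t \<Longrightarrow> e y = \<theta> (?\<pi> y)"
    using injective_module_extend[OF E mZT mT inc _ mod_hom_comp[OF \<pi> \<theta>(1)]] by auto
  have ef: "e (f t z) = g t z" if "z \<in> cocycles Z t" for z using e(2)[OF fz[OF that]] \<theta>(2)[OF that] by simp
  have eB: "e x = \<zero>\<^bsub>E\<^esub>" if x: "x \<in> ?B" for x
    using e(2)[of x] pi_0[of x] x coboundaries_cocycles[OF T, of t] mod_hom_zero[OF mQ mE \<theta>(1)] by auto
  show thesis
  proof (rule that[OF e(1) eB])
    fix n assume n: "n \<noteq> t"
    show "cocycles T n \<subseteq> coboundaries T n"
    proof
      fix y assume y: "y \<in> cocycles T n"
      obtain z where z: "z \<in> cocycles Z n" "y \<ominus>\<^bsub>obj T n\<^esub> f n z \<in> coboundaries T n"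
        using fq y unfolding elementwise_quasi_iso_def by blast
      have "g n z \<in> carrier (obj ?Y n)" using mod_homD(1)[OF chain_mapD(1)[OF g]] z(1) by (simp add: cocycles_def)
      then have "g n z \<in> coboundaries ?Y n" using Yn[OF n] by simp
      then have "z \<in> coboundaries Z n" using gq z(1) unfolding elementwise_quasi_iso_def by blast
      then show "y \<in> coboundaries T n" using bdback[OF zsub[OF y]] z(2) by blast
    qed
  next
    fix y assume y: "y \<in> carrier E"
    obtain z where z: "z \<in> cocycles Z t" "y \<ominus>\<^bsub>E\<^esub> g t z \<in> {\<zero>\<^bsub>E\<^esub>}"
      using gq y Yt unfolding elementwise_quasi_iso_def by metis
    have "g t z \<in> carrier E" using mod_homD(1)[OF gt] z(1) by (simp add: cocycles_def)
    then have "e (f t z) = y" using z y ef by (simp add: ME.M.diff_zero_iff)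
    then show "\<exists>x\<in>cocycles T t. e x = y" using fz[OF z(1)] by blast
  next
    fix y assume y: "y \<in> cocycles T t" and ey: "e y = \<zero>\<^bsub>E\<^esub>"
    obtain z where z: "z \<in> cocycles Z t" "y \<ominus>\<^bsub>obj T t\<^esub> f t z \<in> ?B"
      using fq y unfolding elementwise_quasi_iso_def by blast
    have "?\<pi> y = ?\<pi> (f t z)" using pi_eq[OF y fz[OF z(1)]] z(2) by simp
    then have "g t z = \<zero>\<^bsub>E\<^esub>" using e(2)[OF y] ey \<theta>(2)[OF z(1)] by simp
    then have "g t z \<in> coboundaries ?Y t" using Yt by simp
    then have "z \<in> coboundaries Z t" using gq z(1) unfolding elementwise_quasi_iso_def by blast
    then show "y \<in> ?B" using bdback[OF zsub[OF y]] z(2) by blast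
  qed
qed

text \<open>The resolution \<open>J\<close> and \<open>tot D\<close> both receive a
  quasi-isomorphism from \<open>Hom_into R M D\<close>; injectivity of \<open>tot D\<close> yields a
  compatible map from \<open>J\<close> to \<open>tot D\<close>, up to homotopy. As a
  quasi-isomorphism between bounded below complexes of injectives it stays one after torsion, and
  \<open>torsion_tot\<close> identifies the target with \<open>tot T\<close>.\<close>

lemma (in finite_free_resolution) local_cohomology_RHom:
  assumes I: "ideal I R" and D: "cochain_complex R D" and inj: "\<And>n. injective_module R (obj D n)"
    and bb: "bounded_below D" and E: "injective_module R E"
    and di: "derived_iso R (torsion_complex R I D) (in_degree t E)"
    and J: "injective_resolution R (Hom_into R M D) J"
  shows "mod_iso R (local_cohomology R I J t) (Hom_module R M E)"
    and "i \<noteq> t \<Longrightarrow> zero_module (local_cohomology R I J i)"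
proof -
  obtain f where bJ: "bounded_below J" and injJ: "\<And>n. injective_module R (obj J n)"
    and f: "quasi_iso R (Hom_into R M D) J f"
    using J unfolding injective_resolution_def by blast
  note fq = quasi_iso_elementwise[OF f] and hq = aug_quasi_iso[OF D inj bb]
  note K = cochain_complex_tot[OF D]
  have bK: "bounded_below (tot D)"
    using bb tot_zero[OF D] unfolding bounded_below_def by blast
  have h: "chain_map R (Hom_into R M D) (tot D) (aug_map D)" using hq by (simp add: elementwise_quasi_iso_def)
  obtain g \<tau> where g: "chain_map R J (tot D) g" and \<tau>: "\<And>n. \<tau> n \<in> mod_hom R (obj (Hom_into R M D) (n + 1)) (obj (tot D) n)"
    and gf: "\<And>n x. x \<in> carrier (obj (Hom_into R M D) (n + 1)) \<Longrightarrow> g (n + 1) (f (n + 1) x) =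
       aug_map D (n + 1) x \<oplus>\<^bsub>obj (tot D) (n + 1)\<^esub> (dif (tot D) n (\<tau> n x) \<oplus>\<^bsub>obj (tot D) (n + 1)\<^esub>
         \<tau> (n + 1) (dif (Hom_into R M D) (n + 1) x))"
    using extend_along_quasi_iso[OF fq K injective_tot[OF inj] bK h] by blast
  have gq: "elementwise_quasi_iso R J (tot D) g" by (rule quasi_iso_factor[where \<sigma> = \<tau>, OF fq hq g]) (rule \<tau>, rule gf)
  define T where "T = torsion_complex R I D"
  have T: "cochain_complex R T" unfolding T_def by (rule cochain_complex_torsion[OF I D])
  let ?J = "torsion_complex R I J"
  have tq: "elementwise_quasi_iso R ?J (tot T) g"
    using torsion_quasi_iso[OF I gq injJ injective_tot[OF inj] bJ bK] torsion_tot[OF D bb I] by (simp add: T_def)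
  then have Jc: "cochain_complex R ?J" and Tc: "cochain_complex R (tot T)" and gc: "chain_map R ?J (tot T) g"
    by (auto simp: elementwise_quasi_iso_def)
  obtain e where e: "e \<in> mod_hom R (obj T t) E"
    "\<And>x. x \<in> coboundaries T t \<Longrightarrow> e x = \<zero>\<^bsub>E\<^esub>"
    "\<And>n. n \<noteq> t \<Longrightarrow> cocycles T n \<subseteq> coboundaries T n"
    "\<And>y. y \<in> carrier E \<Longrightarrow> \<exists>x\<in>cocycles T t. e x = y"
    "\<And>x. x \<in> cocycles T t \<Longrightarrow> e x = \<zero>\<^bsub>E\<^esub> \<Longrightarrow> x \<in> coboundaries T t"
    by (rule derived_iso_in_degree[OF T E di[folded T_def]]) blast
  show "zero_module (local_cohomology R I J i)" if i: "i \<noteq> t"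
    unfolding local_cohomology_def zero_cohomology_iff[OF Jc]
  proof
    fix y assume y: "y \<in> cocycles ?J i"
    have "g i y \<in> coboundaries (tot T) i"
      using tot_exact_off[OF T E e i] chain_map_cocycles[OF Jc Tc gc y] by blast
    then show "y \<in> coboundaries ?J i" using tq y unfolding elementwise_quasi_iso_def by blast
  qed
  obtain \<theta> where \<theta>: "\<theta> \<in> mod_hom R ((obj (tot T) t)\<lparr>carrier := cocycles (tot T) t\<rparr>) (Hom_module R M E)"
    "\<theta> ` cocycles (tot T) t = carrier (Hom_module R M E)"
    "\<And>u. u \<in> cocycles (tot T) t \<Longrightarrow> \<theta> u = \<zero>\<^bsub>Hom_module R M E\<^esub> \<longleftrightarrow> u \<in> coboundaries (tot T) t"
    using tot_cohomology_top[OF T E e] by blast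
  have gz: "g t y \<in> cocycles (tot T) t" if "y \<in> cocycles ?J t" for y by (rule chain_map_cocycles[OF Jc Tc gc that])
  note mE = injectiveD[OF E]
  interpret H: module R "Hom_module R M E" by (rule module_Hom[OF M mE])
  interpret Z: module R "(obj (tot T) t)\<lparr>carrier := cocycles (tot T) t\<rparr>" by (rule module_cocycles[OF Tc])
  have gZ: "g t \<in> mod_hom R ((obj ?J t)\<lparr>carrier := cocycles ?J t\<rparr>) ((obj (tot T) t)\<lparr>carrier := cocycles (tot T) t\<rparr>)"
    by (rule mod_hom_sub_cod[OF mod_hom_sub_dom[OF chain_mapD(1)[OF gc]]]) (auto simp: gz cocycles_def[of ?J])
  show "mod_iso R (local_cohomology R I J t) (Hom_module R M E)"
    unfolding local_cohomology_def
  proof (rule mod_iso_cohomology[OF Jc H.module_axioms mod_hom_comp[OF gZ \<theta>(1)]])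
    show "\<theta> (g t y) = \<zero>\<^bsub>Hom_module R M E\<^esub> \<longleftrightarrow> y \<in> coboundaries ?J t" if y: "y \<in> cocycles ?J t" for y
      using \<theta>(3)[OF gz[OF y]] tq y chain_map_coboundaries[OF gc] unfolding elementwise_quasi_iso_def by blast
    show "(\<lambda>y. \<theta> (g t y)) ` cocycles ?J t = carrier (Hom_module R M E)"
    proof (intro equalityI subsetI)
      show "k \<in> carrier (Hom_module R M E)" if "k \<in> (\<lambda>y. \<theta> (g t y)) ` cocycles ?J t" for k
        using that \<theta>(2) gz by blast
      fix k assume "k \<in> carrier (Hom_module R M E)"
      then obtain u where u: "u \<in> cocycles (tot T) t" "k = \<theta> u" using \<theta>(2) by blast
      obtain y where y: "y \<in> cocycles ?J t" "u \<ominus>\<^bsub>obj (tot T) t\<^esub> g t y \<in> coboundaries (tot T) t"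
        using tq u(1) unfolding elementwise_quasi_iso_def by blast
      note s = submodule_cocycles[OF Tc, of t] and m = cochain_complexD(1)[OF Tc, of t]
      have "\<theta> (u \<ominus>\<^bsub>obj (tot T) t\<^esub> g t y) = \<zero>\<^bsub>Hom_module R M E\<^esub>"
        using \<theta>(3) submoduleD(7)[OF m s u(1) gz[OF y(1)]] y(2) by blast
      then have "\<theta> u = \<theta> (g t y)"
        using module_hom_eq_iff[OF Z.module_axioms H.module_axioms \<theta>(1), of u "g t y"] u(1) gz[OF y(1)]
          minus_sub'[OF m s u(1) gz[OF y(1)]] by simp
      then show "k \<in> (\<lambda>y. \<theta> (g t y)) ` cocycles ?J t" using u(2) y(1) by blast
    qed
  qed
qed

section \<open>Finiteness\<close>

lemma submodule_Inter:
  assumes M: "module R M" and "\<And>H. H \<in> A \<Longrightarrow> submodule H R M" and "A \<noteq> {}"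
  shows "submodule (\<Inter>A) R M"
proof (rule submoduleI'[OF M])
  note D = submoduleD[OF M assms(2)]
  obtain H where "H \<in> A" using assms(3) by blast
  then show "\<Inter>A \<subseteq> carrier M" using D(1)[of H] by blast
  show "\<zero>\<^bsub>M\<^esub> \<in> \<Inter>A" using D(3) by blast
  show "a \<oplus>\<^bsub>M\<^esub> b \<in> \<Inter>A" if "a \<in> \<Inter>A" "b \<in> \<Inter>A" for a b
    using that D(4)[of _ a b] by blast
  show "r \<odot>\<^bsub>M\<^esub> a \<in> \<Inter>A" if "r \<in> carrier R" "a \<in> \<Inter>A" for r a
    using that D(5)[of _ r a] by blast
qed

lemma submodule_Int:
  assumes M: "module R M" and "submodule H R M" "submodule K R M"
  shows "submodule (H \<inter> K) R M"
  using submodule_Inter[OF M, of "{H, K}"] assms(2,3) by auto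

lemma gen_submodule:
  assumes M: "module R M" and S: "S \<subseteq> carrier M"
  shows "submodule (gen_submodule R M S) R M" "S \<subseteq> gen_submodule R M S"
    "submodule H R M \<Longrightarrow> S \<subseteq> H \<Longrightarrow> gen_submodule R M S \<subseteq> H"
  unfolding gen_submodule_def
  using submodule_carrier[OF M] S by (auto intro!: submodule_Inter[OF M])

lemma submodule_finsum:
  assumes M: "module R M" and H: "submodule H R M" and A: "finite A" and f: "\<And>a. a \<in> A \<Longrightarrow> f a \<in> H"
  shows "(\<Oplus>\<^bsub>M\<^esub>a\<in>A. f a) \<in> H"
proof -
  interpret M: module R M by fact
  note Hc = submoduleD(2)[OF M H]
  show ?thesis using A f
  proof (induction A)
    case empty
    then show ?case using submoduleD(3)[OF M H] by simp
  next
    case (insert a A)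
    have "(\<Oplus>\<^bsub>M\<^esub>a\<in>insert a A. f a) = f a \<oplus>\<^bsub>M\<^esub> (\<Oplus>\<^bsub>M\<^esub>a\<in>A. f a)"
      using insert.hyps insert.prems Hc by (intro M.M.finsum_insert) auto
    then show ?case using submoduleD(4)[OF M H] insert by simp
  qed
qed

lemma hom_free_mem:
  assumes R: "cring R" and M: "module R M" and H: "submodule H R M"
    and f: "f \<in> mod_hom R (free_module R S) M" and u: "u \<in> carrier (free_module R S)"
    and mem: "\<And>s. s \<in> S \<Longrightarrow> u s \<noteq> \<zero>\<^bsub>R\<^esub> \<Longrightarrow> u s \<odot>\<^bsub>M\<^esub> f (unit_vec R S s) \<in> H"
  shows "f u \<in> H"
  unfolding hom_free_expand[OF R M f u] lin_ext_def
  by (rule submodule_finsum[OF M H]) (use u mem in \<open>auto simp: free_module_def\<close>)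

text \<open>The form of finite generation in which resolutions are built: the generators are the
  images of the unit vectors.\<close>

definition fin_gen :: "('a, 'r) ring_scheme \<Rightarrow> ('a, 'm) module \<Rightarrow> bool"
  where "fin_gen R M \<longleftrightarrow> module R M \<and>
    (\<exists>n. \<exists>\<pi>\<in>mod_hom R (free_module R {..<n::nat}) M. \<pi> ` carrier (free_module R {..<n}) = carrier M)"

text \<open>Generation of \<open>H\<close> is expressed through the submodules of the ambient
  \<open>M\<close>, so no module structure on \<open>H\<close> has to be named.\<close>

definition fg_sub :: "('a, 'r) ring_scheme \<Rightarrow> ('a, 'm) module \<Rightarrow> 'm set \<Rightarrow> bool"
  where "fg_sub R M H \<longleftrightarrow> (\<exists>S. finite S \<and> S \<subseteq> H \<and> (\<forall>K. submodule K R M \<and> S \<subseteq> K \<longrightarrow> H \<subseteq> K))"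

definition noetherian_module :: "('a, 'r) ring_scheme \<Rightarrow> ('a, 'm) module \<Rightarrow> bool"
  where "noetherian_module R M \<longleftrightarrow> module R M \<and> (\<forall>H. submodule H R M \<longrightarrow> fg_sub R M H)"

lemma submodule_of_sub_iff:
  assumes M: "module R M" and H: "submodule H R M" and K: "submodule K R (M\<lparr>carrier := H\<rparr>)"
  shows "submodule K R M"
proof (rule submoduleI'[OF M])
  note D = submoduleD[OF module_sub[OF M H] K]
  show "K \<subseteq> carrier M" using D(1) submoduleD(1)[OF M H] by auto
qed (use submoduleD[OF module_sub[OF M H] K] in auto)

lemma fg_sub_fin_gen:
  assumes M: "module R M" and H: "submodule H R M" and fg: "fg_sub R M H"
  shows "fin_gen R (M\<lparr>carrier := H\<rparr>)"
proof -
  interpret M: module R M by fact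
  note R = M.R.is_cring
  let ?H = "M\<lparr>carrier := H\<rparr>"
  have mH: "module R ?H" by (rule module_sub[OF M H])
  obtain S where S1: "finite S \<and> S \<subseteq> H \<and> (\<forall>K. submodule K R M \<and> S \<subseteq> K \<longrightarrow> H \<subseteq> K)"
    using fg[unfolded fg_sub_def] ..
  note S = conjunct1[OF S1] conjunct1[OF conjunct2[OF S1]] conjunct2[OF conjunct2[OF S1], rule_format, OF conjI]
  obtain b where b: "bij_betw b {..<card S} S"
    using ex_bij_betw_nat_finite[OF S(1)] by (auto simp: atLeast0LessThan)
  let ?F = "free_module R {..<card S}" and ?\<pi> = "lin_ext {..<card S} R ?H b"
  have bH: "b \<in> {..<card S} \<rightarrow> carrier ?H" using b S(2) by (auto simp: bij_betw_def)
  have \<pi>: "?\<pi> \<in> mod_hom R ?F ?H" by (rule lin_ext_hom[OF mH bH])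
  have F: "module R ?F" by (rule module_free_module[OF R])
  have "submodule (?\<pi> ` carrier ?F) R M"
    by (rule submodule_of_sub_iff[OF M H submodule_image[OF F mH \<pi> submodule_carrier[OF F]]])
  moreover have "S \<subseteq> ?\<pi> ` carrier ?F"
  proof
    fix s assume "s \<in> S"
    then obtain i where i: "i \<in> {..<card S}" "s = b i" using b by (auto simp: bij_betw_def)
    then have "s = ?\<pi> (unit_vec R {..<card S} i)" using lin_ext_unit_vec[OF mH bH] by simp
    then show "s \<in> ?\<pi> ` carrier ?F" by (rule image_eqI[OF _ unit_vec_closed[OF R]])
  qed
  ultimately have "H \<subseteq> ?\<pi> ` carrier ?F" by (rule S(3))
  then have "?\<pi> ` carrier ?F = carrier ?H" using mod_homD(1)[OF \<pi>] by auto
  then show ?thesis unfolding fin_gen_def using mH \<pi> by blast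
qed

lemma fg_module_fin_gen:
  assumes "fg_module R M" shows "fin_gen R M"
proof -
  obtain S where M: "module R M" and S: "S \<subseteq> carrier M" "finite S" "gen_submodule R M S = carrier M"
    using assms unfolding fg_module_def by blast
  have "carrier M \<subseteq> K" if "submodule K R M" "S \<subseteq> K" for K
    using gen_submodule(3)[OF M S(1) that] S(3) by simp
  then have "fg_sub R M (carrier M)"
    unfolding fg_sub_def using S(1,2) by (intro exI[of _ S]) simp
  from fg_sub_fin_gen[OF M submodule_carrier[OF M] this] show ?thesis by simp
qed

section \<open>Noetherian modules\<close>

lemma noetherian_image:
  assumes A: "noetherian_module R A" and B: "module R B" and f: "f \<in> mod_hom R A B"
    and surj: "f ` carrier A = carrier B"
  shows "noetherian_module R B"
  unfolding noetherian_module_def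
proof (intro conjI B allI impI)
  fix H assume H: "submodule H R B"
  have mA: "module R A" using A by (simp add: noetherian_module_def)
  let ?H = "{x \<in> carrier A. f x \<in> H}"
  have fgs: "fg_sub R A ?H" using A submodule_vimage[OF mA B f H] by (simp add: noetherian_module_def)
  obtain S where S1: "finite S \<and> S \<subseteq> ?H \<and> (\<forall>K. submodule K R A \<and> S \<subseteq> K \<longrightarrow> ?H \<subseteq> K)"
    using fgs[unfolded fg_sub_def] ..
  note S = conjunct1[OF S1] conjunct1[OF conjunct2[OF S1]] conjunct2[OF conjunct2[OF S1], rule_format, OF conjI]
  have "H \<subseteq> K" if K: "submodule K R B" "f ` S \<subseteq> K" for K
  proof
    fix y assume y: "y \<in> H"
    then obtain x where x: "x \<in> carrier A" "y = f x" using surj submoduleD(1)[OF B H] by blast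
    have "?H \<subseteq> {x \<in> carrier A. f x \<in> K}"
      by (rule S(3)[OF submodule_vimage[OF mA B f K(1)]]) (use S(2) K(2) in auto)
    then show "y \<in> K" using x y by auto
  qed
  then show "fg_sub R B H" unfolding fg_sub_def using S(1,2) by (intro exI[of _ "f ` S"]) auto
qed

text \<open>Zorn's lemma applies because the union of a chain is finitely generated, and its
  finitely many generators already lie in one member, which is therefore the whole union.\<close>

lemma noetherian_maximal:
  assumes M: "noetherian_module R M" and A: "A \<noteq> {}" "\<And>H. H \<in> A \<Longrightarrow> submodule H R M"
  shows "\<exists>X\<in>A. \<forall>Y\<in>A. X \<subseteq> Y \<longrightarrow> Y = X"
proof -
  have mM: "module R M" using M by (simp add: noetherian_module_def)
  show ?thesis
  proof (rule subset_Zorn_nonempty[OF A(1)])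
    fix C assume C: "C \<noteq> {}" "subset.chain A C"
    have sub: "C \<subseteq> A" and ch: "\<And>X Y. X \<in> C \<Longrightarrow> Y \<in> C \<Longrightarrow> X \<subseteq> Y \<or> Y \<subseteq> X"
      using C(2) by (auto simp: subset_chain_def)
    have sm: "submodule X R M" if "X \<in> C" for X using that sub A(2) by blast
    have "submodule (\<Union>C) R M"
    proof (rule submoduleI'[OF mM])
      show "\<Union>C \<subseteq> carrier M" using submoduleD(1)[OF mM sm] by blast
      show "\<zero>\<^bsub>M\<^esub> \<in> \<Union>C" using C(1) submoduleD(3)[OF mM sm] by blast
      show "x \<oplus>\<^bsub>M\<^esub> y \<in> \<Union>C" if xy: "x \<in> \<Union>C" "y \<in> \<Union>C" for x y
      proof -
        obtain X where "X \<in> C" "x \<in> X" "y \<in> X" using xy ch by blast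
        then show ?thesis using submoduleD(4)[OF mM sm] by blast
      qed
      show "r \<odot>\<^bsub>M\<^esub> x \<in> \<Union>C" if "r \<in> carrier R" "x \<in> \<Union>C" for r x
        using that submoduleD(5)[OF mM sm] by blast
    qed
    then have fgs: "fg_sub R M (\<Union>C)" using M by (simp add: noetherian_module_def)
    obtain S where S1: "finite S \<and> S \<subseteq> \<Union>C \<and> (\<forall>K. submodule K R M \<and> S \<subseteq> K \<longrightarrow> \<Union>C \<subseteq> K)"
      using fgs[unfolded fg_sub_def] ..
    note S = conjunct1[OF S1] conjunct1[OF conjunct2[OF S1]] conjunct2[OF conjunct2[OF S1], rule_format, OF conjI]
    have "\<exists>X\<in>C. S \<subseteq> X" using S(1,2)
    proof (induction S)
      case empty
      then show ?case using C(1) by auto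
    next
      case (insert s S)
      then obtain X Y where "X \<in> C" "S \<subseteq> X" "Y \<in> C" "s \<in> Y" by auto
      then show ?case using ch[of X Y] by blast
    qed
    then obtain X where X: "X \<in> C" "S \<subseteq> X" by blast
    then have "\<Union>C = X" using S(3)[OF sm[OF X(1)] X(2)] by blast
    then show "\<Union>C \<in> A" using X(1) sub by auto
  qed
qed

lemma regular_module_simps [simp]:
  "carrier (regular_module R) = carrier R" "\<zero>\<^bsub>regular_module R\<^esub> = \<zero>\<^bsub>R\<^esub>"
  "x \<oplus>\<^bsub>regular_module R\<^esub> y = x \<oplus>\<^bsub>R\<^esub> y" "x \<odot>\<^bsub>regular_module R\<^esub> y = x \<otimes>\<^bsub>R\<^esub> y"
  by (simp_all add: regular_module_def)

lemma minus_regular_module: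
  assumes "cring R" "x \<in> carrier R" shows "\<ominus>\<^bsub>regular_module R\<^esub> x = \<ominus>\<^bsub>R\<^esub> x"
proof -
  interpret cring R by fact
  interpret RR: module R "regular_module R" by (rule module_regular_module[OF assms(1)])
  show ?thesis using RR.M.minus_equality[of "\<ominus>\<^bsub>R\<^esub> x" x] assms(2) by (simp add: l_neg)
qed

lemma ideal_iff_submodule:
  assumes R: "cring R" shows "ideal I R \<longleftrightarrow> submodule I R (regular_module R)"
proof
  interpret cring R by fact
  show "submodule I R (regular_module R)" if "ideal I R"
  proof -
    interpret I: ideal I R by fact
    show ?thesis by (rule submoduleI'[OF module_regular_module[OF R]]) (auto simp: I.I_l_closed)
  qed
  assume I: "submodule I R (regular_module R)"
  note D = submoduleD[OF module_regular_module[OF R] I]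
  show "ideal I R"
  proof (rule idealI[OF ring_axioms])
    show "subgroup I (add_monoid R)"
    proof (rule add.subgroupI)
      show "\<ominus>\<^bsub>R\<^esub> a \<in> I" if "a \<in> I" for a
        using D(6)[OF that] minus_regular_module[OF R, of a] D(2)[OF that] by simp
    qed (use D(1,3,4) in auto)
    fix a x assume a: "a \<in> I" and x: "x \<in> carrier R"
    show "x \<otimes>\<^bsub>R\<^esub> a \<in> I" using D(5)[OF x a] by simp
    then show "a \<otimes>\<^bsub>R\<^esub> x \<in> I" using x D(2)[OF a] by (simp add: m_comm)
  qed
qed

lemma free_coord_hom: "s \<in> S \<Longrightarrow> (\<lambda>u. u s) \<in> mod_hom R (free_module R S) (regular_module R)"
  by (auto simp: mod_hom_def free_module_def)

lemma free_module_simps: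
  "s \<in> S \<Longrightarrow> (u \<oplus>\<^bsub>free_module R S\<^esub> v) s = u s \<oplus>\<^bsub>R\<^esub> v s"
  "s \<in> S \<Longrightarrow> (r \<odot>\<^bsub>free_module R S\<^esub> u) s = r \<otimes>\<^bsub>R\<^esub> u s"
  "s \<in> S \<Longrightarrow> \<zero>\<^bsub>free_module R S\<^esub> s = \<zero>\<^bsub>R\<^esub>"
  by (auto simp: free_module_def)

lemma free_module_val: "u \<in> carrier (free_module R S) \<Longrightarrow> s \<in> S \<Longrightarrow> u s \<in> carrier R"
  by (auto simp: free_module_def)

lemma free_module_eqI:
  assumes "u \<in> carrier (free_module R S)" "v \<in> carrier (free_module R S)" "\<And>s. s \<in> S \<Longrightarrow> u s = v s"
  shows "u = v"
  by (rule PiE_ext[of u S "\<lambda>_. carrier R" v]) (use assms in \<open>auto simp: free_module_def\<close>)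

lemma noetherian_regular:
  assumes R: "cring R" and N: "noetherian_ring R" shows "noetherian_module R (regular_module R)"
  unfolding noetherian_module_def
proof (intro conjI module_regular_module R allI impI)
  interpret cring R by fact
  fix H assume "submodule H R (regular_module R)"
  then have "ideal H R" by (simp add: ideal_iff_submodule[OF R])
  then obtain A where A: "A \<subseteq> carrier R" "finite A" "H = genideal R A" using noetherian_ring.finetely_gen[OF N] by blast
  have "H \<subseteq> K" if "submodule K R (regular_module R)" "A \<subseteq> K" for K
    using genideal_minimal[of K A] that A(3) by (simp add: ideal_iff_submodule[OF R])
  then show "fg_sub R (regular_module R) H"
    unfolding fg_sub_def using A genideal_self[OF A(1)] by (intro exI[of _ A]) simp
qed

text \<open>Induction on the number \<open>n\<close> of leading coordinates that may be nonzero on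
  \<open>H\<close>. In the step, generators of the part where coordinate \<open>n\<close> vanishes,
  together with preimages of generators of the ideal of all coordinates \<open>n\<close>, generate
  \<open>H\<close>.\<close>

lemma noetherian_free:
  fixes N :: nat
  assumes R: "cring R" and NR: "noetherian_ring R" shows "noetherian_module R (free_module R {..<N})"
proof -
  interpret R: cring R by fact
  let ?F = "free_module R {..<N}"
  have F: "module R ?F" by (rule module_free_module[OF R])
  interpret F: module R ?F by fact
  note RR = module_regular_module[OF R]
  have claim: "fg_sub R ?F H"
    if "n \<le> N" "submodule H R ?F" "\<And>u s. u \<in> H \<Longrightarrow> n \<le> s \<Longrightarrow> s < N \<Longrightarrow> u s = \<zero>\<^bsub>R\<^esub>" for n H
    using that
  proof (induction n arbitrary: H)
    case 0
    have "u = \<zero>\<^bsub>?F\<^esub>" if "u \<in> H" for u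
      by (rule free_module_eqI) (use that 0(3) submoduleD(2)[OF F 0(2)] in \<open>auto simp: free_module_simps\<close>)
    then have "H = {\<zero>\<^bsub>?F\<^esub>}" using submoduleD(3)[OF F 0(2)] by blast
    then show ?case unfolding fg_sub_def using submoduleD(3)[OF F] by (intro exI[of _ "{}"]) auto
  next
    case (Suc n)
    have n: "n \<in> {..<N}" using Suc.prems(1) by simp
    note co = free_coord_hom[OF n, of R]
    note D = submoduleD[OF F Suc.prems(2)]
    let ?H = "H \<inter> {u \<in> carrier ?F. u n = \<zero>\<^bsub>R\<^esub>}"
    have sH: "submodule ?H R ?F"
      using submodule_Int[OF F Suc.prems(2) submodule_kernel[OF F RR co]] by simp
    have zH: "u s = \<zero>\<^bsub>R\<^esub>" if "u \<in> ?H" "n \<le> s" "s < N" for u s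
      using that Suc.prems(3)[of u s] by (cases "s = n") auto
    have fgs: "fg_sub R ?F ?H"
    proof (rule Suc.IH[OF _ sH])
      show "n \<le> N" using Suc.prems(1) by simp
      show "u s = \<zero>\<^bsub>R\<^esub>" if "u \<in> ?H" "n \<le> s" "s < N" for u s by (rule zH[OF that])
    qed
    obtain S where S1: "finite S \<and> S \<subseteq> ?H \<and> (\<forall>K. submodule K R ?F \<and> S \<subseteq> K \<longrightarrow> ?H \<subseteq> K)"
      using fgs[unfolded fg_sub_def] ..
    note S = conjunct1[OF S1] conjunct1[OF conjunct2[OF S1]] conjunct2[OF conjunct2[OF S1], rule_format, OF conjI]
    have fgs: "fg_sub R (regular_module R) ((\<lambda>u. u n) ` H)"
      using noetherian_regular[OF R NR] submodule_image[OF F RR co Suc.prems(2)] by (simp add: noetherian_module_def)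
    obtain A where A1: "finite A \<and> A \<subseteq> (\<lambda>u. u n) ` H \<and> (\<forall>K. submodule K R (regular_module R) \<and> A \<subseteq> K \<longrightarrow> (\<lambda>u. u n) ` H \<subseteq> K)"
      using fgs[unfolded fg_sub_def] ..
    note A = conjunct1[OF A1] conjunct1[OF conjunct2[OF A1]] conjunct2[OF conjunct2[OF A1], rule_format, OF conjI]
    obtain B where B: "finite B" "B \<subseteq> H" "A = (\<lambda>u. u n) ` B"
      using finite_subset_image[OF A(1,2)] by blast
    have "H \<subseteq> K" if K: "submodule K R ?F" "S \<union> B \<subseteq> K" for K
    proof
      fix u assume u: "u \<in> H"
      have KH: "submodule (K \<inter> H) R ?F" by (rule submodule_Int[OF F K(1) Suc.prems(2)])
      have "(\<lambda>u. u n) ` H \<subseteq> (\<lambda>u. u n) ` (K \<inter> H)"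
        by (rule A(3)[OF submodule_image[OF F RR co KH]]) (use B K(2) in auto)
      then obtain v where v: "v \<in> K" "v \<in> H" "u n = v n" using u by blast
      have c: "u \<in> carrier ?F" "v \<in> carrier ?F" using u v D(2) by auto
      have "(u \<ominus>\<^bsub>?F\<^esub> v) n = \<zero>\<^bsub>R\<^esub>"
        using mod_hom_diff[OF F RR co c] v(3) free_module_val[OF c(1) n]
        by (simp add: a_minus_def minus_regular_module[OF R] R.r_neg)
      then have "u \<ominus>\<^bsub>?F\<^esub> v \<in> ?H" using D(7)[OF u v(2)] D(2) by auto
      then have "u \<ominus>\<^bsub>?F\<^esub> v \<in> K" using S(3)[OF K(1)] K(2) by blast
      from submoduleD(4)[OF F K(1) this v(1)] show "u \<in> K"
        using c by (simp add: a_minus_def F.M.a_assoc F.M.l_neg)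
    qed
    then show ?case unfolding fg_sub_def using S(1,2) B(1,2) by (intro exI[of _ "S \<union> B"]) auto
  qed
  show ?thesis
    unfolding noetherian_module_def
  proof (intro conjI F allI impI)
    show "fg_sub R ?F H" if "submodule H R ?F" for H by (rule claim[OF order.refl that]) simp
  qed
qed

lemma noetherian_fin_gen:
  assumes "cring R" "noetherian_ring R" "fin_gen R M" shows "noetherian_module R M"
  using assms(3) noetherian_image[OF noetherian_free[OF assms(1,2)]] unfolding fin_gen_def by blast

lemma fin_gen_image:
  assumes "fin_gen R A" "module R B" "f \<in> mod_hom R A B" "f ` carrier A = carrier B"
  shows "fin_gen R B"
proof -
  obtain n and \<pi> where \<pi>: "\<pi> \<in> mod_hom R (free_module R {..<n::nat}) A" "\<pi> ` carrier (free_module R {..<n}) = carrier A"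
    using assms(1) unfolding fin_gen_def by blast
  have "(\<lambda>x. f (\<pi> x)) ` carrier (free_module R {..<n}) = carrier B"
    using \<pi>(2) assms(4) by (metis image_image)
  then show ?thesis unfolding fin_gen_def using assms(2) mod_hom_comp[OF \<pi>(1) assms(3)] by blast
qed

section \<open>Noetherian local rings\<close>

locale local_noetherian =
  fixes R :: "('a, 'r) ring_scheme" and \<mm> :: "'a set"
  assumes local: "noetherian_local_ring R \<mm>"
begin

lemma cring: "cring R" and noetherian: "noetherian_ring R"
  and maximal: "maximalideal \<mm> R" and one_neq_zero: "\<one>\<^bsub>R\<^esub> \<noteq> \<zero>\<^bsub>R\<^esub>"
  using local by (auto simp: noetherian_local_ring_def)

sublocale R: cring R by (rule cring)
sublocale \<mm>: maximalideal \<mm> R by (rule maximal)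

lemma \<mm>_ideal: "ideal \<mm> R" by (rule \<mm>.ideal_axioms)

lemma one_notin: "\<one>\<^bsub>R\<^esub> \<notin> \<mm>"
  using \<mm>.one_imp_carrier \<mm>.I_notcarr by blast

text \<open>Were \<open>a\<close> not a unit, its principal ideal would be proper and lie in a
  maximal ideal, which must be \<open>\<mm>\<close>. That maximal ideal comes from the Noetherian
  condition, as a maximal element among the ideals that contain \<open>a\<close> and omit the unit
  element.\<close>

lemma unit:
  assumes a: "a \<in> carrier R" "a \<notin> \<mm>" obtains b where "b \<in> carrier R" "b \<otimes>\<^bsub>R\<^esub> a = \<one>\<^bsub>R\<^esub>"
proof (cases "\<one>\<^bsub>R\<^esub> \<in> PIdl\<^bsub>R\<^esub> a")
  case True
  then show thesis using that by (auto simp: cgenideal_def)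
next
  case False
  let ?A = "{I. ideal I R \<and> PIdl\<^bsub>R\<^esub> a \<subseteq> I \<and> \<one>\<^bsub>R\<^esub> \<notin> I}"
  have ne: "?A \<noteq> {}" using False R.cgenideal_ideal[OF a(1)] by blast
  have sm: "submodule H R (regular_module R)" if "H \<in> ?A" for H
    using that by (auto simp: ideal_iff_submodule[OF cring])
  obtain X where X1: "X \<in> ?A" and X2: "\<forall>Y\<in>?A. X \<subseteq> Y \<longrightarrow> Y = X"
    using noetherian_maximal[OF noetherian_regular[OF cring noetherian] ne sm] by (rule bexE)
  note X = X1 X2[rule_format]
  have "maximalideal X R"
  proof (rule maximalidealI)
    show "ideal X R" using X by simp
    show "carrier R \<noteq> X" using X by auto
    fix J assume J: "ideal J R" "X \<subseteq> J" "J \<subseteq> carrier R"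
    show "J = X \<or> J = carrier R"
    proof (cases "\<one>\<^bsub>R\<^esub> \<in> J")
      case True
      then show ?thesis using ideal.one_imp_carrier[OF J(1)] by simp
    next
      case False
      then show ?thesis using X(2)[of J] J X(1) by auto
    qed
  qed
  then have "X = \<mm>" using local by (simp add: noetherian_local_ring_def)
  then show thesis using X(1) a R.cgenideal_self[OF a(1)] by blast
qed

section \<open>Minimal covers and minimal free resolutions\<close>

definition mF :: "'s set \<Rightarrow> ('s \<Rightarrow> 'a) set"
  where "mF S = {u \<in> carrier (free_module R S). \<forall>s\<in>S. u s \<in> \<mm>}"

lemma submodule_mF: "submodule (mF S) R (free_module R S)"
proof -
  interpret F: module R "free_module R S" by (rule module_free_module[OF cring])
  show ?thesis
    by (rule submoduleI'[OF F.module_axioms])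
       (auto simp: mF_def free_module_simps \<mm>.I_l_closed)
qed

lemma hom_mF:
  assumes f: "f \<in> mod_hom R (free_module R S) (free_module R S')" and u: "u \<in> mF S"
  shows "f u \<in> mF S'"
proof (rule hom_free_mem[OF cring module_free_module[OF cring] submodule_mF f])
  have uc: "u \<in> carrier (free_module R S)" using u by (simp add: mF_def)
  then show "u \<in> carrier (free_module R S)" .
  fix s assume s: "s \<in> S"
  interpret F': module R "free_module R S'" by (rule module_free_module[OF cring])
  have c: "f (unit_vec R S s) \<in> carrier (free_module R S')" by (rule mod_homD(1)[OF f unit_vec_closed[OF cring]])
  show "u s \<odot>\<^bsub>free_module R S'\<^esub> f (unit_vec R S s) \<in> mF S'"
    using u s c F'.smult_closed[OF free_module_val[OF uc s] c] free_module_val[OF c]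
    by (auto simp: mF_def free_module_simps intro: \<mm>.I_r_closed)
qed

text \<open>The number \<open>n\<close> of generators is taken least. A relation with a coordinate
  outside \<open>\<mm>\<close>, hence a unit, would express one generator by the others, and
  \<open>n - 1\<close> generators would do.\<close>

lemma minimal_cover:
  assumes fg: "fin_gen R M"
  obtains n :: nat and \<pi> where "\<pi> \<in> mod_hom R (free_module R {..<n}) M" "\<pi> ` carrier (free_module R {..<n}) = carrier M"
    "{u \<in> carrier (free_module R {..<n}). \<pi> u = \<zero>\<^bsub>M\<^esub>} \<subseteq> mF {..<n}"
proof -
  have M: "module R M" using fg by (simp add: fin_gen_def)
  interpret M: module R M by fact
  let ?P = "\<lambda>n::nat. \<exists>\<pi>\<in>mod_hom R (free_module R {..<n}) M. \<pi> ` carrier (free_module R {..<n}) = carrier M"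
  have "\<exists>n. ?P n" using fg by (simp add: fin_gen_def)
  then have P: "?P (LEAST n. ?P n)" by (rule LeastI_ex)
  define n where "n = (LEAST n. ?P n)"
  have least: "\<not> ?P k" if "k < n" for k using not_less_Least that unfolding n_def by blast
  let ?F = "free_module R {..<n}"
  have F: "module R ?F" by (rule module_free_module[OF cring])
  interpret F: module R ?F by fact
  obtain \<pi> where \<pi>: "\<pi> \<in> mod_hom R ?F M" "\<pi> ` carrier ?F = carrier M" using P unfolding n_def by blast
  have "u s \<in> \<mm>" if u: "u \<in> carrier ?F" "\<pi> u = \<zero>\<^bsub>M\<^esub>" and s: "s \<in> {..<n}" for u s
  proof (rule ccontr)
    assume us: "u s \<notin> \<mm>"
    note usc = free_module_val[OF u(1) s]
    obtain b where b: "b \<in> carrier R" "b \<otimes>\<^bsub>R\<^esub> u s = \<one>\<^bsub>R\<^esub>" using unit[OF usc us] by blast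
    define k where "k = n - 1"
    have n: "n = Suc k" using s by (simp add: k_def)
    \<comment> \<open>The images of the unit vectors other than \<open>s\<close>, renumbered by
      skipping \<open>s\<close>.\<close>
    define c where "c i = \<pi> (unit_vec R {..<n} (if i < s then i else Suc i))" for i
    have cM: "c \<in> {..<k} \<rightarrow> carrier M" unfolding c_def using mod_homD(1)[OF \<pi>(1) unit_vec_closed[OF cring]] by auto
    let ?F' = "free_module R {..<k}" and ?\<rho> = "lin_ext {..<k} R M c"
    have F': "module R ?F'" by (rule module_free_module[OF cring])
    have \<rho>: "?\<rho> \<in> mod_hom R ?F' M" by (rule lin_ext_hom[OF M cM])
    define L where "L = ?\<rho> ` carrier ?F'"
    have L: "submodule L R M" unfolding L_def by (rule submodule_image[OF F' M \<rho> submodule_carrier[OF F']])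
    have eL: "\<pi> (unit_vec R {..<n} r) \<in> L" if r: "r \<in> {..<n}" "r \<noteq> s" for r
    proof -
      define i where "i = (if r < s then r else r - 1)"
      have i: "i \<in> {..<k}" "(if i < s then i else Suc i) = r" using r s n by (auto simp: i_def)
      have eq: "\<pi> (unit_vec R {..<n} r) = ?\<rho> (unit_vec R {..<k} i)"
        using lin_ext_unit_vec[OF M cM i(1)] i(2) by (simp add: c_def)
      show ?thesis unfolding L_def eq by (rule imageI[OF unit_vec_closed[OF cring]])
    qed
    let ?e = "unit_vec R {..<n} s"
    have e: "?e \<in> carrier ?F" by (rule unit_vec_closed[OF cring])
    have bu: "b \<odot>\<^bsub>?F\<^esub> u \<in> carrier ?F" using b(1) u(1) by blast
    \<comment> \<open>\<open>b\<close> times \<open>u\<close> is a relation with coordinate one at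
      \<open>s\<close>; so \<open>?v\<close> has the same image as the unit vector, but coordinate
      zero at \<open>s\<close>.\<close>
    let ?v = "?e \<ominus>\<^bsub>?F\<^esub> b \<odot>\<^bsub>?F\<^esub> u"
    have v: "?v \<in> carrier ?F" by (rule module_diff_closed[OF F e bu])
    have "?v s = ?e s \<ominus>\<^bsub>regular_module R\<^esub> (b \<odot>\<^bsub>?F\<^esub> u) s"
      using mod_hom_diff[OF F module_regular_module[OF cring] free_coord_hom[OF s] e bu] .
    then have vs: "?v s = \<zero>\<^bsub>R\<^esub>"
      using b usc s by (simp add: a_minus_def minus_regular_module[OF cring] free_module_simps unit_vec_def R.r_neg)
    have "\<pi> ?v \<in> L"
      by (rule hom_free_mem[OF cring M L \<pi>(1) v])
         (metis vs eL submoduleD(5)[OF M L] free_module_val[OF v])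
    moreover have "\<pi> ?v = \<pi> ?e"
      using mod_hom_diff[OF F M \<pi>(1) e bu] mod_homD(3)[OF \<pi>(1) b(1) u(1)] u(2) b(1) mod_homD(1)[OF \<pi>(1) e]
      by (simp add: a_minus_def)
    ultimately have eL': "\<pi> (unit_vec R {..<n} r) \<in> L" if "r \<in> {..<n}" for r using eL[of r] that by (cases "r = s") auto
    have "\<pi> w \<in> L" if w: "w \<in> carrier ?F" for w
      by (rule hom_free_mem[OF cring M L \<pi>(1) w])
         (use eL' submoduleD(5)[OF M L] free_module_val[OF w] in blast)
    then have "\<pi> ` carrier ?F \<subseteq> L" by (rule image_subsetI)
    then have "L = carrier M" using \<pi>(2) submoduleD(1)[OF M L] by simp
    then have "?P k" using \<rho> unfolding L_def by (intro bexI[of _ ?\<rho>])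
    then show False using least[of k] n by simp
  qed
  then have "{u \<in> carrier ?F. \<pi> u = \<zero>\<^bsub>M\<^esub>} \<subseteq> mF {..<n}" by (auto simp: mF_def)
  then show thesis using that \<pi> by blast
qed

text \<open>Minimal covers are iterated on kernels, which are finitely generated because finite free
  modules are Noetherian. Minimality of each cover puts its kernel into \<open>mF\<close>, and this
  kernel is the image of the next differential.\<close>

lemma minimal_resolution:
  assumes fg: "fin_gen R M"
  obtains rk \<delta> \<epsilon> where "finite_free_resolution R M rk \<delta> \<epsilon>"
    "{u \<in> carrier (free_module R {..<rk 0}). \<epsilon> u = \<zero>\<^bsub>M\<^esub>} \<subseteq> mF {..<rk 0}"
    "\<And>i x. x \<in> carrier (free_module R {..<rk (Suc i)}) \<Longrightarrow> \<delta> i x \<in> mF {..<rk i}"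
proof -
  have M: "module R M" using fg by (simp add: fin_gen_def)
  let ?F = "\<lambda>n::nat. free_module R {..<n}"
  have F: "module R (?F n)" for n by (rule module_free_module[OF cring])
  have cover: "\<exists>n' \<pi>. \<pi> \<in> mod_hom R (?F n') (?F n) \<and> \<pi> ` carrier (?F n') = H \<and>
      {u \<in> carrier (?F n'). \<pi> u = \<zero>\<^bsub>?F n\<^esub>} \<subseteq> mF {..<n'}" if H: "submodule H R (?F n)" for n H
  proof -
    have fgH: "fin_gen R ((?F n)\<lparr>carrier := H\<rparr>)"
      using fg_sub_fin_gen[OF F H] noetherian_free[OF cring noetherian] H by (simp add: noetherian_module_def)
    show ?thesis
    proof (rule minimal_cover[OF fgH])
      fix n' :: nat and \<pi>
      assume a: "\<pi> \<in> mod_hom R (?F n') ((?F n)\<lparr>carrier := H\<rparr>)"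
        "\<pi> ` carrier (?F n') = carrier ((?F n)\<lparr>carrier := H\<rparr>)"
        "{u \<in> carrier (?F n'). \<pi> u = \<zero>\<^bsub>(?F n)\<lparr>carrier := H\<rparr>\<^esub>} \<subseteq> mF {..<n'}"
      show ?thesis
        using mod_hom_sub_codD[OF a(1) submoduleD(1)[OF F H]] a(2,3) by (intro exI[of _ n'] exI[of _ \<pi>]) simp
    qed
  qed
  obtain n0 \<epsilon> where \<epsilon>: "\<epsilon> \<in> mod_hom R (?F n0) M" "\<epsilon> ` carrier (?F n0) = carrier M"
    "{u \<in> carrier (?F n0). \<epsilon> u = \<zero>\<^bsub>M\<^esub>} \<subseteq> mF {..<n0}" by (rule minimal_cover[OF fg])
  \<comment> \<open>State of the recursion: the rank of the current free module, and the kernel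
    inside it that the next one has to cover.\<close>
  let ?P = "\<lambda>(i::nat) p. submodule (snd p) R (?F (fst p)) \<and> snd p \<subseteq> mF {..<fst p} \<and>
    (i = 0 \<longrightarrow> p = (n0, {u \<in> carrier (?F n0). \<epsilon> u = \<zero>\<^bsub>M\<^esub>}))"
  let ?r = "\<lambda>(i::nat) p q. \<exists>\<pi>. \<pi> \<in> mod_hom R (?F (fst q)) (?F (fst p)) \<and> \<pi> ` carrier (?F (fst q)) = snd p \<and>
      snd q = {u \<in> carrier (?F (fst q)). \<pi> u = \<zero>\<^bsub>?F (fst p)\<^esub>}"
  have "\<exists>p. \<forall>i. ?P i (p i) \<and> ?r i (p i) (p (Suc i))"
  proof (rule dependent_nat_choice)
    show "\<exists>p. ?P 0 p" using \<epsilon> submodule_kernel[OF F M \<epsilon>(1)] by auto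
  next
    fix p i assume P: "?P i p"
    obtain n' \<pi> where \<pi>: "\<pi> \<in> mod_hom R (?F n') (?F (fst p))" "\<pi> ` carrier (?F n') = snd p"
      "{u \<in> carrier (?F n'). \<pi> u = \<zero>\<^bsub>?F (fst p)\<^esub>} \<subseteq> mF {..<n'}" using cover P by blast
    then show "\<exists>q. ?P (Suc i) q \<and> ?r i p q"
      using submodule_kernel[OF F F \<pi>(1)]
      by (intro exI[of _ "(n', {u \<in> carrier (?F n'). \<pi> u = \<zero>\<^bsub>?F (fst p)\<^esub>})"]) auto
  qed
  then obtain p where p: "\<forall>i. ?P i (p i) \<and> ?r i (p i) (p (Suc i))" ..
  have P: "?P i (p i)" and r: "?r i (p i) (p (Suc i))" for i
    by (rule conjunct1[OF spec[OF p]], rule conjunct2[OF spec[OF p]])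
  define rk where "rk i = fst (p i)" for i
  have "\<exists>\<delta>. \<forall>i. \<delta> i \<in> mod_hom R (?F (rk (Suc i))) (?F (rk i)) \<and> \<delta> i ` carrier (?F (rk (Suc i))) = snd (p i) \<and>
      snd (p (Suc i)) = {u \<in> carrier (?F (rk (Suc i))). \<delta> i u = \<zero>\<^bsub>?F (rk i)\<^esub>}"
    unfolding rk_def by (rule choice) (rule allI, rule r)
  then obtain \<delta> where \<delta>: "\<And>i. \<delta> i \<in> mod_hom R (?F (rk (Suc i))) (?F (rk i))"
    "\<And>i. \<delta> i ` carrier (?F (rk (Suc i))) = snd (p i)"
    "\<And>i. snd (p (Suc i)) = {u \<in> carrier (?F (rk (Suc i))). \<delta> i u = \<zero>\<^bsub>?F (rk i)\<^esub>}" by blast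
  have p0: "rk 0 = n0" "snd (p 0) = {u \<in> carrier (?F n0). \<epsilon> u = \<zero>\<^bsub>M\<^esub>}" using P[of 0] by (auto simp: rk_def)
  show thesis
  proof (rule that)
    show "finite_free_resolution R M rk \<delta> \<epsilon>"
    proof (rule finite_free_resolution.intro)
      show "\<delta> (Suc i) ` carrier (?F (rk (Suc (Suc i)))) = {x \<in> carrier (?F (rk (Suc i))). \<delta> i x = \<zero>\<^bsub>?F (rk i)\<^esub>}" for i
        using \<delta>(2)[of "Suc i"] \<delta>(3)[of i] by simp
    qed (use cring M \<epsilon> p0 \<delta>(1) \<delta>(2)[of 0] in simp_all)
    show "{u \<in> carrier (?F (rk 0)). \<epsilon> u = \<zero>\<^bsub>M\<^esub>} \<subseteq> mF {..<rk 0}" using \<epsilon>(3) p0 by simp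
    show "\<delta> i x \<in> mF {..<rk i}" if "x \<in> carrier (?F (rk (Suc i)))" for i x
      using P[of i] \<delta>(2)[of i] that by (auto simp: rk_def)
  qed
qed

lemma module_RR: "module R (regular_module R)" by (rule module_regular_module[OF cring])

lemma submodule_\<mm>: "submodule \<mm> R (regular_module R)"
  using \<mm>_ideal by (simp add: ideal_iff_submodule[OF cring])

lemma module_residue: "module R (residue_module R \<mm>)"
  unfolding residue_module_def by (rule module_quotient[OF module_RR submodule_\<mm>])

lemma fin_gen_regular: "fin_gen R (regular_module R)"
proof -
  have "fg_sub R (regular_module R) (carrier (regular_module R))"
    using noetherian_regular[OF cring noetherian] submodule_carrier[OF module_RR] unfolding noetherian_module_def by blast
  from fg_sub_fin_gen[OF module_RR submodule_carrier[OF module_RR] this] show ?thesis by (simp add: regular_module_def)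
qed

lemma fin_gen_residue: "fin_gen R (residue_module R \<mm>)"
proof -
  note q = module_quotient[OF module_RR submodule_\<mm>] quotient_hom[OF module_RR submodule_\<mm>]
    quotient_surj[OF module_RR submodule_\<mm>]
  show ?thesis unfolding residue_module_def by (rule fin_gen_image[OF fin_gen_regular q])
qed

end

section \<open>Projective resolutions\<close>

text \<open>Covers both the finite free resolutions and the witnesses of
  \<open>has_projective_resolution\<close>, so that the two can be compared.\<close>

locale projective_resolution =
  fixes R :: "('a, 'r) ring_scheme" and M :: "('a, 'm) module" and P :: "nat \<Rightarrow> ('a, 'p) module"
    and \<delta> :: "nat \<Rightarrow> 'p \<Rightarrow> 'p" and \<epsilon> :: "'p \<Rightarrow> 'm"
  assumes M: "module R M"
    and projective: "projective_module R (P i)"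
    and aug: "\<epsilon> \<in> mod_hom R (P 0) M"
    and aug_surj: "\<epsilon> ` carrier (P 0) = carrier M"
    and bd: "\<delta> i \<in> mod_hom R (P (Suc i)) (P i)"
    and exact_0: "\<delta> 0 ` carrier (P (Suc 0)) = {x \<in> carrier (P 0). \<epsilon> x = \<zero>\<^bsub>M\<^esub>}"
    and exact_Suc: "\<delta> (Suc i) ` carrier (P (Suc (Suc i))) = {x \<in> carrier (P (Suc i)). \<delta> i x = \<zero>\<^bsub>P i\<^esub>}"
begin

lemma P: "module R (P i)"
  using projective[of i] by (simp add: projective_module_def)

sublocale P: module R "P i" for i by (rule P)

lemma bdc: "x \<in> carrier (P (Suc i)) \<Longrightarrow> \<delta> i x \<in> carrier (P i)"
  by (rule mod_homD(1)[OF bd])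

lemma bd_bd:
  assumes "x \<in> carrier (P (Suc (Suc i)))" shows "\<delta> i (\<delta> (Suc i) x) = \<zero>\<^bsub>P i\<^esub>"
proof -
  have "\<delta> (Suc i) x \<in> \<delta> (Suc i) ` carrier (P (Suc (Suc i)))" by (rule imageI[OF assms])
  then show ?thesis unfolding exact_Suc by simp
qed

lemma aug_bd:
  assumes "x \<in> carrier (P (Suc 0))" shows "\<epsilon> (\<delta> 0 x) = \<zero>\<^bsub>M\<^esub>"
proof -
  have "\<delta> 0 x \<in> \<delta> 0 ` carrier (P (Suc 0))" by (rule imageI[OF assms])
  then show ?thesis unfolding exact_0 by simp
qed

lemma lift_cycle:
  assumes Q: "projective_module R Q" and f: "f \<in> mod_hom R Q (P (Suc i))"
    and z: "\<And>x. x \<in> carrier Q \<Longrightarrow> \<delta> i (f x) = \<zero>\<^bsub>P i\<^esub>"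
  shows "\<exists>h\<in>mod_hom R Q (P (Suc (Suc i))). \<forall>x\<in>carrier Q. \<delta> (Suc i) (h x) = f x"
proof (rule projective_lift[OF Q P P bd f])
  show "f ` carrier Q \<subseteq> \<delta> (Suc i) ` carrier (P (Suc (Suc i)))"
    unfolding exact_Suc using mod_homD(1)[OF f] z by (intro image_subsetI) simp
qed

lemma lift_cycle_0:
  assumes Q: "projective_module R Q" and f: "f \<in> mod_hom R Q (P 0)"
    and z: "\<And>x. x \<in> carrier Q \<Longrightarrow> \<epsilon> (f x) = \<zero>\<^bsub>M\<^esub>"
  shows "\<exists>h\<in>mod_hom R Q (P (Suc 0)). \<forall>x\<in>carrier Q. \<delta> 0 (h x) = f x"
proof (rule projective_lift[OF Q P P bd f])
  show "f ` carrier Q \<subseteq> \<delta> 0 ` carrier (P (Suc 0))"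
    unfolding exact_0 using mod_homD(1)[OF f] z by (intro image_subsetI) simp
qed

end

text \<open>Lifts of the identity of \<open>M\<close> exist because \<open>X\<close> is projective
  and \<open>Y\<close> is exact. The last clause of \<open>?P\<close> keeps the composite with the
  differential of \<open>X\<close> inside the boundaries of \<open>Y\<close>, so that the next lift
  exists.\<close>

lemma resolution_comparison:
  assumes X: "projective_resolution R M X d e" and Y: "projective_resolution R M Y d' e'"
  shows "\<exists>a. (\<forall>i. a i \<in> mod_hom R (X i) (Y i)) \<and> (\<forall>x\<in>carrier (X 0). e' (a 0 x) = e x) \<and>
    (\<forall>i. \<forall>x\<in>carrier (X (Suc i)). d' i (a (Suc i) x) = a i (d i x))"
proof -
  interpret X: projective_resolution R M X d e by fact
  interpret Y: projective_resolution R M Y d' e' by fact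
  let ?P = "\<lambda>i a. a \<in> mod_hom R (X i) (Y i) \<and> (i = 0 \<longrightarrow> (\<forall>x\<in>carrier (X 0). e' (a x) = e x)) \<and>
    (\<forall>x\<in>carrier (X (Suc i)). a (d i x) \<in> d' i ` carrier (Y (Suc i)))"
  let ?r = "\<lambda>i a a'. \<forall>x\<in>carrier (X (Suc i)). d' i (a' x) = a (d i x)"
  have "\<exists>a. \<forall>i. ?P i (a i) \<and> ?r i (a i) (a (Suc i))"
  proof (rule dependent_nat_choice)
    have "e ` carrier (X 0) \<subseteq> e' ` carrier (Y 0)" by (simp add: X.aug_surj Y.aug_surj)
    then obtain a where a: "a \<in> mod_hom R (X 0) (Y 0)" and "\<forall>x\<in>carrier (X 0). e' (a x) = e x"
      using projective_lift[OF X.projective Y.P Y.M Y.aug X.aug] by blast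
    note ea = this(2)[rule_format]
    have "a (d 0 x) \<in> d' 0 ` carrier (Y (Suc 0))" if x: "x \<in> carrier (X (Suc 0))" for x
      unfolding Y.exact_0 using mod_homD(1)[OF a X.bdc[OF x]] ea[OF X.bdc[OF x]] X.aug_bd[OF x] by simp
    then show "\<exists>a. ?P 0 a" using a ea by (intro exI[of _ a]) simp
  next
    fix a i assume a: "?P i a"
    then have ah: "a \<in> mod_hom R (X i) (Y i)" by simp
    have "(\<lambda>x. a (d i x)) ` carrier (X (Suc i)) \<subseteq> d' i ` carrier (Y (Suc i))"
      using a by (intro image_subsetI) simp
    from projective_lift[OF X.projective Y.P Y.P Y.bd mod_hom_comp[OF X.bd ah] this]
    obtain a' where a': "a' \<in> mod_hom R (X (Suc i)) (Y (Suc i))" and "?r i a a'" by (rule bexE)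
    note r = this(2)[rule_format]
    have "a' (d (Suc i) x) \<in> d' (Suc i) ` carrier (Y (Suc (Suc i)))" if x: "x \<in> carrier (X (Suc (Suc i)))" for x
      unfolding Y.exact_Suc
      using mod_homD(1)[OF a' X.bdc[OF x]] r[OF X.bdc[OF x]] X.bd_bd[OF x] mod_hom_zero[OF X.P Y.P ah] by simp
    then show "\<exists>a'. ?P (Suc i) a' \<and> ?r i a a'" using a' r by (intro exI[of _ a']) simp
  qed
  then obtain a where a: "\<forall>i. ?P i (a i) \<and> ?r i (a i) (a (Suc i))" ..
  show ?thesis by (rule exI[of _ a]) (use a in simp)
qed

text \<open>The difference of \<open>c\<close> and \<open>h d\<close> takes values in cycles of
  \<open>Y\<close>; these are boundaries, and the difference lifts since \<open>X\<close> is
  projective. This is the uniqueness of lifts up to homotopy.\<close>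

lemma resolution_homotopy:
  assumes X: "projective_resolution R M X d e" and Y: "projective_resolution R N Y d' e'"
    and c: "\<And>i. c i \<in> mod_hom R (X i) (Y i)" and c0: "\<And>x. x \<in> carrier (X 0) \<Longrightarrow> e' (c 0 x) = \<zero>\<^bsub>N\<^esub>"
    and cS: "\<And>i x. x \<in> carrier (X (Suc i)) \<Longrightarrow> d' i (c (Suc i) x) = c i (d i x)"
  shows "\<exists>h. (\<forall>i. h i \<in> mod_hom R (X i) (Y (Suc i))) \<and> (\<forall>x\<in>carrier (X 0). c 0 x = d' 0 (h 0 x)) \<and>
    (\<forall>i. \<forall>x\<in>carrier (X (Suc i)). c (Suc i) x = d' (Suc i) (h (Suc i) x) \<oplus>\<^bsub>Y (Suc i)\<^esub> h i (d i x))"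
proof -
  interpret X: projective_resolution R M X d e by fact
  interpret Y: projective_resolution R N Y d' e' by fact
  let ?P = "\<lambda>i h. h \<in> mod_hom R (X i) (Y (Suc i)) \<and> (i = 0 \<longrightarrow> (\<forall>x\<in>carrier (X 0). c 0 x = d' 0 (h x))) \<and>
    (\<forall>x\<in>carrier (X (Suc i)). d' i (h (d i x)) = c i (d i x))"
  let ?r = "\<lambda>i h h'. \<forall>x\<in>carrier (X (Suc i)). c (Suc i) x = d' (Suc i) (h' x) \<oplus>\<^bsub>Y (Suc i)\<^esub> h (d i x)"
  have "\<exists>h. \<forall>i. ?P i (h i) \<and> ?r i (h i) (h (Suc i))"
  proof (rule dependent_nat_choice)
    have "\<exists>h\<in>mod_hom R (X 0) (Y (Suc 0)). \<forall>x\<in>carrier (X 0). d' 0 (h x) = c 0 x"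
      by (rule Y.lift_cycle_0[OF X.projective c c0])
    then obtain h where h: "h \<in> mod_hom R (X 0) (Y (Suc 0))" and "\<forall>x\<in>carrier (X 0). d' 0 (h x) = c 0 x" by (rule bexE)
    note dh = this(2)[rule_format]
    have "d' 0 (h (d 0 x)) = c 0 (d 0 x)" if "x \<in> carrier (X (Suc 0))" for x by (rule dh[OF X.bdc[OF that]])
    then show "\<exists>h. ?P 0 h" using h dh by (intro exI[of _ h]) simp
  next
    fix h i assume P: "?P i h"
    then have h: "h \<in> mod_hom R (X i) (Y (Suc i))" by simp
    define \<phi> where "\<phi> x = c (Suc i) x \<ominus>\<^bsub>Y (Suc i)\<^esub> h (d i x)" for x
    have hd: "(\<lambda>x. h (d i x)) \<in> mod_hom R (X (Suc i)) (Y (Suc i))" by (rule mod_hom_comp[OF X.bd h])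
    have \<phi>: "\<phi> \<in> mod_hom R (X (Suc i)) (Y (Suc i))" unfolding \<phi>_def by (rule mod_hom_sub[OF Y.P c hd])
    have "d' i (\<phi> x) = \<zero>\<^bsub>Y i\<^esub>" if x: "x \<in> carrier (X (Suc i))" for x
    proof -
      have "d' i (\<phi> x) = c i (d i x) \<ominus>\<^bsub>Y i\<^esub> d' i (h (d i x))"
        unfolding \<phi>_def mod_hom_diff[OF Y.P Y.P Y.bd mod_homD(1)[OF c x] mod_homD(1)[OF hd x]] cS[OF x] ..
      also have "\<dots> = \<zero>\<^bsub>Y i\<^esub>" using P x mod_homD(1)[OF c X.bdc[OF x]] by (simp add: Y.P.M.diff_zero_iff)
      finally show ?thesis .
    qed
    from Y.lift_cycle[OF X.projective \<phi> this]
    obtain h' where h': "h' \<in> mod_hom R (X (Suc i)) (Y (Suc (Suc i)))" and "\<forall>x\<in>carrier (X (Suc i)). d' (Suc i) (h' x) = \<phi> x"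
      by (rule bexE)
    note dh' = this(2)[rule_format]
    have "?r i h h'"
    proof
      fix x assume x: "x \<in> carrier (X (Suc i))"
      show "c (Suc i) x = d' (Suc i) (h' x) \<oplus>\<^bsub>Y (Suc i)\<^esub> h (d i x)"
        unfolding dh'[OF x] \<phi>_def using mod_homD(1)[OF c x] mod_homD(1)[OF hd x]
        by (simp add: a_minus_def Y.P.M.a_assoc Y.P.M.l_neg)
    qed
    moreover have "d' (Suc i) (h' (d (Suc i) x)) = c (Suc i) (d (Suc i) x)" if x: "x \<in> carrier (X (Suc (Suc i)))" for x
      unfolding dh'[OF X.bdc[OF x]] \<phi>_def X.bd_bd[OF x] mod_hom_zero[OF X.P Y.P h]
      using mod_homD(1)[OF c X.bdc[OF x]] by (simp add: a_minus_def)
    ultimately show "\<exists>h'. ?P (Suc i) h' \<and> ?r i h h'" using h' by (intro exI[of _ h']) simp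
  qed
  then obtain h where h: "\<forall>i. ?P i (h i) \<and> ?r i (h i) (h (Suc i))" ..
  show ?thesis by (rule exI[of _ h]) (use h in simp)
qed

lemma (in finite_free_resolution) projective_resolution: "projective_resolution R M F \<delta> \<epsilon>"
  by (rule projective_resolution.intro[OF M projective_F aug aug_surj bd]) (use exact_0 exact_Suc in simp_all)

lemma has_projective_resolution_iff:
  assumes "module R M"
  shows "has_projective_resolution R M n \<longleftrightarrow>
    (\<exists>(P :: nat \<Rightarrow> ('a, nat \<Rightarrow> 'a) module) \<delta> \<epsilon>. projective_resolution R M P \<delta> \<epsilon> \<and> (\<forall>i>n. zero_module (P i)))"
  unfolding has_projective_resolution_def projective_resolution_def One_nat_def
  by (simp only: assms conj_ac simp_thms)

lemma zero_free_module: "zero_module (free_module R {..<0::nat})"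
  unfolding zero_module_def
proof (rule equalityI)
  let ?F = "free_module R {..<0::nat}"
  have z: "\<zero>\<^bsub>?F\<^esub> \<in> carrier ?F" by (simp add: free_module_def restrict_def)
  then show "{\<zero>\<^bsub>?F\<^esub>} \<subseteq> carrier ?F" by simp
  show "carrier ?F \<subseteq> {\<zero>\<^bsub>?F\<^esub>}"
  proof
    fix u assume u: "u \<in> carrier ?F"
    have "u = \<zero>\<^bsub>?F\<^esub>" by (rule free_module_eqI[OF u z]) simp
    then show "u \<in> {\<zero>\<^bsub>?F\<^esub>}" by simp
  qed
qed

section \<open>Vanishing of Ext from the residue field\<close>

locale residue_resolution = local_noetherian R \<mm> + K: finite_free_resolution R "residue_module R \<mm>" rk \<delta> \<epsilon>
  for R :: "('a, 'r) ring_scheme" and \<mm> :: "'a set" and rk \<delta> \<epsilon>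
begin

text \<open>With \<open>K\<close> a free resolution of \<open>R/\<mm>\<close>, the cocycles and
  coboundaries of \<open>Hom(K, N)\<close> compute \<open>Ext(R/\<mm>, N)\<close>. The arguments
  concern its vanishing and the vanishing of induced maps, which can be said on representatives, so
  \<open>Ext\<close> is not formed as a module and functions are compared on carriers.\<close>

definition ext_cocycle :: "('a, 'n) module \<Rightarrow> nat \<Rightarrow> ((nat \<Rightarrow> 'a) \<Rightarrow> 'n) \<Rightarrow> bool"
  where "ext_cocycle N j f \<longleftrightarrow> f \<in> mod_hom R (K.F j) N \<and> (\<forall>x\<in>carrier (K.F (Suc j)). f (\<delta> j x) = \<zero>\<^bsub>N\<^esub>)"

definition ext_coboundary :: "('a, 'n) module \<Rightarrow> nat \<Rightarrow> ((nat \<Rightarrow> 'a) \<Rightarrow> 'n) \<Rightarrow> bool"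
  where "ext_coboundary N j f \<longleftrightarrow> (case j of 0 \<Rightarrow> \<forall>x\<in>carrier (K.F 0). f x = \<zero>\<^bsub>N\<^esub>
    | Suc i \<Rightarrow> \<exists>g\<in>mod_hom R (K.F i) N. \<forall>x\<in>carrier (K.F (Suc i)). f x = g (\<delta> i x))"

definition ext_vanishes :: "('a, 'n) module \<Rightarrow> nat \<Rightarrow> bool"
  where "ext_vanishes N j \<longleftrightarrow> (\<forall>f. ext_cocycle N j f \<longrightarrow> ext_coboundary N j f)"

lemma coboundary_0: "ext_coboundary N 0 f \<longleftrightarrow> (\<forall>x\<in>carrier (K.F 0). f x = \<zero>\<^bsub>N\<^esub>)"
  and coboundary_Suc: "ext_coboundary N (Suc i) f \<longleftrightarrow>
    (\<exists>g\<in>mod_hom R (K.F i) N. \<forall>x\<in>carrier (K.F (Suc i)). f x = g (\<delta> i x))"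
  by (simp_all add: ext_coboundary_def)

lemma residue_smult_zero:
  assumes a: "a \<in> \<mm>" and y: "y \<in> carrier (residue_module R \<mm>)"
  shows "a \<odot>\<^bsub>residue_module R \<mm>\<^esub> y = \<zero>\<^bsub>residue_module R \<mm>\<^esub>"
proof -
  obtain r where r: "r \<in> carrier R" "y = \<mm> +>\<^bsub>regular_module R\<^esub> r"
    using y quotient_surj[OF module_RR submodule_\<mm>] by (auto simp: residue_module_def)
  have aR: "a \<in> carrier R" using a \<mm>.Icarr by blast
  have "a \<otimes>\<^bsub>R\<^esub> r \<in> \<mm>" using a r(1) \<mm>.I_r_closed by blast
  then show ?thesis
    using quotient_smult[OF module_RR submodule_\<mm> aR, of r] coset_eq_zero_iff[OF module_RR submodule_\<mm>, of "a \<otimes>\<^bsub>R\<^esub> r"] r aR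
    by (simp add: residue_module_def)
qed

text \<open>Multiplication by \<open>a\<close> on \<open>K\<close> lifts multiplication by
  \<open>a\<close> on \<open>R/\<mm>\<close>, which is zero.\<close>

lemma multiplication_homotopy:
  assumes a: "a \<in> \<mm>"
  shows "\<exists>h. (\<forall>i. h i \<in> mod_hom R (K.F i) (K.F (Suc i))) \<and>
    (\<forall>x\<in>carrier (K.F 0). a \<odot>\<^bsub>K.F 0\<^esub> x = \<delta> 0 (h 0 x)) \<and>
    (\<forall>i. \<forall>x\<in>carrier (K.F (Suc i)).
       a \<odot>\<^bsub>K.F (Suc i)\<^esub> x = \<delta> (Suc i) (h (Suc i) x) \<oplus>\<^bsub>K.F (Suc i)\<^esub> h i (\<delta> i x))"
proof -
  have aR: "a \<in> carrier R" using a \<mm>.Icarr by blast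
  show ?thesis
  proof (rule resolution_homotopy[OF K.projective_resolution K.projective_resolution])
    show "(\<lambda>x. a \<odot>\<^bsub>K.F i\<^esub> x) \<in> mod_hom R (K.F i) (K.F i)" for i
      by (rule mod_hom_smult[OF K.F mod_hom_id aR])
    show "\<epsilon> (a \<odot>\<^bsub>K.F 0\<^esub> x) = \<zero>\<^bsub>residue_module R \<mm>\<^esub>" if x: "x \<in> carrier (K.F 0)" for x
      using mod_homD(3)[OF K.aug aR x] residue_smult_zero[OF a mod_homD(1)[OF K.aug x]] by simp
    show "\<delta> i (a \<odot>\<^bsub>K.F (Suc i)\<^esub> x) = a \<odot>\<^bsub>K.F i\<^esub> \<delta> i x" if x: "x \<in> carrier (K.F (Suc i))" for i x
      by (rule mod_homD(3)[OF K.bd aR x])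
  qed
qed

text \<open>Apply \<open>f\<close> to the homotopy for multiplication by \<open>a\<close>: the term
  that passes through a boundary vanishes because \<open>f\<close> is a cocycle, and the other one
  factors through \<open>\<delta>\<close>.\<close>

lemma maximal_ideal_kills_ext:
  assumes N: "module R N" and a: "a \<in> \<mm>" and f: "ext_cocycle N j f"
  shows "ext_coboundary N j (\<lambda>x. a \<odot>\<^bsub>N\<^esub> f x)"
proof -
  interpret N: module R N by fact
  have aR: "a \<in> carrier R" using a \<mm>.Icarr by blast
  have fh: "f \<in> mod_hom R (K.F j) N" and fd: "\<And>x. x \<in> carrier (K.F (Suc j)) \<Longrightarrow> f (\<delta> j x) = \<zero>\<^bsub>N\<^esub>"
    using f by (auto simp: ext_cocycle_def)
  obtain h where h: "\<And>i. h i \<in> mod_hom R (K.F i) (K.F (Suc i))"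
    and h0: "\<And>x. x \<in> carrier (K.F 0) \<Longrightarrow> a \<odot>\<^bsub>K.F 0\<^esub> x = \<delta> 0 (h 0 x)"
    and hS: "\<And>i x. x \<in> carrier (K.F (Suc i)) \<Longrightarrow>
       a \<odot>\<^bsub>K.F (Suc i)\<^esub> x = \<delta> (Suc i) (h (Suc i) x) \<oplus>\<^bsub>K.F (Suc i)\<^esub> h i (\<delta> i x)"
    using multiplication_homotopy[OF a] by blast
  have af: "a \<odot>\<^bsub>N\<^esub> f x = f (a \<odot>\<^bsub>K.F j\<^esub> x)" if "x \<in> carrier (K.F j)" for x
    using mod_homD(3)[OF fh aR that] by simp
  show ?thesis
  proof (cases j)
    case 0
    have "a \<odot>\<^bsub>N\<^esub> f x = \<zero>\<^bsub>N\<^esub>" if x: "x \<in> carrier (K.F 0)" for x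
      using af[of x] h0[OF x] fd[of "h 0 x"] x mod_homD(1)[OF h x] 0 by simp
    then show ?thesis unfolding 0 coboundary_0 by simp
  next
    case (Suc i)
    have eq: "a \<odot>\<^bsub>N\<^esub> f x = f (h i (\<delta> i x))" if x: "x \<in> carrier (K.F (Suc i))" for x
    proof -
      have c: "h (Suc i) x \<in> carrier (K.F (Suc (Suc i)))" "h i (\<delta> i x) \<in> carrier (K.F (Suc i))"
        by (rule mod_homD(1)[OF h x], rule mod_homD(1)[OF h K.bdc[OF x]])
      have "a \<odot>\<^bsub>N\<^esub> f x = f (\<delta> (Suc i) (h (Suc i) x) \<oplus>\<^bsub>K.F (Suc i)\<^esub> h i (\<delta> i x))"
        using af x hS[OF x] Suc by simp
      also have "\<dots> = f (\<delta> (Suc i) (h (Suc i) x)) \<oplus>\<^bsub>N\<^esub> f (h i (\<delta> i x))"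
        by (rule mod_homD(2)[OF fh[unfolded Suc] K.bdc[OF c(1)] c(2)])
      finally show ?thesis using fd[of "h (Suc i) x"] c mod_homD(1)[OF fh[unfolded Suc] c(2)] Suc by simp
    qed
    show ?thesis unfolding Suc coboundary_Suc
      by (intro bexI[of _ "\<lambda>y. f (h i y)"] ballI, rule eq, assumption, rule mod_hom_comp[OF h fh[unfolded Suc]])
  qed
qed

lemma ext_cocycle_map:
  assumes "module R A" "module R B" "u \<in> mod_hom R A B" "ext_cocycle A j f"
  shows "ext_cocycle B j (\<lambda>x. u (f x))"
  using assms mod_hom_comp[OF _ assms(3), of f] mod_hom_zero[OF assms(1-3)] by (simp add: ext_cocycle_def)

lemma ext_coboundary_map:
  assumes "module R A" "module R B" "u \<in> mod_hom R A B" "ext_coboundary A j f"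
  shows "ext_coboundary B j (\<lambda>x. u (f x))"
proof (cases j)
  case 0
  then show ?thesis using assms(4) mod_hom_zero[OF assms(1-3)] by (simp add: coboundary_0)
next
  case (Suc i)
  obtain g where "g \<in> mod_hom R (K.F i) A" "\<forall>x\<in>carrier (K.F (Suc i)). f x = g (\<delta> i x)"
    using assms(4) unfolding Suc coboundary_Suc by blast
  then show ?thesis unfolding Suc coboundary_Suc using mod_hom_comp[OF _ assms(3), of g]
    by (intro bexI[of _ "\<lambda>x. u (g x)"]) auto
qed

lemma ext_coboundary_cong:
  assumes "ext_coboundary N j f" "\<And>x. x \<in> carrier (K.F j) \<Longrightarrow> g x = f x" shows "ext_coboundary N j g"
  using assms by (cases j) (auto simp: coboundary_0 coboundary_Suc)

text \<open>By functoriality, \<open>v u = 1\<close> makes \<open>Ext(R/\<mm>, A)\<close> a direct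
  summand of \<open>Ext(R/\<mm>, B)\<close>.\<close>

lemma ext_vanishes_retract:
  assumes A: "module R A" and B: "module R B" and u: "u \<in> mod_hom R A B" and v: "v \<in> mod_hom R B A"
    and vu: "\<And>x. x \<in> carrier A \<Longrightarrow> v (u x) = x" and ev: "ext_vanishes B j"
  shows "ext_vanishes A j"
  unfolding ext_vanishes_def
proof (intro allI impI)
  fix f assume f: "ext_cocycle A j f"
  have "ext_coboundary B j (\<lambda>x. u (f x))" using ev ext_cocycle_map[OF A B u f] by (simp add: ext_vanishes_def)
  from ext_coboundary_map[OF B A v this] show "ext_coboundary A j f"
    by (rule ext_coboundary_cong) (use vu f mod_homD(1) in \<open>fastforce simp: ext_cocycle_def\<close>)
qed

section \<open>Parts of the long exact sequence of Ext\<close>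

context
  fixes A :: "('a, 'm) module" and B :: "('a, 'n) module" and C :: "('a, 'k) module" and u v
  assumes A: "module R A" and B: "module R B" and C: "module R C"
    and u: "u \<in> mod_hom R A B" and v: "v \<in> mod_hom R B C"
    and inj: "\<And>x. x \<in> carrier A \<Longrightarrow> u x = \<zero>\<^bsub>B\<^esub> \<Longrightarrow> x = \<zero>\<^bsub>A\<^esub>"
    and surj: "v ` carrier B = carrier C"
    and ker: "{y \<in> carrier B. v y = \<zero>\<^bsub>C\<^esub>} = u ` carrier A"
begin

interpretation A: module R A by (rule A)
interpretation B: module R B by (rule B)
interpretation C: module R C by (rule C)

private lemma vu: "x \<in> carrier A \<Longrightarrow> v (u x) = \<zero>\<^bsub>C\<^esub>" using ker by blast

private lemma u_inj: "x \<in> carrier A \<Longrightarrow> y \<in> carrier A \<Longrightarrow> u x = u y \<Longrightarrow> x = y"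
  using module_hom_eq_iff[OF A B u, of x y] inj[of "x \<ominus>\<^bsub>A\<^esub> y"] module_diff_closed[OF A, of x y]
  by (simp add: A.M.diff_zero_iff)

private lemma lift_kernel:
  assumes f: "f \<in> mod_hom R (K.F j) B" and z: "\<And>x. x \<in> carrier (K.F j) \<Longrightarrow> v (f x) = \<zero>\<^bsub>C\<^esub>"
  shows "\<exists>g\<in>mod_hom R (K.F j) A. \<forall>x\<in>carrier (K.F j). u (g x) = f x"
proof (rule projective_lift[OF K.projective_F A B u f])
  show "f ` carrier (K.F j) \<subseteq> u ` carrier A"
    unfolding ker[symmetric] using z mod_homD(1)[OF f] by (intro image_subsetI) simp
qed

private lemma lift_quotient:
  assumes f: "f \<in> mod_hom R (K.F j) C"
  shows "\<exists>g\<in>mod_hom R (K.F j) B. \<forall>x\<in>carrier (K.F j). v (g x) = f x"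
proof (rule projective_lift[OF K.projective_F B C v f])
  show "f ` carrier (K.F j) \<subseteq> v ` carrier B"
    unfolding surj using mod_homD(1)[OF f] by (intro image_subsetI)
qed

text \<open>The connecting map: \<open>f\<close> lifts to \<open>B\<close>, and the failure of the
  lift to be a cocycle is a cocycle in \<open>A\<close> of degree \<open>Suc j\<close>. A primitive
  of that cocycle corrects the lift.\<close>

lemma ext_vanishes_quotient:
  assumes evB: "ext_vanishes B j" and evA: "ext_vanishes A (Suc j)"
  shows "ext_vanishes C j"
  unfolding ext_vanishes_def
proof (intro allI impI)
  fix f assume "ext_cocycle C j f"
  then have f: "f \<in> mod_hom R (K.F j) C" and fd: "\<And>x. x \<in> carrier (K.F (Suc j)) \<Longrightarrow> f (\<delta> j x) = \<zero>\<^bsub>C\<^esub>"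
    by (auto simp: ext_cocycle_def)
  obtain f' where f': "f' \<in> mod_hom R (K.F j) B" "\<And>x. x \<in> carrier (K.F j) \<Longrightarrow> v (f' x) = f x"
    using lift_quotient[OF f] by blast
  have f'd: "(\<lambda>x. f' (\<delta> j x)) \<in> mod_hom R (K.F (Suc j)) B" by (rule mod_hom_comp[OF K.bd f'(1)])
  obtain g where g: "g \<in> mod_hom R (K.F (Suc j)) A" "\<And>x. x \<in> carrier (K.F (Suc j)) \<Longrightarrow> u (g x) = f' (\<delta> j x)"
    using lift_kernel[OF f'd] f'(2)[OF K.bdc] fd by auto
  have "g (\<delta> (Suc j) x) = \<zero>\<^bsub>A\<^esub>" if x: "x \<in> carrier (K.F (Suc (Suc j)))" for x
  proof (rule inj)
    show "g (\<delta> (Suc j) x) \<in> carrier A" by (rule mod_homD(1)[OF g(1) K.bdc[OF x]])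
    show "u (g (\<delta> (Suc j) x)) = \<zero>\<^bsub>B\<^esub>" using g(2)[OF K.bdc[OF x]] K.bd_bd[OF x] mod_hom_zero[OF K.F B f'(1)] by simp
  qed
  then have "ext_cocycle A (Suc j) g" using g(1) by (simp add: ext_cocycle_def)
  then obtain b where b: "b \<in> mod_hom R (K.F j) A" "\<And>x. x \<in> carrier (K.F (Suc j)) \<Longrightarrow> g x = b (\<delta> j x)"
    using evA unfolding ext_vanishes_def coboundary_Suc by blast
  have ub: "(\<lambda>x. u (b x)) \<in> mod_hom R (K.F j) B" by (rule mod_hom_comp[OF b(1) u])
  define f'' where "f'' x = f' x \<ominus>\<^bsub>B\<^esub> u (b x)" for x
  have f'': "f'' \<in> mod_hom R (K.F j) B" unfolding f''_def by (rule mod_hom_sub[OF B f'(1) ub])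
  have vf'': "v (f'' x) = f x" if x: "x \<in> carrier (K.F j)" for x
    unfolding f''_def using mod_hom_diff[OF B C v mod_homD(1)[OF f'(1) x] mod_homD(1)[OF ub x]]
      vu[OF mod_homD(1)[OF b(1) x]] f'(2)[OF x] mod_homD(1)[OF f x] by (simp add: a_minus_def)
  have "f'' (\<delta> j x) = \<zero>\<^bsub>B\<^esub>" if x: "x \<in> carrier (K.F (Suc j))" for x
    unfolding f''_def using g(2)[OF x] b(2)[OF x] mod_homD(1)[OF f'd x] by (simp add: B.M.diff_zero_iff)
  then have "ext_cocycle B j f''" using f'' by (simp add: ext_cocycle_def)
  then have "ext_coboundary B j f''" using evB by (simp add: ext_vanishes_def)
  from ext_coboundary_map[OF B C v this] show "ext_coboundary C j f"
    by (rule ext_coboundary_cong) (use vf'' in simp)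
qed

text \<open>Exactness at \<open>Ext(A)\<close>: a class that dies in \<open>Ext(B)\<close> comes
  from \<open>Ext(C)\<close> in degree \<open>j\<close>, which is zero. The condition
  \<open>z\<close> asks that \<open>u\<close> induce the zero map, which covers multiplication by an
  element of \<open>\<mm>\<close> as well as maps from minimal resolutions.\<close>

lemma ext_vanishes_sub_Suc:
  assumes evC: "ext_vanishes C j"
    and z: "\<And>f. ext_cocycle A (Suc j) f \<Longrightarrow> ext_coboundary B (Suc j) (\<lambda>x. u (f x))"
  shows "ext_vanishes A (Suc j)"
  unfolding ext_vanishes_def
proof (intro allI impI)
  fix f assume fc: "ext_cocycle A (Suc j) f"
  then have f: "f \<in> mod_hom R (K.F (Suc j)) A" by (simp add: ext_cocycle_def)
  obtain g where g: "g \<in> mod_hom R (K.F j) B" "\<And>x. x \<in> carrier (K.F (Suc j)) \<Longrightarrow> u (f x) = g (\<delta> j x)"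
    using z[OF fc] unfolding coboundary_Suc by blast
  have "ext_cocycle C j (\<lambda>x. v (g x))"
    unfolding ext_cocycle_def using mod_hom_comp[OF g(1) v] g(2)[symmetric] vu[OF mod_homD(1)[OF f]] by simp
  then have cb: "ext_coboundary C j (\<lambda>x. v (g x))" using evC by (simp add: ext_vanishes_def)
  \<comment> \<open>Modulo \<open>A\<close> the primitive \<open>g\<close> is a cocycle; its class
    in \<open>C\<close> vanishes, so a coboundary can be subtracted until \<open>g\<close> takes
    values in the image of \<open>A\<close>. In degree \<open>0\<close> it already does.\<close>
  have "\<exists>g'\<in>mod_hom R (K.F j) B. (\<forall>x\<in>carrier (K.F j). v (g' x) = \<zero>\<^bsub>C\<^esub>) \<and>
      (\<forall>x\<in>carrier (K.F (Suc j)). g' (\<delta> j x) = u (f x))"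
  proof (cases j)
    case 0
    then show ?thesis using cb g unfolding 0 coboundary_0 by (intro bexI[of _ g]) auto
  next
    case (Suc i)
    obtain h where h: "h \<in> mod_hom R (K.F i) C" "\<And>x. x \<in> carrier (K.F (Suc i)) \<Longrightarrow> v (g x) = h (\<delta> i x)"
      using cb unfolding Suc coboundary_Suc by blast
    obtain h' where h': "h' \<in> mod_hom R (K.F i) B" "\<And>x. x \<in> carrier (K.F i) \<Longrightarrow> v (h' x) = h x"
      using lift_quotient[OF h(1)] by blast
    have gS: "g \<in> mod_hom R (K.F (Suc i)) B" using g(1) Suc by simp
    have hd: "(\<lambda>x. h' (\<delta> i x)) \<in> mod_hom R (K.F (Suc i)) B" by (rule mod_hom_comp[OF K.bd h'(1)])
    show ?thesis unfolding Suc
    proof (intro bexI[of _ "\<lambda>x. g x \<ominus>\<^bsub>B\<^esub> h' (\<delta> i x)"] conjI ballI)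
      show "(\<lambda>x. g x \<ominus>\<^bsub>B\<^esub> h' (\<delta> i x)) \<in> mod_hom R (K.F (Suc i)) B" by (rule mod_hom_sub[OF B gS hd])
      show "v (g x \<ominus>\<^bsub>B\<^esub> h' (\<delta> i x)) = \<zero>\<^bsub>C\<^esub>" if x: "x \<in> carrier (K.F (Suc i))" for x
        using mod_hom_diff[OF B C v mod_homD(1)[OF gS x] mod_homD(1)[OF hd x]] h(2)[OF x] h'(2)[OF K.bdc[OF x]]
          mod_homD(1)[OF h(1) K.bdc[OF x]] by (simp add: C.M.diff_zero_iff)
      show "g (\<delta> (Suc i) x) \<ominus>\<^bsub>B\<^esub> h' (\<delta> i (\<delta> (Suc i) x)) = u (f x)" if x: "x \<in> carrier (K.F (Suc (Suc i)))" for x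
        using K.bd_bd[OF x] mod_hom_zero[OF K.F B h'(1)] g(2)[of x] mod_homD(1)[OF gS K.bdc[OF x]] x
        unfolding Suc by (simp add: a_minus_def)
    qed
  qed
  then obtain g' where g': "g' \<in> mod_hom R (K.F j) B" "\<And>x. x \<in> carrier (K.F j) \<Longrightarrow> v (g' x) = \<zero>\<^bsub>C\<^esub>"
    "\<And>x. x \<in> carrier (K.F (Suc j)) \<Longrightarrow> g' (\<delta> j x) = u (f x)" by blast
  obtain w where w: "w \<in> mod_hom R (K.F j) A" "\<And>x. x \<in> carrier (K.F j) \<Longrightarrow> u (w x) = g' x"
    using lift_kernel[OF g'(1,2)] by blast
  have eq: "f x = w (\<delta> j x)" if x: "x \<in> carrier (K.F (Suc j))" for x
    by (rule u_inj[OF mod_homD(1)[OF f x] mod_homD(1)[OF w(1) K.bdc[OF x]]])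
       (use w(2)[OF K.bdc[OF x]] g'(3)[OF x] in simp)
  show "ext_coboundary A (Suc j) f" unfolding coboundary_Suc
    by (intro bexI[of _ w] ballI, rule eq, assumption, rule w(1))
qed

lemma ext_vanishes_sub_0:
  assumes z: "\<And>f. ext_cocycle A 0 f \<Longrightarrow> ext_coboundary B 0 (\<lambda>x. u (f x))"
  shows "ext_vanishes A 0"
  unfolding ext_vanishes_def coboundary_0
proof (intro allI impI ballI)
  fix f x assume f: "ext_cocycle A 0 f" and x: "x \<in> carrier (K.F 0)"
  show "f x = \<zero>\<^bsub>A\<^esub>"
  proof (rule inj)
    show "f x \<in> carrier A" using f mod_homD(1)[OF _ x, of f R A] by (simp add: ext_cocycle_def)
    show "u (f x) = \<zero>\<^bsub>B\<^esub>" by (rule bspec[OF z[OF f, unfolded coboundary_0] x])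
  qed
qed

end

lemma regular_ext_vanishes_0:
  assumes N: "module R N" and a: "a \<in> \<mm>" and reg: "\<And>y. y \<in> carrier N \<Longrightarrow> a \<odot>\<^bsub>N\<^esub> y = \<zero>\<^bsub>N\<^esub> \<Longrightarrow> y = \<zero>\<^bsub>N\<^esub>"
  shows "ext_vanishes N 0"
  unfolding ext_vanishes_def coboundary_0
proof (intro allI impI ballI)
  fix f x assume f: "ext_cocycle N 0 f" and x: "x \<in> carrier (K.F 0)"
  have "f x \<in> carrier N" using f mod_homD(1)[OF _ x, of f R N] by (simp add: ext_cocycle_def)
  moreover have "a \<odot>\<^bsub>N\<^esub> f x = \<zero>\<^bsub>N\<^esub>" by (rule bspec[OF maximal_ideal_kills_ext[OF N a f, unfolded coboundary_0] x])
  ultimately show "f x = \<zero>\<^bsub>N\<^esub>" by (rule reg)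
qed

text \<open>Multiplication by \<open>a\<close> is injective on \<open>A\<close> with cokernel
  \<open>C\<close> and induces zero on \<open>Ext\<close>. The long exact sequence therefore breaks
  up, and the range of vanishing shrinks by one from \<open>A\<close> to \<open>C\<close>.\<close>

lemma ext_vanishes_regular_quotient:
  assumes A: "module R A" and C: "module R C" and v: "v \<in> mod_hom R A C" and surj: "v ` carrier A = carrier C"
    and a: "a \<in> \<mm>" and reg: "\<And>y. y \<in> carrier A \<Longrightarrow> a \<odot>\<^bsub>A\<^esub> y = \<zero>\<^bsub>A\<^esub> \<Longrightarrow> y = \<zero>\<^bsub>A\<^esub>"
    and ker: "{y \<in> carrier A. v y = \<zero>\<^bsub>C\<^esub>} = (\<lambda>y. a \<odot>\<^bsub>A\<^esub> y) ` carrier A"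
  shows "(\<forall>j<Suc n. ext_vanishes A j) \<longleftrightarrow> (\<forall>j<n. ext_vanishes C j)"
proof -
  have aR: "a \<in> carrier R" using a \<mm>.Icarr by blast
  have u: "(\<lambda>y. a \<odot>\<^bsub>A\<^esub> y) \<in> mod_hom R A A" by (rule mod_hom_smult[OF A mod_hom_id aR])
  note q = ext_vanishes_quotient[OF A A C u v reg surj ker] and s = ext_vanishes_sub_Suc[OF A A C u v reg surj ker]
  show ?thesis
  proof
    assume "\<forall>j<Suc n. ext_vanishes A j"
    then show "\<forall>j<n. ext_vanishes C j" using q by auto
  next
    assume evC: "\<forall>j<n. ext_vanishes C j"
    show "\<forall>j<Suc n. ext_vanishes A j"
    proof (intro allI impI)
      fix j assume j: "j < Suc n"
      show "ext_vanishes A j"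
      proof (cases j)
        case 0
        then show ?thesis using regular_ext_vanishes_0[OF A a reg] by simp
      next
        case (Suc i)
        show ?thesis unfolding Suc
          by (rule s) (use evC j Suc maximal_ideal_kills_ext[OF A a] in auto)
      qed
    qed
  qed
qed

text \<open>An element killed by \<open>\<mm>\<close> defines a nonzero homomorphism from
  \<open>R/\<mm>\<close>, that is, a nonzero class in degree \<open>0\<close>.\<close>

lemma socle_not_ext_vanishes:
  assumes N: "module R N" and y: "y \<in> carrier N" "y \<noteq> \<zero>\<^bsub>N\<^esub>" and k: "\<And>a. a \<in> \<mm> \<Longrightarrow> a \<odot>\<^bsub>N\<^esub> y = \<zero>\<^bsub>N\<^esub>"
  shows "\<not> ext_vanishes N 0"
proof
  assume ev: "ext_vanishes N 0"
  interpret N: module R N by fact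
  let ?RR = "regular_module R" and ?k = "residue_module R \<mm>"
  have \<psi>: "(\<lambda>r. r \<odot>\<^bsub>N\<^esub> y) \<in> mod_hom R ?RR N"
    by (rule mod_homI) (auto simp: y N.smult_l_distr N.smult_assoc1)
  have \<pi>: "(\<lambda>r. \<mm> +>\<^bsub>?RR\<^esub> r) \<in> mod_hom R ?RR ?k" "(\<lambda>r. \<mm> +>\<^bsub>?RR\<^esub> r) ` carrier ?RR = carrier ?k"
    unfolding residue_module_def by (rule quotient_hom[OF module_RR submodule_\<mm>], rule quotient_surj[OF module_RR submodule_\<mm>])
  have "r \<odot>\<^bsub>N\<^esub> y = \<zero>\<^bsub>N\<^esub>" if "r \<in> carrier ?RR" "\<mm> +>\<^bsub>?RR\<^esub> r = \<zero>\<^bsub>?k\<^esub>" for r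
    using that coset_eq_zero_iff[OF module_RR submodule_\<mm>] k by (simp add: residue_module_def)
  then obtain \<theta> where \<theta>: "\<theta> \<in> mod_hom R ?k N" "\<And>r. r \<in> carrier ?RR \<Longrightarrow> \<theta> (\<mm> +>\<^bsub>?RR\<^esub> r) = r \<odot>\<^bsub>N\<^esub> y"
    using mod_hom_factor_surj[OF module_RR module_residue N \<pi>(1) \<psi> \<pi>(2)] by blast
  have "ext_cocycle N 0 (\<lambda>x. \<theta> (\<epsilon> x))"
    unfolding ext_cocycle_def using mod_hom_comp[OF K.aug \<theta>(1)] K.aug_bd mod_hom_zero[OF module_residue N \<theta>(1)] by simp
  then have cb: "ext_coboundary N 0 (\<lambda>x. \<theta> (\<epsilon> x))" using ev by (simp add: ext_vanishes_def)
  have z: "\<theta> (\<epsilon> x) = \<zero>\<^bsub>N\<^esub>" if "x \<in> carrier (K.F 0)" for x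
    by (rule bspec[OF cb[unfolded coboundary_0] that])
  have "\<mm> +>\<^bsub>?RR\<^esub> \<one>\<^bsub>R\<^esub> \<in> \<epsilon> ` carrier (K.F 0)"
    unfolding K.aug_surj \<pi>(2)[symmetric] by (rule imageI) simp
  then obtain x where x: "x \<in> carrier (K.F 0)" "\<mm> +>\<^bsub>?RR\<^esub> \<one>\<^bsub>R\<^esub> = \<epsilon> x" by (rule imageE)
  then have "\<one>\<^bsub>R\<^esub> \<odot>\<^bsub>N\<^esub> y = \<zero>\<^bsub>N\<^esub>" using z[OF x(1)] \<theta>(2)[of "\<one>\<^bsub>R\<^esub>"] by simp
  then show False using y by simp
qed

section \<open>Ext with values in free modules\<close>

lemma ext_coboundary_add:
  assumes N: "module R N" and f: "ext_coboundary N j f" and g: "ext_coboundary N j g"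
  shows "ext_coboundary N j (\<lambda>x. f x \<oplus>\<^bsub>N\<^esub> g x)"
proof -
  interpret N: module R N by fact
  show ?thesis
  proof (cases j)
    case 0
    then show ?thesis using f g by (simp add: coboundary_0)
  next
    case (Suc i)
    obtain f' g' where "f' \<in> mod_hom R (K.F i) N" "\<forall>x\<in>carrier (K.F (Suc i)). f x = f' (\<delta> i x)"
      "g' \<in> mod_hom R (K.F i) N" "\<forall>x\<in>carrier (K.F (Suc i)). g x = g' (\<delta> i x)"
      using f g unfolding Suc coboundary_Suc by blast
    then show ?thesis unfolding Suc coboundary_Suc using mod_hom_plus[OF N, of f' "K.F i" g']
      by (intro bexI[of _ "\<lambda>x. f' x \<oplus>\<^bsub>N\<^esub> g' x"]) auto
  qed
qed

lemma ext_coboundary_zero: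
  assumes N: "module R N" shows "ext_coboundary N j (\<lambda>x. \<zero>\<^bsub>N\<^esub>)"
proof (cases j)
  case 0
  then show ?thesis by (simp add: coboundary_0)
next
  case (Suc i)
  then show ?thesis unfolding Suc coboundary_Suc by (intro bexI[OF _ mod_hom_zero_map[OF N]]) simp
qed

lemma ext_coboundary_finsum:
  assumes N: "module R N" and S: "finite S"
    and f: "\<And>s. s \<in> S \<Longrightarrow> f s \<in> mod_hom R (K.F j) N" "\<And>s. s \<in> S \<Longrightarrow> ext_coboundary N j (f s)"
  shows "ext_coboundary N j (\<lambda>x. \<Oplus>\<^bsub>N\<^esub>s\<in>S. f s x)"
  using S f
proof (induction S)
  case empty
  interpret N: module R N by fact
  show ?case using ext_coboundary_zero[OF N] by simp
next
  case (insert s S)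
  interpret N: module R N by fact
  have "ext_coboundary N j (\<lambda>x. f s x \<oplus>\<^bsub>N\<^esub> (\<Oplus>\<^bsub>N\<^esub>s\<in>S. f s x))"
    using insert by (intro ext_coboundary_add[OF N]) auto
  then show ?case
  proof (rule ext_coboundary_cong)
    fix x assume x: "x \<in> carrier (K.F j)"
    show "(\<Oplus>\<^bsub>N\<^esub>s\<in>insert s S. f s x) = f s x \<oplus>\<^bsub>N\<^esub> (\<Oplus>\<^bsub>N\<^esub>s\<in>S. f s x)"
      using insert.hyps insert.prems(1)[THEN mod_homD(1), OF _ x] by (intro N.M.finsum_insert) auto
  qed
qed

lemma ext_coboundary_free:
  fixes n :: nat
  assumes f: "f \<in> mod_hom R (K.F j) (free_module R {..<n})"
    and c: "\<And>s. s < n \<Longrightarrow> ext_coboundary (regular_module R) j (\<lambda>x. f x s)"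
  shows "ext_coboundary (free_module R {..<n}) j f"
proof (cases j)
  case 0
  have eq: "f x = \<zero>\<^bsub>free_module R {..<n}\<^esub>" if x: "x \<in> carrier (K.F 0)" for x
  proof (rule free_module_eqI)
    show "f x \<in> carrier (free_module R {..<n})" using mod_homD(1)[OF f] x 0 by simp
    show "\<zero>\<^bsub>free_module R {..<n}\<^esub> \<in> carrier (free_module R {..<n})" by (rule submoduleD(3)[OF module_free_module[OF cring] submodule_carrier[OF module_free_module[OF cring]]])
    show "f x s = \<zero>\<^bsub>free_module R {..<n}\<^esub> s" if "s \<in> {..<n}" for s
      using c[of s] that x unfolding 0 coboundary_0 by (simp add: free_module_simps)
  qed
  show ?thesis unfolding 0 coboundary_0 by (intro ballI eq)
next
  case (Suc i)
  have "\<forall>s. \<exists>g. s < n \<longrightarrow> g \<in> mod_hom R (K.F i) (regular_module R) \<and> (\<forall>x\<in>carrier (K.F (Suc i)). f x s = g (\<delta> i x))"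
    using c unfolding Suc coboundary_Suc by blast
  then obtain g where g: "\<And>s. s < n \<Longrightarrow> g s \<in> mod_hom R (K.F i) (regular_module R)"
    "\<And>s x. s < n \<Longrightarrow> x \<in> carrier (K.F (Suc i)) \<Longrightarrow> f x s = g s (\<delta> i x)" by metis
  define G where "G x = (\<lambda>s\<in>{..<n}. g s x)" for x
  have G: "G \<in> mod_hom R (K.F i) (free_module R {..<n})"
    unfolding G_def using mod_homD[OF g(1)]
    by (intro mod_homI) (auto simp: free_module_def intro!: restrict_ext)
  have eq: "f x = G (\<delta> i x)" if x: "x \<in> carrier (K.F (Suc i))" for x
    by (rule free_module_eqI)
       (use mod_homD(1)[OF f] mod_homD(1)[OF G K.bdc[OF x]] x Suc g(2)[OF _ x] in \<open>auto simp: G_def\<close>)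
  show ?thesis unfolding Suc coboundary_Suc
    by (intro bexI[of _ G] ballI, rule eq, assumption, rule G)
qed

lemma ext_vanishes_free:
  fixes n :: nat
  assumes "ext_vanishes (regular_module R) j" shows "ext_vanishes (free_module R {..<n}) j"
  unfolding ext_vanishes_def
proof (intro allI impI)
  fix f assume f: "ext_cocycle (free_module R {..<n}) j f"
  show "ext_coboundary (free_module R {..<n}) j f"
  proof (rule ext_coboundary_free)
    show "f \<in> mod_hom R (K.F j) (free_module R {..<n})" using f by (simp add: ext_cocycle_def)
    show "ext_coboundary (regular_module R) j (\<lambda>x. f x s)" if "s < n" for s
      using ext_cocycle_map[OF module_free_module[OF cring] module_RR free_coord_hom f, of s] that assms
      by (simp add: ext_vanishes_def)
  qed
qed

lemma ext_vanishes_of_free: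
  fixes n :: nat
  assumes ev: "ext_vanishes (free_module R {..<n}) j" and n: "0 < n" shows "ext_vanishes (regular_module R) j"
proof (rule ext_vanishes_retract[OF module_RR module_free_module[OF cring] _ _ _ ev])
  interpret F: module R "free_module R {..<n}" by (rule module_free_module[OF cring])
  let ?u = "\<lambda>r. r \<odot>\<^bsub>free_module R {..<n}\<^esub> unit_vec R {..<n} 0"
  note e = unit_vec_closed[OF cring, of "{..<n}" 0]
  show "?u \<in> mod_hom R (regular_module R) (free_module R {..<n})"
    by (rule mod_homI) (use e in \<open>auto simp: F.smult_l_distr F.smult_assoc1\<close>)
  show "(\<lambda>w. w 0) \<in> mod_hom R (free_module R {..<n}) (regular_module R)" by (rule free_coord_hom) (use n in simp)
  show "?u x 0 = x" if "x \<in> carrier (regular_module R)" for x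
    using that n by (simp add: free_module_simps) (simp add: unit_vec_def)
qed

text \<open>The matrix of \<open>\<iota>\<close> has entries in \<open>\<mm>\<close>, so each
  coordinate of the composite is a combination of the coordinates of \<open>f\<close> with
  coefficients in \<open>\<mm>\<close>, and \<open>maximal_ideal_kills_ext\<close> applies to every
  summand.\<close>

lemma minimal_map_kills_ext:
  fixes n n' :: nat
  assumes \<iota>: "\<iota> \<in> mod_hom R (free_module R {..<n}) (free_module R {..<n'})"
    and m: "\<And>x. x \<in> carrier (free_module R {..<n}) \<Longrightarrow> \<iota> x \<in> mF {..<n'}"
    and f: "ext_cocycle (free_module R {..<n}) j f"
  shows "ext_coboundary (free_module R {..<n'}) j (\<lambda>x. \<iota> (f x))"
proof (rule ext_coboundary_free)
  let ?F = "free_module R {..<n}"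
  note F = module_free_module[OF cring]
  have fh: "f \<in> mod_hom R (K.F j) ?F" using f by (simp add: ext_cocycle_def)
  show "(\<lambda>x. \<iota> (f x)) \<in> mod_hom R (K.F j) (free_module R {..<n'})" by (rule mod_hom_comp[OF fh \<iota>])
  fix q assume q: "q < n'"
  let ?c = "\<lambda>s. \<iota> (unit_vec R {..<n} s) q"
  have cm: "?c s \<in> \<mm>" for s using m[OF unit_vec_closed[OF cring]] q by (simp add: mF_def)
  have cR: "?c s \<in> carrier R" for s using cm \<mm>.Icarr by blast
  have \<iota>q: "(\<lambda>w. \<iota> w q) \<in> mod_hom R ?F (regular_module R)"
    using mod_hom_comp[OF \<iota> free_coord_hom[of q "{..<n'}"]] q by simp
  have fs: "ext_cocycle (regular_module R) j (\<lambda>x. f x s)" if "s \<in> {..<n}" for s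
    by (rule ext_cocycle_map[OF F module_RR free_coord_hom[OF that] f])
  have "ext_coboundary (regular_module R) j
      (\<lambda>x. \<Oplus>\<^bsub>regular_module R\<^esub>s\<in>{..<n}. ?c s \<odot>\<^bsub>regular_module R\<^esub> f x s)"
  proof (rule ext_coboundary_finsum[OF module_RR])
    show "(\<lambda>x. ?c s \<odot>\<^bsub>regular_module R\<^esub> f x s) \<in> mod_hom R (K.F j) (regular_module R)" if "s \<in> {..<n}" for s
      by (rule mod_hom_smult[OF module_RR _ cR]) (use fs[OF that] in \<open>simp add: ext_cocycle_def\<close>)
    show "ext_coboundary (regular_module R) j (\<lambda>x. ?c s \<odot>\<^bsub>regular_module R\<^esub> f x s)" if "s \<in> {..<n}" for s
      by (rule maximal_ideal_kills_ext[OF module_RR cm fs[OF that]])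
  qed simp
  then show "ext_coboundary (regular_module R) j (\<lambda>x. \<iota> (f x) q)"
  proof (rule ext_coboundary_cong)
    fix x assume x: "x \<in> carrier (K.F j)"
    note fx = mod_homD(1)[OF fh x]
    interpret RR: module R "regular_module R" by (rule module_RR)
    have "\<iota> (f x) q = lin_ext {..<n} R (regular_module R) ?c (f x)"
      by (rule hom_free_expand[OF cring module_RR \<iota>q fx])
    also have "\<dots> = (\<Oplus>\<^bsub>regular_module R\<^esub>s\<in>{..<n}. f x s \<odot>\<^bsub>regular_module R\<^esub> ?c s)"
      by (rule lin_ext_superset[OF module_RR]) (use cR free_module_val[OF fx] in auto)
    also have "\<dots> = (\<Oplus>\<^bsub>regular_module R\<^esub>s\<in>{..<n}. ?c s \<odot>\<^bsub>regular_module R\<^esub> f x s)"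
      by (rule RR.M.finsum_cong') (use cR free_module_val[OF fx] in \<open>auto simp: R.m_comm\<close>)
    finally show "\<iota> (f x) q = (\<Oplus>\<^bsub>regular_module R\<^esub>s\<in>{..<n}. ?c s \<odot>\<^bsub>regular_module R\<^esub> f x s)" .
  qed
qed

end

section \<open>Zero divisors and depth\<close>

text \<open>Multiply an element of \<open>I\<close> outside \<open>P\<close> by one element of each
  \<open>Q\<close> outside \<open>P\<close>; the product avoids \<open>P\<close> because
  \<open>P\<close> is prime.\<close>

lemma prime_product:
  assumes R: "cring R" and P: "primeideal P R" and I: "ideal I R" "\<not> I \<subseteq> P" and G: "finite G"
    and Q: "\<And>Q. Q \<in> G \<Longrightarrow> ideal Q R" "\<And>Q. Q \<in> G \<Longrightarrow> \<not> Q \<subseteq> P"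
  shows "\<exists>b\<in>I. b \<notin> P \<and> (\<forall>Q\<in>G. b \<in> Q)"
  using G Q
proof (induction G)
  case empty
  then show ?case using I(2) by auto
next
  case (insert Q G)
  interpret R: cring R by fact
  obtain b where b: "b \<in> I" "b \<notin> P" "\<forall>Q\<in>G. b \<in> Q"
    using insert.IH insert.prems by auto
  obtain c where c: "c \<in> Q" "c \<notin> P" using insert.prems(2)[of Q] by auto
  have bc: "b \<in> carrier R" "c \<in> carrier R"
    using ideal.Icarr[OF I(1) b(1)] ideal.Icarr[OF insert.prems(1)[of Q] c(1)] by auto
  have "b \<otimes>\<^bsub>R\<^esub> c \<in> I" by (rule ideal.I_r_closed[OF I(1) b(1) bc(2)])
  moreover have "b \<otimes>\<^bsub>R\<^esub> c \<notin> P" using primeideal.I_prime[OF P bc] b(2) c(2) by blast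
  moreover have "b \<otimes>\<^bsub>R\<^esub> c \<in> Q" by (rule ideal.I_l_closed[OF _ c(1) bc(1)]) (rule insert.prems(1), simp)
  moreover have "b \<otimes>\<^bsub>R\<^esub> c \<in> Q'" if "Q' \<in> G" for Q'
    by (rule ideal.I_r_closed[OF _ _ bc(2)]) (use insert.prems(1) b(3) that in auto)
  ultimately show ?case by (intro bexI[of _ "b \<otimes>\<^bsub>R\<^esub> c"]) auto
qed

text \<open>In a cover of least cardinality some \<open>a \<in> I\<close> lies in \<open>Q\<close>
  and in no other member. A product \<open>b\<close> that lies in all other members but not in
  \<open>Q\<close> makes \<open>a + b\<close> avoid every member.\<close>

lemma prime_avoidance:
  assumes R: "cring R" and I: "ideal I R" and G: "finite G" and P: "\<And>P. P \<in> G \<Longrightarrow> primeideal P R"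
    and sub: "I \<subseteq> \<Union>G"
  shows "\<exists>P\<in>G. I \<subseteq> P"
proof (rule ccontr)
  assume no: "\<not> (\<exists>P\<in>G. I \<subseteq> P)"
  interpret R: cring R by fact
  interpret I: ideal I R by fact
  obtain G0 where G0: "G0 \<subseteq> G \<and> I \<subseteq> \<Union>G0" and least: "\<And>G'. G' \<subseteq> G \<and> I \<subseteq> \<Union>G' \<Longrightarrow> card G0 \<le> card G'"
    using ex_has_least_nat[of "\<lambda>G'. G' \<subseteq> G \<and> I \<subseteq> \<Union>G'" G card] sub by auto
  have finG0: "finite G0" using G0 G finite_subset by auto
  have minimal: "\<not> I \<subseteq> \<Union>(G0 - {Q})" if "Q \<in> G0" for Q
  proof
    assume "I \<subseteq> \<Union>(G0 - {Q})"
    then have "card G0 \<le> card (G0 - {Q})" using G0 by (intro least) auto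
    then show False using card_Diff1_less[OF finG0 that] by simp
  qed
  obtain Q where Q: "Q \<in> G0" using G0 I.zero_closed by blast
  have pQ: "primeideal Q R" using P Q G0 by auto
  obtain a where a: "a \<in> I" "a \<notin> \<Union>(G0 - {Q})" using minimal[OF Q] by blast
  then have aQ: "a \<in> Q" using G0 by blast
  have "\<exists>b\<in>I. b \<notin> Q \<and> (\<forall>Q'\<in>G0 - {Q}. b \<in> Q')"
  proof (rule prime_product[OF R pQ I])
    show "\<not> I \<subseteq> Q" using no Q G0 by blast
    show "finite (G0 - {Q})" using finG0 by simp
    fix Q' assume Q': "Q' \<in> G0 - {Q}"
    then show "ideal Q' R" using primeideal.axioms(1)[OF P[of Q']] G0 by auto
    obtain c where c: "c \<in> I" "c \<notin> \<Union>(G0 - {Q'})" using minimal[of Q'] Q' by blast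
    then have "c \<in> Q'" "c \<notin> Q" using G0 Q Q' by auto
    then show "\<not> Q' \<subseteq> Q" by blast
  qed
  then obtain b where b: "b \<in> I" "b \<notin> Q" "\<And>Q'. Q' \<in> G0 - {Q} \<Longrightarrow> b \<in> Q'" by blast
  have ab: "a \<in> carrier R" "b \<in> carrier R" using a(1) b(1) I.Icarr by auto
  have "a \<oplus>\<^bsub>R\<^esub> b \<in> I" by (rule I.a_closed[OF a(1) b(1)])
  then obtain Q' where Q': "Q' \<in> G0" "a \<oplus>\<^bsub>R\<^esub> b \<in> Q'" using G0 by blast
  interpret Q': primeideal Q' R using P Q' G0 by auto
  show False
  proof (cases "Q' = Q")
    case True
    have "a \<in> Q'" using aQ True by simp
    have "\<ominus>\<^bsub>R\<^esub> a \<oplus>\<^bsub>R\<^esub> (a \<oplus>\<^bsub>R\<^esub> b) \<in> Q'" by (rule Q'.a_closed[OF Q'.a_inv_closed[OF \<open>a \<in> Q'\<close>] Q'(2)])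
    moreover have "\<ominus>\<^bsub>R\<^esub> a \<oplus>\<^bsub>R\<^esub> (a \<oplus>\<^bsub>R\<^esub> b) = b" by (rule R.r_neg1[OF ab])
    ultimately show False using True b(2) by (simp only:)
  next
    case False
    then have "b \<in> Q'" using b(3) Q'(1) by blast
    then have "(a \<oplus>\<^bsub>R\<^esub> b) \<oplus>\<^bsub>R\<^esub> \<ominus>\<^bsub>R\<^esub> b \<in> Q'" by (rule Q'.a_closed[OF Q'(2) Q'.a_inv_closed])
    then have "a \<in> Q'" using ab by (simp add: R.a_assoc R.r_neg)
    then show False using a(2) Q'(1) False by blast
  qed
qed

section \<open>Annihilators of elements, the socle and Nakayama\<close>

definition elem_ann :: "('a, 'r) ring_scheme \<Rightarrow> ('a, 'm) module \<Rightarrow> 'm \<Rightarrow> 'a set"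
  where "elem_ann R N y = {r \<in> carrier R. r \<odot>\<^bsub>N\<^esub> y = \<zero>\<^bsub>N\<^esub>}"

lemma submodule_elem_ann:
  assumes N: "module R N" and y: "y \<in> carrier N"
  shows "submodule (elem_ann R N y) R (regular_module R)"
proof -
  interpret N: module R N by fact
  have "(\<lambda>r. r \<odot>\<^bsub>N\<^esub> y) \<in> mod_hom R (regular_module R) N"
    by (rule mod_homI) (auto simp: y N.smult_l_distr N.smult_assoc1)
  from submodule_kernel[OF module_regular_module[OF N.R.is_cring] N this] show ?thesis by (simp add: elem_ann_def)
qed

text \<open>If \<open>b\<close> times \<open>y\<close> is nonzero, its annihilator contains that of
  \<open>y\<close> and equals it by maximality; so an \<open>a\<close> that kills \<open>b\<close>
  times \<open>y\<close> already kills \<open>y\<close>.\<close>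

lemma maximal_elem_ann_prime:
  assumes N: "module R N" and y: "y \<in> carrier N" "y \<noteq> \<zero>\<^bsub>N\<^esub>"
    and max: "\<And>z. z \<in> carrier N \<Longrightarrow> z \<noteq> \<zero>\<^bsub>N\<^esub> \<Longrightarrow> elem_ann R N y \<subseteq> elem_ann R N z \<Longrightarrow> elem_ann R N z = elem_ann R N y"
  shows "primeideal (elem_ann R N y) R"
proof (rule primeidealI)
  interpret N: module R N by fact
  show "ideal (elem_ann R N y) R"
    using submodule_elem_ann[OF N y(1)] by (simp add: ideal_iff_submodule[OF N.R.is_cring])
  show "cring R" by (rule N.R.is_cring)
  have "\<one>\<^bsub>R\<^esub> \<notin> elem_ann R N y" using y by (simp add: elem_ann_def)
  then show "carrier R \<noteq> elem_ann R N y" using N.R.one_closed by blast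
  fix a b assume a: "a \<in> carrier R" and b: "b \<in> carrier R" and ab: "a \<otimes>\<^bsub>R\<^esub> b \<in> elem_ann R N y"
  show "a \<in> elem_ann R N y \<or> b \<in> elem_ann R N y"
  proof (cases "b \<in> elem_ann R N y")
    case False
    let ?z = "b \<odot>\<^bsub>N\<^esub> y"
    have z: "?z \<in> carrier N" "?z \<noteq> \<zero>\<^bsub>N\<^esub>" using False b y by (auto simp: elem_ann_def)
    have "elem_ann R N y \<subseteq> elem_ann R N ?z"
    proof
      fix r assume "r \<in> elem_ann R N y"
      then have r: "r \<in> carrier R" "r \<odot>\<^bsub>N\<^esub> y = \<zero>\<^bsub>N\<^esub>" by (auto simp: elem_ann_def)
      have "r \<odot>\<^bsub>N\<^esub> ?z = b \<odot>\<^bsub>N\<^esub> (r \<odot>\<^bsub>N\<^esub> y)"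
        using r(1) b y(1) by (metis N.R.m_comm N.smult_assoc1)
      then show "r \<in> elem_ann R N ?z" using r b by (simp add: elem_ann_def)
    qed
    from max[OF z this] have "elem_ann R N ?z = elem_ann R N y" .
    moreover have "a \<in> elem_ann R N ?z" using ab a b y(1) by (simp add: elem_ann_def N.smult_assoc1)
    ultimately show ?thesis by simp
  qed simp
qed

context local_noetherian
begin

text \<open>The zero divisors are the union of the maximal annihilators of elements, of which there are
  finitely many because \<open>N\<close> is Noetherian.\<close>

lemma zero_divisors_socle:
  assumes fg: "fin_gen R N"
    and zd: "\<And>a. a \<in> \<mm> \<Longrightarrow> \<exists>y\<in>carrier N. y \<noteq> \<zero>\<^bsub>N\<^esub> \<and> a \<odot>\<^bsub>N\<^esub> y = \<zero>\<^bsub>N\<^esub>"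
  shows "\<exists>y\<in>carrier N. y \<noteq> \<zero>\<^bsub>N\<^esub> \<and> (\<forall>a\<in>\<mm>. a \<odot>\<^bsub>N\<^esub> y = \<zero>\<^bsub>N\<^esub>)"
proof -
  have N: "module R N" using fg by (simp add: fin_gen_def)
  interpret N: module R N by fact
  note NN = noetherian_fin_gen[OF cring noetherian fg] and NR = noetherian_regular[OF cring noetherian]
  let ?ann = "elem_ann R N"
  \<comment> \<open>The elements whose annihilator is maximal among those of nonzero elements. These
    annihilators are prime, and by \<open>above\<close> every annihilator of a nonzero element lies
    in one of them.\<close>
  define T where "T = {y \<in> carrier N. y \<noteq> \<zero>\<^bsub>N\<^esub> \<and> (\<forall>z\<in>carrier N. z \<noteq> \<zero>\<^bsub>N\<^esub> \<longrightarrow> ?ann y \<subseteq> ?ann z \<longrightarrow> ?ann z = ?ann y)}"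
  have prime: "primeideal (?ann y) R" if "y \<in> T" for y
    by (rule maximal_elem_ann_prime[OF N]) (use that in \<open>auto simp: T_def\<close>)
  have idl: "ideal (?ann y) R" if "y \<in> T" for y by (rule primeideal.axioms(1)[OF prime[OF that]])
  have above: "\<exists>z\<in>T. ?ann y \<subseteq> ?ann z" if y: "y \<in> carrier N" "y \<noteq> \<zero>\<^bsub>N\<^esub>" for y
  proof -
    let ?A = "?ann ` {z \<in> carrier N. z \<noteq> \<zero>\<^bsub>N\<^esub> \<and> ?ann y \<subseteq> ?ann z}"
    have ne: "?A \<noteq> {}" using y by blast
    have sm: "submodule H R (regular_module R)" if "H \<in> ?A" for H
      using that submodule_elem_ann[OF N] by auto
    obtain X where X1: "X \<in> ?A" and X2: "\<forall>Y\<in>?A. X \<subseteq> Y \<longrightarrow> Y = X"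
      using noetherian_maximal[OF NR ne sm] by (rule bexE)
    note X = X1 X2[rule_format]
    then obtain z where z: "z \<in> carrier N" "z \<noteq> \<zero>\<^bsub>N\<^esub>" "?ann y \<subseteq> ?ann z" "X = ?ann z" by auto
    have "?ann w = ?ann z" if "w \<in> carrier N" "w \<noteq> \<zero>\<^bsub>N\<^esub>" "?ann z \<subseteq> ?ann w" for w
      using X(2)[of "?ann w"] that z(3,4) by auto
    then have "z \<in> T" using z by (simp add: T_def)
    then show ?thesis using z(3) by blast
  qed
  have TN: "T \<subseteq> carrier N" by (auto simp: T_def)
  \<comment> \<open>A maximal submodule among those generated by finitely many elements of
    \<open>T\<close> contains all of \<open>T\<close>. The finite set \<open>S\<close> behind it is
    what bounds the number of primes.\<close>
  let ?G = "gen_submodule R N ` {S. finite S \<and> S \<subseteq> T}"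
  have neG: "?G \<noteq> {}" by blast
  have smG: "submodule H R N" if "H \<in> ?G" for H
  proof -
    obtain S where "S \<subseteq> T" "H = gen_submodule R N S" using \<open>H \<in> ?G\<close> by auto
    then show ?thesis using gen_submodule(1)[OF N, of S] TN by auto
  qed
  obtain X where X1: "X \<in> ?G" and X2: "\<forall>Y\<in>?G. X \<subseteq> Y \<longrightarrow> Y = X"
    using noetherian_maximal[OF NN neG smG] by (rule bexE)
  note X = X1 X2[rule_format]
  then obtain S where S: "finite S" "S \<subseteq> T" "X = gen_submodule R N S" by auto
  have SN: "S \<subseteq> carrier N" using S(2) TN by auto
  have TX: "z \<in> gen_submodule R N S" if z: "z \<in> T" for z
  proof -
    have zS: "insert z S \<subseteq> carrier N" using z SN TN by auto
    note g = gen_submodule[OF N zS]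
    have "gen_submodule R N S \<subseteq> gen_submodule R N (insert z S)"
      by (rule gen_submodule(3)[OF N SN g(1)]) (use g(2) in auto)
    moreover have "gen_submodule R N (insert z S) \<in> ?G" using S z by blast
    ultimately have "gen_submodule R N (insert z S) = gen_submodule R N S" using X(2) S(3) by simp
    then show ?thesis using g(2) by auto
  qed
  have "\<mm> \<subseteq> \<Union>(?ann ` S)"
  proof
    fix a assume a: "a \<in> \<mm>"
    then have aR: "a \<in> carrier R" by (rule \<mm>.Icarr)
    obtain y where y: "y \<in> carrier N" "y \<noteq> \<zero>\<^bsub>N\<^esub>" "a \<odot>\<^bsub>N\<^esub> y = \<zero>\<^bsub>N\<^esub>" using zd[OF a] by blast
    obtain z where z: "z \<in> T" "?ann y \<subseteq> ?ann z" using above[OF y(1,2)] by blast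
    then have az: "a \<in> ?ann z" using y(3) aR by (auto simp: elem_ann_def)
    \<comment> \<open>Since \<open>z\<close> lies in the submodule generated by \<open>S\<close>,
      whatever kills \<open>S\<close> kills \<open>z\<close>. If the prime \<open>?ann z\<close>
      contained no \<open>?ann y\<close>, then \<open>prime_product\<close> would yield an element
      that kills \<open>S\<close> but not \<open>z\<close>.\<close>
    have "\<exists>y\<in>S. ?ann y \<subseteq> ?ann z"
    proof (rule ccontr)
      assume no: "\<not> (\<exists>y\<in>S. ?ann y \<subseteq> ?ann z)"
      have "\<one>\<^bsub>R\<^esub> \<notin> ?ann z" using z(1) by (auto simp: elem_ann_def T_def)
      then have "\<not> carrier R \<subseteq> ?ann z" using R.one_closed by blast
      then have "\<exists>b\<in>carrier R. b \<notin> ?ann z \<and> (\<forall>Q\<in>?ann ` S. b \<in> Q)"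
        using no S(1,2) idl by (intro prime_product[OF cring prime[OF z(1)] R.oneideal]) auto
      then obtain b where b: "b \<in> carrier R" "b \<notin> ?ann z" "\<And>y. y \<in> S \<Longrightarrow> b \<in> ?ann y" by blast
      have bh: "(\<lambda>x. b \<odot>\<^bsub>N\<^esub> x) \<in> mod_hom R N N" by (rule mod_hom_smult[OF N mod_hom_id b(1)])
      have "gen_submodule R N S \<subseteq> {x \<in> carrier N. b \<odot>\<^bsub>N\<^esub> x = \<zero>\<^bsub>N\<^esub>}"
        by (rule gen_submodule(3)[OF N SN submodule_kernel[OF N N bh]]) (use SN b(3) in \<open>auto simp: elem_ann_def\<close>)
      then have "b \<odot>\<^bsub>N\<^esub> z = \<zero>\<^bsub>N\<^esub>" using TX[OF z(1)] by blast
      then show False using b(1,2) by (simp add: elem_ann_def)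
    qed
    then obtain w where w: "w \<in> S" "?ann w \<subseteq> ?ann z" by blast
    have "?ann z = ?ann w" using w S(2) z(1) unfolding T_def by blast
    then show "a \<in> \<Union>(?ann ` S)" using az w(1) by blast
  qed
  then have "\<exists>P\<in>?ann ` S. \<mm> \<subseteq> P"
    using S(1,2) prime by (intro prime_avoidance[OF cring \<mm>_ideal]) auto
  then obtain y where y: "y \<in> S" "\<mm> \<subseteq> ?ann y" by blast
  show ?thesis
    by (rule bexI[of _ y]) (use y S(2) in \<open>auto simp: T_def elem_ann_def\<close>)
qed

text \<open>In a minimal cover of \<open>N\<close>, the first unit vector would have the same image
  as some \<open>w\<close> in \<open>mF\<close>. Their difference is a relation, hence in
  \<open>mF\<close> too, and so the unit vector would be in \<open>mF\<close>, although its
  coordinate one is outside \<open>\<mm>\<close>.\<close>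

lemma nakayama:
  assumes fg: "fin_gen R N" and nz: "\<not> zero_module N"
    and S: "S \<subseteq> {x \<odot>\<^bsub>N\<^esub> y | x y. x \<in> \<mm> \<and> y \<in> carrier N}"
  shows "gen_submodule R N S \<noteq> carrier N"
proof
  assume gen: "gen_submodule R N S = carrier N"
  have N: "module R N" using fg by (simp add: fin_gen_def)
  interpret N: module R N by fact
  obtain n :: nat and \<pi> where \<pi>: "\<pi> \<in> mod_hom R (free_module R {..<n}) N" "\<pi> ` carrier (free_module R {..<n}) = carrier N"
    "{u \<in> carrier (free_module R {..<n}). \<pi> u = \<zero>\<^bsub>N\<^esub>} \<subseteq> mF {..<n}" by (rule minimal_cover[OF fg])
  let ?F = "free_module R {..<n}"
  have F: "module R ?F" by (rule module_free_module[OF cring])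
  interpret F: module R ?F by fact
  have L: "submodule (\<pi> ` mF {..<n}) R N" by (rule submodule_image[OF F N \<pi>(1) submodule_mF])
  have "S \<subseteq> \<pi> ` mF {..<n}"
  proof
    fix s assume "s \<in> S"
    then obtain x y where s: "s = x \<odot>\<^bsub>N\<^esub> y" "x \<in> \<mm>" "y \<in> carrier N" using S by auto
    then obtain u where u: "u \<in> carrier ?F" "y = \<pi> u" using \<pi>(2) by auto
    have xR: "x \<in> carrier R" using s(2) by (rule \<mm>.Icarr)
    have mem: "x \<odot>\<^bsub>?F\<^esub> u \<in> mF {..<n}"
      using F.smult_closed[OF xR u(1)] free_module_val[OF u(1)] s(2) by (auto simp: mF_def free_module_simps intro: \<mm>.I_r_closed)
    have eq: "s = \<pi> (x \<odot>\<^bsub>?F\<^esub> u)" using mod_homD(3)[OF \<pi>(1) xR u(1)] s(1) u(2) by simp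
    show "s \<in> \<pi> ` mF {..<n}" unfolding eq by (rule imageI[OF mem])
  qed
  moreover have SN: "S \<subseteq> carrier N" using S \<mm>.Icarr by auto
  ultimately have cover: "carrier N \<subseteq> \<pi> ` mF {..<n}" using gen_submodule(3)[OF N SN L] gen by simp
  have n: "0 < n"
  proof (rule ccontr)
    assume "\<not> 0 < n"
    then have "u = \<zero>\<^bsub>?F\<^esub>" if "u \<in> carrier ?F" for u
      by (intro free_module_eqI[OF that F.M.zero_closed]) auto
    then have "carrier ?F \<subseteq> {\<zero>\<^bsub>?F\<^esub>}" by blast
    from image_mono[OF this, of \<pi>] have "carrier N \<subseteq> {\<zero>\<^bsub>N\<^esub>}"
      unfolding \<pi>(2) by (simp add: mod_hom_zero[OF F N \<pi>(1)])
    then show False using nz N.M.zero_closed unfolding zero_module_def by blast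
  qed
  let ?e = "unit_vec R {..<n} 0"
  have e: "?e \<in> carrier ?F" by (rule unit_vec_closed[OF cring])
  obtain w where w: "w \<in> mF {..<n}" "\<pi> ?e = \<pi> w" using cover mod_homD(1)[OF \<pi>(1) e] by auto
  have wc: "w \<in> carrier ?F" using w(1) by (simp add: mF_def)
  have "?e \<ominus>\<^bsub>?F\<^esub> w \<in> {u \<in> carrier ?F. \<pi> u = \<zero>\<^bsub>N\<^esub>}"
    using module_diff_closed[OF F e wc] module_hom_eq_iff[OF F N \<pi>(1) e wc] w(2) by simp
  then have "?e \<ominus>\<^bsub>?F\<^esub> w \<in> mF {..<n}" using \<pi>(3) by blast
  from submoduleD(4)[OF F submodule_mF this w(1)] have "?e \<in> mF {..<n}"
    using e wc by (simp add: a_minus_def F.M.a_assoc F.M.l_neg)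
  then have "\<forall>s\<in>{..<n}. ?e s \<in> \<mm>" by (simp add: mF_def)
  from bspec[OF this, of 0] n have "?e 0 \<in> \<mm>" by simp
  then show False using n one_notin by (simp add: unit_vec_def)
qed

end

section \<open>Regular sequences and the first nonvanishing Ext\<close>

lemma seq_submodule_props:
  assumes N: "module R N" and xs: "set xs \<subseteq> carrier R"
  shows "submodule (seq_submodule R N xs) R N"
    and "x \<in> set xs \<Longrightarrow> y \<in> carrier N \<Longrightarrow> x \<odot>\<^bsub>N\<^esub> y \<in> seq_submodule R N xs"
    and "submodule H R N \<Longrightarrow> (\<And>x y. x \<in> set xs \<Longrightarrow> y \<in> carrier N \<Longrightarrow> x \<odot>\<^bsub>N\<^esub> y \<in> H) \<Longrightarrow> seq_submodule R N xs \<subseteq> H"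
proof -
  interpret N: module R N by fact
  let ?S = "{x \<odot>\<^bsub>N\<^esub> y |x y. x \<in> set xs \<and> y \<in> carrier N}"
  have S: "?S \<subseteq> carrier N" using xs by auto
  note g = gen_submodule[OF N S]
  show "submodule (seq_submodule R N xs) R N" unfolding seq_submodule_def by (rule g(1))
  show "x \<odot>\<^bsub>N\<^esub> y \<in> seq_submodule R N xs" if "x \<in> set xs" "y \<in> carrier N"
    unfolding seq_submodule_def by (rule subsetD[OF g(2)]) (use that in blast)
  show "seq_submodule R N xs \<subseteq> H" if "submodule H R N" "\<And>x y. x \<in> set xs \<Longrightarrow> y \<in> carrier N \<Longrightarrow> x \<odot>\<^bsub>N\<^esub> y \<in> H"
    unfolding seq_submodule_def by (rule g(3)[OF that(1)]) (use that(2) in auto)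
qed

lemma seq_submodule_Nil:
  assumes N: "module R N" shows "seq_submodule R N [] = {\<zero>\<^bsub>N\<^esub>}"
  using seq_submodule_props(3)[OF N _ submodule_zero[OF N], of "[]"]
    submoduleD(3)[OF N seq_submodule_props(1)[OF N, of "[]"]] by auto

text \<open>The description as a sum identifies the kernel of the map between the quotients by
  \<open>xs\<close> and by \<open>xs @ [x]\<close> with the multiples of \<open>x\<close>.\<close>

lemma seq_submodule_snoc:
  assumes N: "module R N" and xs: "set xs \<subseteq> carrier R" and x: "x \<in> carrier R"
  shows "seq_submodule R N (xs @ [x]) = {h \<oplus>\<^bsub>N\<^esub> x \<odot>\<^bsub>N\<^esub> z | h z. h \<in> seq_submodule R N xs \<and> z \<in> carrier N}"
    (is "_ = ?L")
proof
  interpret N: module R N by fact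
  note P = seq_submodule_props[OF N xs]
  note D = submoduleD[OF N P(1)]
  have xsx: "set (xs @ [x]) \<subseteq> carrier R" using xs x by simp
  note P' = seq_submodule_props[OF N xsx]
  have LI: "y \<in> ?L" if "h \<in> seq_submodule R N xs" "z \<in> carrier N" "y = h \<oplus>\<^bsub>N\<^esub> x \<odot>\<^bsub>N\<^esub> z" for y h z
    using that by blast
  have "submodule ?L R N"
  proof (rule submoduleI'[OF N])
    show "?L \<subseteq> carrier N" using D(2) x by auto
    show "\<zero>\<^bsub>N\<^esub> \<in> ?L" by (rule LI[OF D(3) N.M.zero_closed]) (use x in simp)
    fix a assume "a \<in> ?L"
    then obtain h z where a: "h \<in> seq_submodule R N xs" "z \<in> carrier N" "a = h \<oplus>\<^bsub>N\<^esub> x \<odot>\<^bsub>N\<^esub> z" by blast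
    show "r \<odot>\<^bsub>N\<^esub> a \<in> ?L" if r: "r \<in> carrier R" for r
    proof (rule LI[OF D(5)[OF r a(1)] N.smult_closed[OF r a(2)]])
      have "r \<odot>\<^bsub>N\<^esub> (x \<odot>\<^bsub>N\<^esub> z) = x \<odot>\<^bsub>N\<^esub> (r \<odot>\<^bsub>N\<^esub> z)" using r x a(2) by (metis N.R.m_comm N.smult_assoc1)
      then show "r \<odot>\<^bsub>N\<^esub> a = r \<odot>\<^bsub>N\<^esub> h \<oplus>\<^bsub>N\<^esub> x \<odot>\<^bsub>N\<^esub> (r \<odot>\<^bsub>N\<^esub> z)" using a D(2) r x by (simp add: N.smult_r_distr)
    qed
    fix b assume "b \<in> ?L"
    then obtain h' z' where b: "h' \<in> seq_submodule R N xs" "z' \<in> carrier N" "b = h' \<oplus>\<^bsub>N\<^esub> x \<odot>\<^bsub>N\<^esub> z'" by blast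
    show "a \<oplus>\<^bsub>N\<^esub> b \<in> ?L"
      by (rule LI[OF D(4)[OF a(1) b(1)] N.M.a_closed[OF a(2) b(2)]])
         (use a b D(2) x in \<open>simp add: N.smult_r_distr N.M.a_ac\<close>)
  qed
  then show "seq_submodule R N (xs @ [x]) \<subseteq> ?L"
  proof (rule P'(3))
    fix x' y assume x': "x' \<in> set (xs @ [x])" and y: "y \<in> carrier N"
    show "x' \<odot>\<^bsub>N\<^esub> y \<in> ?L"
    proof (cases "x' = x")
      case True
      show ?thesis by (rule LI[OF D(3) y]) (use True x y in simp)
    next
      case False
      then have "x' \<in> set xs" using x' by simp
      from P(2)[OF this y] show ?thesis by (rule LI[OF _ N.M.zero_closed]) (use D(2) P(2)[OF \<open>x' \<in> set xs\<close> y] x in simp)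
    qed
  qed
  have sub: "seq_submodule R N xs \<subseteq> seq_submodule R N (xs @ [x])" by (rule P(3)[OF P'(1)]) (rule P'(2), auto)
  show "?L \<subseteq> seq_submodule R N (xs @ [x])"
  proof
    fix a assume "a \<in> ?L"
    then obtain h z where a: "h \<in> seq_submodule R N xs" "z \<in> carrier N" "a = h \<oplus>\<^bsub>N\<^esub> x \<odot>\<^bsub>N\<^esub> z" by blast
    have "x \<odot>\<^bsub>N\<^esub> z \<in> seq_submodule R N (xs @ [x])" by (rule P'(2)[OF _ a(2)]) simp
    then show "a \<in> seq_submodule R N (xs @ [x])" unfolding a(3) using submoduleD(4)[OF N P'(1)] a(1) sub by blast
  qed
qed

abbreviation "seq_quotient R N xs \<equiv> quotient_module N (seq_submodule R N xs)"

text \<open>The inductive part of \<open>regular_sequence\<close>; the remaining condition, that the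
  quotient is nonzero, comes from \<open>seq_submodule_proper\<close>.\<close>

definition weakly_regular :: "('a, 'r) ring_scheme \<Rightarrow> ('a, 'm) module \<Rightarrow> 'a list \<Rightarrow> bool"
  where "weakly_regular R N xs \<longleftrightarrow> (\<forall>i<length xs. \<forall>y\<in>carrier (seq_quotient R N (take i xs)).
    (xs ! i) \<odot>\<^bsub>seq_quotient R N (take i xs)\<^esub> y = \<zero>\<^bsub>seq_quotient R N (take i xs)\<^esub> \<longrightarrow>
    y = \<zero>\<^bsub>seq_quotient R N (take i xs)\<^esub>)"

lemma weakly_regular_snoc: "weakly_regular R N (xs @ [x]) \<longleftrightarrow> weakly_regular R N xs \<and>
    (\<forall>y\<in>carrier (seq_quotient R N xs). x \<odot>\<^bsub>seq_quotient R N xs\<^esub> y = \<zero>\<^bsub>seq_quotient R N xs\<^esub> \<longrightarrow>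
      y = \<zero>\<^bsub>seq_quotient R N xs\<^esub>)"
  unfolding weakly_regular_def length_append_singleton All_less_Suc by (simp add: nth_append conj_commute)

lemma regular_sequence_iff: "regular_sequence R N xs \<longleftrightarrow>
    weakly_regular R N xs \<and> \<not> zero_module (seq_quotient R N xs)"
  by (simp add: regular_sequence_def weakly_regular_def Let_def)

context residue_resolution
begin

lemma ext_vanishes_iso:
  assumes A: "module R A" and B: "module R B" and u: "u \<in> mod_hom R A B"
    and inj: "\<And>x. x \<in> carrier A \<Longrightarrow> u x = \<zero>\<^bsub>B\<^esub> \<Longrightarrow> x = \<zero>\<^bsub>A\<^esub>" and surj: "u ` carrier A = carrier B"
  shows "ext_vanishes A j \<longleftrightarrow> ext_vanishes B j"
proof -
  have "\<exists>v\<in>mod_hom R B A. \<forall>x\<in>carrier A. v (u x) = x"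
    by (rule mod_hom_factor_surj[OF A B A u mod_hom_id surj]) (rule inj)
  then obtain v where v: "v \<in> mod_hom R B A" and "\<forall>x\<in>carrier A. v (u x) = x" by (rule bexE)
  note vu = this(2)[rule_format]
  have "u (v y) = y" if "y \<in> carrier B" for y
  proof -
    have "y \<in> u ` carrier A" unfolding surj by (rule that)
    then obtain x where "x \<in> carrier A" "y = u x" by (elim imageE)
    then show ?thesis using vu by simp
  qed
  then show ?thesis
    using ext_vanishes_retract[OF A B u v vu, of j] ext_vanishes_retract[OF B A v u, of j] by metis
qed

text \<open>Each element of the sequence shortens the range of vanishing by one. Regularity of the
  last element refers to the quotient by all earlier ones, hence the reverse induction. For
  \<open>n = 0\<close> the right side is void, and the left side says that \<open>Ext\<close>
  vanishes below the length of the sequence.\<close>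

lemma ext_vanishes_weakly_regular:
  assumes N: "module R N" and xs: "set xs \<subseteq> \<mm>" and reg: "weakly_regular R N xs"
  shows "(\<forall>j<length xs + n. ext_vanishes N j) \<longleftrightarrow> (\<forall>j<n. ext_vanishes (seq_quotient R N xs) j)"
  using xs reg
proof (induction xs arbitrary: n rule: rev_induct)
  case Nil
  note H = seq_submodule_props(1)[OF N, of "[]"]
  have "ext_vanishes N j \<longleftrightarrow> ext_vanishes (seq_quotient R N []) j" for j
  proof (rule ext_vanishes_iso[OF N module_quotient[OF N] quotient_hom[OF N] _ quotient_surj[OF N]])
    show "x = \<zero>\<^bsub>N\<^esub>" if "x \<in> carrier N" "seq_submodule R N [] +>\<^bsub>N\<^esub> x = \<zero>\<^bsub>seq_quotient R N []\<^esub>" for x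
      using that coset_eq_zero_iff[OF N H that(1)] seq_submodule_Nil[OF N] by simp
  qed (use H in auto)
  then show ?case by simp
next
  case (snoc x xs)
  have xs: "set xs \<subseteq> carrier R" "set (xs @ [x]) \<subseteq> carrier R" "x \<in> carrier R" "x \<in> \<mm>" "set xs \<subseteq> \<mm>"
    using snoc.prems(1) \<mm>.Icarr by auto
  note H = seq_submodule_props(1)[OF N xs(1)] and H' = seq_submodule_props(1)[OF N xs(2)]
  let ?Q = "seq_quotient R N xs" and ?Q' = "seq_quotient R N (xs @ [x])"
  let ?\<pi> = "\<lambda>y. seq_submodule R N xs +>\<^bsub>N\<^esub> y" and ?\<pi>' = "\<lambda>y. seq_submodule R N (xs @ [x]) +>\<^bsub>N\<^esub> y"
  interpret N: module R N by fact
  note mQ = module_quotient[OF N H] and mQ' = module_quotient[OF N H']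
  note \<pi> = quotient_hom[OF N H] and \<pi>' = quotient_hom[OF N H']
  note snocH = seq_submodule_snoc[OF N xs(1,3)]
  interpret Q: module R ?Q by (rule mQ)
  have mem: "h \<oplus>\<^bsub>N\<^esub> x \<odot>\<^bsub>N\<^esub> z \<in> seq_submodule R N (xs @ [x])"
    if "h \<in> seq_submodule R N xs" "z \<in> carrier N" for h z unfolding snocH using that by blast
  have "?\<pi>' y = \<zero>\<^bsub>?Q'\<^esub>" if y: "y \<in> carrier N" "?\<pi> y = \<zero>\<^bsub>?Q\<^esub>" for y
  proof -
    have "y \<in> seq_submodule R N xs" using y coset_eq_zero_iff[OF N H y(1)] by simp
    from mem[OF this N.M.zero_closed] have "y \<in> seq_submodule R N (xs @ [x])" using y(1) xs(3) by simp
    then show ?thesis using coset_eq_zero_iff[OF N H' y(1)] by simp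
  qed
  then have "\<exists>v\<in>mod_hom R ?Q ?Q'. \<forall>y\<in>carrier N. v (?\<pi> y) = ?\<pi>' y"
    by (rule mod_hom_factor_surj[OF N mQ mQ' \<pi> \<pi>' quotient_surj[OF N H]])
  then obtain v where "v \<in> mod_hom R ?Q ?Q'" and "\<forall>y\<in>carrier N. v (?\<pi> y) = ?\<pi>' y" by (rule bexE)
  note v = this(1) this(2)[rule_format]
  have "v ` carrier ?Q = (\<lambda>y. v (?\<pi> y)) ` carrier N" unfolding quotient_surj[OF N H, symmetric] by (simp add: image_image)
  also have "\<dots> = ?\<pi>' ` carrier N" by (rule image_cong[OF refl v(2)])
  also have "\<dots> = carrier ?Q'" by (rule quotient_surj[OF N H'])
  finally have surj: "v ` carrier ?Q = carrier ?Q'" .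
  have reg: "y = \<zero>\<^bsub>?Q\<^esub>" if "y \<in> carrier ?Q" "x \<odot>\<^bsub>?Q\<^esub> y = \<zero>\<^bsub>?Q\<^esub>" for y
    using snoc.prems(2) that unfolding weakly_regular_snoc by blast
  have ker: "{C \<in> carrier ?Q. v C = \<zero>\<^bsub>?Q'\<^esub>} = (\<lambda>C. x \<odot>\<^bsub>?Q\<^esub> C) ` carrier ?Q"
  proof (intro equalityI subsetI)
    fix C assume "C \<in> {C \<in> carrier ?Q. v C = \<zero>\<^bsub>?Q'\<^esub>}"
    then have "C \<in> ?\<pi> ` carrier N" and vC: "v C = \<zero>\<^bsub>?Q'\<^esub>" unfolding quotient_surj[OF N H] by auto
    then obtain y where y: "y \<in> carrier N" "C = ?\<pi> y" by (elim imageE)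
    then have "y \<in> seq_submodule R N (xs @ [x])" using v(2)[OF y(1)] coset_eq_zero_iff[OF N H' y(1)] vC by simp
    then obtain h z where h: "h \<in> seq_submodule R N xs" "z \<in> carrier N" "y = h \<oplus>\<^bsub>N\<^esub> x \<odot>\<^bsub>N\<^esub> z" unfolding snocH by blast
    have hc: "h \<in> carrier N" by (rule submoduleD(2)[OF N H h(1)])
    have xz: "x \<odot>\<^bsub>N\<^esub> z \<in> carrier N" using xs(3) h(2) by simp
    have "C = ?\<pi> h \<oplus>\<^bsub>?Q\<^esub> ?\<pi> (x \<odot>\<^bsub>N\<^esub> z)" unfolding y(2) h(3) by (rule mod_homD(2)[OF \<pi> hc xz])
    also have "?\<pi> h = \<zero>\<^bsub>?Q\<^esub>" using coset_eq_zero_iff[OF N H hc] h(1) by simp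
    also have "\<zero>\<^bsub>?Q\<^esub> \<oplus>\<^bsub>?Q\<^esub> ?\<pi> (x \<odot>\<^bsub>N\<^esub> z) = x \<odot>\<^bsub>?Q\<^esub> ?\<pi> z"
      using Q.M.l_zero[OF mod_homD(1)[OF \<pi> xz]] mod_homD(3)[OF \<pi> xs(3) h(2)] by simp
    finally show "C \<in> (\<lambda>C. x \<odot>\<^bsub>?Q\<^esub> C) ` carrier ?Q" by (rule image_eqI[OF _ mod_homD(1)[OF \<pi> h(2)]])
  next
    fix C assume "C \<in> (\<lambda>C. x \<odot>\<^bsub>?Q\<^esub> C) ` carrier ?Q"
    then obtain B where B: "B \<in> carrier ?Q" "C = x \<odot>\<^bsub>?Q\<^esub> B" by (rule imageE)
    then have "B \<in> ?\<pi> ` carrier N" unfolding quotient_surj[OF N H] by simp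
    then obtain z where z: "z \<in> carrier N" "B = ?\<pi> z" by (elim imageE)
    have xz: "x \<odot>\<^bsub>N\<^esub> z \<in> carrier N" using xs(3) z(1) by simp
    have C: "C = ?\<pi> (x \<odot>\<^bsub>N\<^esub> z)" using mod_homD(3)[OF \<pi> xs(3) z(1)] B(2) z(2) by simp
    have "\<zero>\<^bsub>N\<^esub> \<oplus>\<^bsub>N\<^esub> x \<odot>\<^bsub>N\<^esub> z \<in> seq_submodule R N (xs @ [x])" by (rule mem[OF submoduleD(3)[OF N H] z(1)])
    then have "v C = \<zero>\<^bsub>?Q'\<^esub>" using v(2)[OF xz] coset_eq_zero_iff[OF N H' xz] C xz by simp
    then show "C \<in> {C \<in> carrier ?Q. v C = \<zero>\<^bsub>?Q'\<^esub>}" using mod_homD(1)[OF \<pi> xz] C by simp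
  qed
  have "(\<forall>j<length xs + Suc n. ext_vanishes N j) \<longleftrightarrow> (\<forall>j<Suc n. ext_vanishes ?Q j)"
    using snoc.IH[OF xs(5), of "Suc n"] snoc.prems(2) unfolding weakly_regular_snoc by simp
  also have "\<dots> \<longleftrightarrow> (\<forall>j<n. ext_vanishes ?Q' j)"
    by (rule ext_vanishes_regular_quotient[OF mQ mQ' v(1) surj xs(4) reg ker])
  finally show ?case by simp
qed

text \<open>A relation and not a function, so that existence can be a separate statement,
  \<open>ext_depth_exists\<close>.\<close>

definition ext_depth :: "('a, 'n) module \<Rightarrow> nat \<Rightarrow> bool"
  where "ext_depth N r \<longleftrightarrow> (\<forall>j<r. ext_vanishes N j) \<and> \<not> ext_vanishes N r"

lemma zero_ext_vanishes:
  assumes N: "module R N" and z: "zero_module N" shows "ext_vanishes N j"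
  unfolding ext_vanishes_def
proof (intro allI impI)
  fix f assume f: "ext_cocycle N j f"
  show "ext_coboundary N j f"
    by (rule ext_coboundary_cong[OF ext_coboundary_zero[OF N]])
       (use f z mod_homD(1)[of f R "K.F j" N] in \<open>auto simp: ext_cocycle_def zero_module_def\<close>)
qed

lemma fin_gen_seq_quotient:
  assumes fg: "fin_gen R N" and xs: "set xs \<subseteq> \<mm>" shows "fin_gen R (seq_quotient R N xs)"
proof -
  have N: "module R N" using fg by (simp add: fin_gen_def)
  have "set xs \<subseteq> carrier R" using xs \<mm>.Icarr by auto
  note H = seq_submodule_props(1)[OF N this]
  show ?thesis by (rule fin_gen_image[OF fg module_quotient[OF N H] quotient_hom[OF N H] quotient_surj[OF N H]])
qed

lemma seq_submodule_proper:
  assumes fg: "fin_gen R N" and nz: "\<not> zero_module N" and xs: "set xs \<subseteq> \<mm>"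
  shows "seq_submodule R N xs \<noteq> carrier N"
  unfolding seq_submodule_def by (rule nakayama[OF fg nz]) (use xs in blast)

text \<open>Otherwise \<open>\<mm>\<close> consists of zero divisors, and
  \<open>zero_divisors_socle\<close> provides an element killed by all of \<open>\<mm>\<close>,
  hence a nonzero class in degree \<open>0\<close>.\<close>

lemma regular_element:
  assumes fg: "fin_gen R N" and ev: "ext_vanishes N 0"
  shows "\<exists>x\<in>\<mm>. \<forall>y\<in>carrier N. x \<odot>\<^bsub>N\<^esub> y = \<zero>\<^bsub>N\<^esub> \<longrightarrow> y = \<zero>\<^bsub>N\<^esub>"
proof (rule ccontr)
  assume no: "\<not> ?thesis"
  have N: "module R N" using fg by (simp add: fin_gen_def)
  have zd: "\<exists>y\<in>carrier N. y \<noteq> \<zero>\<^bsub>N\<^esub> \<and> a \<odot>\<^bsub>N\<^esub> y = \<zero>\<^bsub>N\<^esub>" if "a \<in> \<mm>" for a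
    using no that by blast
  obtain y where y: "y \<in> carrier N" "y \<noteq> \<zero>\<^bsub>N\<^esub>" "\<And>a. a \<in> \<mm> \<Longrightarrow> a \<odot>\<^bsub>N\<^esub> y = \<zero>\<^bsub>N\<^esub>"
    using zero_divisors_socle[OF fg zd] by blast
  show False using socle_not_ext_vanishes[OF N y] ev by simp
qed

text \<open>A weakly regular sequence of length below \<open>r\<close> can be prolonged, since
  \<open>Ext\<close> of the quotient still vanishes in degree \<open>0\<close>. No regular sequence
  is longer than \<open>r\<close>, since \<open>Ext\<close> vanishes below its length.\<close>

lemma depth_eq_ext_depth:
  assumes fg: "fin_gen R N" and r: "ext_depth N r"
  shows "depth R \<mm> N = enat r"
proof -
  have N: "module R N" using fg by (simp add: fin_gen_def)
  have below: "\<forall>j<r. ext_vanishes N j" and at: "\<not> ext_vanishes N r" using r by (auto simp: ext_depth_def)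
  have nz: "\<not> zero_module N" using zero_ext_vanishes[OF N] at by blast
  have "\<exists>xs. length xs = i \<and> set xs \<subseteq> \<mm> \<and> weakly_regular R N xs" if "i \<le> r" for i
    using that
  proof (induction i)
    case 0
    show ?case by (rule exI[of _ "[]"]) (simp add: weakly_regular_def)
  next
    case (Suc i)
    then obtain xs where xs: "length xs = i" "set xs \<subseteq> \<mm>" "weakly_regular R N xs" by auto
    have "\<forall>j<length xs + (r - i). ext_vanishes N j" using below xs(1) Suc.prems by auto
    then have "\<forall>j<r - i. ext_vanishes (seq_quotient R N xs) j"
      using ext_vanishes_weakly_regular[OF N xs(2,3)] by blast
    then have "ext_vanishes (seq_quotient R N xs) 0" using Suc.prems by simp
    then obtain x where x: "x \<in> \<mm>"
      "\<forall>y\<in>carrier (seq_quotient R N xs). x \<odot>\<^bsub>seq_quotient R N xs\<^esub> y = \<zero>\<^bsub>seq_quotient R N xs\<^esub> \<longrightarrow> y = \<zero>\<^bsub>seq_quotient R N xs\<^esub>"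
      using regular_element[OF fin_gen_seq_quotient[OF fg xs(2)]] by blast
    then show ?case using xs by (intro exI[of _ "xs @ [x]"]) (simp add: weakly_regular_snoc)
  qed
  then obtain xs where xs: "length xs = r" "set xs \<subseteq> \<mm>" "weakly_regular R N xs" by blast
  have "set xs \<subseteq> carrier R" using xs(2) \<mm>.Icarr by auto
  then have "\<not> zero_module (seq_quotient R N xs)"
    using zero_quotient_iff[OF N seq_submodule_props(1)[OF N]] seq_submodule_proper[OF fg nz xs(2)] by simp
  then have lower: "enat r \<in> {enat (length xs) |xs. set xs \<subseteq> \<mm> \<and> regular_sequence R N xs}"
    using xs by (auto simp: regular_sequence_iff)
  have upper: "length ys \<le> r" if ys: "set ys \<subseteq> \<mm>" "regular_sequence R N ys" for ys
  proof (rule ccontr)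
    assume "\<not> length ys \<le> r"
    moreover have "\<forall>j<length ys. ext_vanishes N j"
      using ext_vanishes_weakly_regular[OF N ys(1), of 0] ys(2) by (simp add: regular_sequence_iff)
    ultimately show False using at by simp
  qed
  show ?thesis unfolding depth_def
    by (rule antisym[OF Sup_least Sup_upper[OF lower]]) (use upper in auto)
qed

text \<open>If \<open>Ext\<close> vanished in all degrees, weakly regular sequences could always be
  prolonged. Take one whose submodule is maximal: a further regular \<open>x\<close> then multiplies
  the quotient to zero, so the quotient is zero, against
  \<open>seq_submodule_proper\<close>.\<close>

lemma ext_depth_exists:
  assumes fg: "fin_gen R N" and nz: "\<not> zero_module N"
  shows "\<exists>r. ext_depth N r"
proof -
  have N: "module R N" using fg by (simp add: fin_gen_def)
  interpret N: module R N by fact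
  have "\<exists>j. \<not> ext_vanishes N j"
  proof (rule ccontr)
    assume "\<nexists>j. \<not> ext_vanishes N j"
    then have all: "ext_vanishes N j" for j by blast
    let ?A = "seq_submodule R N ` {xs. set xs \<subseteq> \<mm> \<and> weakly_regular R N xs}"
    have "weakly_regular R N []" by (simp add: weakly_regular_def)
    then have ne: "?A \<noteq> {}" by force
    have mR: "set xs \<subseteq> carrier R" if "set xs \<subseteq> \<mm>" for xs using that \<mm>.Icarr by auto
    have sm: "submodule H R N" if "H \<in> ?A" for H
      using that seq_submodule_props(1)[OF N mR] by auto
    obtain X where X1: "X \<in> ?A" and X2: "\<forall>Y\<in>?A. X \<subseteq> Y \<longrightarrow> Y = X"
      using noetherian_maximal[OF noetherian_fin_gen[OF cring noetherian fg] ne sm] by (rule bexE)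
    note X = X1 X2[rule_format]
    then obtain xs where xs: "set xs \<subseteq> \<mm>" "weakly_regular R N xs" "X = seq_submodule R N xs" by auto
    let ?Q = "seq_quotient R N xs"
    note H = seq_submodule_props(1)[OF N mR[OF xs(1)]]
    have "\<forall>j<1. ext_vanishes ?Q j"
      using ext_vanishes_weakly_regular[OF N xs(1,2), of 1] all by blast
    then have "ext_vanishes ?Q 0" by simp
    then obtain x where x: "x \<in> \<mm>" "\<forall>y\<in>carrier ?Q. x \<odot>\<^bsub>?Q\<^esub> y = \<zero>\<^bsub>?Q\<^esub> \<longrightarrow> y = \<zero>\<^bsub>?Q\<^esub>"
      using regular_element[OF fin_gen_seq_quotient[OF fg xs(1)]] by blast
    have xR: "x \<in> carrier R" using x(1) by (rule \<mm>.Icarr)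
    have xsx: "set (xs @ [x]) \<subseteq> \<mm>" using xs(1) x(1) by simp
    have "seq_submodule R N (xs @ [x]) \<in> ?A"
      using xsx xs(2) x(2) by (intro imageI) (simp add: weakly_regular_snoc)
    moreover have "X \<subseteq> seq_submodule R N (xs @ [x])"
      unfolding xs(3) by (rule seq_submodule_props(3)[OF N mR[OF xs(1)] seq_submodule_props(1)[OF N mR[OF xsx]]])
        (rule seq_submodule_props(2)[OF N mR[OF xsx]], auto)
    ultimately have eq: "seq_submodule R N (xs @ [x]) = seq_submodule R N xs" using X(2) xs(3) by simp
    have "z \<in> seq_submodule R N xs" if z: "z \<in> carrier N" for z
    proof -
      let ?z = "seq_submodule R N xs +>\<^bsub>N\<^esub> z"
      have xz: "x \<odot>\<^bsub>N\<^esub> z \<in> carrier N" using xR z by simp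
      have "x \<odot>\<^bsub>N\<^esub> z \<in> seq_submodule R N xs"
        using seq_submodule_props(2)[OF N mR[OF xsx], of x z] z eq by simp
      then have "x \<odot>\<^bsub>?Q\<^esub> ?z = \<zero>\<^bsub>?Q\<^esub>"
        using quotient_smult[OF N H xR z] coset_eq_zero_iff[OF N H xz] by simp
      then have "?z = \<zero>\<^bsub>?Q\<^esub>" using x(2) mod_homD(1)[OF quotient_hom[OF N H] z] by blast
      then show ?thesis using coset_eq_zero_iff[OF N H z] by simp
    qed
    then have "seq_submodule R N xs = carrier N" using submoduleD(1)[OF N H] by blast
    then show False using seq_submodule_proper[OF fg nz xs(1)] by simp
  qed
  then have "\<not> ext_vanishes N (LEAST j. \<not> ext_vanishes N j)" by (rule LeastI_ex)
  moreover have "\<forall>j<(LEAST j. \<not> ext_vanishes N j). ext_vanishes N j" using not_less_Least by blast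
  ultimately show ?thesis unfolding ext_depth_def by blast
qed

end

section \<open>The Auslander--Buchsbaum formula\<close>

context local_noetherian
begin

text \<open>The identity of a minimal resolution \<open>F\<close> is homotopic to a map that factors through the given
  resolution. For a homotopy \<open>h\<close> of \<open>F\<close>, \<open>\<delta>h + h\<delta>\<close> takes values in \<open>\<mm>F\<close>, so \<open>F i = \<mm>F i\<close> wherever the given resolution vanishes.\<close>

lemma minimal_resolution_length:
  assumes F: "finite_free_resolution R M rk \<delta> \<epsilon>"
    and min: "\<And>i x. x \<in> carrier (free_module R {..<rk (Suc i)}) \<Longrightarrow> \<delta> i x \<in> mF {..<rk i}"
    and P: "has_projective_resolution R M n" and i: "n < i"
  shows "rk i = 0"
proof (rule ccontr)
  assume rk: "rk i \<noteq> 0"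
  interpret F: finite_free_resolution R M rk \<delta> \<epsilon> by fact
  obtain P :: "nat \<Rightarrow> ('a, nat \<Rightarrow> 'a) module" and \<delta>' \<epsilon>' where P: "projective_resolution R M P \<delta>' \<epsilon>'" and z: "\<forall>i>n. zero_module (P i)"
    using P unfolding has_projective_resolution_iff[OF F.M] by (elim exE conjE)
  interpret P: projective_resolution R M P \<delta>' \<epsilon>' by fact
  note X = F.projective_resolution
  obtain a where "\<forall>i. a i \<in> mod_hom R (F.F i) (P i)" and "\<forall>x\<in>carrier (F.F 0). \<epsilon>' (a 0 x) = \<epsilon> x"
    and "\<forall>i. \<forall>x\<in>carrier (F.F (Suc i)). \<delta>' i (a (Suc i) x) = a i (\<delta> i x)"
    using resolution_comparison[OF X P] by (elim exE conjE)
  note a = this(1)[rule_format] and a0 = this(2)[rule_format] and aS = this(3)[rule_format]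
  obtain b where "\<forall>i. b i \<in> mod_hom R (P i) (F.F i)" and "\<forall>x\<in>carrier (P 0). \<epsilon> (b 0 x) = \<epsilon>' x"
    and "\<forall>i. \<forall>x\<in>carrier (P (Suc i)). \<delta> i (b (Suc i) x) = b i (\<delta>' i x)"
    using resolution_comparison[OF P X] by (elim exE conjE)
  note b = this(1)[rule_format] and b0 = this(2)[rule_format] and bS = this(3)[rule_format]
  \<comment> \<open>The identity minus the round trip through \<open>P\<close>; it induces zero on
    \<open>M\<close> and is therefore null-homotopic.\<close>
  define c where "c i x = x \<ominus>\<^bsub>F.F i\<^esub> b i (a i x)" for i x
  have ba: "(\<lambda>x. b i (a i x)) \<in> mod_hom R (F.F i) (F.F i)" for i by (rule mod_hom_comp[OF a b])
  have c: "c i \<in> mod_hom R (F.F i) (F.F i)" for i unfolding c_def by (rule mod_hom_sub[OF F.F mod_hom_id ba])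
  have c0: "\<epsilon> (c 0 x) = \<zero>\<^bsub>M\<^esub>" if x: "x \<in> carrier (F.F 0)" for x
  proof -
    interpret M: module R M by (rule F.M)
    show ?thesis unfolding c_def mod_hom_diff[OF F.F F.M F.aug x mod_homD(1)[OF ba x]]
        b0[OF mod_homD(1)[OF a x]] a0[OF x] using mod_homD(1)[OF F.aug x] by (simp add: M.M.diff_zero_iff)
  qed
  have cS: "\<delta> i (c (Suc i) x) = c i (\<delta> i x)" if x: "x \<in> carrier (F.F (Suc i))" for i x
    unfolding c_def mod_hom_diff[OF F.F F.F F.bd x mod_homD(1)[OF ba x]] bS[OF mod_homD(1)[OF a x]] aS[OF x] ..
  have "\<exists>h. (\<forall>i. h i \<in> mod_hom R (F.F i) (F.F (Suc i))) \<and> (\<forall>x\<in>carrier (F.F 0). c 0 x = \<delta> 0 (h 0 x)) \<and>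
    (\<forall>i. \<forall>x\<in>carrier (F.F (Suc i)). c (Suc i) x = \<delta> (Suc i) (h (Suc i) x) \<oplus>\<^bsub>F.F (Suc i)\<^esub> h i (\<delta> i x))"
    by (rule resolution_homotopy[OF X X]) (rule c, rule c0, assumption, rule cS)
  then obtain h where "\<forall>i. h i \<in> mod_hom R (F.F i) (F.F (Suc i))"
    and "\<forall>i. \<forall>x\<in>carrier (F.F (Suc i)). c (Suc i) x = \<delta> (Suc i) (h (Suc i) x) \<oplus>\<^bsub>F.F (Suc i)\<^esub> h i (\<delta> i x)"
    by (elim exE conjE)
  note h = this(1)[rule_format] and hS = this(2)[rule_format]
  obtain k where k: "i = Suc k" using i by (cases i) auto
  let ?e = "unit_vec R {..<rk i} 0"
  have e: "?e \<in> carrier (F.F (Suc k))" using unit_vec_closed[OF cring, of "{..<rk i}" 0] k by simp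
  \<comment> \<open>Here \<open>P\<close> is zero, so the round trip kills \<open>?e\<close> and
    \<open>c\<close> fixes it, while the homotopy places its value in \<open>mF\<close>.\<close>
  have "a (Suc k) ?e = \<zero>\<^bsub>P (Suc k)\<^esub>"
    using mod_homD(1)[OF a e] z i unfolding zero_module_def k by simp
  then have "c (Suc k) ?e = ?e"
    unfolding c_def using mod_hom_zero[OF P.P F.F b] e by (simp add: a_minus_def)
  moreover have "\<delta> (Suc k) (h (Suc k) ?e) \<oplus>\<^bsub>F.F (Suc k)\<^esub> h k (\<delta> k ?e) \<in> mF {..<rk (Suc k)}"
    by (rule submoduleD(4)[OF F.F submodule_mF min[OF mod_homD(1)[OF h e]] hom_mF[OF h min[OF e]]])
  ultimately have "?e \<in> mF {..<rk i}" using hS[OF e] k by simp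
  then have "\<forall>s\<in>{..<rk i}. ?e s \<in> \<mm>" by (simp add: mF_def)
  from bspec[OF this, of 0] rk have "?e 0 \<in> \<mm>" by simp
  then show False using rk one_notin by (simp add: unit_vec_def)
qed

text \<open>The infimum defining \<open>proj_dim\<close> is attained, so the minimal resolution is
  zero after index \<open>p\<close>. If it were zero at \<open>p\<close> as well, it would itself be
  a projective resolution of length \<open>p - 1\<close>, or \<open>M\<close> would be zero in case
  \<open>p = 0\<close>.\<close>

lemma minimal_resolution_proj_dim:
  assumes F: "finite_free_resolution R M rk \<delta> \<epsilon>" and nz: "\<not> zero_module M"
    and min: "\<And>i x. x \<in> carrier (free_module R {..<rk (Suc i)}) \<Longrightarrow> \<delta> i x \<in> mF {..<rk i}"
    and p: "proj_dim R M = enat p"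
  shows "0 < rk p" and "rk (Suc p) = 0"
proof -
  interpret F: finite_free_resolution R M rk \<delta> \<epsilon> by fact
  let ?A = "{enat n |n. has_projective_resolution R M n}"
  have "?A \<noteq> {}"
  proof
    assume e: "?A = {}"
    have "proj_dim R M = \<infinity>" unfolding proj_dim_def e by (simp add: Inf_enat_def)
    then show False using p by simp
  qed
  then obtain n where "n \<in> ?A" by blast
  from wellorder_InfI[OF this] have "enat p \<in> ?A" using p by (simp only: proj_dim_def)
  then have hp: "has_projective_resolution R M p" by simp
  note vanish = minimal_resolution_length[OF F min hp]
  show "rk (Suc p) = 0" by (rule vanish) simp_all
  show "0 < rk p"
  proof (rule ccontr)
    assume "\<not> 0 < rk p"
    then have rp: "rk p = 0" by simp
    show False
    proof (cases p)
      case 0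
      have "carrier (F.F 0) = {\<zero>\<^bsub>F.F 0\<^esub>}" using zero_free_module rp 0 unfolding zero_module_def by simp
      then have "carrier M = {\<zero>\<^bsub>M\<^esub>}" using F.aug_surj mod_hom_zero[OF F.F F.M F.aug] by simp
      then show False using nz by (simp add: zero_module_def)
    next
      case (Suc q)
      have "zero_module (F.F i)" if "q < i" for i
      proof -
        have "rk i = 0" using rp vanish[of i] that Suc by (cases "i = p") simp_all
        then show ?thesis using zero_free_module by simp
      qed
      then have "has_projective_resolution R M q"
        unfolding has_projective_resolution_iff[OF F.M] using F.projective_resolution by blast
      then have "enat q \<in> ?A" by blast
      then have "proj_dim R M \<le> enat q" unfolding proj_dim_def by (rule Inf_lower)
      then show False using p Suc by simp
    qed
  qed
qed

end

context residue_resolution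
begin

lemma ext_depth_iso:
  assumes "module R A" "module R B" "u \<in> mod_hom R A B"
    and "\<And>x. x \<in> carrier A \<Longrightarrow> u x = \<zero>\<^bsub>B\<^esub> \<Longrightarrow> x = \<zero>\<^bsub>A\<^esub>" and "u ` carrier A = carrier B"
  shows "ext_depth A s \<longleftrightarrow> ext_depth B s"
  unfolding ext_depth_def using ext_vanishes_iso[OF assms] by simp

lemma ext_depth_free:
  fixes n :: nat
  assumes r: "ext_depth (regular_module R) r" and n: "0 < n"
  shows "ext_depth (free_module R {..<n}) r"
  using r ext_vanishes_free[of _ n] ext_vanishes_of_free[OF _ n] unfolding ext_depth_def by auto

text \<open>Since \<open>Ext(A)\<close> maps to zero in \<open>Ext(B)\<close> in degree
  \<open>s\<close>, its nonzero classes there come from \<open>Ext(C)\<close> in degree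
  \<open>s - 1\<close>; below that degree both neighbours of \<open>Ext(C)\<close> vanish. The value
  \<open>s = 0\<close> is excluded because \<open>u\<close> is injective on homomorphisms.\<close>

lemma ext_depth_quotient:
  assumes A: "module R A" and B: "module R B" and C: "module R C" and u: "u \<in> mod_hom R A B" and v: "v \<in> mod_hom R B C"
    and inj: "\<And>x. x \<in> carrier A \<Longrightarrow> u x = \<zero>\<^bsub>B\<^esub> \<Longrightarrow> x = \<zero>\<^bsub>A\<^esub>" and surj: "v ` carrier B = carrier C"
    and ker: "{y \<in> carrier B. v y = \<zero>\<^bsub>C\<^esub>} = u ` carrier A"
    and s: "ext_depth A s" and evB: "\<And>j. j < s \<Longrightarrow> ext_vanishes B j"
    and z: "\<And>f. ext_cocycle A s f \<Longrightarrow> ext_coboundary B s (\<lambda>x. u (f x))"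
  shows "\<exists>s'. s = Suc s' \<and> ext_depth C s'"
proof (cases s)
  case 0
  have "ext_vanishes A 0" by (rule ext_vanishes_sub_0[OF A B C u v inj surj ker]) (use z 0 in simp_all)
  then show ?thesis using s 0 by (simp add: ext_depth_def)
next
  case (Suc s')
  have "ext_vanishes C j" if "j < s'" for j
    by (rule ext_vanishes_quotient[OF A B C u v inj surj ker]) (use that s evB Suc in \<open>auto simp: ext_depth_def\<close>)
  moreover have "\<not> ext_vanishes C s'"
  proof
    assume C0: "ext_vanishes C s'"
    have "ext_vanishes A (Suc s')" by (rule ext_vanishes_sub_Suc[OF A B C u v inj surj ker C0]) (use z Suc in simp_all)
    then show False using s Suc by (simp add: ext_depth_def)
  qed
  ultimately show ?thesis using Suc by (simp add: ext_depth_def)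
qed

text \<open>Descend along a minimal resolution \<open>F\<close>: by minimality \<open>F p \<rightarrow> F (p - 1)\<close> induces zero on
  \<open>Ext\<^sup>r(R/\<mm>, -)\<close>, and \<open>Ext\<^sup>j(R/\<mm>, F i) = 0\<close> for \<open>j < r\<close>, so each syzygy has depth one less than the next.\<close>

theorem auslander_buchsbaum:
  assumes fg: "fin_gen R M" and nz: "\<not> zero_module M" and p: "proj_dim R M = enat p"
    and r: "ext_depth (regular_module R) r"
  shows "\<exists>s. s + p = r \<and> ext_depth M s"
proof (rule minimal_resolution[OF fg])
  fix rkM \<delta>M \<epsilon>M
  assume FM: "finite_free_resolution R M rkM \<delta>M \<epsilon>M"
    and min: "\<And>i x. x \<in> carrier (free_module R {..<rkM (Suc i)}) \<Longrightarrow> \<delta>M i x \<in> mF {..<rkM i}"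
  interpret G: finite_free_resolution R M rkM \<delta>M \<epsilon>M by (rule FM)
  note rk = minimal_resolution_proj_dim[OF FM nz min p]
  have dp: "ext_depth (G.F p) r" by (rule ext_depth_free[OF r rk(1)])
  have vF: "ext_vanishes (G.F i) j" if "j < r" for i j
    using r that ext_vanishes_free by (simp add: ext_depth_def)
  have zp: "x = \<zero>\<^bsub>G.F (Suc p)\<^esub>" if "x \<in> carrier (G.F (Suc p))" for x
    using that zero_free_module[of R] rk(2) by (simp add: zero_module_def)
  show ?thesis
  proof (cases p)
    case 0
    have inj: "x = \<zero>\<^bsub>G.F 0\<^esub>" if x: "x \<in> carrier (G.F 0)" "\<epsilon>M x = \<zero>\<^bsub>M\<^esub>" for x
    proof -
      have "x \<in> \<delta>M 0 ` carrier (G.F 1)" unfolding G.exact_0 using x by simp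
      then obtain y where "y \<in> carrier (G.F 1)" "x = \<delta>M 0 y" by (elim imageE)
      then show ?thesis using zp[of y] 0 mod_hom_zero[OF G.F G.F G.bd] by simp
    qed
    have "ext_depth M r" using ext_depth_iso[OF G.F G.M G.aug inj G.aug_surj] dp 0 by simp
    then show ?thesis using 0 by simp
  next
    case (Suc q)
    define B where "B i = \<delta>M i ` carrier (G.F (Suc i))" for i
    \<comment> \<open>The syzygies, as images inside \<open>G.F i\<close>. Each step of the descent
      uses the exact sequence formed by \<open>Z (Suc i)\<close>, \<open>G.F (Suc i)\<close> and
      \<open>Z i\<close>.\<close>
    define Z where "Z i = (G.F i)\<lparr>carrier := B i\<rparr>" for i
    have B: "submodule (B i) R (G.F i)" for i
      unfolding B_def by (rule submodule_image[OF G.F G.F G.bd submodule_carrier[OF G.F]])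
    have Z: "module R (Z i)" for i unfolding Z_def by (rule module_sub[OF G.F B])
    have Zs: "carrier (Z i) = B i" "\<zero>\<^bsub>Z i\<^esub> = \<zero>\<^bsub>G.F i\<^esub>" for i by (simp_all add: Z_def)
    have incl: "(\<lambda>x. x) \<in> mod_hom R (Z i) (G.F i)" for i
      unfolding Z_def by (rule mod_hom_sub_dom[OF mod_hom_id submoduleD(1)[OF G.F B]])
    have proj: "\<delta>M i \<in> mod_hom R (G.F (Suc i)) (Z i)" for i
      unfolding Z_def by (rule mod_hom_sub_cod[OF G.bd]) (simp add: B_def)
    have surj: "\<delta>M i ` carrier (G.F (Suc i)) = carrier (Z i)" for i by (simp add: Zs B_def)
    have kerS: "{y \<in> carrier (G.F (Suc i)). \<delta>M i y = \<zero>\<^bsub>Z i\<^esub>} = (\<lambda>x. x) ` carrier (Z (Suc i))" for i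
      unfolding Zs B_def G.exact_Suc by simp
    have ker0: "{y \<in> carrier (G.F 0). \<epsilon>M y = \<zero>\<^bsub>M\<^esub>} = (\<lambda>x. x) ` carrier (Z 0)"
      using G.exact_0 by (simp add: Zs B_def)
    \<comment> \<open>Descent from \<open>Z q\<close>, a copy of \<open>G.F p\<close>, to
      \<open>Z 0\<close>. The last clause says that the inclusion of the syzygy is zero on
      \<open>Ext\<close> in degree \<open>s\<close>: for \<open>k = 0\<close> by minimality,
      afterwards because \<open>s < r\<close> and \<open>Ext\<close> of a free module vanishes below
      \<open>r\<close>.\<close>
    have "\<exists>s. s + k = r \<and> ext_depth (Z (q - k)) s \<and>
        (\<forall>f. ext_cocycle (Z (q - k)) s f \<longrightarrow> ext_coboundary (G.F (q - k)) s f)" if "k \<le> q" for k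
      using that
    proof (induction k)
      case 0
      have inj: "x = \<zero>\<^bsub>G.F (Suc q)\<^esub>" if x: "x \<in> carrier (G.F (Suc q))" "\<delta>M q x = \<zero>\<^bsub>Z q\<^esub>" for x
      proof -
        have "x \<in> \<delta>M (Suc q) ` carrier (G.F (Suc (Suc q)))" unfolding G.exact_Suc using x by (simp add: Zs)
        then obtain y where "y \<in> carrier (G.F (Suc p))" "x = \<delta>M p y" unfolding Suc by (elim imageE)
        then show ?thesis using zp[of y] Suc mod_hom_zero[OF G.F G.F G.bd] by simp
      qed
      have "ext_depth (Z q) r" using ext_depth_iso[OF G.F Z proj inj surj] dp Suc by simp
      moreover have "ext_coboundary (G.F q) r f" if f: "ext_cocycle (Z q) r f" for f
      proof -
        have "\<exists>\<theta>\<in>mod_hom R (Z q) (G.F (Suc q)). \<forall>x\<in>carrier (G.F (Suc q)). \<theta> (\<delta>M q x) = x"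
          by (rule mod_hom_factor_surj[OF G.F Z G.F proj mod_hom_id surj]) (rule inj)
        then obtain \<theta> where \<theta>: "\<theta> \<in> mod_hom R (Z q) (G.F (Suc q))"
          and "\<forall>x\<in>carrier (G.F (Suc q)). \<theta> (\<delta>M q x) = x" by (rule bexE)
        note \<theta>\<delta> = this(2)[rule_format]
        have \<delta>\<theta>: "\<delta>M q (\<theta> y) = y" if y: "y \<in> carrier (Z q)" for y
        proof -
          have "y \<in> \<delta>M q ` carrier (G.F (Suc q))" unfolding surj by (rule y)
          then obtain x where "x \<in> carrier (G.F (Suc q))" "y = \<delta>M q x" by (elim imageE)
          then show ?thesis using \<theta>\<delta> by simp
        qed
        \<comment> \<open>\<open>\<theta>\<close> followed by \<open>\<delta>M q\<close> is the
          identity on \<open>Z q\<close>, so \<open>f\<close> is the image of a cocycle in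
          \<open>G.F (Suc q)\<close> under a map with entries in \<open>\<mm>\<close>.\<close>
        have "ext_coboundary (G.F q) r (\<lambda>x. \<delta>M q (\<theta> (f x)))"
          by (rule minimal_map_kills_ext[OF G.bd min ext_cocycle_map[OF Z G.F \<theta> f]])
        then show ?thesis
        proof (rule ext_coboundary_cong)
          fix x assume x: "x \<in> carrier (K.F r)"
          have "f \<in> mod_hom R (K.F r) (Z q)" using f by (simp add: ext_cocycle_def)
          from \<delta>\<theta>[OF mod_homD(1)[OF this x]] show "f x = \<delta>M q (\<theta> (f x))" by simp
        qed
      qed
      ultimately show ?case by (intro exI[of _ r]) simp
    next
      case (Suc k)
      then obtain s where s: "s + k = r" "ext_depth (Z (q - k)) s"
        "\<forall>f. ext_cocycle (Z (q - k)) s f \<longrightarrow> ext_coboundary (G.F (q - k)) s f" by auto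
      have i: "q - k = Suc (q - Suc k)" using Suc.prems by simp
      have "\<exists>s'. s = Suc s' \<and> ext_depth (Z (q - Suc k)) s'"
        by (rule ext_depth_quotient[OF Z G.F Z incl proj _ surj kerS s(2)[unfolded i]])
           (use vF s in \<open>auto simp: Zs i\<close>)
      then obtain s' where s': "s = Suc s'" "ext_depth (Z (q - Suc k)) s'" by blast
      have "ext_coboundary (G.F (q - Suc k)) s' f" if f: "ext_cocycle (Z (q - Suc k)) s' f" for f
        using ext_cocycle_map[OF Z G.F incl f] vF[of s'] s(1) s'(1) by (simp add: ext_vanishes_def)
      then show ?case using s(1) s' by (intro exI[of _ s']) simp
    qed
    from this[of q] obtain s where s: "s + q = r" "ext_depth (Z 0) s"
      "\<forall>f. ext_cocycle (Z 0) s f \<longrightarrow> ext_coboundary (G.F 0) s f" by auto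
    have "\<exists>s'. s = Suc s' \<and> ext_depth M s'"
      by (rule ext_depth_quotient[OF Z G.F G.M incl G.aug _ G.aug_surj ker0 s(2)])
         (use vF s in \<open>auto simp: Zs\<close>)
    then show ?thesis using s(1) Suc by auto
  qed
qed

end

section \<open>Generalized local cohomology of the dualizing complex\<close>

text \<open>Primes pull back along \<open>h\<close>, and strict inclusions stay strict because
  \<open>h\<close> is surjective.\<close>

lemma krull_dim_image:
  assumes R: "cring R" and S: "cring S" and h: "h \<in> ring_hom R S" and surj: "h ` carrier R = carrier S"
  shows "krull_dim S \<le> krull_dim R"
  unfolding krull_dim_def
proof (rule Sup_subset_mono, rule subsetI)
  interpret h: ring_hom_ring R S h by (rule ring_hom_ringI2[OF cring.axioms(1)[OF R] cring.axioms(1)[OF S] h])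
  fix x assume "x \<in> {enat n |n. \<exists>\<pp>. (\<forall>i\<le>n. primeideal (\<pp> i) S) \<and> (\<forall>i<n. \<pp> i \<subset> \<pp> (Suc i))}"
  then obtain n \<pp> where x: "x = enat n" and prime: "\<And>i. i \<le> n \<Longrightarrow> primeideal (\<pp> i) S"
    and chain: "\<And>i. i < n \<Longrightarrow> \<pp> i \<subset> \<pp> (Suc i)" by blast
  let ?\<qq> = "\<lambda>i. {r \<in> carrier R. h r \<in> \<pp> i}"
  have "primeideal (?\<qq> i) R" if "i \<le> n" for i by (rule h.primeideal_vimage[OF R prime[OF that]])
  moreover have "?\<qq> i \<subset> ?\<qq> (Suc i)" if i: "i < n" for i
  proof
    show "?\<qq> i \<subseteq> ?\<qq> (Suc i)" using chain[OF i] by auto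
    obtain s where s: "s \<in> \<pp> (Suc i)" "s \<notin> \<pp> i" using chain[OF i] by blast
    have "ideal (\<pp> (Suc i)) S" by (rule primeideal.axioms(1)[OF prime]) (use i in simp)
    then have "s \<in> h ` carrier R" unfolding surj using s(1) by (rule ideal.Icarr)
    then obtain r where "r \<in> carrier R" "s = h r" by (elim imageE)
    then show "?\<qq> i \<noteq> ?\<qq> (Suc i)" using s by blast
  qed
  ultimately show "x \<in> {enat n |n. \<exists>\<pp>. (\<forall>i\<le>n. primeideal (\<pp> i) R) \<and> (\<forall>i<n. \<pp> i \<subset> \<pp> (Suc i))}"
    unfolding x by (intro CollectI exI[of _ n] exI[of _ ?\<qq>] conjI allI impI) simp_all
qed

lemma krull_dim_iso:
  assumes R: "cring R" and S: "cring S" and iso: "R \<simeq> S" shows "krull_dim S \<le> krull_dim R"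
proof -
  obtain h where "h \<in> ring_iso R S" using iso by (auto simp: is_ring_iso_def)
  then show ?thesis by (intro krull_dim_image[OF R S, of h]) (auto simp: ring_iso_def bij_betw_def)
qed

text \<open>The unit element shows that the annihilator is zero; the isomorphisms between
  \<open>R\<close> and its quotient by zero, one in each direction, give the two
  inequalities.\<close>

lemma module_dim_regular:
  assumes R: "cring R" shows "module_dim R (regular_module R) = krull_dim R"
proof -
  interpret R: cring R by fact
  have "annihilator R (regular_module R) = {\<zero>\<^bsub>R\<^esub>}"
  proof (rule equalityI)
    show "annihilator R (regular_module R) \<subseteq> {\<zero>\<^bsub>R\<^esub>}"
    proof
      fix r assume "r \<in> annihilator R (regular_module R)"
      then have r: "r \<in> carrier R" "\<forall>x\<in>carrier R. r \<otimes>\<^bsub>R\<^esub> x = \<zero>\<^bsub>R\<^esub>" by (simp_all add: annihilator_def)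
      from bspec[OF r(2) R.one_closed] r(1) show "r \<in> {\<zero>\<^bsub>R\<^esub>}" by simp
    qed
  qed (simp add: annihilator_def)
  moreover have "cring (R Quot {\<zero>\<^bsub>R\<^esub>})" by (rule ideal.quotient_is_cring[OF R.zeroideal R])
  ultimately show ?thesis unfolding module_dim_def
    using krull_dim_iso[OF _ R R.FactRing_zeroideal(1)] krull_dim_iso[OF R _ R.FactRing_zeroideal(2)]
    by (simp add: antisym)
qed

lemma mod_iso_zero_module:
  assumes iso: "mod_iso R X Y" and Y: "module R Y" and z: "zero_module X" shows "zero_module Y"
proof -
  interpret Y: module R Y by fact
  obtain f where "bij_betw f (carrier X) (carrier Y)" using iso by (auto simp: mod_iso_def)
  then have "carrier Y = f ` {\<zero>\<^bsub>X\<^esub>}" using z by (simp add: bij_betw_def zero_module_def)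
  then show ?thesis using Y.M.zero_closed by (simp add: zero_module_def)
qed

context local_noetherian
begin

text \<open>The annihilator of a nonzero \<open>x\<close> lies in \<open>\<mm>\<close>, since a unit
  cannot kill \<open>x\<close>. So sending \<open>r\<close> times \<open>x\<close> to the class of
  \<open>r\<close> is a well defined map from the submodule generated by \<open>x\<close> to
  \<open>R/\<mm>\<close>; followed by the embedding into \<open>E\<close> it extends to
  \<open>M\<close> and is nonzero at \<open>x\<close>.\<close>

lemma Hom_injective_hull_nonzero:
  assumes M: "module R M" and nz: "\<not> zero_module M" and E: "injective_hull R (residue_module R \<mm>) E"
  shows "\<not> zero_module (Hom_module R M E)"
proof
  assume z: "zero_module (Hom_module R M E)"
  let ?RR = "regular_module R" and ?k = "residue_module R \<mm>"
  interpret M: module R M by fact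
  note RR = module_RR and k = module_residue
  have \<pi>: "(\<lambda>r. \<mm> +>\<^bsub>?RR\<^esub> r) \<in> mod_hom R ?RR ?k"
    unfolding residue_module_def by (rule quotient_hom[OF RR submodule_\<mm>])
  have \<pi>0: "\<mm> +>\<^bsub>?RR\<^esub> r = \<zero>\<^bsub>?k\<^esub> \<longleftrightarrow> r \<in> \<mm>" if "r \<in> carrier R" for r
    using coset_eq_zero_iff[OF RR submodule_\<mm>, of r] that by (simp add: residue_module_def)
  have inj: "injective_module R E" using E by (simp add: injective_hull_def)
  then have Em: "module R E" by (simp add: injective_module_def)
  obtain j where j: "j \<in> mod_hom R ?k E" "inj_on j (carrier ?k)" using E unfolding injective_hull_def by blast
  obtain x where x: "x \<in> carrier M" "x \<noteq> \<zero>\<^bsub>M\<^esub>" using nz M.M.zero_closed unfolding zero_module_def by blast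
  have u: "(\<lambda>r. r \<odot>\<^bsub>M\<^esub> x) \<in> mod_hom R ?RR M"
    by (rule mod_homI) (auto simp: x M.smult_l_distr M.smult_assoc1)
  have ker: "j (\<mm> +>\<^bsub>?RR\<^esub> r) = \<zero>\<^bsub>E\<^esub>" if r: "r \<in> carrier ?RR" "r \<odot>\<^bsub>M\<^esub> x = \<zero>\<^bsub>M\<^esub>" for r
  proof -
    have rR: "r \<in> carrier R" using r(1) by simp
    have "r \<in> \<mm>"
    proof (rule ccontr)
      assume "r \<notin> \<mm>"
      then obtain b where b: "b \<in> carrier R" "b \<otimes>\<^bsub>R\<^esub> r = \<one>\<^bsub>R\<^esub>" by (rule unit[OF rR])
      have "(b \<otimes>\<^bsub>R\<^esub> r) \<odot>\<^bsub>M\<^esub> x = \<zero>\<^bsub>M\<^esub>" using M.smult_assoc1[OF b(1) rR x(1)] r(2) b(1) by simp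
      then show False using b(2) x by simp
    qed
    then show ?thesis using \<pi>0[OF rR] mod_hom_zero[OF k Em j(1)] by simp
  qed
  obtain s where s: "s \<in> mod_hom R M E" and "\<forall>r\<in>carrier ?RR. s (r \<odot>\<^bsub>M\<^esub> x) = j (\<mm> +>\<^bsub>?RR\<^esub> r)"
    using injective_extend[OF inj RR M u mod_hom_comp[OF \<pi> j(1)] ker] by (rule bexE)
  note sx = bspec[OF this(2), of "\<one>\<^bsub>R\<^esub>"]
  have "restrict s (carrier M) \<in> carrier (Hom_module R M E)"
    using mod_hom_cong[OF s M, of "restrict s (carrier M)"] by (simp add: Hom_module_def)
  then have "restrict s (carrier M) = \<zero>\<^bsub>Hom_module R M E\<^esub>"
    using z unfolding zero_module_def by (simp only: singleton_iff)
  from fun_cong[OF this, of x] have "s x = \<zero>\<^bsub>E\<^esub>" using x(1) by simp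
  then have "j (\<mm> +>\<^bsub>?RR\<^esub> \<one>\<^bsub>R\<^esub>) = j \<zero>\<^bsub>?k\<^esub>" using sx x(1) mod_hom_zero[OF k Em j(1)] by simp
  moreover have "\<mm> +>\<^bsub>?RR\<^esub> \<one>\<^bsub>R\<^esub> \<in> carrier ?k" by (rule mod_homD(1)[OF \<pi>]) simp
  moreover have "\<zero>\<^bsub>?k\<^esub> \<in> carrier ?k" by (rule submoduleD(3)[OF k submodule_carrier[OF k]])
  ultimately have "\<mm> +>\<^bsub>?RR\<^esub> \<one>\<^bsub>R\<^esub> = \<zero>\<^bsub>?k\<^esub>" using inj_onD[OF j(2)] by blast
  then show False using \<pi>0[OF R.one_closed] one_notin by simp
qed

text \<open>The vanishing of \<open>Ext\<close> is formulated with a chosen free resolution of the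
  residue field. Fixing one here and translating to \<open>depth\<close> on both sides removes that
  choice from the statement.\<close>

lemma depth_auslander_buchsbaum:
  assumes fg: "fin_gen R M" and nz: "\<not> zero_module M" and p: "proj_dim R M = enat p"
  shows "\<exists>s r. s + p = r \<and> depth R \<mm> M = enat s \<and> depth R \<mm> (regular_module R) = enat r"
proof (rule minimal_resolution[OF fin_gen_residue])
  fix rk \<delta> \<epsilon> assume "finite_free_resolution R (residue_module R \<mm>) rk \<delta> \<epsilon>"
  then interpret residue_resolution R \<mm> rk \<delta> \<epsilon> by (intro residue_resolution.intro local_noetherian_axioms)
  have "\<not> zero_module (regular_module R)"
    using one_neq_zero R.one_closed unfolding zero_module_def by auto
  then obtain r where r: "ext_depth (regular_module R) r" using ext_depth_exists[OF fin_gen_regular] by blast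
  then obtain s where "s + p = r" "ext_depth M s" using auslander_buchsbaum[OF fg nz p] by blast
  then show ?thesis using depth_eq_ext_depth[OF fg] depth_eq_ext_depth[OF fin_gen_regular r] by blast
qed

end

theorem theorem3p4:
  fixes R :: "('a, 'r) ring_scheme" and \<mm> :: "'a set"
    and E :: "('a, 'e) module" and D :: "('a, 'd) cochain"
    and M :: "('a, 'm) module" and J :: "('a, 'j) cochain"
    and t d :: nat
  assumes "noetherian_local_ring R \<mm>" and "krull_dim R = enat t"
    and "injective_hull R (residue_module R \<mm>) E"
    and "normalized_dualizing_complex R \<mm> t E D"
    and "fg_module R M" and "\<not> zero_module M" and "module_dim R M = enat d"
    and "resolves_RHom R M D J"
  shows "(mod_iso R (local_cohomology R \<mm> J (int t)) (Hom_module R M E) \<and>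
          \<not> zero_module (Hom_module R M E) \<and>
          (\<forall>i. i \<noteq> int t \<longrightarrow> zero_module (local_cohomology R \<mm> J i))) \<and>
         (\<forall>p. proj_dim R M = enat p \<longrightarrow>
          (\<not> zero_module (local_cohomology R \<mm> J (int (p + d))) \<longleftrightarrow>
           cm_defect R \<mm> M = cm_defect R \<mm> (regular_module R)))"
proof -
  interpret local_noetherian R \<mm> by unfold_locales (rule assms(1))
  have fg: "fin_gen R M" by (rule fg_module_fin_gen[OF assms(5)])
  then have M: "module R M" by (simp add: fin_gen_def)
  have E: "injective_module R E" using assms(3) by (simp add: injective_hull_def)
  have D: "cochain_complex R D" "bounded_below D" "\<And>n. injective_module R (obj D n)"
    and DE: "derived_iso R (torsion_complex R \<mm> D) (in_degree (int t) E)"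
    using assms(4) by (simp_all add: normalized_dualizing_complex_def dualizing_complex_def)
  have "mod_iso R (local_cohomology R \<mm> J (int t)) (Hom_module R M E) \<and>
      (\<forall>i. i \<noteq> int t \<longrightarrow> zero_module (local_cohomology R \<mm> J i))"
  proof (rule minimal_resolution[OF fg])
    fix rk \<delta> \<epsilon> assume "finite_free_resolution R M rk \<delta> \<epsilon>"
    note lc = finite_free_resolution.local_cohomology_RHom[OF this \<mm>_ideal D(1,3,2) E DE assms(8)[unfolded resolves_RHom_def]]
    show ?thesis by (intro conjI allI impI lc)
  qed
  then have iso: "mod_iso R (local_cohomology R \<mm> J (int t)) (Hom_module R M E)"
    and zero: "\<And>i. i \<noteq> int t \<Longrightarrow> zero_module (local_cohomology R \<mm> J i)" by simp_all
  have Em: "module R E" using E by (simp add: injective_module_def)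
  note nz = Hom_injective_hull_nonzero[OF M assms(6,3)]
  have "\<not> zero_module (local_cohomology R \<mm> J (int t))"
    using mod_iso_zero_module[OF iso module_Hom[OF M Em]] nz by blast
  then have at_t: "\<not> zero_module (local_cohomology R \<mm> J (int (p + d))) \<longleftrightarrow> p + d = t" for p
    using zero[of "int (p + d)"] by (metis of_nat_eq_iff)
  have "cm_defect R \<mm> M = cm_defect R \<mm> (regular_module R) \<longleftrightarrow> p + d = t" if p: "proj_dim R M = enat p" for p
  proof -
    obtain s r where "s + p = r" "depth R \<mm> M = enat s" "depth R \<mm> (regular_module R) = enat r"
      using depth_auslander_buchsbaum[OF fg assms(6) p] by blast
    then show ?thesis
      using assms(2,7) by (auto simp: cm_defect_def module_dim_regular[OF cring])
  qed
  then show ?thesis using iso nz zero at_t by simp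
qed

end
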